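(* Let $K$ be a field over $\mathbb{F}_q$ with a nontrivial valuation $v\colon K^\times\to\mathbb{Z}$ and ring of integers $R$. The base change functor $M\mapsto\mathcal{B}_K\otimes_{\mathcal{B}^b}M$ from the category of pure $\mathcal{B}^b$-isocrystals to the category of $\mathcal{B}_K$-isocrystals is fully faithful.
   Context: $F$ is a local field over $\mathbb{F}_q$ with ring of integers $\mathcal{O}$, maximal ideal $\mathfrak{m}$, uniformizer $z$, $d=[\mathcal{O}/\mathfrak{m}:\mathbb{F}_q]$. For an $\mathbb{F}_q$-algebra $S$, $\mathcal{A}_S$ is the completion of $S\otimes_{\mathbb{F}_q}\mathcal{O}$ at $S\otimes\mathfrak{m}$, $\mathcal{B}_S=\mathcal{A}_S\otimes_{\mathcal{O}}F$, with $\sigma$ induced by $q$-Frobenius on $S$ and identity on $\mathcal{O}$. Set $\mathcal{A}^b=K\otimes_R\mathcal{A}_R$ and $\mathcal{B}^b=K\otimes_R\mathcal{B}_R$ with the induced $\sigma$. For a ring $\mathcal{B}$ with endomorphism $\sigma$, a $\mathcal{B}$-isocrystal is a left $\mathcal{B}\{\tau\}$-module ($\tau x=\sigma(x)\tau$), locally free of finite type over $\mathcal{B}$, with linearization $\sigma^*M\to M$ an isomorphism; morphisms are $\mathcal{B}$-linear maps commuting with $\tau$. A lattice in a $\mathcal{B}^b$-isocrystal $M$ is a locally free $\mathcal{A}^b$-submodule of finite type spanning $M$ over $\mathcal{B}^b$; $M$ is pure if there are integers $s,r$, $r>0$, and a lattice $T$ such that $z^sT$ is generated by $\tau^{rd}T$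 over $\mathcal{A}^b$. *)

theory Defs
  imports "HOL-Algebra.Free_Abelian_Groups" "HOL-Algebra.Ideal_Product" "HOL-Algebra.Embedded_Algebras"
begin

section \<open>Tensor products\<close>

text \<open>
  A commutative \<open>A\<close>-algebra is a record of type \<^typ>\<open>('a, 'b) module\<close> satisfying
  \<^locale>\<open>algebra\<close>; for a mere module the fields \<open>mult\<close> and \<open>one\<close> carry no meaning.
\<close>

definition algebra_via :: "('a \<Rightarrow> 'b) \<Rightarrow> ('b, 'y) ring_scheme \<Rightarrow> ('a, 'b) module" where
  "algebra_via \<phi> B = \<lparr>carrier = carrier B, monoid.mult = monoid.mult B, one = \<one>\<^bsub>B\<^esub>,
     ring.zero = \<zero>\<^bsub>B\<^esub>, ring.add = ring.add B, smult = (\<lambda>a b. \<phi> a \<otimes>\<^bsub>B\<^esub> b)\<rparr>"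

definition restrict_scalars :: "('a \<Rightarrow> 'b) \<Rightarrow> ('b, 'm, 'z) module_scheme \<Rightarrow> ('a, 'm) module" where
  "restrict_scalars \<phi> M = \<lparr>carrier = carrier M, monoid.mult = monoid.mult M, one = \<one>\<^bsub>M\<^esub>,
     ring.zero = \<zero>\<^bsub>M\<^esub>, ring.add = ring.add M, smult = (\<lambda>a m. \<phi> a \<odot>\<^bsub>M\<^esub> m)\<rparr>"

type_synonym ('m, 'n) tens = "(('m \<times> 'n) \<Rightarrow>\<^sub>0 int) set"

definition tensor_rels ::
    "('a, 'x) ring_scheme \<Rightarrow> ('a, 'm, 'y) module_scheme \<Rightarrow> ('a, 'n, 'z) module_scheme \<Rightarrow> ('m, 'n) tens" where
  "tensor_rels A M N = generate (free_Abelian_group (carrier M \<times> carrier N))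
     ({frag_of (m \<oplus>\<^bsub>M\<^esub> m', n) - frag_of (m, n) - frag_of (m', n) | m m' n.
         m \<in> carrier M \<and> m' \<in> carrier M \<and> n \<in> carrier N}
    \<union> {frag_of (m, n \<oplus>\<^bsub>N\<^esub> n') - frag_of (m, n) - frag_of (m, n') | m n n'.
         m \<in> carrier M \<and> n \<in> carrier N \<and> n' \<in> carrier N}
    \<union> {frag_of (a \<odot>\<^bsub>M\<^esub> m, n) - frag_of (m, a \<odot>\<^bsub>N\<^esub> n) | a m n.
         a \<in> carrier A \<and> m \<in> carrier M \<and> n \<in> carrier N})"

definition tensor_group ::
    "('a, 'x) ring_scheme \<Rightarrow> ('a, 'm, 'y) module_scheme \<Rightarrow> ('a, 'n, 'z) module_scheme \<Rightarrow> ('m, 'n) tens monoid" where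
  "tensor_group A M N = free_Abelian_group (carrier M \<times> carrier N) Mod tensor_rels A M N"

definition pure_tensor ::
    "('a, 'x) ring_scheme \<Rightarrow> ('a, 'm, 'y) module_scheme \<Rightarrow> ('a, 'n, 'z) module_scheme \<Rightarrow> 'm \<Rightarrow> 'n \<Rightarrow> ('m, 'n) tens" where
  "pure_tensor A M N m n =
     tensor_rels A M N #>\<^bsub>free_Abelian_group (carrier M \<times> carrier N)\<^esub> frag_of (m, n)"

text \<open>
  The map out of a tensor product into an abelian group \<open>G\<close> (written multiplicatively) induced by a
  balanced map \<open>\<beta>\<close>. A tensor is a coset \<open>X\<close> of formal sums, on which the extension of \<open>\<beta>\<close> to formal
  sums is constant.
\<close>

definition tensor_lift :: "('g, 'x) monoid_scheme \<Rightarrow> ('m \<times> 'n \<Rightarrow> 'g) \<Rightarrow> ('m, 'n) tens \<Rightarrow> 'g" where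
  "tensor_lift G \<beta> X = the_elem
     ((\<lambda>c. finprod G (\<lambda>p. \<beta> p [^]\<^bsub>G\<^esub> Poly_Mapping.lookup c p) (Poly_Mapping.keys c)) ` X)"

definition tensor_map ::
    "('a, 'x) ring_scheme \<Rightarrow> ('a, 'm, 'y) module_scheme \<Rightarrow> ('a, 'n, 'z) module_scheme \<Rightarrow>
     ('k \<Rightarrow> 'm) \<Rightarrow> ('l \<Rightarrow> 'n) \<Rightarrow> ('k, 'l) tens \<Rightarrow> ('m, 'n) tens" where
  "tensor_map A M N f g =
     tensor_lift (tensor_group A M N) (\<lambda>(k, l). pure_tensor A M N (f k) (g l))"

definition tensor_ring ::
    "('a, 'x) ring_scheme \<Rightarrow> ('a, 's, 'y) module_scheme \<Rightarrow> ('a, 't, 'z) module_scheme \<Rightarrow> ('s, 't) tens ring" where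
  "tensor_ring A S T = \<lparr>carrier = carrier (tensor_group A S T),
     monoid.mult = (\<lambda>X Y. tensor_lift (tensor_group A S T)
       (\<lambda>(s, t). tensor_lift (tensor_group A S T)
         (\<lambda>(s', t'). pure_tensor A S T (s \<otimes>\<^bsub>S\<^esub> s') (t \<otimes>\<^bsub>T\<^esub> t')) Y) X),
     one = pure_tensor A S T \<one>\<^bsub>S\<^esub> \<one>\<^bsub>T\<^esub>,
     ring.zero = one (tensor_group A S T),
     ring.add = monoid.mult (tensor_group A S T)\<rparr>"

text \<open>The \<open>B\<close>-module \<open>B \<otimes>\<^sub>A M\<close> for a ring homomorphism \<open>\<phi>\<close> from \<open>A\<close> to \<open>B\<close>.\<close>

definition base_change ::
    "('a, 'x) ring_scheme \<Rightarrow> ('a \<Rightarrow> 'b) \<Rightarrow> ('b, 'y) ring_scheme \<Rightarrow> ('a, 'm, 'z) module_scheme \<Rightarrow>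
     ('b, ('b, 'm) tens) module" where
  "base_change A \<phi> B M = (let G = tensor_group A (algebra_via \<phi> B) M in
     \<lparr>carrier = carrier G, monoid.mult = undefined, one = undefined,
      ring.zero = one G, ring.add = monoid.mult G,
      smult = (\<lambda>b. tensor_map A (algebra_via \<phi> B) M (\<lambda>b'. b \<otimes>\<^bsub>B\<^esub> b') (\<lambda>m. m))\<rparr>)"


section \<open>Completion at an ideal\<close>

fun ideal_power :: "('a, 'x) ring_scheme \<Rightarrow> 'a set \<Rightarrow> nat \<Rightarrow> 'a set" where
  "ideal_power R I 0 = carrier R"
| "ideal_power R I (Suc n) = I \<cdot>\<^bsub>R\<^esub> ideal_power R I n"

text \<open>
  The inverse limit of the rings \<open>R / I\<^sup>n\<close>. The transition map sends a coset of \<open>I\<^sup>n\<^sup>+\<^sup>1\<close> to the unique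
  coset of \<open>I\<^sup>n\<close> containing it.
\<close>

definition completion :: "('a, 'x) ring_scheme \<Rightarrow> 'a set \<Rightarrow> (nat \<Rightarrow> 'a set) ring" where
  "completion R I = (let Q = (\<lambda>n. R Quot ideal_power R I n) in
     \<lparr>carrier = {x. \<forall>n. x n \<in> carrier (Q n) \<and> x (Suc n) \<subseteq> x n},
      monoid.mult = (\<lambda>x y n. x n \<otimes>\<^bsub>Q n\<^esub> y n), one = (\<lambda>n. \<one>\<^bsub>Q n\<^esub>),
      ring.zero = (\<lambda>n. \<zero>\<^bsub>Q n\<^esub>), ring.add = (\<lambda>x y n. x n \<oplus>\<^bsub>Q n\<^esub> y n)\<rparr>)"

definition to_completion :: "('a, 'x) ring_scheme \<Rightarrow> 'a set \<Rightarrow> 'a \<Rightarrow> nat \<Rightarrow> 'a set" where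
  "to_completion R I a = (\<lambda>n. ideal_power R I n +>\<^bsub>R\<^esub> a)"

text \<open>The map of completions induced by \<open>f\<close> mapping \<open>I\<close> into \<open>I'\<close>, where \<open>I'\<close> is an ideal of \<open>R'\<close>.\<close>

definition completion_map ::
    "('b, 'x) ring_scheme \<Rightarrow> 'b set \<Rightarrow> ('a \<Rightarrow> 'b) \<Rightarrow> (nat \<Rightarrow> 'a set) \<Rightarrow> (nat \<Rightarrow> 'b set)" where
  "completion_map R' I' f x = (\<lambda>n. \<Union>a\<in>x n. ideal_power R' I' n +>\<^bsub>R'\<^esub> f a)"


section \<open>Locally free modules of finite type\<close>

text \<open>The localization \<open>B[1/f]\<close>, as classes of pairs \<open>(b, i)\<close> standing for \<open>b / f\<^sup>i\<close>.\<close>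

definition loc_rel :: "('b, 'x) ring_scheme \<Rightarrow> 'b \<Rightarrow> (('b \<times> nat) \<times> ('b \<times> nat)) set" where
  "loc_rel B f = {((a, i), (b, j)). a \<in> carrier B \<and> b \<in> carrier B \<and>
     (\<exists>k::nat. f [^]\<^bsub>B\<^esub> (k + j) \<otimes>\<^bsub>B\<^esub> a = f [^]\<^bsub>B\<^esub> (k + i) \<otimes>\<^bsub>B\<^esub> b)}"

definition loc_ring :: "('b, 'x) ring_scheme \<Rightarrow> 'b \<Rightarrow> ('b \<times> nat) set ring" where
  "loc_ring B f = \<lparr>carrier = (carrier B \<times> UNIV) // loc_rel B f,
     monoid.mult = (\<lambda>X Y. \<Union>(a, i)\<in>X. \<Union>(b, j)\<in>Y. loc_rel B f `` {(a \<otimes>\<^bsub>B\<^esub> b, i + j)}),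
     one = loc_rel B f `` {(\<one>\<^bsub>B\<^esub>, 0)},
     ring.zero = loc_rel B f `` {(\<zero>\<^bsub>B\<^esub>, 0)},
     ring.add = (\<lambda>X Y. \<Union>(a, i)\<in>X. \<Union>(b, j)\<in>Y.
       loc_rel B f `` {(f [^]\<^bsub>B\<^esub> j \<otimes>\<^bsub>B\<^esub> a \<oplus>\<^bsub>B\<^esub> f [^]\<^bsub>B\<^esub> i \<otimes>\<^bsub>B\<^esub> b, i + j)})\<rparr>"

definition to_loc :: "('b, 'x) ring_scheme \<Rightarrow> 'b \<Rightarrow> 'b \<Rightarrow> ('b \<times> nat) set" where
  "to_loc B f b = loc_rel B f `` {(b, 0)}"

definition finite_free :: "('b, 'x) ring_scheme \<Rightarrow> ('b, 'm, 'z) module_scheme \<Rightarrow> bool" where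
  "finite_free B M \<longleftrightarrow> (\<exists>(n::nat) e. e \<in> {..<n} \<rightarrow> carrier M \<and>
     (\<forall>x\<in>carrier M. \<exists>!c. c \<in> {..<n} \<rightarrow>\<^sub>E carrier B \<and> x = (\<Oplus>\<^bsub>M\<^esub>i\<in>{..<n}. c i \<odot>\<^bsub>M\<^esub> e i)))"

text \<open>Free of finite rank on each member of a cover of \<open>Spec B\<close> by basic open sets \<open>D(f)\<close>.\<close>

definition finite_locally_free :: "('b, 'x) ring_scheme \<Rightarrow> ('b, 'm, 'z) module_scheme \<Rightarrow> bool" where
  "finite_locally_free B M \<longleftrightarrow> module B M \<and>
     (\<exists>D. finite D \<and> D \<subseteq> carrier B \<and> genideal B D = carrier B \<and>
       (\<forall>f\<in>D. finite_free (loc_ring B f) (base_change B (to_loc B f) (loc_ring B f) M)))"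

definition module_span :: "('b, 'x) ring_scheme \<Rightarrow> ('b, 'm, 'z) module_scheme \<Rightarrow> 'm set \<Rightarrow> 'm set" where
  "module_span B M X = \<Inter>{H. submodule H B M \<and> X \<subseteq> H}"


section \<open>Isocrystals\<close>

text \<open>
  A left \<open>B{\<tau>}\<close>-module is a \<open>B\<close>-module with an additive operator \<open>\<tau>\<close> satisfying
  \<open>\<tau> (b m) = \<sigma> b (\<tau> m)\<close>.
\<close>

record ('b, 'm) tau_module = "('b, 'm) module" + tau :: "'m \<Rightarrow> 'm"

definition left_tau_module ::
    "('b, 'x) ring_scheme \<Rightarrow> ('b \<Rightarrow> 'b) \<Rightarrow> ('b, 'm) tau_module \<Rightarrow> bool" where
  "left_tau_module B \<sigma> M \<longleftrightarrow> module B M \<and> tau M \<in> carrier M \<rightarrow> carrier M \<and>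
     (\<forall>x\<in>carrier M. \<forall>y\<in>carrier M. tau M (x \<oplus>\<^bsub>M\<^esub> y) = tau M x \<oplus>\<^bsub>M\<^esub> tau M y) \<and>
     (\<forall>b\<in>carrier B. \<forall>x\<in>carrier M. tau M (b \<odot>\<^bsub>M\<^esub> x) = \<sigma> b \<odot>\<^bsub>M\<^esub> tau M x)"

definition linearization :: "('b, 'm) tau_module \<Rightarrow> ('b, 'm) tens \<Rightarrow> 'm" where
  "linearization M = tensor_lift (add_monoid M) (\<lambda>(b, m). b \<odot>\<^bsub>M\<^esub> tau M m)"

definition isocrystal ::
    "('b, 'x) ring_scheme \<Rightarrow> ('b \<Rightarrow> 'b) \<Rightarrow> ('b, 'm) tau_module \<Rightarrow> bool" where
  "isocrystal B \<sigma> M \<longleftrightarrow> left_tau_module B \<sigma> M \<and> finite_locally_free B M \<and>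
     bij_betw (linearization M) (carrier (base_change B \<sigma> B M)) (carrier M)"

text \<open>Morphisms are extensional functions, so that equality of morphisms is equality on the carrier.\<close>

definition isocrystal_hom ::
    "('b, 'x) ring_scheme \<Rightarrow> ('b, 'm) tau_module \<Rightarrow> ('b, 'n) tau_module \<Rightarrow> ('m \<Rightarrow> 'n) set" where
  "isocrystal_hom B M N = {f \<in> carrier M \<rightarrow>\<^sub>E carrier N.
     (\<forall>x\<in>carrier M. \<forall>y\<in>carrier M. f (x \<oplus>\<^bsub>M\<^esub> y) = f x \<oplus>\<^bsub>N\<^esub> f y) \<and>
     (\<forall>b\<in>carrier B. \<forall>x\<in>carrier M. f (b \<odot>\<^bsub>M\<^esub> x) = b \<odot>\<^bsub>N\<^esub> f x) \<and>
     (\<forall>x\<in>carrier M. f (tau M x) = tau N (f x))}"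

text \<open>
  Base change along a homomorphism \<open>\<phi>\<close> from \<open>B\<close> to \<open>(C, \<sigma>)\<close>, with \<open>\<tau> (c \<otimes> m) = \<sigma> c \<otimes> \<tau> m\<close>.
\<close>

definition base_change_obj ::
    "('b, 'x) ring_scheme \<Rightarrow> ('b \<Rightarrow> 'c) \<Rightarrow> ('c, 'y) ring_scheme \<Rightarrow> ('c \<Rightarrow> 'c) \<Rightarrow> ('b, 'm) tau_module \<Rightarrow>
     ('c, ('c, 'm) tens) tau_module" where
  "base_change_obj B \<phi> C \<sigma> M = module.extend (base_change B \<phi> C M)
     (tau_module.fields (tensor_map B (algebra_via \<phi> C) M \<sigma> (tau M)))"

definition base_change_mor ::
    "('b, 'x) ring_scheme \<Rightarrow> ('b \<Rightarrow> 'c) \<Rightarrow> ('c, 'y) ring_scheme \<Rightarrow>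
     ('b, 'm) tau_module \<Rightarrow> ('b, 'n) tau_module \<Rightarrow> ('m \<Rightarrow> 'n) \<Rightarrow> ('c, 'm) tens \<Rightarrow> ('c, 'n) tens" where
  "base_change_mor B \<phi> C M N f =
     restrict (tensor_map B (algebra_via \<phi> C) N (\<lambda>c. c) f) (carrier (base_change B \<phi> C M))"


section \<open>Valuations and local fields\<close>

text \<open>The value of \<open>v\<close> at zero is irrelevant.\<close>

definition discrete_valuation :: "('a, 'x) ring_scheme \<Rightarrow> ('a \<Rightarrow> int) \<Rightarrow> bool" where
  "discrete_valuation K v \<longleftrightarrow>
     (\<forall>x\<in>carrier K - {\<zero>\<^bsub>K\<^esub>}. \<forall>y\<in>carrier K - {\<zero>\<^bsub>K\<^esub>}.
        v (x \<otimes>\<^bsub>K\<^esub> y) = v x + v y \<and>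
        (x \<oplus>\<^bsub>K\<^esub> y \<noteq> \<zero>\<^bsub>K\<^esub> \<longrightarrow> min (v x) (v y) \<le> v (x \<oplus>\<^bsub>K\<^esub> y)))"

definition nontrivial_valuation :: "('a, 'x) ring_scheme \<Rightarrow> ('a \<Rightarrow> int) \<Rightarrow> bool" where
  "nontrivial_valuation K v \<longleftrightarrow> (\<exists>x\<in>carrier K - {\<zero>\<^bsub>K\<^esub>}. v x \<noteq> 0)"

definition val_ball :: "('a, 'x) ring_scheme \<Rightarrow> ('a \<Rightarrow> int) \<Rightarrow> int \<Rightarrow> 'a set" where
  "val_ball K v n = {x \<in> carrier K. x = \<zero>\<^bsub>K\<^esub> \<or> n \<le> v x}"

definition int_ring :: "('a, 'b) module \<Rightarrow> ('b \<Rightarrow> int) \<Rightarrow> ('a, 'b) module" where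
  "int_ring K v = K\<lparr>carrier := val_ball K v 0\<rparr>"

definition max_ideal :: "('a, 'b) module \<Rightarrow> ('b \<Rightarrow> int) \<Rightarrow> 'b set" where
  "max_ideal K v = val_ball K v 1"

definition val_complete :: "('a, 'x) ring_scheme \<Rightarrow> ('a \<Rightarrow> int) \<Rightarrow> bool" where
  "val_complete K v \<longleftrightarrow> (\<forall>x::nat \<Rightarrow> 'a. range x \<subseteq> carrier K \<longrightarrow>
     (\<forall>n. \<exists>N. \<forall>i\<ge>N. \<forall>j\<ge>N. x i \<ominus>\<^bsub>K\<^esub> x j \<in> val_ball K v n) \<longrightarrow>
     (\<exists>l\<in>carrier K. \<forall>n. \<exists>N. \<forall>i\<ge>N. x i \<ominus>\<^bsub>K\<^esub> l \<in> val_ball K v n))"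

text \<open>
  A local field containing a finite field is non-archimedean: a field complete for a discrete
  valuation, here normalized to have value group all of \<open>\<int>\<close>, with finite residue field.
\<close>

definition local_field_over :: "'q ring \<Rightarrow> ('q, 'f) module \<Rightarrow> ('f \<Rightarrow> int) \<Rightarrow> bool" where
  "local_field_over Fq F w \<longleftrightarrow> field F \<and> algebra Fq F \<and> discrete_valuation F w \<and>
     w ` (carrier F - {\<zero>\<^bsub>F\<^esub>}) = UNIV \<and> val_complete F w \<and>
     finite (carrier (int_ring F w Quot max_ideal F w))"

definition uniformizer :: "('q, 'f) module \<Rightarrow> ('f \<Rightarrow> int) \<Rightarrow> 'f \<Rightarrow> bool" where
  "uniformizer F w z \<longleftrightarrow> z \<in> carrier (int_ring F w) \<and> max_ideal F w = PIdl\<^bsub>int_ring F w\<^esub> z"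

definition residue_degree :: "'q ring \<Rightarrow> ('q, 'f) module \<Rightarrow> ('f \<Rightarrow> int) \<Rightarrow> nat" where
  "residue_degree Fq F w = (let k = int_ring F w Quot max_ideal F w in
     ring.dim k ((\<lambda>a. max_ideal F w +>\<^bsub>int_ring F w\<^esub> (a \<odot>\<^bsub>F\<^esub> \<one>\<^bsub>F\<^esub>)) ` carrier Fq) (carrier k))"


section \<open>The rings \<open>\<A>\<^sub>S\<close> and \<open>\<B>\<^sub>S\<close>\<close>

text \<open>
  Throughout, \<open>S\<close> is an \<open>\<bbbF>\<^sub>q\<close>-algebra, and \<open>F\<close> is the local field with normalized valuation \<open>w\<close>.
\<close>

type_synonym ('s, 'f) A_elt = "nat \<Rightarrow> ('s, 'f) tens set"
type_synonym ('s, 'f) B_elt = "(('s, 'f) A_elt, 'f) tens"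

definition frob :: "'q ring \<Rightarrow> ('q, 's) module \<Rightarrow> 's \<Rightarrow> 's" where
  "frob Fq S s = s [^]\<^bsub>S\<^esub> card (carrier Fq)"

definition A_pre :: "'q ring \<Rightarrow> ('q, 'f) module \<Rightarrow> ('f \<Rightarrow> int) \<Rightarrow> ('q, 's) module \<Rightarrow> ('s, 'f) tens ring" where
  "A_pre Fq F w S = tensor_ring Fq S (int_ring F w)"

definition A_ideal :: "'q ring \<Rightarrow> ('q, 'f) module \<Rightarrow> ('f \<Rightarrow> int) \<Rightarrow> ('q, 's) module \<Rightarrow> ('s, 'f) tens set" where
  "A_ideal Fq F w S = genideal (A_pre Fq F w S)
     {pure_tensor Fq S (int_ring F w) s x | s x. s \<in> carrier S \<and> x \<in> max_ideal F w}"

definition A_ring :: "'q ring \<Rightarrow> ('q, 'f) module \<Rightarrow> ('f \<Rightarrow> int) \<Rightarrow> ('q, 's) module \<Rightarrow> ('s, 'f) A_elt ring" where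
  "A_ring Fq F w S = completion (A_pre Fq F w S) (A_ideal Fq F w S)"

definition S_to_A :: "'q ring \<Rightarrow> ('q, 'f) module \<Rightarrow> ('f \<Rightarrow> int) \<Rightarrow> ('q, 's) module \<Rightarrow> 's \<Rightarrow> ('s, 'f) A_elt" where
  "S_to_A Fq F w S s = to_completion (A_pre Fq F w S) (A_ideal Fq F w S)
     (pure_tensor Fq S (int_ring F w) s \<one>\<^bsub>F\<^esub>)"

definition O_to_A :: "'q ring \<Rightarrow> ('q, 'f) module \<Rightarrow> ('f \<Rightarrow> int) \<Rightarrow> ('q, 's) module \<Rightarrow> 'f \<Rightarrow> ('s, 'f) A_elt" where
  "O_to_A Fq F w S x = to_completion (A_pre Fq F w S) (A_ideal Fq F w S)
     (pure_tensor Fq S (int_ring F w) \<one>\<^bsub>S\<^esub> x)"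

text \<open>The map \<open>\<A>\<^sub>S' \<rightarrow> \<A>\<^sub>S\<close> induced by a ring homomorphism \<open>h\<close> from \<open>S'\<close> to \<open>S\<close> over \<open>\<bbbF>\<^sub>q\<close>.\<close>

definition A_map :: "'q ring \<Rightarrow> ('q, 'f) module \<Rightarrow> ('f \<Rightarrow> int) \<Rightarrow> ('q, 's) module \<Rightarrow>
    ('r \<Rightarrow> 's) \<Rightarrow> ('r, 'f) A_elt \<Rightarrow> ('s, 'f) A_elt" where
  "A_map Fq F w S h = completion_map (A_pre Fq F w S) (A_ideal Fq F w S)
     (tensor_map Fq S (int_ring F w) h (\<lambda>x. x))"

definition A_over_O :: "'q ring \<Rightarrow> ('q, 'f) module \<Rightarrow> ('f \<Rightarrow> int) \<Rightarrow> ('q, 's) module \<Rightarrow>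
    ('f, ('s, 'f) A_elt) module" where
  "A_over_O Fq F w S = algebra_via (O_to_A Fq F w S) (A_ring Fq F w S)"

definition F_over_O :: "('q, 'f) module \<Rightarrow> ('f, 'f) module" where
  "F_over_O F = algebra_via (\<lambda>x. x) F"

definition B_ring :: "'q ring \<Rightarrow> ('q, 'f) module \<Rightarrow> ('f \<Rightarrow> int) \<Rightarrow> ('q, 's) module \<Rightarrow> ('s, 'f) B_elt ring" where
  "B_ring Fq F w S = tensor_ring (int_ring F w) (A_over_O Fq F w S) (F_over_O F)"

definition AF_to_B :: "'q ring \<Rightarrow> ('q, 'f) module \<Rightarrow> ('f \<Rightarrow> int) \<Rightarrow> ('q, 's) module \<Rightarrow>
    ('s, 'f) A_elt \<Rightarrow> 'f \<Rightarrow> ('s, 'f) B_elt" where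
  "AF_to_B Fq F w S = pure_tensor (int_ring F w) (A_over_O Fq F w S) (F_over_O F)"

definition A_to_B :: "'q ring \<Rightarrow> ('q, 'f) module \<Rightarrow> ('f \<Rightarrow> int) \<Rightarrow> ('q, 's) module \<Rightarrow>
    ('s, 'f) A_elt \<Rightarrow> ('s, 'f) B_elt" where
  "A_to_B Fq F w S a = AF_to_B Fq F w S a \<one>\<^bsub>F\<^esub>"

definition S_to_B :: "'q ring \<Rightarrow> ('q, 'f) module \<Rightarrow> ('f \<Rightarrow> int) \<Rightarrow> ('q, 's) module \<Rightarrow> 's \<Rightarrow> ('s, 'f) B_elt" where
  "S_to_B Fq F w S s = A_to_B Fq F w S (S_to_A Fq F w S s)"

definition F_to_B :: "'q ring \<Rightarrow> ('q, 'f) module \<Rightarrow> ('f \<Rightarrow> int) \<Rightarrow> ('q, 's) module \<Rightarrow> 'f \<Rightarrow> ('s, 'f) B_elt" where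
  "F_to_B Fq F w S x = AF_to_B Fq F w S \<one>\<^bsub>A_ring Fq F w S\<^esub> x"

definition B_map :: "'q ring \<Rightarrow> ('q, 'f) module \<Rightarrow> ('f \<Rightarrow> int) \<Rightarrow> ('q, 's) module \<Rightarrow>
    ('r \<Rightarrow> 's) \<Rightarrow> ('r, 'f) B_elt \<Rightarrow> ('s, 'f) B_elt" where
  "B_map Fq F w S h =
     tensor_map (int_ring F w) (A_over_O Fq F w S) (F_over_O F) (A_map Fq F w S h) (\<lambda>x. x)"

definition sigma_A :: "'q ring \<Rightarrow> ('q, 'f) module \<Rightarrow> ('f \<Rightarrow> int) \<Rightarrow> ('q, 's) module \<Rightarrow>
    ('s, 'f) A_elt \<Rightarrow> ('s, 'f) A_elt" where
  "sigma_A Fq F w S = A_map Fq F w S (frob Fq S)"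

definition sigma_B :: "'q ring \<Rightarrow> ('q, 'f) module \<Rightarrow> ('f \<Rightarrow> int) \<Rightarrow> ('q, 's) module \<Rightarrow>
    ('s, 'f) B_elt \<Rightarrow> ('s, 'f) B_elt" where
  "sigma_B Fq F w S = B_map Fq F w S (frob Fq S)"


section \<open>The rings \<open>\<A>\<^sup>b\<close> and \<open>\<B>\<^sup>b\<close>\<close>

text \<open>\<open>K\<close> is an \<open>\<bbbF>\<^sub>q\<close>-algebra with valuation \<open>v\<close>, and \<open>R\<close> is \<^term>\<open>int_ring K v\<close>.\<close>

type_synonym ('k, 'f) Ab_elt = "('k, ('k, 'f) A_elt) tens"
type_synonym ('k, 'f) Bb_elt = "('k, ('k, 'f) B_elt) tens"

definition K_over_R :: "('q, 'k) module \<Rightarrow> ('k, 'k) module" where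
  "K_over_R K = algebra_via (\<lambda>x. x) K"

definition A_over_R :: "'q ring \<Rightarrow> ('q, 'f) module \<Rightarrow> ('f \<Rightarrow> int) \<Rightarrow> ('q, 'k) module \<Rightarrow> ('k \<Rightarrow> int) \<Rightarrow>
    ('k, ('k, 'f) A_elt) module" where
  "A_over_R Fq F w K v = algebra_via (S_to_A Fq F w (int_ring K v)) (A_ring Fq F w (int_ring K v))"

definition B_over_R :: "'q ring \<Rightarrow> ('q, 'f) module \<Rightarrow> ('f \<Rightarrow> int) \<Rightarrow> ('q, 'k) module \<Rightarrow> ('k \<Rightarrow> int) \<Rightarrow>
    ('k, ('k, 'f) B_elt) module" where
  "B_over_R Fq F w K v = algebra_via (S_to_B Fq F w (int_ring K v)) (B_ring Fq F w (int_ring K v))"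

definition Ab_ring :: "'q ring \<Rightarrow> ('q, 'f) module \<Rightarrow> ('f \<Rightarrow> int) \<Rightarrow> ('q, 'k) module \<Rightarrow> ('k \<Rightarrow> int) \<Rightarrow>
    ('k, 'f) Ab_elt ring" where
  "Ab_ring Fq F w K v = tensor_ring (int_ring K v) (K_over_R K) (A_over_R Fq F w K v)"

definition Bb_ring :: "'q ring \<Rightarrow> ('q, 'f) module \<Rightarrow> ('f \<Rightarrow> int) \<Rightarrow> ('q, 'k) module \<Rightarrow> ('k \<Rightarrow> int) \<Rightarrow>
    ('k, 'f) Bb_elt ring" where
  "Bb_ring Fq F w K v = tensor_ring (int_ring K v) (K_over_R K) (B_over_R Fq F w K v)"

definition Ab_to_Bb :: "'q ring \<Rightarrow> ('q, 'f) module \<Rightarrow> ('f \<Rightarrow> int) \<Rightarrow> ('q, 'k) module \<Rightarrow> ('k \<Rightarrow> int) \<Rightarrow>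
    ('k, 'f) Ab_elt \<Rightarrow> ('k, 'f) Bb_elt" where
  "Ab_to_Bb Fq F w K v = tensor_map (int_ring K v) (K_over_R K) (B_over_R Fq F w K v)
     (\<lambda>c. c) (A_to_B Fq F w (int_ring K v))"

definition F_to_Bb :: "'q ring \<Rightarrow> ('q, 'f) module \<Rightarrow> ('f \<Rightarrow> int) \<Rightarrow> ('q, 'k) module \<Rightarrow> ('k \<Rightarrow> int) \<Rightarrow>
    'f \<Rightarrow> ('k, 'f) Bb_elt" where
  "F_to_Bb Fq F w K v x = pure_tensor (int_ring K v) (K_over_R K) (B_over_R Fq F w K v)
     \<one>\<^bsub>K\<^esub> (F_to_B Fq F w (int_ring K v) x)"

definition sigma_Bb :: "'q ring \<Rightarrow> ('q, 'f) module \<Rightarrow> ('f \<Rightarrow> int) \<Rightarrow> ('q, 'k) module \<Rightarrow> ('k \<Rightarrow> int) \<Rightarrow>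
    ('k, 'f) Bb_elt \<Rightarrow> ('k, 'f) Bb_elt" where
  "sigma_Bb Fq F w K v = tensor_map (int_ring K v) (K_over_R K) (B_over_R Fq F w K v)
     (frob Fq K) (sigma_B Fq F w (int_ring K v))"

text \<open>
  The canonical homomorphism \<open>\<B>\<^sup>b \<rightarrow> \<B>\<^sub>K\<close>, given by \<open>c \<otimes> b \<mapsto> c b\<close>, where \<open>\<B>\<^sub>R \<rightarrow> \<B>\<^sub>K\<close> is induced by
  the inclusion of \<open>R\<close> in \<open>K\<close>.
\<close>

definition Bb_to_BK :: "'q ring \<Rightarrow> ('q, 'f) module \<Rightarrow> ('f \<Rightarrow> int) \<Rightarrow> ('q, 'k) module \<Rightarrow>
    ('k, 'f) Bb_elt \<Rightarrow> ('k, 'f) B_elt" where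
  "Bb_to_BK Fq F w K = tensor_lift (add_monoid (B_ring Fq F w K))
     (\<lambda>(c, b). S_to_B Fq F w K c \<otimes>\<^bsub>B_ring Fq F w K\<^esub> B_map Fq F w K (\<lambda>x. x) b)"


section \<open>Pure isocrystals\<close>

definition isocrystal_lattice :: "'q ring \<Rightarrow> ('q, 'f) module \<Rightarrow> ('f \<Rightarrow> int) \<Rightarrow> ('q, 'k) module \<Rightarrow>
    ('k \<Rightarrow> int) \<Rightarrow> (('k, 'f) Bb_elt, 'm) tau_module \<Rightarrow> 'm set \<Rightarrow> bool" where
  "isocrystal_lattice Fq F w K v M T \<longleftrightarrow>
     (let M\<^sub>A = restrict_scalars (Ab_to_Bb Fq F w K v) M in
       submodule T (Ab_ring Fq F w K v) M\<^sub>A \<and>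
       finite_locally_free (Ab_ring Fq F w K v) (M\<^sub>A\<lparr>carrier := T\<rparr>) \<and>
       module_span (Bb_ring Fq F w K v) M T = carrier M)"

definition pure_isocrystal :: "'q ring \<Rightarrow> ('q, 'f) module \<Rightarrow> ('f \<Rightarrow> int) \<Rightarrow> 'f \<Rightarrow> ('q, 'k) module \<Rightarrow>
    ('k \<Rightarrow> int) \<Rightarrow> (('k, 'f) Bb_elt, 'm) tau_module \<Rightarrow> bool" where
  "pure_isocrystal Fq F w z K v M \<longleftrightarrow>
     isocrystal (Bb_ring Fq F w K v) (sigma_Bb Fq F w K v) M \<and>
     (\<exists>(s::int) (r::nat) T. 0 < r \<and> isocrystal_lattice Fq F w K v M T \<and>
       (\<lambda>t. F_to_Bb Fq F w K v (z [^]\<^bsub>F\<^esub> s) \<odot>\<^bsub>M\<^esub> t) ` T =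
       module_span (Ab_ring Fq F w K v) (restrict_scalars (Ab_to_Bb Fq F w K v) M)
         ((tau M ^^ (r * residue_degree Fq F w)) ` T))"

definition BK_obj :: "'q ring \<Rightarrow> ('q, 'f) module \<Rightarrow> ('f \<Rightarrow> int) \<Rightarrow> ('q, 'k) module \<Rightarrow> ('k \<Rightarrow> int) \<Rightarrow>
    (('k, 'f) Bb_elt, 'm) tau_module \<Rightarrow> (('k, 'f) B_elt, (('k, 'f) B_elt, 'm) tens) tau_module" where
  "BK_obj Fq F w K v = base_change_obj (Bb_ring Fq F w K v) (Bb_to_BK Fq F w K)
     (B_ring Fq F w K) (sigma_B Fq F w K)"

definition BK_mor :: "'q ring \<Rightarrow> ('q, 'f) module \<Rightarrow> ('f \<Rightarrow> int) \<Rightarrow> ('q, 'k) module \<Rightarrow> ('k \<Rightarrow> int) \<Rightarrow>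
    (('k, 'f) Bb_elt, 'm) tau_module \<Rightarrow> (('k, 'f) Bb_elt, 'n) tau_module \<Rightarrow> ('m \<Rightarrow> 'n) \<Rightarrow>
    (('k, 'f) B_elt, 'm) tens \<Rightarrow> (('k, 'f) B_elt, 'n) tens" where
  "BK_mor Fq F w K v = base_change_mor (Bb_ring Fq F w K v) (Bb_to_BK Fq F w K) (B_ring Fq F w K)"

end

theory Submission
 imports Defs "HOL-Algebra.Sylow" "HOL-Algebra.Multiplicative_Group"
begin

text \<open>
  Let \<open>n\<close> be a common exponent for the purity conditions of \<open>M\<close> and \<open>N\<close>. In terms of generators of the
  two lattices, a morphism of the base changes to \<open>\<B>\<^sub>K\<close> is a matrix whose finite set \<open>G\<close> of entries satisfies
  either \<open>\<sigma>\<^sup>n G \<subseteq> span G\<close> or \<open>G \<subseteq> z\<^sup>s span (\<sigma>\<^sup>n G)\<close> with \<open>s > 0\<close>, the spans being over \<open>\<A>\<^sup>b\<close>. Digit expansions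
  in \<open>\<O>\<close> give coordinates on \<open>\<A>\<^sub>K\<close> with values in \<open>K\<close> on which \<open>\<sigma>\<close> acts by the \<open>q\<close>-Frobenius, while
  elements of \<open>\<A>\<^sup>b\<close> lower valuations by a bounded amount. In the first case the coordinates have
  bounded valuation, because \<open>v\<close> is multiplied by \<open>q\<^sup>n\<close>, so that \<open>G\<close> lies in \<open>\<B>\<^sup>b\<close>; in the second case \<open>G\<close> is
  divisible by every power of \<open>z\<close> and vanishes. Since lattices are projective, this makes
  the morphism descend to \<open>\<B>\<^sup>b\<close>, uniquely because \<open>\<B>\<^sup>b \<rightarrow> \<B>\<^sub>K\<close> is injective.

  The structure of an operation is written after a dot, and \<open>x \<in>. M\<close> stands for \<open>x \<in> carrier M\<close>.
\<close>

\<comment> \<open>The lattices are only locally free, so there is no square matrix to invert. A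
  lattice is given instead by generators with coordinate functionals, as every finitely generated
  projective module has, and the Frobenius equation is kept as an inclusion of spans over A^b, which
  tolerates redundant generators. The obstacle in the first case is uniformity. At each z-adic level
  the coordinates of an element of A_K have valuations bounded below, but the bound may decay with
  the level; the elements of A^b are those for which one bound serves all levels. The equation
  provides it: the loss k caused by coefficients from A^b does not depend on the level, and if m is
  the least valuation at a level, then q^n m \<ge> m - k forces m \<ge> -k, whatever bound was known
  before. The coordinates are F_q-linear functionals on O/z^N, not coefficients of power series.
  Such coefficients would lie in K \<otimes> k with k the residue field, which need not be a field
  and on which \<sigma> is not the q-th power; functionals take values in K itself.\<close>
syntax (input) "_index" :: "logic \<Rightarrow> index" ("._" [1000])

abbreviation in_carrier :: "'a \<Rightarrow> ('a, 'b) partial_object_scheme \<Rightarrow> bool" (infix "\<in>." 50) where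
  "x \<in>. M \<equiv> x \<in> carrier M"

section \<open>Additive maps\<close>

abbreviation ahom :: "('a, 'x) ring_scheme \<Rightarrow> ('b, 'y) ring_scheme \<Rightarrow> ('a \<Rightarrow> 'b) set" where
 "ahom P Q \<equiv> hom (add_monoid P) (add_monoid Q)"

lemma ahomI:
 assumes "\<And>x. x \<in>. P ==> f x \<in>. Q"
  and "\<And>x y. x \<in>. P ==> y \<in>. P ==> f (x \<oplus>.P y) = f x \<oplus>.Q f y"
 shows "f \<in> ahom P Q" using assms by (intro homI) auto

lemma ahom_closed: "f \<in> ahom P Q ==> x \<in>. P ==> f x \<in>. Q" by (auto simp: hom_def Pi_def)

lemma ahom_add:
 "f \<in> ahom P Q ==> x \<in>. P ==> y \<in>. P ==> f (x \<oplus>.P y) = f x \<oplus>.Q f y"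
 by (auto simp: hom_def)

lemma ahom_group_hom:
 assumes "abelian_group P" "abelian_group Q" "f \<in> ahom P Q"
 shows "group_hom (add_monoid P) (add_monoid Q) f" using assms by (simp add: group_hom_def group_hom_axioms_def abelian_group.a_group)

lemma ahom_zero:
 assumes "abelian_group P" "abelian_group Q" "f \<in> ahom P Q"
 shows "f \<zero>.P = \<zero>.Q" using group_hom.hom_one[OF ahom_group_hom[OF assms]] by simp

lemma ahom_minus:
 assumes "abelian_group P" "abelian_group Q" "f \<in> ahom P Q" "x \<in>. P"
 shows "f (\<ominus>.P x) = \<ominus>.Q f x" using group_hom.hom_inv[OF ahom_group_hom[OF assms(1-3)], of x] assms(4) by (simp add: a_inv_def)

lemma ahom_diff:
 assumes "abelian_group P" "abelian_group Q" "f \<in> ahom P Q" "x \<in>. P" "y \<in>. P"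
 shows "f (x \<ominus>.P y) = f x \<ominus>.Q f y" using assms by (simp add: a_minus_def ahom_add ahom_minus abelian_group.a_inv_closed)

lemma ahom_finsum:
 assumes "abelian_group P" "abelian_group Q" "f \<in> ahom P Q" "g \<in> I \<rightarrow> carrier P"
 shows "f (\<Oplus>.P i\<in>I. g i) = (\<Oplus>.Q i\<in>I. f (g i))"
proof -
 interpret P: abelian_group P by fact
 interpret Q: abelian_group Q by fact
 show ?thesis using assms(4)
 proof (induction I rule: infinite_finite_induct)
  case (insert i I)
  have "(\<lambda>i. f (g i)) \<in> I \<rightarrow> carrier Q" "f (g i) \<in>. Q" using insert.prems ahom_closed[OF assms(3)] by auto
  then show ?case using insert by (simp add: ahom_add[OF assms(3)] P.finsum_closed)
 qed (simp_all add: ahom_zero[OF assms(1-3)])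
qed

lemma ahom_comp: "f \<in> ahom P Q ==> g \<in> ahom Q S ==> (\<lambda>x. g (f x)) \<in> ahom P S"
 by (intro ahomI) (auto simp: ahom_closed ahom_add)

lemma ahom_plus:
 assumes "f \<in> ahom P Q" "g \<in> ahom P Q" "abelian_group Q"
 shows "(\<lambda>x. f x \<oplus>.Q g x) \<in> ahom P Q"
proof -
 interpret Q: abelian_group Q by fact
 show ?thesis using assms(1,2) by (intro ahomI) (simp_all add: ahom_closed ahom_add Q.a_ac)
qed

section \<open>Tensor products\<close>

lemma finsum_swap:
 assumes "abelian_group Q" "finite I" "finite J"
  and "\<And>i j. i \<in> I ==> j \<in> J ==> g i j \<in>. Q"
 shows "(\<Oplus>.Q i\<in>I. \<Oplus>.Q j\<in>J. g i j) = (\<Oplus>.Q j\<in>J. \<Oplus>.Q i\<in>I. g i j)"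
proof -
 interpret Q: abelian_group Q by fact
 show ?thesis using assms(2,4)
 proof (induction I)
  case (insert i I)
  have "(\<Oplus>.Q j\<in>J. \<Oplus>.Q i\<in>insert i I. g i j) = (\<Oplus>.Q j\<in>J. g i j \<oplus>.Q (\<Oplus>.Q i\<in>I. g i j))"
   using insert by (intro Q.finsum_cong' refl Q.finsum_insert) (auto intro!: Q.finsum_closed)
  also have "\<dots> = (\<Oplus>.Q j\<in>J. g i j) \<oplus>.Q (\<Oplus>.Q j\<in>J. \<Oplus>.Q i\<in>I. g i j)"
   using insert by (intro Q.finsum_addf) (auto intro!: Q.finsum_closed)
  finally show ?case using insert by (simp add: Pi_def)
 qed simp
qed

text \<open>The expression inside \<open>tensor_lift\<close>, split off: the extension of
  \<open>be\<close> from generators to formal sums. A lift is well defined as soon as this extension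
  vanishes on \<open>tensor_rels\<close>.\<close>

definition frag_eval :: "('g, 'x) monoid_scheme \<Rightarrow> ('c \<Rightarrow> 'g) \<Rightarrow> ('c \<Rightarrow>\<^sub>0 int) \<Rightarrow> 'g" where
 "frag_eval G be c = finprod G (\<lambda>p. be p [^].G Poly_Mapping.lookup c p) (Poly_Mapping.keys c)"

context comm_group
begin

lemma frag_eval_superset:
 assumes "finite U" "Poly_Mapping.keys c \<subseteq> U" "be \<in> U \<rightarrow> carrier G"
 shows "frag_eval G be c = (\<Otimes>p\<in>U. be p [^] Poly_Mapping.lookup c p)" unfolding frag_eval_def
 using assms by (intro finprod_mono_neutral_cong_left) (auto simp: in_keys_iff Pi_def)

lemma frag_eval_hom:
 assumes "be \<in> S \<rightarrow> carrier G"
 shows "frag_eval G be \<in> hom (free_Abelian_group S) G"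
proof (rule homI)
 fix x assume x: "x \<in> carrier (free_Abelian_group S)"
 then show "frag_eval G be x \<in>. G" unfolding frag_eval_def using assms by (intro finprod_closed) (auto simp: Pi_def)
next
 fix x y assume "x \<in> carrier (free_Abelian_group S)" "y \<in> carrier (free_Abelian_group S)"
 then have xy: "Poly_Mapping.keys x \<subseteq> S" "Poly_Mapping.keys y \<subseteq> S" by auto
 let ?U = "Poly_Mapping.keys x \<union> Poly_Mapping.keys y"
 have b: "be \<in> ?U \<rightarrow> carrier G" using assms xy by blast
 have "frag_eval G be (x + y) = (\<Otimes>p\<in>?U. be p [^] Poly_Mapping.lookup (x + y) p)" using b by (intro frag_eval_superset keys_add) auto
 also have "\<dots> = (\<Otimes>p\<in>?U. be p [^] Poly_Mapping.lookup x p \<otimes> be p [^] Poly_Mapping.lookup y p)"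
  using b by (intro finprod_cong') (auto simp: lookup_add int_pow_mult Pi_def)
 also have "\<dots> = frag_eval G be x \<otimes> frag_eval G be y" using b by (subst finprod_multf) (auto simp: frag_eval_superset[of ?U] Pi_def)
 finally show "frag_eval G be (x \<otimes>\<^bsub>free_Abelian_group S\<^esub> y) = frag_eval G be x \<otimes> frag_eval G be y" by simp
qed

lemma frag_eval_of:
 assumes "be p \<in>. G"
 shows "frag_eval G be (frag_of p) = be p" using assms by (simp add: frag_eval_def Pi_def)

end

lemma tensor_rels_least:
 assumes "subgroup H (free_Abelian_group (carrier M \<times> carrier N))"
  and "\<And>m m' n. m \<in>. M ==> m' \<in>. M ==> n \<in>. N ==>
   frag_of (m \<oplus>.M m', n) - frag_of (m, n) - frag_of (m', n) \<in> H"
  and "\<And>m n n'. m \<in>. M ==> n \<in>. N ==> n' \<in>. N ==>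
   frag_of (m, n \<oplus>.N n') - frag_of (m, n) - frag_of (m, n') \<in> H"
  and "\<And>a m n. a \<in>. A ==> m \<in>. M ==> n \<in>. N ==>
   frag_of (a \<odot>.M m, n) - frag_of (m, a \<odot>.N n) \<in> H"
 shows "tensor_rels A M N \<subseteq> H" unfolding tensor_rels_def by (rule group.generate_subgroup_incl[OF group_free_Abelian_group _ assms(1)])
   (use assms(2-4) in blast)

lemma add_monoid_tensor_ring: "add_monoid (tensor_ring A M N) = tensor_group A M N" by (simp add: tensor_ring_def tensor_group_def FactGroup_def)

lemma base_change_simps [simp]:
 "carrier (base_change A ph B M) = carrier (tensor_ring A (algebra_via ph B) M)"
 "ring.add (base_change A ph B M) = ring.add (tensor_ring A (algebra_via ph B) M)"
 "\<zero>\<^bsub>base_change A ph B M\<^esub> = \<zero>\<^bsub>tensor_ring A (algebra_via ph B) M\<^esub>"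
 by (simp_all add: base_change_def tensor_ring_def Let_def)

lemma ahom_base_change:
 "ahom (base_change A ph B M) H = ahom (tensor_ring A (algebra_via ph B) M) H"
 "ahom H (base_change A ph B M) = ahom H (tensor_ring A (algebra_via ph B) M)" by (simp_all add: hom_def)

context
 fixes A :: "('a, 'x) ring_scheme" and M :: "('a, 'm, 'y) module_scheme"
  and N :: "('a, 'n, 'z) module_scheme"
 assumes M: "module A M" and N: "module A N"
begin

interpretation M: module A M by (rule M)
interpretation N: module A N by (rule N)

private abbreviation "FG \<equiv> free_Abelian_group (carrier M \<times> carrier N)"

lemma frag_keys2: "Poly_Mapping.keys (frag_of p - frag_of q) \<subseteq> {p, q}" using keys_diff[of "frag_of p" "frag_of q"] by auto

lemma frag_keys3: "Poly_Mapping.keys (frag_of p - frag_of q - frag_of r) \<subseteq> {p, q, r}"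
 using keys_diff[of "frag_of p - frag_of q" "frag_of r"] frag_keys2[of p q] by auto

lemma tensor_rels_subgroup: "subgroup (tensor_rels A M N) FG" unfolding tensor_rels_def
proof (rule group.generate_is_subgroup[OF group_free_Abelian_group], safe)
qed (auto simp: dest!: subsetD[OF frag_keys3] subsetD[OF frag_keys2])

lemma tensor_rels_normal: "tensor_rels A M N \<lhd> FG" by (rule comm_group.subgroup_imp_normal[OF abelian_free_Abelian_group tensor_rels_subgroup])

lemma tensor_comm_group: "comm_group (tensor_group A M N)" unfolding tensor_group_def
 by (rule comm_group.abelian_FactGroup[OF abelian_free_Abelian_group tensor_rels_subgroup])

lemma tensor_abelian_group: "abelian_group (tensor_ring A M N)" using tensor_comm_group
 unfolding abelian_group_def abelian_monoid_def abelian_group_axioms_def add_monoid_tensor_ring[symmetric] comm_group_def by simp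

lemma tensor_proj_hom: "(\<lambda>c. tensor_rels A M N #>.FG c) \<in> hom FG (tensor_group A M N)" unfolding tensor_group_def
 by (rule normal.r_coset_hom_Mod[OF tensor_rels_normal])

lemma pure_tensor_closed [simp]:
 assumes "m \<in>. M" "n \<in>. N"
 shows "pure_tensor A M N m n \<in> carrier (tensor_ring A M N)" using hom_in_carrier[OF tensor_proj_hom, of "frag_of (m, n)"] assms
 by (simp add: tensor_ring_def pure_tensor_def)

lemma tensor_proj_zero_iff:
 assumes "c \<in>. FG"
 shows "tensor_rels A M N #>.FG c = \<zero>\<^bsub>tensor_ring A M N\<^esub> \<longleftrightarrow> c \<in> tensor_rels A M N"
proof -
 have "\<zero>\<^bsub>tensor_ring A M N\<^esub> = tensor_rels A M N" by (simp add: tensor_ring_def tensor_group_def FactGroup_def)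
 moreover have "tensor_rels A M N #>.FG c = tensor_rels A M N \<longleftrightarrow> c \<in> tensor_rels A M N"
  using group.coset_join1[OF group_free_Abelian_group _ assms tensor_rels_subgroup]
   group.coset_join2[OF group_free_Abelian_group assms tensor_rels_subgroup]
   subgroup.subset[OF tensor_rels_subgroup] by blast
 ultimately show ?thesis by simp
qed

lemma tensor_proj_add:
 assumes "c \<in>. FG" "c' \<in>. FG"
 shows "tensor_rels A M N #>.FG (c + c') =
  (tensor_rels A M N #>.FG c) \<oplus>\<^bsub>tensor_ring A M N\<^esub> (tensor_rels A M N #>.FG c')"
 using hom_mult[OF tensor_proj_hom assms] by (simp add: tensor_ring_def)

lemma tensor_proj_eqI:
 assumes "c \<in>. FG" "c' \<in>. FG" "c - c' \<in> tensor_rels A M N"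
 shows "tensor_rels A M N #>.FG c = tensor_rels A M N #>.FG c'"
proof -
 interpret T: abelian_group "tensor_ring A M N" by (rule tensor_abelian_group)
 have cl: "tensor_rels A M N #>.FG c' \<in> carrier (tensor_ring A M N)"
  using hom_in_carrier[OF tensor_proj_hom assms(2)] by (simp add: tensor_ring_def)
 have d: "c - c' \<in>. FG" using assms(3) subgroup.subset[OF tensor_rels_subgroup] by blast
 show ?thesis using tensor_proj_add[OF d assms(2)] tensor_proj_zero_iff[OF d] assms(3) cl by simp
qed

lemma pure_tensor_add_left:
 assumes "m \<in>. M" "m' \<in>. M" "n \<in>. N"
 shows "pure_tensor A M N (m \<oplus>.M m') n = pure_tensor A M N m n \<oplus>\<^bsub>tensor_ring A M N\<^esub> pure_tensor A M N m' n"
proof -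
 have "frag_of (m \<oplus>.M m', n) - frag_of (m, n) - frag_of (m', n) \<in> tensor_rels A M N"
  unfolding tensor_rels_def using assms by (intro generate.incl) blast
 then have "tensor_rels A M N #>.FG frag_of (m \<oplus>.M m', n) = tensor_rels A M N #>.FG (frag_of (m, n) + frag_of (m', n))"
  using assms keys_add[of "frag_of (m, n)" "frag_of (m', n)"] by (intro tensor_proj_eqI) (auto simp: diff_diff_eq)
 then show ?thesis using assms by (simp add: pure_tensor_def tensor_proj_add)
qed

lemma pure_tensor_add_right:
 assumes "m \<in>. M" "n \<in>. N" "n' \<in>. N"
 shows "pure_tensor A M N m (n \<oplus>.N n') = pure_tensor A M N m n \<oplus>\<^bsub>tensor_ring A M N\<^esub> pure_tensor A M N m n'"
proof -
 have "frag_of (m, n \<oplus>.N n') - frag_of (m, n) - frag_of (m, n') \<in> tensor_rels A M N"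
  unfolding tensor_rels_def using assms by (intro generate.incl) blast
 then have "tensor_rels A M N #>.FG frag_of (m, n \<oplus>.N n') = tensor_rels A M N #>.FG (frag_of (m, n) + frag_of (m, n'))"
  using assms keys_add[of "frag_of (m, n)" "frag_of (m, n')"] by (intro tensor_proj_eqI) (auto simp: diff_diff_eq)
 then show ?thesis using assms by (simp add: pure_tensor_def tensor_proj_add)
qed

lemma pure_tensor_smult:
 assumes "a \<in>. A" "m \<in>. M" "n \<in>. N"
 shows "pure_tensor A M N (a \<odot>.M m) n = pure_tensor A M N m (a \<odot>.N n)"
proof -
 have "frag_of (a \<odot>.M m, n) - frag_of (m, a \<odot>.N n) \<in> tensor_rels A M N"
  unfolding tensor_rels_def using assms by (intro generate.incl) blast
 then show ?thesis unfolding pure_tensor_def using assms by (intro tensor_proj_eqI) auto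
qed

lemma pure_tensor_ahom_left: "n \<in>. N ==> (\<lambda>m. pure_tensor A M N m n) \<in> ahom M (tensor_ring A M N)"
 by (intro ahomI) (auto simp: pure_tensor_add_left)

lemma pure_tensor_ahom_right: "m \<in>. M ==> pure_tensor A M N m \<in> ahom N (tensor_ring A M N)"
 by (intro ahomI) (auto simp: pure_tensor_add_right)

lemmas pure_tensor_zero_left = ahom_zero[OF M.abelian_group_axioms tensor_abelian_group pure_tensor_ahom_left]
lemmas pure_tensor_zero_right = ahom_zero[OF N.abelian_group_axioms tensor_abelian_group pure_tensor_ahom_right]

lemma tensor_cases:
 assumes "X \<in> carrier (tensor_ring A M N)"
 obtains c where "c \<in>. FG" "X = tensor_rels A M N #>.FG c"
 using assms unfolding tensor_ring_def tensor_group_def FactGroup_def RCOSETS_def by auto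

text \<open>Zero is the pure tensor of two zeros and the negative of a pure tensor is again pure, so
  sums of pure tensors already exhaust the tensor product.\<close>

lemma tensor_induct [consumes 1, case_names pure add]:
 assumes X: "X \<in> carrier (tensor_ring A M N)"
  and pure: "\<And>m n. m \<in>. M ==> n \<in>. N ==> P (pure_tensor A M N m n)"
  and add: "\<And>X Y. X \<in> carrier (tensor_ring A M N) ==> Y \<in> carrier (tensor_ring A M N) ==>
   P X ==> P Y ==> P (X \<oplus>\<^bsub>tensor_ring A M N\<^esub> Y)"
 shows "P X"
proof -
 interpret T: abelian_group "tensor_ring A M N" by (rule tensor_abelian_group)
 define q where "q = (\<lambda>c. tensor_rels A M N #>.FG c)"
 have q: "q \<in> hom FG (tensor_group A M N)" unfolding q_def by (rule tensor_proj_hom)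
 have q_pure: "q (frag_of (m, n)) = pure_tensor A M N m n" for m n by (simp add: q_def pure_tensor_def)
 \<comment> \<open>Induction on formal sums proceeds through differences, so the claim is carried
   for \<open>q c\<close> and for its negative together.\<close>
 have "P (q c) \<and> P (\<ominus>\<^bsub>tensor_ring A M N\<^esub> q c) \<and> q c \<in> carrier (tensor_ring A M N)" if "Poly_Mapping.keys c \<subseteq> carrier M \<times> carrier N" for c
  using that
 proof (induction c rule: free_Abelian_group_induct[consumes 1, case_names zero diff of])
  case zero
  have "q 0 = \<zero>\<^bsub>tensor_ring A M N\<^esub>"
   unfolding q_def by (subst tensor_proj_zero_iff) (use subgroup.one_closed[OF tensor_rels_subgroup] in auto)
  moreover have "P \<zero>\<^bsub>tensor_ring A M N\<^esub>" using pure[of "\<zero>.M" "\<zero>.N"] by (simp add: pure_tensor_zero_left)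
  moreover have "\<ominus>\<^bsub>tensor_ring A M N\<^esub> \<zero>\<^bsub>tensor_ring A M N\<^esub> = \<zero>\<^bsub>tensor_ring A M N\<^esub>"
   by (rule T.minus_equality) simp_all
  ultimately show ?case by (metis T.zero_closed)
 next
  case (diff x y)
  have "Poly_Mapping.keys (x - y) \<subseteq> carrier M \<times> carrier N" using diff keys_diff[of x y] by blast
  then have "q x = q (x - y) \<oplus>\<^bsub>tensor_ring A M N\<^esub> q y" "q (x - y) \<in> carrier (tensor_ring A M N)"
   using tensor_proj_add[of "x - y" y] diff hom_in_carrier[OF q, of "x - y"] by (auto simp: q_def tensor_ring_def)
  then have "q (x - y) = q x \<oplus>\<^bsub>tensor_ring A M N\<^esub> \<ominus>\<^bsub>tensor_ring A M N\<^esub> q y"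
   using diff by (simp add: T.a_assoc T.r_neg)
  then show ?case
   using diff add[of "q x" "\<ominus>\<^bsub>tensor_ring A M N\<^esub> q y"] add[of "\<ominus>\<^bsub>tensor_ring A M N\<^esub> q x" "q y"] by (simp add: T.minus_add)
 next
  case (of p)
  obtain m n where p: "p = (m, n)" "m \<in>. M" "n \<in>. N" using of by auto
  have "\<ominus>\<^bsub>tensor_ring A M N\<^esub> pure_tensor A M N m n = pure_tensor A M N (\<ominus>.M m) n"
   using ahom_minus[OF M.abelian_group_axioms tensor_abelian_group pure_tensor_ahom_left] p by simp
  then show ?case using p pure by (simp add: q_pure)
 qed
 moreover obtain c where "c \<in>. FG" "X = q c" unfolding q_def by (rule tensor_cases[OF X])
 ultimately show ?thesis by simp
qed

lemma tensor_hom_eqI: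
 assumes "f \<in> ahom (tensor_ring A M N) H" "g \<in> ahom (tensor_ring A M N) H"
  and "\<And>m n. m \<in>. M ==> n \<in>. N ==> f (pure_tensor A M N m n) = g (pure_tensor A M N m n)"
  and "X \<in> carrier (tensor_ring A M N)"
 shows "f X = g X" using assms(4) by (induction rule: tensor_induct) (simp_all add: assms(3) ahom_add[OF assms(1)] ahom_add[OF assms(2)])

text \<open>
 A sequence of maps that is eventually balanced detects when a pure tensor vanishes; this stands in
 for a map to a direct limit.
\<close>

lemma tensor_rels_eventually:
 fixes H :: "('h, 'w) ring_scheme" and b :: "nat \<Rightarrow> 'm \<Rightarrow> 'n \<Rightarrow> 'h"
 assumes H: "abelian_group H"
  and cl: "\<And>k m n. m \<in>. M ==> n \<in>. N ==> b k m n \<in>. H"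
  and addl: "\<And>m m' n. m \<in>. M ==> m' \<in>. M ==> n \<in>. N ==>
   \<exists>k0. \<forall>k\<ge>k0. b k (m \<oplus>.M m') n = b k m n \<oplus>.H b k m' n"
  and addr: "\<And>m n n'. m \<in>. M ==> n \<in>. N ==> n' \<in>. N ==>
   \<exists>k0. \<forall>k\<ge>k0. b k m (n \<oplus>.N n') = b k m n \<oplus>.H b k m n'"
  and bal: "\<And>a m n. a \<in>. A ==> m \<in>. M ==> n \<in>. N ==>
   \<exists>k0. \<forall>k\<ge>k0. b k (a \<odot>.M m) n = b k m (a \<odot>.N n)"
  and c: "c \<in> tensor_rels A M N"
 shows "\<exists>k0. \<forall>k\<ge>k0. frag_eval (add_monoid H) (\<lambda>(m, n). b k m n) c = \<zero>.H"
proof -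
 interpret H: abelian_group H by fact
 let ?e = "\<lambda>k. frag_eval (add_monoid H) (\<lambda>(m, n). b k m n)"
 have e: "?e k \<in> hom FG (add_monoid H)" for k by (rule comm_group.frag_eval_hom) (auto simp: cl H.a_comm_group)
 interpret e: group_hom FG "add_monoid H" "?e k" for k by (simp add: group_hom_def group_hom_axioms_def e H.a_group)
 have e_of: "?e k (frag_of (m, n)) = b k m n" if "m \<in>. M" "n \<in>. N" for k m n
  using that comm_group.frag_eval_of[OF H.a_comm_group, of "\<lambda>(m, n). b k m n" "(m, n)"] by (simp add: cl)
 have e_diff: "?e k (x - y) = ?e k x \<ominus>.H ?e k y" if "x \<in>. FG" "y \<in>. FG" for k x y
 proof -
  have "?e k (x \<otimes>.FG inv\<^bsub>FG\<^esub> y) = ?e k x \<oplus>.H inv\<^bsub>add_monoid H\<^esub> ?e k y"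
   using e.hom_mult[of x "inv\<^bsub>FG\<^esub> y" k] e.hom_inv[of y k] that group.inv_closed[OF group_free_Abelian_group] by auto
  then show ?thesis using that by (simp add: a_minus_def a_inv_def)
 qed
 \<comment> \<open>The threshold may depend on the formal sum; two thresholds combine to their
   maximum, and this makes \<open>Z\<close> a subgroup.\<close>
 define Z where "Z = {c \<in> carrier FG. \<exists>k0. \<forall>k\<ge>k0. ?e k c = \<zero>.H}"
 have Z: "subgroup Z FG"
 proof (rule group.subgroupI[OF group_free_Abelian_group])
  have "0 \<in> Z" using e.hom_one unfolding Z_def by simp
  then show "Z \<noteq> {}" by blast
  fix x assume x: "x \<in> Z"
  then have xF: "x \<in>. FG" unfolding Z_def by blast
  from x obtain k0 where k0: "\<forall>k\<ge>k0. ?e k x = \<zero>.H" unfolding Z_def by blast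
  have mz: "\<ominus>.H \<zero>.H = \<zero>.H" by (rule H.minus_equality) simp_all
  have "?e k (inv\<^bsub>FG\<^esub> x) = \<zero>.H" if "k \<ge> k0" for k using e.hom_inv[OF xF, of k] k0 mz that by (simp only: a_inv_def)
  then show "inv\<^bsub>FG\<^esub> x \<in> Z" using group.inv_closed[OF group_free_Abelian_group xF] unfolding Z_def by blast
 next
  fix x y assume "x \<in> Z" "y \<in> Z"
  then obtain k0 k1 where "x \<in>. FG" "y \<in>. FG" "\<forall>k\<ge>k0. ?e k x = \<zero>.H" "\<forall>k\<ge>k1. ?e k y = \<zero>.H"
   unfolding Z_def by blast
  moreover from this have "\<forall>k\<ge>max k0 k1. ?e k (x \<otimes>.FG y) = \<zero>.H" using e.hom_mult[of x y] by simp
  ultimately show "x \<otimes>.FG y \<in> Z" unfolding Z_def using monoid.m_closed[OF group.is_monoid[OF group_free_Abelian_group]] by blast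
 qed (auto simp: Z_def)
 have "tensor_rels A M N \<subseteq> Z"
 proof (rule tensor_rels_least[OF Z])
  fix m m' n assume mn: "m \<in>. M" "m' \<in>. M" "n \<in>. N"
  obtain k0 where "\<forall>k\<ge>k0. b k (m \<oplus>.M m') n = b k m n \<oplus>.H b k m' n" using addl[OF mn] by blast
  then have "\<forall>k\<ge>k0. ?e k (frag_of (m \<oplus>.M m', n) - (frag_of (m, n) + frag_of (m', n))) = \<zero>.H"
   using mn keys_add[of "frag_of (m, n)" "frag_of (m', n)"] e.hom_mult[of "frag_of (m, n)" "frag_of (m', n)"]
   by (subst e_diff) (auto simp: e_of cl a_minus_def H.r_neg)
  then show "frag_of (m \<oplus>.M m', n) - frag_of (m, n) - frag_of (m', n) \<in> Z"
   unfolding Z_def using mn frag_keys3[of "(m \<oplus>.M m', n)" "(m, n)" "(m', n)"] by (auto simp: diff_diff_eq)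
 next
  fix m n n' assume mn: "m \<in>. M" "n \<in>. N" "n' \<in>. N"
  obtain k0 where "\<forall>k\<ge>k0. b k m (n \<oplus>.N n') = b k m n \<oplus>.H b k m n'" using addr[OF mn] by blast
  then have "\<forall>k\<ge>k0. ?e k (frag_of (m, n \<oplus>.N n') - (frag_of (m, n) + frag_of (m, n'))) = \<zero>.H"
   using mn keys_add[of "frag_of (m, n)" "frag_of (m, n')"] e.hom_mult[of "frag_of (m, n)" "frag_of (m, n')"]
   by (subst e_diff) (auto simp: e_of cl a_minus_def H.r_neg)
  then show "frag_of (m, n \<oplus>.N n') - frag_of (m, n) - frag_of (m, n') \<in> Z"
   unfolding Z_def using mn frag_keys3[of "(m, n \<oplus>.N n')" "(m, n)" "(m, n')"] by (auto simp: diff_diff_eq)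
 next
  fix a m n assume mn: "a \<in>. A" "m \<in>. M" "n \<in>. N"
  obtain k0 where "\<forall>k\<ge>k0. b k (a \<odot>.M m) n = b k m (a \<odot>.N n)" using bal[OF mn] by blast
  then have "\<forall>k\<ge>k0. ?e k (frag_of (a \<odot>.M m, n) - frag_of (m, a \<odot>.N n)) = \<zero>.H"
   using mn by (subst e_diff) (auto simp: e_of cl a_minus_def H.r_neg)
  then show "frag_of (a \<odot>.M m, n) - frag_of (m, a \<odot>.N n) \<in> Z"
   unfolding Z_def using mn frag_keys2[of "(a \<odot>.M m, n)" "(m, a \<odot>.N n)"] by auto
 qed
 then show ?thesis using c unfolding Z_def by blast
qed

text \<open>Computes two kernels below, that of a localization of a module and that of A_S
  \<rightarrow> B_S. In both, \<open>b k\<close> multiplies by a k-th power and is additive and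
  balanced only once that power has cleared the denominators involved.\<close>

lemma pure_tensor_zero_eventually:
 fixes H :: "('h, 'w) ring_scheme" and b :: "nat \<Rightarrow> 'm \<Rightarrow> 'n \<Rightarrow> 'h"
 assumes H: "abelian_group H"
  and cl: "\<And>k m n. m \<in>. M ==> n \<in>. N ==> b k m n \<in>. H"
  and "\<And>m m' n. m \<in>. M ==> m' \<in>. M ==> n \<in>. N ==>
   \<exists>k0. \<forall>k\<ge>k0. b k (m \<oplus>.M m') n = b k m n \<oplus>.H b k m' n"
  and "\<And>m n n'. m \<in>. M ==> n \<in>. N ==> n' \<in>. N ==>
   \<exists>k0. \<forall>k\<ge>k0. b k m (n \<oplus>.N n') = b k m n \<oplus>.H b k m n'"
  and "\<And>a m n. a \<in>. A ==> m \<in>. M ==> n \<in>. N ==>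
   \<exists>k0. \<forall>k\<ge>k0. b k (a \<odot>.M m) n = b k m (a \<odot>.N n)"
  and mn: "m \<in>. M" "n \<in>. N"
  and zero: "pure_tensor A M N m n = \<zero>\<^bsub>tensor_ring A M N\<^esub>"
 shows "\<exists>k0. \<forall>k\<ge>k0. b k m n = \<zero>.H"
proof -
 interpret H: abelian_group H by fact
 have "frag_of (m, n) \<in> tensor_rels A M N" using zero mn tensor_proj_zero_iff[of "frag_of (m, n)"] by (simp add: pure_tensor_def)
 from tensor_rels_eventually[of H b, OF assms(1-5) this]
 obtain k0 where k0: "\<forall>k\<ge>k0. frag_eval (add_monoid H) (\<lambda>(m, n). b k m n) (frag_of (m, n)) = \<zero>.H" by blast
 have "frag_eval (add_monoid H) (\<lambda>(m, n). b k m n) (frag_of (m, n)) = b k m n" for k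
  using mn comm_group.frag_eval_of[OF H.a_comm_group, of "\<lambda>(m, n). b k m n" "(m, n)"] by (simp add: cl)
 with k0 show ?thesis by auto
qed

lemma tensor_lift:
 fixes H :: "('h, 'w) ring_scheme" and b :: "'m \<Rightarrow> 'n \<Rightarrow> 'h"
 assumes H: "abelian_group H"
  and cl: "\<And>m n. m \<in>. M ==> n \<in>. N ==> b m n \<in>. H"
  and addl: "\<And>m m' n. m \<in>. M ==> m' \<in>. M ==> n \<in>. N ==>
   b (m \<oplus>.M m') n = b m n \<oplus>.H b m' n"
  and addr: "\<And>m n n'. m \<in>. M ==> n \<in>. N ==> n' \<in>. N ==>
   b m (n \<oplus>.N n') = b m n \<oplus>.H b m n'"
  and bal: "\<And>a m n. a \<in>. A ==> m \<in>. M ==> n \<in>. N ==>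
   b (a \<odot>.M m) n = b m (a \<odot>.N n)"
 shows tensor_lift_hom: "tensor_lift (add_monoid H) (\<lambda>(m, n). b m n) \<in> ahom (tensor_ring A M N) H"
  and tensor_lift_pure: "\<And>m n. m \<in>. M ==> n \<in>. N ==>
   tensor_lift (add_monoid H) (\<lambda>(m, n). b m n) (pure_tensor A M N m n) = b m n"
proof -
 interpret H: abelian_group H by fact
 let ?e = "frag_eval (add_monoid H) (\<lambda>(m, n). b m n)"
 have e: "?e \<in> hom FG (add_monoid H)" by (rule comm_group.frag_eval_hom) (auto simp: cl H.a_comm_group)
 \<comment> \<open>A balanced map is the case of a constant sequence.\<close>
 have e_rels: "?e c = \<zero>.H" if "c \<in> tensor_rels A M N" for c
  using tensor_rels_eventually[of H "\<lambda>_. b" c, OF H] cl addl addr bal that by auto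
 have key: "tensor_lift (add_monoid H) (\<lambda>(m, n). b m n) (tensor_rels A M N #>.FG c) = ?e c" if c: "c \<in>. FG" for c
 proof -
  have sub: "tensor_rels A M N \<subseteq> carrier FG" by (rule subgroup.subset[OF tensor_rels_subgroup])
  have "?e (h + c) = ?e c" if "h \<in> tensor_rels A M N" for h
   using hom_mult[OF e _ c, of h] e_rels[OF that] sub that hom_in_carrier[OF e c] by auto
  then have "?e ` (tensor_rels A M N #>.FG c) = {?e c}" using subgroup.one_closed[OF tensor_rels_subgroup] by (force simp: r_coset_def)
  then show ?thesis unfolding tensor_lift_def frag_eval_def[symmetric] by simp
 qed
 show "tensor_lift (add_monoid H) (\<lambda>(m, n). b m n) \<in> ahom (tensor_ring A M N) H"
 proof (rule ahomI)
  fix X assume "X \<in> carrier (tensor_ring A M N)"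
  then obtain c where "c \<in>. FG" "X = tensor_rels A M N #>.FG c" by (rule tensor_cases)
  then show "tensor_lift (add_monoid H) (\<lambda>(m, n). b m n) X \<in>. H" using key[of c] hom_in_carrier[OF e, of c] by simp
 next
  fix X Y assume "X \<in> carrier (tensor_ring A M N)" "Y \<in> carrier (tensor_ring A M N)"
  then obtain c d where cd: "c \<in>. FG" "X = tensor_rels A M N #>.FG c" "d \<in>. FG" "Y = tensor_rels A M N #>.FG d" by (elim tensor_cases)
  have s: "c + d \<in>. FG" using cd(1,3) keys_add[of c d] by auto
  show "tensor_lift (add_monoid H) (\<lambda>(m, n). b m n) (X \<oplus>\<^bsub>tensor_ring A M N\<^esub> Y) =
   tensor_lift (add_monoid H) (\<lambda>(m, n). b m n) X \<oplus>.H tensor_lift (add_monoid H) (\<lambda>(m, n). b m n) Y"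
   using hom_mult[OF e cd(1,3)] key[OF s] key[OF cd(1)] key[OF cd(3)] by (simp add: cd(2,4) tensor_proj_add[OF cd(1,3), symmetric])
 qed
 show "tensor_lift (add_monoid H) (\<lambda>(m, n). b m n) (pure_tensor A M N m n) = b m n" if "m \<in>. M" "n \<in>. N" for m n
  using that key[of "frag_of (m, n)"] comm_group.frag_eval_of[OF H.a_comm_group, of "\<lambda>(m, n). b m n" "(m, n)"]
  by (simp add: pure_tensor_def cl)
qed

end

section \<open>Algebras over a ring map, restriction of scalars and maps between tensor
  products\<close>

lemma algebra_via_simps [simp]:
 "carrier (algebra_via ph B) = carrier B" "monoid.mult (algebra_via ph B) = monoid.mult B"
 "\<one>\<^bsub>algebra_via ph B\<^esub> = \<one>.B" "\<zero>\<^bsub>algebra_via ph B\<^esub> = \<zero>.B"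
 "ring.add (algebra_via ph B) = ring.add B" "a \<odot>\<^bsub>algebra_via ph B\<^esub> b = ph a \<otimes>.B b" by (simp_all add: algebra_via_def)

lemma restrict_scalars_simps [simp]:
 "carrier (restrict_scalars ph M) = carrier M"
 "\<zero>\<^bsub>restrict_scalars ph M\<^esub> = \<zero>.M"
 "ring.add (restrict_scalars ph M) = ring.add M" "a \<odot>\<^bsub>restrict_scalars ph M\<^esub> m = ph a \<odot>.M m"
 by (simp_all add: restrict_scalars_def)

lemma abelian_group_cong:
 assumes "abelian_group P" "carrier Q = carrier P" "ring.add Q = ring.add P" "\<zero>.Q = \<zero>.P"
 shows "abelian_group Q"
proof -
 interpret P: abelian_group P by fact
 show ?thesis
  by (rule abelian_groupI) (use P.a_closed P.a_assoc P.a_comm P.l_neg in \<open>auto simp: assms(2-4) P.a_ac intro!: bexI[of _ "\<ominus>.P _"]\<close>)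
qed

lemma cring_cong:
 assumes "cring P" "carrier Q = carrier P" "ring.add Q = ring.add P" "\<zero>.Q = \<zero>.P"
  "monoid.mult Q = monoid.mult P" "\<one>.Q = \<one>.P"
 shows "cring Q"
proof -
 interpret P: cring P by fact
 show ?thesis
 proof (rule cringI)
  show "abelian_group Q" by (rule abelian_group_cong[OF P.abelian_group_axioms assms(2-4)])
  show "Group.comm_monoid Q" by (rule comm_monoidI) (simp_all add: assms P.m_ac)
 qed (simp_all add: assms P.l_distr)
qed

lemma algebra_via_algebra:
 assumes "cring A" "cring B" "ph \<in> ring_hom A B"
 shows "algebra A (algebra_via ph B)"
proof -
 interpret A: cring A by fact
 interpret B: cring B by fact
 interpret h: ring_hom_ring A B ph using assms(3) by (simp add: ring_hom_ring_def ring_hom_ring_axioms_def A.ring_axioms B.ring_axioms)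
 show ?thesis by (rule algebraI)
    (auto simp: A.is_cring B.l_distr B.r_distr B.m_assoc intro: cring_cong[OF assms(2)])
qed

lemma restrict_scalars_module:
 assumes "cring A" "module B M" "ph \<in> ring_hom A B"
 shows "module A (restrict_scalars ph M)"
proof -
 interpret A: cring A by fact
 interpret M: module B M by fact
 interpret h: ring_hom_ring A B ph using assms(3) by (simp add: ring_hom_ring_def ring_hom_ring_axioms_def A.ring_axioms M.R.ring_axioms)
 show ?thesis by (rule moduleI)
    (auto simp: A.is_cring M.smult_l_distr M.smult_r_distr M.smult_assoc1 intro: abelian_group_cong[OF M.abelian_group_axioms])
qed

text \<open>The maps in use are often only semilinear, for instance over a Frobenius. Balancedness
  needs no more than one scalar \<open>b\<close> on the target side by which \<open>a\<close> acts
  on both factors.\<close>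

lemma tensor_map:
 assumes "module A M" "module A N" "module A' M'" "module A' N'"
  and f: "f \<in> ahom M' M" and g: "g \<in> ahom N' N"
  and bal: "\<And>a m n. a \<in>. A' ==> m \<in>. M' ==> n \<in>. N' ==>
   \<exists>b\<in>carrier A. f (a \<odot>.M' m) = b \<odot>.M f m \<and> g (a \<odot>.N' n) = b \<odot>.N g n"
 shows tensor_map_hom: "tensor_map A M N f g \<in> ahom (tensor_ring A' M' N') (tensor_ring A M N)"
  and tensor_map_pure: "\<And>m n. m \<in>. M' ==> n \<in>. N' ==>
   tensor_map A M N f g (pure_tensor A' M' N' m n) = pure_tensor A M N (f m) (g n)"
proof -
 let ?b = "\<lambda>m n. pure_tensor A M N (f m) (g n)"
 have fg: "m \<in>. M' ==> f m \<in>. M" "n \<in>. N' ==> g n \<in>. N" for m n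
  using ahom_closed[OF f] ahom_closed[OF g] by auto
 note H = assms(1,2)
 have l: "?b (a \<odot>.M' m) n = ?b m (a \<odot>.N' n)" if "a \<in>. A'" "m \<in>. M'" "n \<in>. N'" for a m n
  using bal[OF that] pure_tensor_smult[OF H] fg that by metis
 note L = tensor_lift[OF assms(3,4) tensor_abelian_group[OF H], of ?b]
 show "tensor_map A M N f g \<in> ahom (tensor_ring A' M' N') (tensor_ring A M N)"
  unfolding tensor_map_def add_monoid_tensor_ring[symmetric, of A M N]
  by (rule L(1)) (simp_all add: fg pure_tensor_closed[OF H] ahom_add[OF f] ahom_add[OF g] pure_tensor_add_left[OF H] pure_tensor_add_right[OF H] l)
 show "tensor_map A M N f g (pure_tensor A' M' N' m n) = pure_tensor A M N (f m) (g n)"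
  if "m \<in>. M'" "n \<in>. N'" for m n unfolding tensor_map_def add_monoid_tensor_ring[symmetric, of A M N]
  by (rule L(2)) (simp_all add: that fg pure_tensor_closed[OF H] ahom_add[OF f] ahom_add[OF g] pure_tensor_add_left[OF H] pure_tensor_add_right[OF H] l)
qed

lemma ahom_id: "(\<lambda>x. x) \<in> ahom P P" by (rule ahomI) auto

lemma ring_hom_ahom: "h \<in> ring_hom R S ==> h \<in> ahom R S" by (intro ahomI) (auto simp: ring_hom_closed ring_hom_add)

subsection \<open>Tensor products of algebras\<close>

lemma tensor_ring_sel:
 "X \<otimes>\<^bsub>tensor_ring A S T\<^esub> Y = tensor_lift (add_monoid (tensor_ring A S T))
    (\<lambda>(s, t). tensor_lift (add_monoid (tensor_ring A S T))
     (\<lambda>(s', t'). pure_tensor A S T (s \<otimes>.S s') (t \<otimes>.T t')) Y) X"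
 "\<one>\<^bsub>tensor_ring A S T\<^esub> = pure_tensor A S T \<one>.S \<one>.T" unfolding add_monoid_tensor_ring by (simp_all add: tensor_ring_def)

context
 fixes A :: "('a, 'x) ring_scheme" and S :: "('a, 's, 'y) module_scheme"
  and T :: "('a, 't, 'z) module_scheme"
 assumes S: "algebra A S" and T: "algebra A T"
begin

interpretation S: algebra A S by (rule S)
interpretation T: algebra A T by (rule T)

lemmas ST_modules = S.module_axioms T.module_axioms
lemmas tensor_alg_induct = tensor_induct[OF ST_modules, consumes 1, case_names pure add]

private abbreviation "P \<equiv> tensor_ring A S T"
private abbreviation "pt \<equiv> pure_tensor A S T"

interpretation P: abelian_group P by (rule tensor_abelian_group[OF ST_modules])

text \<open>The inner lift in the product of \<open>tensor_ring\<close>: multiplication by the pure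
  tensor of \<open>s\<close> and \<open>t\<close>.\<close>

private definition "mu s t = tensor_lift (add_monoid P) (\<lambda>(s', t'). pt (s \<otimes>.S s') (t \<otimes>.T t'))"

lemmas pt_simps = pure_tensor_closed[OF ST_modules] pure_tensor_add_left[OF ST_modules]
 pure_tensor_add_right[OF ST_modules]

private lemma mu:
 assumes "s \<in>. S" "t \<in>. T"
 shows mu_hom: "mu s t \<in> ahom P P"
  and mu_pure: "\<And>s' t'. s' \<in>. S ==> t' \<in>. T ==> mu s t (pt s' t') = pt (s \<otimes>.S s') (t \<otimes>.T t')"
proof -
 let ?b = "\<lambda>s' t'. pt (s \<otimes>.S s') (t \<otimes>.T t')"
 have "?b (a \<odot>.S m) n = ?b m (a \<odot>.T n)" if "a \<in>. A" "m \<in>. S" "n \<in>. T" for a m n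
 proof -
  have "s \<otimes>.S (a \<odot>.S m) = a \<odot>.S (s \<otimes>.S m)" "t \<otimes>.T (a \<odot>.T n) = a \<odot>.T (t \<otimes>.T n)"
   using assms that S.smult_assoc2[of a m s] T.smult_assoc2[of a n t] by (simp_all add: S.m_comm T.m_comm)
  then show ?thesis using that assms by (simp add: pure_tensor_smult[OF ST_modules])
 qed
 note L = tensor_lift[OF ST_modules P.abelian_group_axioms, of ?b, OF _ _ _ this]
 show "mu s t \<in> ahom P P" unfolding mu_def using assms by (intro L(1)) (simp_all add: pt_simps S.r_distr T.r_distr)
 show "mu s t (pt s' t') = ?b s' t'" if "s' \<in>. S" "t' \<in>. T" for s' t'
  unfolding mu_def using assms that by (intro L(2)) (simp_all add: pt_simps S.r_distr T.r_distr)
qed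

private lemma mult_alt: "X \<otimes>.P Y = tensor_lift (add_monoid P) (\<lambda>(s, t). mu s t Y) X" unfolding tensor_ring_sel(1) mu_def ..

private lemma mult:
 assumes Y: "Y \<in>. P"
 shows mult_hom_left: "(\<lambda>X. X \<otimes>.P Y) \<in> ahom P P"
  and mult_pure_left: "\<And>s t. s \<in>. S ==> t \<in>. T ==> pt s t \<otimes>.P Y = mu s t Y"
proof -
 let ?b = "\<lambda>s t. mu s t Y"
 have 1: "?b s t \<in>. P" if "s \<in>. S" "t \<in>. T" for s t by (rule ahom_closed[OF mu_hom[OF that] Y])
 have 2: "?b (s \<oplus>.S s') t = ?b s t \<oplus>.P ?b s' t" if "s \<in>. S" "s' \<in>. S" "t \<in>. T" for s s' t
  by (rule tensor_hom_eqI[OF ST_modules mu_hom ahom_plus[OF mu_hom mu_hom] _ Y])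
    (use that in \<open>auto simp: mu_pure pt_simps S.l_distr P.abelian_group_axioms\<close>)
 have 3: "?b s (t \<oplus>.T t') = ?b s t \<oplus>.P ?b s t'" if "s \<in>. S" "t \<in>. T" "t' \<in>. T" for s t t'
  by (rule tensor_hom_eqI[OF ST_modules mu_hom ahom_plus[OF mu_hom mu_hom] _ Y])
    (use that in \<open>auto simp: mu_pure pt_simps T.l_distr P.abelian_group_axioms\<close>)
 have 4: "?b (a \<odot>.S s) t = ?b s (a \<odot>.T t)" if "a \<in>. A" "s \<in>. S" "t \<in>. T" for a s t
  by (rule tensor_hom_eqI[OF ST_modules mu_hom mu_hom _ Y])
    (use that in \<open>auto simp: mu_pure S.smult_assoc2 T.smult_assoc2 pure_tensor_smult[OF ST_modules]\<close>)
 note L = tensor_lift[OF ST_modules P.abelian_group_axioms, of ?b, OF 1 2 3 4]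
 show "(\<lambda>X. X \<otimes>.P Y) \<in> ahom P P" unfolding mult_alt by (rule L(1))
 show "pt s t \<otimes>.P Y = mu s t Y" if "s \<in>. S" "t \<in>. T" for s t unfolding mult_alt using that by (intro L(2))
qed

lemma tensor_mult_pure:
 assumes "s \<in>. S" "t \<in>. T" "s' \<in>. S" "t' \<in>. T"
 shows "pt s t \<otimes>.P pt s' t' = pt (s \<otimes>.S s') (t \<otimes>.T t')" using assms by (simp add: mult_pure_left pt_simps mu_pure)

private lemma mult_closed: "X \<in>. P ==> Y \<in>. P ==> X \<otimes>.P Y \<in>. P" using ahom_closed[OF mult_hom_left] .

private lemma mult_l_distr: "X \<in>. P ==> X' \<in>. P ==> Y \<in>. P ==>
 (X \<oplus>.P X') \<otimes>.P Y = X \<otimes>.P Y \<oplus>.P X' \<otimes>.P Y" using ahom_add[OF mult_hom_left] .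

private lemma mult_r_distr:
 assumes "X \<in>. P" "Y \<in>. P" "Y' \<in>. P"
 shows "X \<otimes>.P (Y \<oplus>.P Y') = X \<otimes>.P Y \<oplus>.P X \<otimes>.P Y'" using assms(1) by (induction rule: tensor_alg_induct)
   (use assms(2,3) in \<open>simp_all add: mult_pure_left ahom_add[OF mu_hom] mult_l_distr mult_closed P.a_ac\<close>)

private lemma mult_comm:
 assumes X: "X \<in>. P" and Y: "Y \<in>. P"
 shows "X \<otimes>.P Y = Y \<otimes>.P X" using X
proof (induction rule: tensor_alg_induct)
 case (pure s t)
 from Y show ?case by (induction rule: tensor_alg_induct)
    (use pure in \<open>simp_all add: tensor_mult_pure mult_l_distr mult_r_distr pt_simps S.m_comm T.m_comm\<close>)
qed (use Y in \<open>simp_all add: mult_l_distr mult_r_distr\<close>)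

private lemma mult_assoc:
 assumes X: "X \<in>. P" and Y: "Y \<in>. P" and Z: "Z \<in>. P"
 shows "X \<otimes>.P Y \<otimes>.P Z = X \<otimes>.P (Y \<otimes>.P Z)" using X
proof (induction rule: tensor_alg_induct)
 case X: (pure s t)
 from Y show ?case
 proof (induction rule: tensor_alg_induct)
  case Y: (pure s' t')
  from Z show ?case by (induction rule: tensor_alg_induct)
     (use X Y in \<open>simp_all add: tensor_mult_pure mult_r_distr mult_closed pt_simps S.m_assoc T.m_assoc\<close>)
 qed (use X Z in \<open>simp_all add: mult_l_distr mult_r_distr mult_closed pt_simps\<close>)
qed (use Y Z in \<open>simp_all add: mult_l_distr mult_closed\<close>)

lemma tensor_cring: "cring P"
proof (rule cringI)
 show "abelian_group P" by (rule P.abelian_group_axioms)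
 show "Group.comm_monoid P"
 proof (rule comm_monoidI)
  show "\<one>.P \<in>. P" by (simp add: tensor_ring_sel pt_simps)
  fix X assume "X \<in>. P"
  then show "\<one>.P \<otimes>.P X = X" unfolding tensor_ring_sel(2)
   by (induction rule: tensor_alg_induct) (simp_all add: tensor_mult_pure mult_r_distr pt_simps)
 qed ((rule mult_closed mult_assoc mult_comm; assumption)+)
qed (rule mult_l_distr)

text \<open>Both sides of the multiplicativity law are additive in each argument, so it may be
  checked on pure tensors.\<close>

lemma tensor_ring_hom:
 assumes C: "cring C" and h: "h \<in> ahom P C" and one: "h (pt \<one>.S \<one>.T) = \<one>.C"
  and mult: "\<And>s t s' t'. s \<in>. S ==> t \<in>. T ==> s' \<in>. S ==> t' \<in>. T ==>
   h (pt (s \<otimes>.S s') (t \<otimes>.T t')) = h (pt s t) \<otimes>.C h (pt s' t')"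
 shows "h \<in> ring_hom P C"
proof (rule ring_hom_memI)
 interpret C: cring C by fact
 fix X Y assume X: "X \<in>. P" and Y: "Y \<in>. P"
 from X show "h (X \<otimes>.P Y) = h X \<otimes>.C h Y"
 proof (induction rule: tensor_alg_induct)
  case (pure s t)
  from Y show ?case by (induction rule: tensor_alg_induct)
     (use pure in \<open>simp_all add: tensor_mult_pure mult_r_distr mult_closed pt_simps mult ahom_add[OF h] ahom_closed[OF h] C.r_distr\<close>)
 qed (use Y in \<open>simp_all add: mult_l_distr mult_closed ahom_add[OF h] ahom_closed[OF h] C.l_distr\<close>)
qed (use one ahom_closed[OF h] ahom_add[OF h] in \<open>auto simp: tensor_ring_sel\<close>)

lemma pure_tensor_ring_hom_left: "(\<lambda>s. pt s \<one>.T) \<in> ring_hom S P"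
 by (rule ring_hom_memI) (simp_all add: pt_simps tensor_mult_pure tensor_ring_sel(2))

lemma pure_tensor_ring_hom_right: "(\<lambda>t. pt \<one>.S t) \<in> ring_hom T P"
 by (rule ring_hom_memI) (simp_all add: pt_simps tensor_mult_pure tensor_ring_sel(2))

lemma tensor_lift_ring_hom:
 assumes C: "cring C" and f: "f \<in> ring_hom S C" and g: "g \<in> ring_hom T C"
  and bal: "\<And>a s t. a \<in>. A ==> s \<in>. S ==> t \<in>. T ==>
   f (a \<odot>.S s) \<otimes>.C g t = f s \<otimes>.C g (a \<odot>.T t)"
 shows "tensor_lift (add_monoid C) (\<lambda>(s, t). f s \<otimes>.C g t) \<in> ring_hom P C"
  and "\<And>s t. s \<in>. S ==> t \<in>. T ==>
   tensor_lift (add_monoid C) (\<lambda>(s, t). f s \<otimes>.C g t) (pt s t) = f s \<otimes>.C g t"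
proof -
 interpret C: cring C by fact
 have fg: "s \<in>. S ==> f s \<in>. C" "t \<in>. T ==> g t \<in>. C" for s t
  using ring_hom_closed[OF f] ring_hom_closed[OF g] by auto
 note L = tensor_lift[OF ST_modules C.abelian_group_axioms, of "\<lambda>s t. f s \<otimes>.C g t", OF _ _ _ bal]
 show 1: "tensor_lift (add_monoid C) (\<lambda>(s, t). f s \<otimes>.C g t) (pt s t) = f s \<otimes>.C g t"
  if "s \<in>. S" "t \<in>. T" for s t
  by (rule L(2)) (use that fg in \<open>auto simp: ring_hom_add[OF f] ring_hom_add[OF g] C.l_distr C.r_distr\<close>)
 show "tensor_lift (add_monoid C) (\<lambda>(s, t). f s \<otimes>.C g t) \<in> ring_hom P C"
 proof (rule tensor_ring_hom[OF C])
  show "tensor_lift (add_monoid C) (\<lambda>(s, t). f s \<otimes>.C g t) \<in> ahom P C"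
   by (rule L(1)) (use fg in \<open>auto simp: ring_hom_add[OF f] ring_hom_add[OF g] C.l_distr C.r_distr\<close>)
 qed (simp_all add: 1 ring_hom_one[OF f] ring_hom_one[OF g] ring_hom_mult[OF f] ring_hom_mult[OF g] fg C.m_ac)
qed

end

lemma tensor_map_ring_hom:
 assumes S: "algebra A S" and T: "algebra A T" and S': "algebra A' S'" and T': "algebra A' T'"
  and f: "f \<in> ring_hom S' S" and g: "g \<in> ring_hom T' T"
  and bal: "\<And>a m n. a \<in>. A' ==> m \<in>. S' ==> n \<in>. T' ==>
   \<exists>b\<in>carrier A. f (a \<odot>.S' m) = b \<odot>.S f m \<and> g (a \<odot>.T' n) = b \<odot>.T g n"
 shows "tensor_map A S T f g \<in> ring_hom (tensor_ring A' S' T') (tensor_ring A S T)"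
proof (rule tensor_ring_hom[OF S' T' tensor_cring[OF S T]])
 interpret S: algebra A S by (rule S)
 interpret T: algebra A T by (rule T)
 interpret S': algebra A' S' by (rule S')
 interpret T': algebra A' T' by (rule T')
 note m = tensor_map[OF S.module_axioms T.module_axioms S'.module_axioms T'.module_axioms ring_hom_ahom[OF f] ring_hom_ahom[OF g] bal]
 show "tensor_map A S T f g \<in> ahom (tensor_ring A' S' T') (tensor_ring A S T)" by (rule m(1))
 show "tensor_map A S T f g (pure_tensor A' S' T' \<one>.S' \<one>.T') = \<one>\<^bsub>tensor_ring A S T\<^esub>"
  by (subst m(2)) (simp_all add: ring_hom_one[OF f] ring_hom_one[OF g] tensor_ring_sel(2))
 fix s t s' t' assume st: "s \<in>. S'" "t \<in>. T'" "s' \<in>. S'" "t' \<in>. T'"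
 have m2: "tensor_map A S T f g (pure_tensor A' S' T' s t) = pure_tensor A S T (f s) (g t)"
  if "s \<in>. S'" "t \<in>. T'" for s t by (rule m(2)) (use that in auto)
 show "tensor_map A S T f g (pure_tensor A' S' T' (s \<otimes>.S' s') (t \<otimes>.T' t')) =
  tensor_map A S T f g (pure_tensor A' S' T' s t) \<otimes>\<^bsub>tensor_ring A S T\<^esub> tensor_map A S T f g (pure_tensor A' S' T' s' t')"
  using st by (simp add: m2 tensor_mult_pure[OF S T] ring_hom_mult[OF f] ring_hom_mult[OF g] ring_hom_closed[OF f] ring_hom_closed[OF g])
qed

subsection \<open>Base change of modules\<close>

context
 fixes A :: "('a, 'x) ring_scheme" and ph :: "'a \<Rightarrow> 'b" and B :: "('b, 'y) ring_scheme"
  and M :: "('a, 'm, 'z) module_scheme"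
 assumes B: "cring B" and ph: "ph \<in> ring_hom A B" and M: "module A M"
begin

interpretation B: cring B by (rule B)
interpretation M: module A M by (rule M)
interpretation BA: algebra A "algebra_via ph B" by (rule algebra_via_algebra[OF M.R.is_cring B ph])

lemmas bc_modules = BA.module_axioms M
lemmas base_change_induct = tensor_induct[OF bc_modules, simplified, consumes 1, case_names pure add]

private abbreviation "PB \<equiv> tensor_ring A (algebra_via ph B) M"
private abbreviation "ptB \<equiv> pure_tensor A (algebra_via ph B) M"

lemmas bc_pt_simps = pure_tensor_closed[OF bc_modules, simplified] pure_tensor_add_left[OF bc_modules, simplified]
 pure_tensor_add_right[OF bc_modules, simplified]

interpretation P: abelian_group PB by (rule tensor_abelian_group[OF bc_modules])

lemma base_change_smult:
 assumes "b \<in>. B"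
 shows base_change_smult_hom: "(\<lambda>X. b \<odot>\<^bsub>base_change A ph B M\<^esub> X) \<in> ahom PB PB"
  and base_change_smult_pure: "\<And>b' m. b' \<in>. B ==> m \<in>. M ==>
   b \<odot>\<^bsub>base_change A ph B M\<^esub> ptB b' m = ptB (b \<otimes>.B b') m"
proof -
 have s: "b \<odot>\<^bsub>base_change A ph B M\<^esub> X = tensor_map A (algebra_via ph B) M (\<lambda>b'. b \<otimes>.B b') (\<lambda>m. m) X" for X
  by (simp add: base_change_def Let_def)
 have h: "(\<lambda>b'. b \<otimes>.B b') \<in> ahom (algebra_via ph B) (algebra_via ph B)" using assms by (intro ahomI) (auto simp: B.r_distr)
 have bal: "\<exists>c\<in>carrier A. b \<otimes>.B (a \<odot>\<^bsub>algebra_via ph B\<^esub> b') = c \<odot>\<^bsub>algebra_via ph B\<^esub> (b \<otimes>.B b') \<and> a \<odot>.M m = c \<odot>.M m"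
  if "a \<in>. A" "b' \<in> carrier (algebra_via ph B)" for a b' m
  using that assms ring_hom_closed[OF ph] by (intro bexI[of _ a]) (auto simp: B.m_lcomm)
 note t = tensor_map[OF bc_modules bc_modules h ahom_id bal]
 show "(\<lambda>X. b \<odot>\<^bsub>base_change A ph B M\<^esub> X) \<in> ahom PB PB" unfolding s by (rule t(1))
 show "b \<odot>\<^bsub>base_change A ph B M\<^esub> ptB b' m = ptB (b \<otimes>.B b') m" if "b' \<in>. B" "m \<in>. M" for b' m
  unfolding s using that by (subst t(2)) simp_all
qed

lemma base_change_module: "module B (base_change A ph B M)"
proof (rule moduleI)
 show "cring B" by (rule B)
 show "abelian_group (base_change A ph B M)" by (rule abelian_group_cong[OF P.abelian_group_axioms]) simp_all
 fix a b x
 assume ab: "a \<in>. B" "b \<in>. B" and "x \<in> carrier (base_change A ph B M)"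
 then have x: "x \<in>. PB" by simp
 note sc = ahom_closed[OF base_change_smult_hom] ahom_add[OF base_change_smult_hom]
 from x show "(a \<oplus>.B b) \<odot>\<^bsub>base_change A ph B M\<^esub> x = a \<odot>\<^bsub>base_change A ph B M\<^esub> x \<oplus>\<^bsub>base_change A ph B M\<^esub> b \<odot>\<^bsub>base_change A ph B M\<^esub> x"
  by (induction rule: base_change_induct) (use ab in \<open>simp_all add: sc base_change_smult_pure bc_pt_simps B.l_distr P.a_ac\<close>)
 from x show "(a \<otimes>.B b) \<odot>\<^bsub>base_change A ph B M\<^esub> x = a \<odot>\<^bsub>base_change A ph B M\<^esub> (b \<odot>\<^bsub>base_change A ph B M\<^esub> x)"
  by (induction rule: base_change_induct) (use ab in \<open>simp_all add: sc base_change_smult_pure B.m_assoc\<close>)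
next
 fix x assume "x \<in> carrier (base_change A ph B M)"
 then have x: "x \<in>. PB" by simp
 then show "\<one>.B \<odot>\<^bsub>base_change A ph B M\<^esub> x = x"
  by (induction rule: base_change_induct) (simp_all add: base_change_smult_pure ahom_add[OF base_change_smult_hom])
qed (simp_all add: ahom_closed[OF base_change_smult_hom] ahom_add[OF base_change_smult_hom])

lemma base_change_unit_hom: "(\<lambda>m. ptB \<one>.B m) \<in> ahom M PB" using pure_tensor_ahom_right[OF bc_modules] by simp

lemma base_change_unit_smult:
 assumes "a \<in>. A" "m \<in>. M"
 shows "ptB \<one>.B (a \<odot>.M m) = ph a \<odot>\<^bsub>base_change A ph B M\<^esub> ptB \<one>.B m"
 using pure_tensor_smult[OF bc_modules, of a "\<one>.B" m] assms ring_hom_closed[OF ph] by (simp add: base_change_smult_pure)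

lemma base_change_pure_eq:
 "b \<in>. B ==> m \<in>. M ==> ptB b m = b \<odot>\<^bsub>base_change A ph B M\<^esub> ptB \<one>.B m"
 by (simp add: base_change_smult_pure)

end

section \<open>Localization\<close>

text \<open>The operations of \<open>loc_ring\<close> are unions over all representatives;
  independence of the representatives turns such a union into a value.\<close>

lemma UN_pairs_const:
 assumes "X \<noteq> {}" "Y \<noteq> {}" "\<And>a i b j. (a, i) \<in> X ==> (b, j) \<in> Y ==> g a i b j = c"
 shows "(\<Union>(a, i)\<in>X. \<Union>(b, j)\<in>Y. g a i b j) = c"
proof -
 have "(\<Union>(b, j)\<in>Y. g a i b j) = c" if "(a, i) \<in> X" for a i
  by (rule SUP_eq_const[OF assms(2)]) (use assms(3) that in \<open>clarsimp split: prod.split\<close>)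
 then show ?thesis by (intro SUP_eq_const[OF assms(1)]) (clarsimp split: prod.split)
qed

context cring
begin

context
 fixes f
 assumes f [simp]: "f \<in>. R"
begin

definition "loc_frac a i = loc_rel R f `` {(a, i)}"

lemma loc_rel_equiv: "equiv (carrier R \<times> UNIV) (loc_rel R f)"
proof (rule equivI)
 show "refl_on (carrier R \<times> UNIV) (loc_rel R f)" by (auto simp: refl_on_def loc_rel_def)
 show "sym (loc_rel R f)" by (auto simp: sym_def loc_rel_def intro: sym)
 show "trans (loc_rel R f)"
 proof (rule transI, clarsimp simp: loc_rel_def)
  fix a b c and i j l k k' :: nat
  assume c: "a \<in>. R" "b \<in>. R" "c \<in>. R"
   and 1: "f [^] (k + j) \<otimes> a = f [^] (k + i) \<otimes> b" and 2: "f [^] (k' + l) \<otimes> b = f [^] (k' + j) \<otimes> (c :: 'a)"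
  \<comment> \<open>The witness collects the two cancelling exponents and the denominator
    \<open>j\<close> of the middle fraction.\<close>
  have "f [^] ((k + k' + j) + l) \<otimes> a = f [^] (k' + l) \<otimes> (f [^] (k + j) \<otimes> a)"
   using c by (simp add: nat_pow_mult[symmetric] m_ac)
  also have "\<dots> = f [^] (k + i) \<otimes> (f [^] (k' + l) \<otimes> b)" unfolding 1 using c by (simp add: m_lcomm)
  also have "\<dots> = f [^] ((k + k' + j) + i) \<otimes> c" unfolding 2 using c by (simp add: nat_pow_mult[symmetric] m_ac)
  finally show "\<exists>k::nat. f [^] (k + l) \<otimes> a = f [^] (k + i) \<otimes> c" by blast
 qed
qed (auto simp: loc_rel_def)

lemma loc_frac_eq_iff:
 assumes "a \<in>. R" "b \<in>. R"
 shows "loc_frac a i = loc_frac b j \<longleftrightarrow> (\<exists>k::nat. f [^] (k + j) \<otimes> a = f [^] (k + i) \<otimes> b)"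
 unfolding loc_frac_def by (subst eq_equiv_class_iff[OF loc_rel_equiv]) (use assms in \<open>auto simp: loc_rel_def\<close>)

lemma loc_fracI:
 "a \<in>. R ==> b \<in>. R ==> f [^] j \<otimes> a = f [^] i \<otimes> b ==> loc_frac a i = loc_frac b j"
 by (subst loc_frac_eq_iff) (auto intro: exI[of _ 0])

lemma loc_frac_mem: "(a, i) \<in> loc_frac b j \<longleftrightarrow> a \<in>. R \<and> b \<in>. R \<and> loc_frac a i = loc_frac b j"
proof
 assume "(a, i) \<in> loc_frac b j"
 then have *: "((b, j), (a, i)) \<in> loc_rel R f" by (simp add: loc_frac_def)
 then show "a \<in>. R \<and> b \<in>. R \<and> loc_frac a i = loc_frac b j"
  using equiv_class_eq[OF loc_rel_equiv *] unfolding loc_frac_def by (simp add: loc_rel_def)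
next
 assume *: "a \<in>. R \<and> b \<in>. R \<and> loc_frac a i = loc_frac b j"
 then have "(a, i) \<in> loc_frac a i" unfolding loc_frac_def using equiv_class_self[OF loc_rel_equiv, of "(a, i)"] by simp
 then show "(a, i) \<in> loc_frac b j" using * by simp
qed

lemma loc_carrier: "carrier (loc_ring R f) = {loc_frac a i | a i. a \<in> carrier R}" unfolding loc_ring_def loc_frac_def by (auto simp: quotient_def)

lemma loc_frac_carrier [simp]: "a \<in>. R ==> loc_frac a i \<in> carrier (loc_ring R f)" by (auto simp: loc_carrier)

lemma loc_mult:
 assumes "a \<in>. R" "b \<in>. R"
 shows "loc_frac a i \<otimes>\<^bsub>loc_ring R f\<^esub> loc_frac b j = loc_frac (a \<otimes> b) (i + j)"
proof -
 have *: "loc_frac (a' \<otimes> b') (i' + j') = loc_frac (a \<otimes> b) (i + j)"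
  if "(a', i') \<in> loc_frac a i" "(b', j') \<in> loc_frac b j" for a' b' i' j'
 proof -
  from that obtain k k' :: nat where c: "a' \<in>. R" "b' \<in>. R"
   and 1: "f [^] (k + i) \<otimes> a' = f [^] (k + i') \<otimes> a" and 2: "f [^] (k' + j) \<otimes> b' = f [^] (k' + j') \<otimes> b"
   using assms by (auto simp: loc_frac_mem loc_frac_eq_iff)
  have "f [^] (k + k' + (i + j)) \<otimes> (a' \<otimes> b') = (f [^] (k + i) \<otimes> a') \<otimes> (f [^] (k' + j) \<otimes> b')"
   using c by (simp add: nat_pow_mult[symmetric] m_ac)
  also have "\<dots> = f [^] (k + k' + (i' + j')) \<otimes> (a \<otimes> b)" unfolding 1 2 using assms by (simp add: nat_pow_mult[symmetric] m_ac)
  finally show ?thesis using c assms by (subst loc_frac_eq_iff) auto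
 qed
 have ne: "(a, i) \<in> loc_frac a i" "(b, j) \<in> loc_frac b j" using assms by (auto simp: loc_frac_mem)
 have "loc_frac a i \<otimes>\<^bsub>loc_ring R f\<^esub> loc_frac b j =
  (\<Union>(a', i')\<in>loc_frac a i. \<Union>(b', j')\<in>loc_frac b j. loc_frac (a' \<otimes> b') (i' + j'))"
  by (simp add: loc_ring_def loc_frac_def)
 also have "\<dots> = loc_frac (a \<otimes> b) (i + j)" using ne by (intro UN_pairs_const *) blast+
 finally show ?thesis .
qed

lemma loc_add:
 assumes "a \<in>. R" "b \<in>. R"
 shows "loc_frac a i \<oplus>\<^bsub>loc_ring R f\<^esub> loc_frac b j = loc_frac (f [^] j \<otimes> a \<oplus> f [^] i \<otimes> b) (i + j)"
proof -
 have *: "loc_frac (f [^] j' \<otimes> a' \<oplus> f [^] i' \<otimes> b') (i' + j') = loc_frac (f [^] j \<otimes> a \<oplus> f [^] i \<otimes> b) (i + j)"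
  if "(a', i') \<in> loc_frac a i" "(b', j') \<in> loc_frac b j" for a' b' i' j'
 proof -
  from that obtain k k' :: nat where c: "a' \<in>. R" "b' \<in>. R"
   and 1: "f [^] (k + i) \<otimes> a' = f [^] (k + i') \<otimes> a" and 2: "f [^] (k' + j) \<otimes> b' = f [^] (k' + j') \<otimes> b"
   using assms by (auto simp: loc_frac_mem loc_frac_eq_iff)
  have "f [^] (k + k' + (i + j)) \<otimes> (f [^] j' \<otimes> a' \<oplus> f [^] i' \<otimes> b') =
   f [^] (k' + j + j') \<otimes> (f [^] (k + i) \<otimes> a') \<oplus> f [^] (k + i + i') \<otimes> (f [^] (k' + j) \<otimes> b')"
   using c by (simp add: nat_pow_mult[symmetric] m_ac r_distr)
  also have "\<dots> = f [^] (k + k' + (i' + j')) \<otimes> (f [^] j \<otimes> a \<oplus> f [^] i \<otimes> b)"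
   unfolding 1 2 using assms by (simp add: nat_pow_mult[symmetric] m_ac r_distr)
  finally show ?thesis using c assms by (subst loc_frac_eq_iff) auto
 qed
 have ne: "(a, i) \<in> loc_frac a i" "(b, j) \<in> loc_frac b j" using assms by (auto simp: loc_frac_mem)
 have "loc_frac a i \<oplus>\<^bsub>loc_ring R f\<^esub> loc_frac b j =
  (\<Union>(a', i')\<in>loc_frac a i. \<Union>(b', j')\<in>loc_frac b j. loc_frac (f [^] j' \<otimes> a' \<oplus> f [^] i' \<otimes> b') (i' + j'))"
  by (simp add: loc_ring_def loc_frac_def)
 also have "\<dots> = loc_frac (f [^] j \<otimes> a \<oplus> f [^] i \<otimes> b) (i + j)" using ne by (intro UN_pairs_const *) blast+
 finally show ?thesis .
qed

lemma loc_one: "\<one>\<^bsub>loc_ring R f\<^esub> = loc_frac \<one> 0" and loc_zero: "\<zero>\<^bsub>loc_ring R f\<^esub> = loc_frac \<zero> 0"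
 by (simp_all add: loc_ring_def loc_frac_def)

lemma loc_cring: "cring (loc_ring R f)"
proof (rule cringI)
 show "abelian_group (loc_ring R f)"
 proof (rule abelian_groupI)
  fix x assume "x \<in> carrier (loc_ring R f)"
  then obtain a i where x: "x = loc_frac a i" "a \<in>. R" by (auto simp: loc_carrier)
  have "loc_frac (\<ominus> a) i \<oplus>\<^bsub>loc_ring R f\<^esub> x = loc_frac \<zero> 0"
   using x by (simp add: loc_add r_distr[symmetric] l_neg) (intro loc_fracI, auto)
  then show "\<exists>y\<in>carrier (loc_ring R f). y \<oplus>\<^bsub>loc_ring R f\<^esub> x = \<zero>\<^bsub>loc_ring R f\<^esub>"
   using x by (auto simp: loc_zero)
 next
  fix x y z assume "x \<in> carrier (loc_ring R f)" "y \<in> carrier (loc_ring R f)" "z \<in> carrier (loc_ring R f)"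
  then obtain a b c i j l where "a \<in>. R" "b \<in>. R" "c \<in>. R"
   "x = loc_frac a i" "y = loc_frac b j" "z = loc_frac c l" unfolding loc_carrier by blast
  then show "x \<oplus>\<^bsub>loc_ring R f\<^esub> y \<oplus>\<^bsub>loc_ring R f\<^esub> z = x \<oplus>\<^bsub>loc_ring R f\<^esub> (y \<oplus>\<^bsub>loc_ring R f\<^esub> z)"
   by (simp add: loc_add, intro loc_fracI) (simp_all add: nat_pow_mult[symmetric] m_ac r_distr a_ac)
 next
  fix x y assume "x \<in> carrier (loc_ring R f)" "y \<in> carrier (loc_ring R f)"
  then obtain a b i j where "a \<in>. R" "b \<in>. R" "x = loc_frac a i" "y = loc_frac b j" unfolding loc_carrier by blast
  then show "x \<oplus>\<^bsub>loc_ring R f\<^esub> y = y \<oplus>\<^bsub>loc_ring R f\<^esub> x"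
   by (simp add: loc_add, intro loc_fracI) (simp_all add: nat_pow_mult[symmetric] m_ac r_distr a_ac)
  from \<open>a \<in>. R\<close> \<open>b \<in>. R\<close> show "x \<oplus>\<^bsub>loc_ring R f\<^esub> y \<in> carrier (loc_ring R f)"
   by (simp add: loc_add \<open>x = loc_frac a i\<close> \<open>y = loc_frac b j\<close>)
 next
  fix x assume "x \<in> carrier (loc_ring R f)"
  then obtain a i where "a \<in>. R" "x = loc_frac a i" unfolding loc_carrier by blast
  then show "\<zero>\<^bsub>loc_ring R f\<^esub> \<oplus>\<^bsub>loc_ring R f\<^esub> x = x" by (simp add: loc_add loc_zero)
 qed (simp add: loc_zero)
 show "Group.comm_monoid (loc_ring R f)"
 proof (rule comm_monoidI)
  fix x y z assume "x \<in> carrier (loc_ring R f)" "y \<in> carrier (loc_ring R f)" "z \<in> carrier (loc_ring R f)"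
  then obtain a b c i j l where "a \<in>. R" "b \<in>. R" "c \<in>. R"
   "x = loc_frac a i" "y = loc_frac b j" "z = loc_frac c l" unfolding loc_carrier by blast
  then show "x \<otimes>\<^bsub>loc_ring R f\<^esub> y \<otimes>\<^bsub>loc_ring R f\<^esub> z = x \<otimes>\<^bsub>loc_ring R f\<^esub> (y \<otimes>\<^bsub>loc_ring R f\<^esub> z)"
   by (simp add: loc_mult m_ac add.assoc)
 next
  fix x y assume "x \<in> carrier (loc_ring R f)" "y \<in> carrier (loc_ring R f)"
  then obtain a b i j where "a \<in>. R" "b \<in>. R" "x = loc_frac a i" "y = loc_frac b j" unfolding loc_carrier by blast
  then show "x \<otimes>\<^bsub>loc_ring R f\<^esub> y = y \<otimes>\<^bsub>loc_ring R f\<^esub> x"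
   "x \<otimes>\<^bsub>loc_ring R f\<^esub> y \<in> carrier (loc_ring R f)" by (simp_all add: loc_mult m_ac add.commute)
 next
  fix x assume "x \<in> carrier (loc_ring R f)"
  then obtain a i where "a \<in>. R" "x = loc_frac a i" unfolding loc_carrier by blast
  then show "\<one>\<^bsub>loc_ring R f\<^esub> \<otimes>\<^bsub>loc_ring R f\<^esub> x = x" by (simp add: loc_mult loc_one)
 qed (simp add: loc_one)
 fix x y z assume "x \<in> carrier (loc_ring R f)" "y \<in> carrier (loc_ring R f)" "z \<in> carrier (loc_ring R f)"
 then obtain a b c i j l where "a \<in>. R" "b \<in>. R" "c \<in>. R"
  "x = loc_frac a i" "y = loc_frac b j" "z = loc_frac c l" unfolding loc_carrier by blast
 then show "(x \<oplus>\<^bsub>loc_ring R f\<^esub> y) \<otimes>\<^bsub>loc_ring R f\<^esub> z = x \<otimes>\<^bsub>loc_ring R f\<^esub> z \<oplus>\<^bsub>loc_ring R f\<^esub> y \<otimes>\<^bsub>loc_ring R f\<^esub> z"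
  by (simp add: loc_add loc_mult, intro loc_fracI) (simp_all add: nat_pow_mult[symmetric] m_ac r_distr)
qed

lemma to_loc_eq: "to_loc R f b = loc_frac b 0" by (simp add: to_loc_def loc_frac_def)

lemma to_loc_hom: "to_loc R f \<in> ring_hom R (loc_ring R f)" by (rule ring_hom_memI) (auto simp: to_loc_eq loc_mult loc_add loc_one)

lemma to_loc_unit: "loc_frac \<one> 1 \<otimes>\<^bsub>loc_ring R f\<^esub> to_loc R f f = \<one>\<^bsub>loc_ring R f\<^esub>"
 by (simp add: to_loc_eq loc_mult loc_one) (intro loc_fracI, auto)

lemma to_loc_zero_iff:
 assumes "b \<in>. R"
 shows "to_loc R f b = \<zero>\<^bsub>loc_ring R f\<^esub> \<longleftrightarrow> (\<exists>k::nat. f [^] k \<otimes> b = \<zero>)"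
 unfolding to_loc_eq loc_zero using assms by (subst loc_frac_eq_iff) auto

lemma to_loc_surj:
 assumes "ga \<in> carrier (loc_ring R f)"
 shows "\<exists>b\<in>carrier R. \<exists>i::nat. to_loc R f (f [^] i) \<otimes>\<^bsub>loc_ring R f\<^esub> ga = to_loc R f b"
proof -
 obtain a i where "ga = loc_frac a i" "a \<in>. R" using assms by (auto simp: loc_carrier)
 then have "to_loc R f (f [^] i) \<otimes>\<^bsub>loc_ring R f\<^esub> ga = to_loc R f a" "a \<in>. R"
  by (simp_all add: to_loc_eq loc_mult, intro loc_fracI) simp_all
 then show ?thesis by blast
qed

end

text \<open>Powers of elements generating the unit ideal generate it again. This is the source of
  every passage from local to global below: \<open>Q\<close> is the ideal of all ring elements for
  which some statement holds.\<close>

lemma comaximal_powers: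
 assumes D: "finite D" "D \<subseteq> carrier R" "genideal R D = carrier R"
  and Q: "ideal Q R" and pow: "\<And>f. f \<in> D ==> \<exists>k::nat. f [^] k \<in> Q"
 shows "\<one> \<in> Q"
proof -
 have Qc: "Q \<subseteq> carrier R" using Q by (simp add: ideal.Icarr subsetI)
 \<comment> \<open>The generators are discarded one at a time until only \<open>Q\<close> is
   left.\<close>
 have "\<one> \<in> Q" if "E \<subseteq> D" "\<one> \<in> Idl (Q \<union> E)" for E using finite_subset[OF that(1) D(1)] that
 proof (induction E)
  case empty
  then show ?case using genideal_minimal[OF Q, of Q] by auto
 next
  case (insert f E)
  have f: "f \<in>. R" using insert.prems D by auto
  have QE: "Q \<union> E \<subseteq> carrier R" using insert.prems D Qc by auto
  define J where "J = Idl (Q \<union> E)"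
  interpret J: ideal J R unfolding J_def by (rule genideal_ideal[OF QE])
  have Jsub: "Q \<union> E \<subseteq> J" unfolding J_def by (rule genideal_self[OF QE])
  have P: "ideal (PIdl f <+> J) R" by (rule add_ideals[OF cgenideal_ideal[OF f] J.ideal_axioms])
  have "Q \<union> insert f E \<subseteq> PIdl f <+> J"
  proof -
   have "f \<oplus> \<zero> \<in> PIdl f <+> J" unfolding set_add_def' using cgenideal_self[OF f] J.zero_closed by blast
   moreover have "\<zero> \<oplus> x \<in> PIdl f <+> J" if "x \<in> J" for x
    unfolding set_add_def' using that additive_subgroup.zero_closed[OF ideal.axioms(1)[OF cgenideal_ideal[OF f]]] by blast
   ultimately show ?thesis using Jsub J.Icarr f by (auto simp: subset_iff)
  qed
  from genideal_minimal[OF P this] have "\<one> \<in> PIdl f <+> J" using insert.prems(2) by blast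
  then obtain a j where aj: "a \<in>. R" "j \<in> J" "\<one> = a \<otimes> f \<oplus> j" unfolding set_add_def' cgenideal_def by blast
  define g where "g = a \<otimes> f"
  have g: "g \<in>. R" "j \<in>. R" "\<one> = g \<oplus> j" using aj f J.Icarr by (auto simp: g_def)
  \<comment> \<open>In the relation \<open>\<one> = g \<oplus> j\<close> the element
    \<open>g\<close> may be replaced by any power: multiply the relation for \<open>k\<close> by
    \<open>g\<close> and add \<open>j\<close>. For large \<open>k\<close> the power of
    \<open>f\<close> inside \<open>g [^] k\<close> lies in \<open>Q\<close>.\<close>
  have pw: "\<exists>i\<in>J. \<one> = g [^] k \<oplus> i" for k :: nat
  proof (induction k)
   case 0 show ?case by (rule bexI[OF _ J.zero_closed]) simp
  next
   case (Suc k)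
   then obtain i where i: "i \<in> J" "\<one> = g [^] k \<oplus> i" by blast
   have ic: "i \<in>. R" using i J.Icarr by blast
   have "\<one> = g \<oplus> j" by (rule g(3))
   also have "g = (g [^] k \<oplus> i) \<otimes> g" unfolding i(2)[symmetric] using g(1) by simp
   also have "(g [^] k \<oplus> i) \<otimes> g \<oplus> j = g [^] Suc k \<oplus> (i \<otimes> g \<oplus> j)"
    using g ic by (simp add: l_distr a_assoc)
   finally show ?case using i(1) g aj(2) by (intro bexI[of _ "i \<otimes> g \<oplus> j"]) (auto intro: J.I_r_closed)
  qed
  obtain k :: nat where k: "f [^] k \<in> Q" using pow insert.prems by blast
  obtain i where i: "i \<in> J" "\<one> = g [^] k \<oplus> i" using pw by blast
  have "g [^] k = a [^] k \<otimes> f [^] k" unfolding g_def using aj f by (simp add: nat_pow_distrib)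
  then have "g [^] k \<in> J" using k Jsub aj J.I_l_closed by auto
  then have "\<one> \<in> J" using i J.a_closed by metis
  then show ?case using insert by (simp add: J_def)
 qed
 note reduce = this
 have sub: "Q \<union> D \<subseteq> carrier R" using Qc D(2) by blast
 have "D \<subseteq> Idl (Q \<union> D)" using genideal_self[OF sub] by blast
 from genideal_minimal[OF genideal_ideal[OF sub] this] D(3) have "\<one> \<in> Idl (Q \<union> D)" by auto
 then show ?thesis using reduce[of D] by blast
qed

end

section \<open>Dual bases\<close>

definition functionals :: "('b, 'x) ring_scheme \<Rightarrow> ('b, 'm, 'z) module_scheme \<Rightarrow> ('m \<Rightarrow> 'b) set" where
 "functionals B M = {h \<in> ahom M B. \<forall>b\<in>carrier B. \<forall>x\<in>carrier M. h (b \<odot>.M x) = b \<otimes>.B h x}"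

lemma functionals_simps:
 assumes "h \<in> functionals B M"
 shows "x \<in>. M ==> h x \<in>. B"
  and "x \<in>. M ==> y \<in>. M ==> h (x \<oplus>.M y) = h x \<oplus>.B h y"
  and "b \<in>. B ==> x \<in>. M ==> h (b \<odot>.M x) = b \<otimes>.B h x"
  and functionals_ahom: "h \<in> ahom M B" using assms ahom_closed[of h M B] ahom_add[of h M B] by (auto simp: functionals_def)

lemma functionalsI:
 assumes "\<And>x. x \<in>. M ==> h x \<in>. B"
  and "\<And>x y. x \<in>. M ==> y \<in>. M ==> h (x \<oplus>.M y) = h x \<oplus>.B h y"
  and "\<And>b x. b \<in>. B ==> x \<in>. M ==> h (b \<odot>.M x) = b \<otimes>.B h x"
 shows "h \<in> functionals B M" using assms unfolding functionals_def by (auto intro!: ahomI)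

context module
begin

lemma finsum_smult_rdistr:
 assumes "finite I" "x \<in>. M" "c \<in> I \<rightarrow> carrier R"
 shows "(\<Oplus>i\<in>I. c i) \<odot>.M x = (\<Oplus>.M i\<in>I. c i \<odot>.M x)" using assms(1,3)
 by (induction I) (use assms(2) in \<open>simp_all add: smult_l_distr Pi_def\<close>)

lemma finsum_in_submodule:
 assumes "submodule H R M" "g \<in> I \<rightarrow> H"
 shows "(\<Oplus>.M i\<in>I. g i) \<in> H" using assms(2)
proof (induction I rule: infinite_finite_induct)
 case (insert i I)
 then show ?case using submoduleE[OF assms(1)] by (subst M.finsum_insert) (auto simp: Pi_def)
qed (use submoduleE[OF assms(1)] subgroup.one_closed[OF submodule.axioms(1)[OF assms(1)]] in auto)

definition lincombs :: "nat \<Rightarrow> (nat \<Rightarrow> 'c) \<Rightarrow> 'c set" where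
 "lincombs n e = {\<Oplus>.M i\<in>{..<n}. c i \<odot>.M e i | c. c \<in> {..<n} \<rightarrow> carrier R}"

lemma lincombs_submodule:
 assumes e: "e \<in> {..<n} \<rightarrow> carrier M"
 shows "submodule (lincombs n e) R M"
proof (rule submoduleI)
 have cl: "(\<lambda>i. c i \<odot>.M e i) \<in> {..<n} \<rightarrow> carrier M" if "c \<in> {..<n} \<rightarrow> carrier R" for c
  using e that by (auto simp: Pi_def)
 show "lincombs n e \<subseteq> carrier M" unfolding lincombs_def using cl by (auto intro!: M.finsum_closed simp: Pi_def)
 have "(\<Oplus>.M i\<in>{..<n}. \<zero> \<odot>.M e i) = \<zero>.M" using e by (intro M.add.finprod_one_eqI) (auto simp: Pi_def)
 then show "\<zero>.M \<in> lincombs n e" unfolding lincombs_def by (intro CollectI exI[of _ "\<lambda>_. \<zero>"]) auto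
 fix x y assume "x \<in> lincombs n e" "y \<in> lincombs n e"
 then obtain c d where cd: "c \<in> {..<n} \<rightarrow> carrier R" "d \<in> {..<n} \<rightarrow> carrier R"
  "x = (\<Oplus>.M i\<in>{..<n}. c i \<odot>.M e i)" "y = (\<Oplus>.M i\<in>{..<n}. d i \<odot>.M e i)" unfolding lincombs_def by blast
 have "x \<oplus>.M y = (\<Oplus>.M i\<in>{..<n}. c i \<odot>.M e i \<oplus>.M d i \<odot>.M e i)"
  unfolding cd(3,4) using cl cd(1,2) by (intro M.finsum_addf[symmetric])
 also have "\<dots> = (\<Oplus>.M i\<in>{..<n}. (c i \<oplus> d i) \<odot>.M e i)"
  using e cd(1,2) by (intro M.finsum_cong') (auto simp: smult_l_distr Pi_def)
 finally show "x \<oplus>.M y \<in> lincombs n e"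
  unfolding lincombs_def using cd(1,2) by (intro CollectI exI[of _ "\<lambda>i. c i \<oplus> d i"]) auto
next
 fix a x assume a: "a \<in>. R" and "x \<in> lincombs n e"
 then obtain c where c: "c \<in> {..<n} \<rightarrow> carrier R" "x = (\<Oplus>.M i\<in>{..<n}. c i \<odot>.M e i)" unfolding lincombs_def by blast
 have "a \<odot>.M x = (\<Oplus>.M i\<in>{..<n}. a \<odot>.M (c i \<odot>.M e i))" unfolding c(2) using e c a by (intro finsum_smult_ldistr) auto
 also have "\<dots> = (\<Oplus>.M i\<in>{..<n}. (a \<otimes> c i) \<odot>.M e i)"
  using e c a by (intro M.finsum_cong') (auto simp: smult_assoc1 Pi_def)
 finally show sm: "a \<odot>.M x \<in> lincombs n e"
  unfolding lincombs_def using c a by (intro CollectI exI[of _ "\<lambda>i. a \<otimes> c i"]) auto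
next
 fix x assume "x \<in> lincombs n e"
 then obtain c where c: "c \<in> {..<n} \<rightarrow> carrier R" "x = (\<Oplus>.M i\<in>{..<n}. c i \<odot>.M e i)" unfolding lincombs_def by blast
 have cl: "(\<lambda>i. c i \<odot>.M e i) \<in> {..<n} \<rightarrow> carrier M" using e c by (auto simp: Pi_def)
 then have "\<ominus>.M x = (\<ominus> \<one>) \<odot>.M x" unfolding c(2) by (simp add: smult_l_minus)
 also have "\<dots> = (\<Oplus>.M i\<in>{..<n}. (\<ominus> \<one>) \<odot>.M (c i \<odot>.M e i))"
  unfolding c(2) using cl by (intro finsum_smult_ldistr) auto
 also have "\<dots> = (\<Oplus>.M i\<in>{..<n}. (\<ominus> c i) \<odot>.M e i)" using e c by (intro M.finsum_cong') (auto simp: smult_l_minus Pi_def)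
 finally show "\<ominus>.M x \<in> lincombs n e" unfolding lincombs_def using c by (intro CollectI exI[of _ "\<lambda>i. \<ominus> c i"]) auto
qed

lemma lincombs_base:
 assumes e: "e \<in> {..<n} \<rightarrow> carrier M" and i: "i < n"
 shows "e i \<in> lincombs n e"
proof -
 have "(\<Oplus>.M j\<in>{..<n}. (if j = i then \<one> else \<zero>) \<odot>.M e j) = (\<Oplus>.M j\<in>{..<n}. if i = j then e j else \<zero>.M)"
  using e by (intro M.finsum_cong') (auto simp: Pi_def)
 also have "\<dots> = e i" using e i by (intro M.finsum_singleton) auto
 finally show ?thesis unfolding lincombs_def by (intro CollectI exI[of _ "\<lambda>j. if j = i then \<one> else \<zero>"]) auto
qed

end

text \<open>The data of the dual basis lemma for finitely generated projective modules. The
  generators \<open>e\<close> may be linearly dependent.\<close>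

definition dual_basis ::
  "('b, 'x) ring_scheme \<Rightarrow> ('b, 'm, 'z) module_scheme \<Rightarrow> nat \<Rightarrow> (nat \<Rightarrow> 'm) \<Rightarrow> (nat \<Rightarrow> 'm \<Rightarrow> 'b) \<Rightarrow> bool" where
 "dual_basis B M n e ep \<longleftrightarrow> e \<in> {..<n} \<rightarrow> carrier M \<and> ep \<in> {..<n} \<rightarrow> functionals B M \<and>
   (\<forall>x\<in>carrier M. x = (\<Oplus>.M i\<in>{..<n}. ep i x \<odot>.M e i))"

text \<open>Says that \<open>m\<close> becomes a basis after inverting \<open>f\<close>, with
  denominators cleared so that only elements of \<open>M\<close> occur: spanning holds up to powers
  of \<open>f\<close>, and the coefficients of a relation are killed by a power of
  \<open>f\<close>.\<close>

definition local_basis ::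
  "('b, 'x) ring_scheme \<Rightarrow> ('b, 'm, 'z) module_scheme \<Rightarrow> 'b \<Rightarrow> nat \<Rightarrow> (nat \<Rightarrow> 'm) \<Rightarrow> bool" where
 "local_basis B M f n m \<longleftrightarrow> m \<in> {..<n} \<rightarrow> carrier M \<and>
   (\<forall>x\<in>carrier M. \<exists>k::nat. \<exists>c. c \<in> {..<n} \<rightarrow> carrier B \<and>
    f [^].B k \<odot>.M x = (\<Oplus>.M i\<in>{..<n}. c i \<odot>.M m i)) \<and>
   (\<forall>c. c \<in> {..<n} \<rightarrow> carrier B \<longrightarrow> (\<Oplus>.M i\<in>{..<n}. c i \<odot>.M m i) = \<zero>.M \<longrightarrow>
    (\<exists>k::nat. \<forall>i<n. f [^].B k \<otimes>.B c i = \<zero>.B))"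

text \<open>The sum of the individual exponents works for all, by monotonicity. It equalizes
  exponents of \<open>f\<close>, denominators in z, and bounds on valuations.\<close>

lemma finite_uniform_bound:
 assumes "finite I" "\<And>i. i \<in> I ==> \<exists>k::nat. P i k" "\<And>i k l. i \<in> I ==> P i k ==> k \<le> l ==> P i l"
 shows "\<exists>k. \<forall>i\<in>I. P i k"
proof -
 obtain k where k: "\<And>i. i \<in> I ==> P i (k i)" using assms(2) by metis
 have "P i (\<Sum>j\<in>I. k j)" if "i \<in> I" for i using assms(3)[OF that k[OF that]] member_le_sum[OF that _ assms(1), of k] by simp
 then show ?thesis by blast
qed

declare base_change_simps [simp del]

lemma base_change_facts:
 fixes B :: "('b, 'y) ring_scheme" and M :: "('a, 'm, 'z) module_scheme"
 assumes B: "cring B" and ph: "ph \<in> ring_hom A B" and M: "module A M"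
 shows base_change_closed: "\<And>b m. b \<in>. B ==> m \<in>. M ==>
   pure_tensor A (algebra_via ph B) M b m \<in> carrier (base_change A ph B M)"
  and base_change_unit_ahom:
   "(\<lambda>m. pure_tensor A (algebra_via ph B) M \<one>.B m) \<in> ahom M (base_change A ph B M)"
  and base_change_add_left: "\<And>b b' m. b \<in>. B ==> b' \<in>. B ==> m \<in>. M ==>
   pure_tensor A (algebra_via ph B) M (b \<oplus>.B b') m =
   pure_tensor A (algebra_via ph B) M b m \<oplus>\<^bsub>base_change A ph B M\<^esub> pure_tensor A (algebra_via ph B) M b' m"
proof -
 show "(\<lambda>m. pure_tensor A (algebra_via ph B) M \<one>.B m) \<in> ahom M (base_change A ph B M)"
  unfolding ahom_base_change by (rule base_change_unit_hom[OF assms])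
qed (use bc_pt_simps[OF assms] in \<open>simp_all add: base_change_simps\<close>)

lemma base_change_mod_induct [consumes 4, case_names pure add]:
 assumes "cring B" and "ph \<in> ring_hom A B" and "module A M"
  and "X \<in> carrier (base_change A ph B M)"
  and "\<And>b m. b \<in>. B ==> m \<in>. M ==> P (pure_tensor A (algebra_via ph B) M b m)"
  and "\<And>X Y. X \<in> carrier (base_change A ph B M) ==> Y \<in> carrier (base_change A ph B M) ==>
   P X ==> P Y ==> P (X \<oplus>\<^bsub>base_change A ph B M\<^esub> Y)"
 shows "P X" using base_change_induct[OF assms(1-3), of X P] assms(4-) by (simp add: base_change_simps)

lemma base_change_hom_eqI:
 assumes "cring B" "ph \<in> ring_hom A B" "module A M"
  and "f \<in> ahom (base_change A ph B M) H" "g \<in> ahom (base_change A ph B M) H"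
  and "\<And>b m. b \<in>. B ==> m \<in>. M ==>
   f (pure_tensor A (algebra_via ph B) M b m) = g (pure_tensor A (algebra_via ph B) M b m)"
  and "X \<in> carrier (base_change A ph B M)"
 shows "f X = g X"
 using assms(1-3,7) by (induction rule: base_change_mod_induct) (simp_all add: assms(6) ahom_add[OF assms(4)] ahom_add[OF assms(5)])

lemma base_change_lift:
 fixes H :: "('h, 'w) ring_scheme" and b :: "'b \<Rightarrow> 'm \<Rightarrow> 'h"
 assumes B: "cring B" and ph: "ph \<in> ring_hom A B" and M: "module A M"
  and H: "abelian_group H"
  and cl: "\<And>c m. c \<in>. B ==> m \<in>. M ==> b c m \<in>. H"
  and addl: "\<And>c c' m. c \<in>. B ==> c' \<in>. B ==> m \<in>. M ==>
   b (c \<oplus>.B c') m = b c m \<oplus>.H b c' m"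
  and addr: "\<And>c m m'. c \<in>. B ==> m \<in>. M ==> m' \<in>. M ==>
   b c (m \<oplus>.M m') = b c m \<oplus>.H b c m'"
  and bal: "\<And>a c m. a \<in>. A ==> c \<in>. B ==> m \<in>. M ==>
   b (ph a \<otimes>.B c) m = b c (a \<odot>.M m)"
 shows base_change_lift_hom: "tensor_lift (add_monoid H) (\<lambda>(c, m). b c m) \<in> ahom (base_change A ph B M) H"
  and base_change_lift_pure: "\<And>c m. c \<in>. B ==> m \<in>. M ==>
   tensor_lift (add_monoid H) (\<lambda>(c, m). b c m) (pure_tensor A (algebra_via ph B) M c m) = b c m"
 using tensor_lift[OF bc_modules[OF assms(1-3)] H, of b] cl addl addr bal by (simp_all add: ahom_base_change)

section \<open>Local freeness in terms of elements\<close>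

context
 fixes B :: "('b, 'x) ring_scheme" and M :: "('b, 'm, 'z) module_scheme" and f :: 'b
 assumes M: "module B M" and f: "f \<in>. B"
begin

interpretation M: module B M by (rule M)

private abbreviation "L \<equiv> loc_ring B f"
private abbreviation "psj \<equiv> to_loc B f"
private abbreviation "Mf \<equiv> base_change B psj L M"
private abbreviation "ptL \<equiv> pure_tensor B (algebra_via psj L) M"

interpretation L: cring L by (rule M.R.loc_cring[OF f])
interpretation psj: ring_hom_ring B L psj by (simp add: ring_hom_ring_def ring_hom_ring_axioms_def M.R.ring_axioms L.ring_axioms M.R.to_loc_hom[OF f])
lemmas loc_mod = L.is_cring psj.homh M
interpretation Mf: module L Mf by (rule base_change_module[OF loc_mod])

text \<open>Vanishing in the localization means that a power of \<open>f\<close> kills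
  \<open>u k0\<close>, and moving along the sequence multiplies by exactly such powers.\<close>

lemma loc_eventually_zero:
 assumes u: "\<And>k. k \<ge> k0 ==> u k \<in>. B" "\<And>k. k \<ge> k0 ==> u (Suc k) = f \<otimes>.B u k"
  and z: "psj (u k0) = \<zero>.L"
 shows "\<exists>k1. \<forall>k\<ge>k1. u k = \<zero>.B"
proof -
 obtain l :: nat where l: "f [^].B l \<otimes>.B u k0 = \<zero>.B" using z M.R.to_loc_zero_iff[OF f u(1)] by auto
 have step: "u (k0 + d) = f [^].B d \<otimes>.B u k0" for d by (induction d) (use u f in \<open>simp_all add: M.R.m_ac\<close>)
 have "u k = \<zero>.B" if "k \<ge> k0 + l" for k
 proof -
  have d: "k = k0 + ((k - k0 - l) + l)" using that by simp
  have "u (k0 + ((k - k0 - l) + l)) = f [^].B (k - k0 - l) \<otimes>.B (f [^].B l \<otimes>.B u k0)"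
   unfolding step using f u(1)[of k0] by (simp add: M.R.nat_pow_mult[symmetric] M.R.m_assoc)
  then show ?thesis using l f d by simp
 qed
 then show ?thesis by blast
qed

text \<open>Conceptually the localized module is the direct limit of copies of \<open>M\<close>
  along multiplication by \<open>f\<close>. Instead of forming the limit, each fraction
  \<open>ga\<close> gets a numerator \<open>r k ga\<close> of \<open>f^k ga\<close> in
  \<open>B\<close>. The maps taking the tensor of \<open>ga\<close> and \<open>x\<close> to
  \<open>r k ga\<close> times \<open>x\<close> are eventually balanced, and on 1 \<otimes> y they
  give \<open>f^k y\<close>.\<close>

lemma base_change_loc_kernel:
 assumes y: "y \<in>. M" and z: "ptL \<one>.L y = \<zero>.Mf"
 shows "\<exists>k::nat. f [^].B k \<odot>.M y = \<zero>.M"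
proof -
 have "\<forall>ga. \<exists>b. \<exists>i::nat. ga \<in>. L \<longrightarrow> b \<in>. B \<and> psj (f [^].B i) \<otimes>.L ga = psj b"
  using M.R.to_loc_surj[OF f] by blast
 then obtain nb :: "_ \<Rightarrow> 'b" and ni :: "_ \<Rightarrow> nat" where
  nb: "\<And>ga. ga \<in>. L ==> nb ga \<in>. B"
   "\<And>ga. ga \<in>. L ==> psj (f [^].B ni ga) \<otimes>.L ga = psj (nb ga)" by metis
 \<comment> \<open>Because subtraction is truncated, \<open>r k ga\<close> has the intended meaning
   only for \<open>k \<ge> ni ga\<close>; an eventual statement asks for no more.\<close>
 define r where "r k ga = f [^].B (k - ni ga) \<otimes>.B nb ga" for k ga
 have rc: "r k ga \<in>. B" if "ga \<in>. L" for k ga using nb that f by (simp add: r_def)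
 have rS: "r (Suc k) ga = f \<otimes>.B r k ga" if "ga \<in>. L" "k \<ge> ni ga" for k ga using that nb f by (simp add: r_def Suc_diff_le M.R.m_ac)
 have rpsj: "psj (r k ga) = psj (f [^].B k) \<otimes>.L ga" if "ga \<in>. L" "k \<ge> ni ga" for k ga
 proof -
  have "psj (r k ga) = psj (f [^].B (k - ni ga)) \<otimes>.L (psj (f [^].B ni ga) \<otimes>.L ga)" using that nb f by (simp add: r_def)
  also have "\<dots> = psj (f [^].B (k - ni ga) \<otimes>.B f [^].B ni ga) \<otimes>.L ga" using that f by (simp add: L.m_assoc)
  finally show ?thesis using that f by (simp add: M.R.nat_pow_mult)
 qed
 \<comment> \<open>Numerators are not additive on the nose, since they depend on choices. Two
   sequences that scale by \<open>f\<close> and agree in the localization do agree from some point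
   on.\<close>
 have ev: "\<exists>k0. \<forall>k\<ge>k0. u k = w k"
  if "\<And>k. k \<ge> k0 ==> u k \<in>. B" "\<And>k. k \<ge> k0 ==> w k \<in>. B"
   "\<And>k. k \<ge> k0 ==> u (Suc k) = f \<otimes>.B u k" "\<And>k. k \<ge> k0 ==> w (Suc k) = f \<otimes>.B w k" "psj (u k0) = psj (w k0)" for u w and k0 :: nat
 proof -
  have "\<exists>k1. \<forall>k\<ge>k1. u k \<ominus>.B w k = \<zero>.B"
  proof (rule loc_eventually_zero)
   show "u (Suc k) \<ominus>.B w (Suc k) = f \<otimes>.B (u k \<ominus>.B w k)" if "k \<ge> k0" for k
    using \<open>\<And>k. k \<ge> k0 ==> u k \<in>. B\<close>[OF that] \<open>\<And>k. k \<ge> k0 ==> w k \<in>. B\<close>[OF that] f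
     \<open>\<And>k. k \<ge> k0 ==> u (Suc k) = f \<otimes>.B u k\<close>[OF that] \<open>\<And>k. k \<ge> k0 ==> w (Suc k) = f \<otimes>.B w k\<close>[OF that]
    by (simp add: M.R.minus_eq M.R.r_distr M.R.r_minus)
  qed (use that in \<open>simp_all add: M.R.minus_eq L.r_neg\<close>)
  then obtain k1 where k1: "\<forall>k\<ge>k1. u k \<ominus>.B w k = \<zero>.B" by blast
  have "u k = w k" if "k \<ge> max k0 k1" for k
   using M.R.r_right_minus_eq[of "u k" "w k"] k1[rule_format, of k] that \<open>\<And>k. k \<ge> k0 ==> u k \<in>. B\<close>[of k] \<open>\<And>k. k \<ge> k0 ==> w k \<in>. B\<close>[of k] by simp
  then show ?thesis by blast
 qed
 have "\<exists>k0. \<forall>k\<ge>k0. r k \<one>.L \<odot>.M y = \<zero>.M"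
 proof (rule pure_tensor_zero_eventually[OF bc_modules[OF loc_mod] M.M.abelian_group_axioms, where b = "\<lambda>k ga x. r k ga \<odot>.M x"])
  show "ptL \<one>.L y = \<zero>\<^bsub>tensor_ring B (algebra_via psj L) M\<^esub>" using z by (simp add: base_change_simps)
  fix m m' n assume "m \<in> carrier (algebra_via psj L)" "m' \<in> carrier (algebra_via psj L)" and n: "n \<in>. M"
  then have m: "m \<in>. L" "m' \<in>. L" by simp_all
  have "\<exists>k0. \<forall>k\<ge>k0. r k (m \<oplus>.L m') = r k m \<oplus>.B r k m'"
   by (rule ev[of "max (ni (m \<oplus>.L m')) (max (ni m) (ni m'))"])
     (use m rc rS rpsj f in \<open>simp_all add: M.R.r_distr L.r_distr\<close>)
  then obtain k0 where "\<forall>k\<ge>k0. r k (m \<oplus>.L m') = r k m \<oplus>.B r k m'" by blast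
  then show "\<exists>k0. \<forall>k\<ge>k0. r k (m \<oplus>\<^bsub>algebra_via psj L\<^esub> m') \<odot>.M n = r k m \<odot>.M n \<oplus>.M r k m' \<odot>.M n"
   using m n rc by (intro exI[of _ k0]) (simp add: M.smult_l_distr)
 next
  fix a m n assume a: "a \<in>. B" and "m \<in> carrier (algebra_via psj L)" and n: "n \<in>. M"
  then have m: "m \<in>. L" by simp
  have "\<exists>k0. \<forall>k\<ge>k0. r k (psj a \<otimes>.L m) = r k m \<otimes>.B a" by (rule ev[of "max (ni (psj a \<otimes>.L m)) (ni m)"])
     (use m rc rS rpsj f a in \<open>simp_all add: M.R.m_ac L.m_ac\<close>)
  then obtain k0 where "\<forall>k\<ge>k0. r k (psj a \<otimes>.L m) = r k m \<otimes>.B a" by blast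
  then show "\<exists>k0. \<forall>k\<ge>k0. r k (a \<odot>\<^bsub>algebra_via psj L\<^esub> m) \<odot>.M n = r k m \<odot>.M (a \<odot>.M n)"
   using m n a rc by (intro exI[of _ k0]) (simp add: M.smult_assoc1)
 qed (use y rc in \<open>auto simp: M.smult_r_distr\<close>)
 moreover have "\<exists>k0. \<forall>k\<ge>k0. r k \<one>.L = f [^].B k"
  by (rule ev[of "ni \<one>.L"]) (use rc rS rpsj f in \<open>simp_all add: M.R.m_ac\<close>)
 ultimately show ?thesis by (metis nle_le)
qed

lemma base_change_loc_denominator:
 assumes X: "X \<in>. Mf"
 shows "\<exists>k::nat. \<exists>m\<in>carrier M. psj (f [^].B k) \<odot>.Mf X = ptL \<one>.L m" using loc_mod X
proof (induction rule: base_change_mod_induct)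
 case (pure ga m)
 obtain b i where b: "b \<in>. B" "psj (f [^].B (i::nat)) \<otimes>.L ga = psj b" using M.R.to_loc_surj[OF f pure(1)] by blast
 have "psj (f [^].B i) \<odot>.Mf ptL ga m = ptL \<one>.L (b \<odot>.M m)"
  using pure b f by (simp add: base_change_smult_pure[OF loc_mod] base_change_unit_smult[OF loc_mod])
 then show ?case using b pure by blast
next
 case (add X Y)
 then obtain k l :: nat and m n where mn: "m \<in>. M" "n \<in>. M"
  "psj (f [^].B k) \<odot>.Mf X = ptL \<one>.L m" "psj (f [^].B l) \<odot>.Mf Y = ptL \<one>.L n" by blast
 have "psj (f [^].B (k + l)) = psj (f [^].B l) \<otimes>.L psj (f [^].B k)" "psj (f [^].B (k + l)) = psj (f [^].B k) \<otimes>.L psj (f [^].B l)"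
  using f by (simp_all add: M.R.nat_pow_mult[symmetric] L.m_comm)
 then have "psj (f [^].B (k + l)) \<odot>.Mf (X \<oplus>.Mf Y) = psj (f [^].B l) \<odot>.Mf (psj (f [^].B k) \<odot>.Mf X) \<oplus>.Mf psj (f [^].B k) \<odot>.Mf (psj (f [^].B l) \<odot>.Mf Y)"
  using add f by (simp add: Mf.smult_r_distr Mf.smult_assoc1[symmetric])
 also have "\<dots> = ptL \<one>.L (f [^].B l \<odot>.M m \<oplus>.M f [^].B k \<odot>.M n)"
  unfolding mn(3,4) using mn(1,2) f by (simp add: ahom_add[OF base_change_unit_ahom[OF loc_mod]] base_change_unit_smult[OF loc_mod])
 finally show ?case using mn(1,2) f by blast
qed

private lemma unit_pow: "M.R.loc_frac f \<one>.B 1 [^].L k \<otimes>.L psj (f [^].B k) = \<one>.L" for k :: nat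
proof -
 have c: "M.R.loc_frac f \<one>.B 1 \<in>. L" using M.R.loc_frac_carrier[OF f] by simp
 have "psj (f [^].B k) = psj f [^].L k" using f by (simp add: psj.hom_nat_pow)
 then show ?thesis using L.nat_pow_distrib[OF c, of "psj f" k] M.R.to_loc_unit[OF f] f by simp
qed

private definition "iv k = M.R.loc_frac f \<one>.B 1 [^].L (k::nat)"
private lemma iv_closed: "iv k \<in>. L" unfolding iv_def using M.R.loc_frac_carrier[OF f, of "\<one>.B" 1] by simp
private lemma iv: "iv k \<otimes>.L psj (f [^].B k) = \<one>.L" unfolding iv_def by (rule unit_pow)

private lemma uniform_denominator:
 assumes "finite I" "\<And>i. i \<in> I ==> de i \<in>. L"
 shows "\<exists>k::nat. \<exists>c. \<forall>i\<in>I. c i \<in>. B \<and> psj (f [^].B k) \<otimes>.L de i = psj (c i)"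
proof -
 have "\<exists>k::nat. \<forall>i\<in>I. \<exists>c. c \<in>. B \<and> psj (f [^].B k) \<otimes>.L de i = psj c"
 proof (rule finite_uniform_bound[OF assms(1), where P = "\<lambda>i (k::nat). \<exists>c. c \<in>. B \<and> psj (f [^].B k) \<otimes>.L de i = psj c"])
  fix i assume "i \<in> I"
  then show "\<exists>k::nat. \<exists>c. c \<in>. B \<and> psj (f [^].B k) \<otimes>.L de i = psj c" using M.R.to_loc_surj[OF f assms(2)] by blast
 next
  fix i and k l :: nat assume i: "i \<in> I" and "\<exists>c. c \<in>. B \<and> psj (f [^].B k) \<otimes>.L de i = psj c" and kl: "k \<le> l"
  then obtain c where c: "c \<in>. B" "psj (f [^].B k) \<otimes>.L de i = psj c" by blast
  have "f [^].B l = f [^].B (l - k) \<otimes>.B f [^].B k" using f kl by (simp add: M.R.nat_pow_mult)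
  then have "psj (f [^].B l) \<otimes>.L de i = psj (f [^].B (l - k) \<otimes>.B c)" using c f assms(2)[OF i] by (simp add: L.m_assoc)
  then show "\<exists>c. c \<in>. B \<and> psj (f [^].B l) \<otimes>.L de i = psj c" using c f by (intro exI[of _ "f [^].B (l - k) \<otimes>.B c"]) auto
 qed
 then show ?thesis by metis
qed

private lemma image_lincomb:
 assumes "m \<in> {..<n} \<rightarrow> carrier M" "c \<in> {..<n} \<rightarrow> carrier B"
 shows "ptL \<one>.L (\<Oplus>.M i\<in>{..<n}. c i \<odot>.M m i) = (\<Oplus>.Mf i\<in>{..<n}. psj (c i) \<odot>.Mf ptL \<one>.L (m i))"
proof -
 have "ptL \<one>.L (\<Oplus>.M i\<in>{..<n}. c i \<odot>.M m i) = (\<Oplus>.Mf i\<in>{..<n}. ptL \<one>.L (c i \<odot>.M m i))"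
  using assms by (intro ahom_finsum[OF M.M.abelian_group_axioms Mf.M.abelian_group_axioms base_change_unit_ahom[OF loc_mod]]) auto
 also have "\<dots> = (\<Oplus>.Mf i\<in>{..<n}. psj (c i) \<odot>.Mf ptL \<one>.L (m i))"
  using assms by (intro Mf.M.finsum_cong') (auto simp: base_change_unit_smult[OF loc_mod] Pi_def base_change_closed[OF loc_mod])
 finally show ?thesis .
qed

text \<open>A basis of the localized module is scaled, vector by vector, until it comes from
  \<open>M\<close>. Identities then hold in \<open>M\<close> after one more power of
  \<open>f\<close>, by \<open>base_change_loc_kernel\<close>.\<close>

lemma finite_free_imp_local_basis:
 assumes "finite_free L Mf"
 shows "\<exists>n m. local_basis B M f n m"
proof -
 from assms obtain n e where e: "e \<in> {..<n::nat} \<rightarrow> carrier Mf"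
  and uniq': "\<forall>x\<in>carrier Mf. \<exists>!c. c \<in> {..<n} \<rightarrow>\<^sub>E carrier L \<and> x = (\<Oplus>.Mf i\<in>{..<n}. c i \<odot>.Mf e i)"
  unfolding finite_free_def by (elim exE conjE)
 note uniq = bspec[OF uniq']
 have "\<forall>i\<in>{..<n}. \<exists>k::nat. \<exists>m\<in>carrier M. psj (f [^].B k) \<odot>.Mf e i = ptL \<one>.L m"
  using base_change_loc_denominator e by blast
 then obtain kk :: "nat \<Rightarrow> nat" and m where
  m: "\<And>i. i < n ==> m i \<in>. M" "\<And>i. i < n ==> psj (f [^].B kk i) \<odot>.Mf e i = ptL \<one>.L (m i)"
  by (metis lessThan_iff)
 have mc: "m \<in> {..<n} \<rightarrow> carrier M" using m by auto
 have ec: "i < n ==> e i \<in>. Mf" for i using e by auto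
 have "local_basis B M f n m" unfolding local_basis_def
 proof (intro conjI mc ballI allI impI)
  fix x assume x: "x \<in>. M"
  obtain ga where ga: "ga \<in> {..<n} \<rightarrow>\<^sub>E carrier L" "ptL \<one>.L x = (\<Oplus>.Mf i\<in>{..<n}. ga i \<odot>.Mf e i)"
   using uniq[OF base_change_closed[OF loc_mod L.one_closed x]] by blast
  have gac: "i < n ==> ga i \<in>. L" for i using ga(1) by auto
  \<comment> \<open>Coefficients for the scaled vectors: the power \<open>f^(kk i)\<close> put into
    \<open>m i\<close> is divided out again.\<close>
  define de where "de i = ga i \<otimes>.L iv (kk i)" for i
  have dec: "i \<in> {..<n} ==> de i \<in>. L" for i using gac by (simp add: de_def iv_closed)
  have dee: "ga i \<odot>.Mf e i = de i \<odot>.Mf ptL \<one>.L (m i)" if "i < n" for i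
  proof -
   have "de i \<odot>.Mf ptL \<one>.L (m i) = (ga i \<otimes>.L (iv (kk i) \<otimes>.L psj (f [^].B kk i))) \<odot>.Mf e i"
    unfolding m(2)[OF that, symmetric] de_def using that ec gac f iv_closed by (simp add: Mf.smult_assoc1[symmetric] L.m_assoc)
   then show ?thesis using that gac by (simp add: iv)
  qed
  have "\<exists>k::nat. \<exists>c. \<forall>i\<in>{..<n}. c i \<in>. B \<and> psj (f [^].B k) \<otimes>.L de i = psj (c i)"
   by (rule uniform_denominator[OF finite_lessThan dec])
  then obtain k :: nat and c where
   kc: "\<forall>i\<in>{..<n}. c i \<in>. B \<and> psj (f [^].B k) \<otimes>.L de i = psj (c i)" by (elim exE)
  then have c: "\<And>i. i < n ==> c i \<in>. B" "\<And>i. i < n ==> psj (f [^].B k) \<otimes>.L de i = psj (c i)" by simp_all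
  have cc: "c \<in> {..<n} \<rightarrow> carrier B" using c by auto
  have "ptL \<one>.L (f [^].B k \<odot>.M x) = psj (f [^].B k) \<odot>.Mf (\<Oplus>.Mf i\<in>{..<n}. ga i \<odot>.Mf e i)"
   unfolding ga(2)[symmetric] using x f by (simp add: base_change_unit_smult[OF loc_mod])
  also have "\<dots> = (\<Oplus>.Mf i\<in>{..<n}. psj (f [^].B k) \<odot>.Mf (ga i \<odot>.Mf e i))"
   using f gac ec by (intro Mf.finsum_smult_ldistr) auto
  also have "\<dots> = (\<Oplus>.Mf i\<in>{..<n}. psj (c i) \<odot>.Mf ptL \<one>.L (m i))" using c m(1) dec f
   by (intro Mf.M.finsum_cong') (auto simp: dee c(2)[symmetric] Mf.smult_assoc1[symmetric] Pi_def base_change_closed[OF loc_mod] simp del: c(2))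
  also have "\<dots> = ptL \<one>.L (\<Oplus>.M i\<in>{..<n}. c i \<odot>.M m i)" by (rule image_lincomb[OF mc cc, symmetric])
  finally have eq: "ptL \<one>.L (f [^].B k \<odot>.M x) = ptL \<one>.L (\<Oplus>.M i\<in>{..<n}. c i \<odot>.M m i)" .
  let ?s = "\<Oplus>.M i\<in>{..<n}. c i \<odot>.M m i"
  have s: "?s \<in>. M" using cc mc by (auto intro!: M.M.finsum_closed)
  have fx: "f [^].B k \<odot>.M x \<in>. M" using f x by simp
  have kz: "ptL \<one>.L (f [^].B k \<odot>.M x \<ominus>.M ?s) = \<zero>.Mf"
   using ahom_diff[OF M.M.abelian_group_axioms Mf.M.abelian_group_axioms base_change_unit_ahom[OF loc_mod] fx s] eq s
   by (simp add: Mf.M.minus_eq Mf.M.r_neg base_change_closed[OF loc_mod])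
  obtain l :: nat where "f [^].B l \<odot>.M (f [^].B k \<odot>.M x \<ominus>.M ?s) = \<zero>.M"
   using base_change_loc_kernel[OF M.M.minus_closed[OF fx s] kz] by blast
  then have "f [^].B l \<odot>.M (f [^].B k \<odot>.M x) \<oplus>.M \<ominus>.M (f [^].B l \<odot>.M ?s) = \<zero>.M"
   using fx s f by (simp add: M.M.minus_eq M.smult_r_distr M.smult_r_minus)
  then have "f [^].B l \<odot>.M (f [^].B k \<odot>.M x) = f [^].B l \<odot>.M ?s"
   using M.M.minus_equality[of "f [^].B l \<odot>.M (f [^].B k \<odot>.M x)" "\<ominus>.M (f [^].B l \<odot>.M ?s)"] fx s f by simp
  also have "\<dots> = (\<Oplus>.M i\<in>{..<n}. f [^].B l \<odot>.M (c i \<odot>.M m i))" using f cc mc by (intro M.finsum_smult_ldistr) auto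
  also have "\<dots> = (\<Oplus>.M i\<in>{..<n}. (f [^].B l \<otimes>.B c i) \<odot>.M m i)"
   using f cc mc by (intro M.M.finsum_cong') (auto simp: M.smult_assoc1 Pi_def)
  finally have "f [^].B (l + k) \<odot>.M x = (\<Oplus>.M i\<in>{..<n}. (f [^].B l \<otimes>.B c i) \<odot>.M m i)"
   using f x by (simp add: M.R.nat_pow_mult[symmetric] M.smult_assoc1)
  moreover have "(\<lambda>i. f [^].B l \<otimes>.B c i) \<in> {..<n} \<rightarrow> carrier B" using f cc by auto
  ultimately show "\<exists>k::nat. \<exists>c. c \<in> {..<n} \<rightarrow> carrier B \<and> f [^].B k \<odot>.M x = (\<Oplus>.M i\<in>{..<n}. c i \<odot>.M m i)"
   by (intro exI[of _ "l + k"] exI[of _ "\<lambda>i. f [^].B l \<otimes>.B c i"] conjI)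
 next
  fix c assume c: "c \<in> {..<n} \<rightarrow> carrier B" and z: "(\<Oplus>.M i\<in>{..<n}. c i \<odot>.M m i) = \<zero>.M"
  have cc: "i < n ==> c i \<in>. B" for i using c by auto
  define ga where "ga = restrict (\<lambda>i. psj (c i) \<otimes>.L psj (f [^].B kk i)) {..<n}"
  have ga: "ga \<in> {..<n} \<rightarrow>\<^sub>E carrier L" using cc f by (auto simp: ga_def)
  have "\<zero>.Mf = ptL \<one>.L (\<Oplus>.M i\<in>{..<n}. c i \<odot>.M m i)"
   unfolding z by (rule ahom_zero[OF M.M.abelian_group_axioms Mf.M.abelian_group_axioms base_change_unit_ahom[OF loc_mod], symmetric])
  also have "\<dots> = (\<Oplus>.Mf i\<in>{..<n}. psj (c i) \<odot>.Mf ptL \<one>.L (m i))" by (rule image_lincomb[OF mc c])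
  also have "\<dots> = (\<Oplus>.Mf i\<in>{..<n}. ga i \<odot>.Mf e i)"
   using cc f ec by (intro Mf.M.finsum_cong') (auto simp: m(2)[symmetric] ga_def Mf.smult_assoc1 Pi_def)
  finally have 1: "\<zero>.Mf = (\<Oplus>.Mf i\<in>{..<n}. ga i \<odot>.Mf e i)" .
  have 2: "restrict (\<lambda>i. \<zero>.L) {..<n} \<in> {..<n} \<rightarrow>\<^sub>E carrier L" by auto
  have 3: "\<zero>.Mf = (\<Oplus>.Mf i\<in>{..<n}. restrict (\<lambda>i. \<zero>.L) {..<n} i \<odot>.Mf e i)"
   by (rule Mf.M.add.finprod_one_eqI[symmetric]) (use ec in auto)
  \<comment> \<open>Uniqueness of coefficients, applied to the zero vector, is linear
    independence.\<close>
  have ga0: "ga = restrict (\<lambda>i. \<zero>.L) {..<n}" using uniq[OF Mf.M.zero_closed] 1 2 3 ga by blast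
  have "psj (c i) \<otimes>.L psj (f [^].B kk i) = \<zero>.L" if "i < n" for i
  proof -
   have "ga i = \<zero>.L" unfolding ga0 using that by simp
   then show ?thesis using that by (simp add: ga_def)
  qed
  then have "psj (c i \<otimes>.B f [^].B kk i) = \<zero>.L" if "i < n" for i using that cc f by simp
  then have ex0: "\<exists>k::nat. f [^].B k \<otimes>.B (c i \<otimes>.B f [^].B kk i) = \<zero>.B" if "i < n" for i
   using that cc f M.R.to_loc_zero_iff[OF f, of "c i \<otimes>.B f [^].B kk i"] by simp
  have ex: "\<exists>k::nat. f [^].B k \<otimes>.B c i = \<zero>.B" if i: "i \<in> {..<n}" for i
  proof -
   obtain k :: nat where "f [^].B k \<otimes>.B (c i \<otimes>.B f [^].B kk i) = \<zero>.B" using ex0[of i] i by auto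
   then have "f [^].B (k + kk i) \<otimes>.B c i = \<zero>.B" using cc[of i] i f by (simp add: M.R.nat_pow_mult[symmetric] M.R.m_ac)
   then show ?thesis by blast
  qed
  have "\<exists>k::nat. \<forall>i\<in>{..<n}. f [^].B k \<otimes>.B c i = \<zero>.B"
  proof (rule finite_uniform_bound[OF _ ex])
   fix i and k l :: nat assume i: "i \<in> {..<n}" and k: "f [^].B k \<otimes>.B c i = \<zero>.B" and "k \<le> l"
   then have "f [^].B l = f [^].B (l - k) \<otimes>.B f [^].B k" using f by (simp add: M.R.nat_pow_mult)
   then show "f [^].B l \<otimes>.B c i = \<zero>.B" using k cc i f by (simp add: M.R.m_assoc)
  qed simp_all
  then show "\<exists>k::nat. \<forall>i<n. f [^].B k \<otimes>.B c i = \<zero>.B" by auto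
 qed
 then show ?thesis by blast
qed

text \<open>The powers of \<open>f\<close> that a local basis tolerates are undone by their inverses
  \<open>iv k\<close>, both for spanning and for independence.\<close>

lemma local_basis_imp_finite_free:
 assumes lb: "local_basis B M f n m"
 shows "finite_free L Mf"
proof -
 have mc: "m \<in> {..<n} \<rightarrow> carrier M" using lb by (simp add: local_basis_def)
 define e where "e i = ptL \<one>.L (m i)" for i
 have ec: "e \<in> {..<n} \<rightarrow> carrier Mf" using mc by (auto simp: e_def intro!: base_change_closed[OF loc_mod])
 have sub: "submodule (Mf.lincombs n e) L Mf" by (rule Mf.lincombs_submodule[OF ec])
 have span: "X \<in> Mf.lincombs n e" if "X \<in>. Mf" for X using loc_mod that
 proof (induction rule: base_change_mod_induct)
  case (pure ga x)
  obtain k :: nat and c where c: "c \<in> {..<n} \<rightarrow> carrier B" "f [^].B k \<odot>.M x = (\<Oplus>.M i\<in>{..<n}. c i \<odot>.M m i)"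
   using lb pure(2) unfolding local_basis_def by blast
  have "ptL \<one>.L (f [^].B k \<odot>.M x) \<in> Mf.lincombs n e" unfolding c(2) image_lincomb[OF mc c(1)] Mf.lincombs_def e_def
   using c(1) by (intro CollectI exI[of _ "\<lambda>i. psj (c i)"]) (auto intro!: psj.hom_closed)
  then have "(ga \<otimes>.L iv k) \<odot>.Mf ptL \<one>.L (f [^].B k \<odot>.M x) \<in> Mf.lincombs n e"
   using pure by (intro Mf.submoduleE(4)[OF sub]) (simp_all add: iv_closed)
  moreover have "(ga \<otimes>.L iv k) \<odot>.Mf ptL \<one>.L (f [^].B k \<odot>.M x) = (ga \<otimes>.L (iv k \<otimes>.L psj (f [^].B k))) \<odot>.Mf ptL \<one>.L x"
   using pure f by (simp add: base_change_unit_smult[OF loc_mod] Mf.smult_assoc1[symmetric] L.m_assoc iv_closed base_change_closed[OF loc_mod])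
  ultimately show ?case using pure by (simp add: iv base_change_pure_eq[OF loc_mod, of ga])
 qed (rule Mf.submoduleE(5)[OF sub])
 have indep: "ga i = \<zero>.L" if ga: "ga \<in> {..<n} \<rightarrow> carrier L" and z: "(\<Oplus>.Mf i\<in>{..<n}. ga i \<odot>.Mf e i) = \<zero>.Mf" and i: "i < n" for ga i
 proof -
  have "\<exists>k::nat. \<exists>c. \<forall>i\<in>{..<n}. c i \<in>. B \<and> psj (f [^].B k) \<otimes>.L ga i = psj (c i)"
   by (rule uniform_denominator[OF finite_lessThan Pi_mem[OF ga]])
  then obtain k :: nat and c where
   kc: "\<forall>i\<in>{..<n}. c i \<in>. B \<and> psj (f [^].B k) \<otimes>.L ga i = psj (c i)" by (elim exE)
  then have c: "\<And>i. i < n ==> c i \<in>. B" "\<And>i. i < n ==> psj (f [^].B k) \<otimes>.L ga i = psj (c i)" by simp_all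
  have cc: "c \<in> {..<n} \<rightarrow> carrier B" using c by auto
  have gae: "(\<lambda>i. ga i \<odot>.Mf e i) \<in> {..<n} \<rightarrow> carrier Mf" using ga ec by (auto simp: Pi_def)
  have "\<zero>.Mf = psj (f [^].B k) \<odot>.Mf (\<Oplus>.Mf i\<in>{..<n}. ga i \<odot>.Mf e i)" unfolding z using f by simp
  also have "\<dots> = (\<Oplus>.Mf i\<in>{..<n}. psj (f [^].B k) \<odot>.Mf (ga i \<odot>.Mf e i))"
   using gae f by (intro Mf.finsum_smult_ldistr) auto
  also have "\<dots> = (\<Oplus>.Mf i\<in>{..<n}. psj (c i) \<odot>.Mf e i)"
   using ga ec c f by (intro Mf.M.finsum_cong') (auto simp: c(2)[symmetric] Mf.smult_assoc1 Pi_def)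
  also have "\<dots> = ptL \<one>.L (\<Oplus>.M i\<in>{..<n}. c i \<odot>.M m i)" unfolding e_def by (rule image_lincomb[OF mc cc, symmetric])
  finally have z': "ptL \<one>.L (\<Oplus>.M i\<in>{..<n}. c i \<odot>.M m i) = \<zero>.Mf" by simp
  have cm: "(\<lambda>i. c i \<odot>.M m i) \<in> {..<n} \<rightarrow> carrier M" using cc mc by (auto simp: Pi_def)
  obtain l :: nat where "f [^].B l \<odot>.M (\<Oplus>.M i\<in>{..<n}. c i \<odot>.M m i) = \<zero>.M"
   using base_change_loc_kernel[OF _ z'] cm by (auto intro: M.M.finsum_closed)
  moreover have "f [^].B l \<odot>.M (\<Oplus>.M i\<in>{..<n}. c i \<odot>.M m i) = (\<Oplus>.M i\<in>{..<n}. f [^].B l \<odot>.M (c i \<odot>.M m i))"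
   using cm f by (intro M.finsum_smult_ldistr) auto
  moreover have "\<dots> = (\<Oplus>.M i\<in>{..<n}. (f [^].B l \<otimes>.B c i) \<odot>.M m i)"
   using f cc mc by (intro M.M.finsum_cong') (auto simp: M.smult_assoc1 Pi_def)
  moreover have "(\<lambda>i. f [^].B l \<otimes>.B c i) \<in> {..<n} \<rightarrow> carrier B" using f cc by auto
  ultimately have "(\<Oplus>.M i\<in>{..<n}. (f [^].B l \<otimes>.B c i) \<odot>.M m i) = \<zero>.M"
   and "(\<lambda>i. f [^].B l \<otimes>.B c i) \<in> {..<n} \<rightarrow> carrier B" by simp_all
  from conjunct2[OF conjunct2[OF lb[unfolded local_basis_def]], rule_format, OF this(2,1)] i
  obtain k' :: nat where "f [^].B k' \<otimes>.B (f [^].B l \<otimes>.B c i) = \<zero>.B" by blast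
  then have "f [^].B (k' + l) \<otimes>.B c i = \<zero>.B" using f c(1)[OF i] by (simp add: M.R.nat_pow_mult[symmetric] M.R.m_assoc)
  then have "psj (c i) = \<zero>.L" using M.R.to_loc_zero_iff[OF f c(1)[OF i]] by blast
  then have "iv k \<otimes>.L (psj (f [^].B k) \<otimes>.L ga i) = \<zero>.L" using c(2)[OF i] iv_closed by simp
  then show "ga i = \<zero>.L" using ga i f iv_closed by (simp add: L.m_assoc[symmetric] iv Pi_iff)
 qed
 show ?thesis unfolding finite_free_def
 proof (intro exI[of _ n] exI[of _ e] conjI ec ballI ex_ex1I)
  fix X assume X: "X \<in>. Mf"
  then obtain c where c: "c \<in> {..<n} \<rightarrow> carrier L" "X = (\<Oplus>.Mf i\<in>{..<n}. c i \<odot>.Mf e i)"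
   using span[OF X] unfolding Mf.lincombs_def by blast
  have "(\<Oplus>.Mf i\<in>{..<n}. c i \<odot>.Mf e i) = (\<Oplus>.Mf i\<in>{..<n}. restrict c {..<n} i \<odot>.Mf e i)"
   using c(1) ec by (intro Mf.M.finsum_cong') (auto simp: Pi_def)
  then show "\<exists>c. c \<in> {..<n} \<rightarrow>\<^sub>E carrier L \<and> X = (\<Oplus>.Mf i\<in>{..<n}. c i \<odot>.Mf e i)"
   using c by (intro exI[of _ "restrict c {..<n}"]) auto
 next
  fix X c d assume cd: "c \<in> {..<n} \<rightarrow>\<^sub>E carrier L \<and> X = (\<Oplus>.Mf i\<in>{..<n}. c i \<odot>.Mf e i)"
   "d \<in> {..<n} \<rightarrow>\<^sub>E carrier L \<and> X = (\<Oplus>.Mf i\<in>{..<n}. d i \<odot>.Mf e i)"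
  have cc: "i < n ==> c i \<in>. L" "i < n ==> d i \<in>. L" "i < n ==> e i \<in>. Mf" for i using cd ec by auto
  have "(\<Oplus>.Mf i\<in>{..<n}. (c i \<ominus>.L d i) \<odot>.Mf e i) = (\<Oplus>.Mf i\<in>{..<n}. c i \<odot>.Mf e i \<oplus>.Mf (\<ominus>.L \<one>.L) \<odot>.Mf (d i \<odot>.Mf e i))"
   using cc by (intro Mf.M.finsum_cong') (auto simp: L.minus_eq Mf.smult_l_distr Mf.smult_l_minus)
  also have "\<dots> = (\<Oplus>.Mf i\<in>{..<n}. c i \<odot>.Mf e i) \<oplus>.Mf (\<Oplus>.Mf i\<in>{..<n}. (\<ominus>.L \<one>.L) \<odot>.Mf (d i \<odot>.Mf e i))"
   using cc by (intro Mf.M.finsum_addf) auto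
  also have "(\<Oplus>.Mf i\<in>{..<n}. (\<ominus>.L \<one>.L) \<odot>.Mf (d i \<odot>.Mf e i)) = (\<ominus>.L \<one>.L) \<odot>.Mf X"
   unfolding conjunct2[OF cd(2)] using cc by (intro Mf.finsum_smult_ldistr[symmetric]) auto
  also have "(\<Oplus>.Mf i\<in>{..<n}. c i \<odot>.Mf e i) = X" using cd by simp
  also have "X \<oplus>.Mf (\<ominus>.L \<one>.L) \<odot>.Mf X = \<zero>.Mf"
  proof -
   have "X \<in>. Mf" unfolding conjunct2[OF cd(1)] using cc by (intro Mf.M.finsum_closed) auto
   then show ?thesis by (simp add: Mf.smult_l_minus Mf.M.r_neg)
  qed
  finally have "c i \<ominus>.L d i = \<zero>.L" if "i < n" for i by (intro indep[of "\<lambda>i. c i \<ominus>.L d i"]) (use cc that in auto)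
  then have eq: "c i = d i" if "i \<in> {..<n}" for i using that cc by simp
  show "c = d" by (rule PiE_ext[OF conjunct1[OF cd(1)] conjunct1[OF cd(2)] eq])
 qed
qed

end

text \<open>Removes the localized rings and modules from the notion; everything later works with
  elements of \<open>M\<close> and powers of \<open>f\<close>.\<close>

lemma finite_locally_free_iff:
 assumes "module B M"
 shows "finite_locally_free B M \<longleftrightarrow> (\<exists>D. finite D \<and> D \<subseteq> carrier B \<and> genideal B D = carrier B \<and>
  (\<forall>f\<in>D. \<exists>n m. local_basis B M f n m))"
proof -
 have "finite_free (loc_ring B f) (base_change B (to_loc B f) (loc_ring B f) M) \<longleftrightarrow> (\<exists>n m. local_basis B M f n m)"
  if "f \<in>. B" for f using finite_free_imp_local_basis[OF assms that] local_basis_imp_finite_free[OF assms that] by blast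
 then show ?thesis unfolding finite_locally_free_def using assms by (intro iffI; elim conjE exE; metis subset_iff)
qed

section \<open>Locally free modules of finite type are finitely generated projective\<close>

lemma (in abelian_monoid) finsum_lessThan_add:
 fixes n m :: nat
 assumes "g \<in> {..<n + m} \<rightarrow> carrier G"
 shows "(\<Oplus>i\<in>{..<n + m}. g i) = (\<Oplus>i\<in>{..<n}. g i) \<oplus> (\<Oplus>i\<in>{..<m}. g (n + i))" using assms
proof (induction m)
 case (Suc m)
 have c: "g (n + m) \<in>. G" "g \<in> {..<n + m} \<rightarrow> carrier G" "(\<lambda>i. g (n + i)) \<in> {..<m} \<rightarrow> carrier G"
  "g \<in> {..<n} \<rightarrow> carrier G" using Suc.prems by auto
 have "(\<Oplus>i\<in>{..<n + Suc m}. g i) = g (n + m) \<oplus> (\<Oplus>i\<in>{..<n + m}. g i)" using c by (simp add: lessThan_Suc)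
 also have "\<dots> = (\<Oplus>i\<in>{..<n}. g i) \<oplus> (\<Oplus>i\<in>{..<Suc m}. g (n + i))"
  using c Suc.IH by (simp add: lessThan_Suc a_ac finsum_closed)
 finally show ?case .
qed simp

section \<open>From local statements on a comaximal family to global ones\<close>

context cring
begin

lemma ideal_of_closed:
 assumes "Q \<subseteq> carrier R" "\<zero> \<in> Q" "\<And>a b. a \<in> Q ==> b \<in> Q ==> a \<oplus> b \<in> Q"
  and mult: "\<And>a b. a \<in>. R ==> b \<in> Q ==> a \<otimes> b \<in> Q"
 shows "ideal Q R"
proof (rule idealI)
 show "subgroup Q (add_monoid R)"
 proof
  fix x assume x: "x \<in> Q"
  then have "\<ominus> x = \<ominus> \<one> \<otimes> x" using assms(1) by (auto simp: l_minus)
  then show "inv\<^bsub>add_monoid R\<^esub> x \<in> Q" using mult[of "\<ominus> \<one>" x] x by (simp add: a_inv_def)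
 qed (use assms in auto)
 show "x \<otimes> a \<in> Q" if "a \<in> Q" "x \<in>. R" for a x using mult that by simp
 show "a \<otimes> x \<in> Q" if "a \<in> Q" "x \<in>. R" for a x using mult[OF that(2,1)] that assms(1) by (simp add: m_comm subset_iff)
qed (rule ring_axioms)

lemma comaximal_zero:
 assumes D: "finite D" "D \<subseteq> carrier R" "genideal R D = carrier R"
  and b: "b \<in>. R" and k: "\<And>f. f \<in> D ==> \<exists>k::nat. f [^] k \<otimes> b = \<zero>"
 shows "b = \<zero>"
proof -
 define Q where "Q = {c \<in> carrier R. c \<otimes> b = \<zero>}"
 have "ideal Q R" by (rule ideal_of_closed) (use b in \<open>auto simp: Q_def l_distr m_assoc\<close>)
 moreover have "\<exists>k::nat. f [^] k \<in> Q" if "f \<in> D" for f using k[OF that] D that by (auto simp: Q_def)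
 ultimately have "\<one> \<in> Q" by (rule comaximal_powers[OF D])
 then show ?thesis using b by (simp add: Q_def)
qed

lemma nat_pow_split: "f \<in>. R ==> k \<le> l ==> f [^] (l::nat) = f [^] (l - k) \<otimes> f [^] k"
 by (simp add: nat_pow_mult)

lemma nat_pow_annihilates:
 "f \<in>. R ==> b \<in>. R ==> f [^] k \<otimes> b = \<zero> ==> k \<le> (l::nat) ==> f [^] l \<otimes> b = \<zero>"
 by (simp add: nat_pow_split[of f k l] m_assoc)

end

context module
begin

text \<open>The scalars carrying \<open>y\<close> into \<open>H\<close> form an ideal that contains
  a power of every member of \<open>D\<close>.\<close>

lemma comaximal_submodule:
 assumes D: "finite D" "D \<subseteq> carrier R" "genideal R D = carrier R"
  and H: "submodule H R M" and y: "y \<in>. M"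
  and k: "\<And>f. f \<in> D ==> \<exists>k::nat. f [^] k \<odot>.M y \<in> H"
 shows "y \<in> H"
proof -
 note Hs = submoduleE[OF H]
 define Q where "Q = {c \<in> carrier R. c \<odot>.M y \<in> H}"
 have "\<zero>.M \<in> H" using subgroup.one_closed[OF submodule.axioms(1)[OF H]] by simp
 then have "ideal Q R" by (intro R.ideal_of_closed) (use y Hs in \<open>auto simp: Q_def smult_l_distr smult_assoc1\<close>)
 moreover have "\<exists>k::nat. f [^] k \<in> Q" if "f \<in> D" for f using k[OF that] D that by (auto simp: Q_def)
 ultimately have "\<one> \<in> Q" by (rule R.comaximal_powers[OF D])
 then show ?thesis using y by (simp add: Q_def)
qed

text \<open>All local bases taken together generate: a power of each \<open>f\<close> brings any
  given element into their span.\<close>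

lemma finite_locally_free_generators:
 assumes D: "finite D" "D \<subseteq> carrier R" "genideal R D = carrier R"
  and lb: "\<And>f. f \<in> D ==> local_basis R M f (nn f) (mm f)"
 obtains N x where "x \<in> {..<N::nat} \<rightarrow> carrier M" "lincombs N x = carrier M"
proof -
 define X where "X = (\<Union>f\<in>D. mm f ` {..<nn f})"
 have "finite X" using D by (simp add: X_def)
 then obtain N :: nat and x where x: "X = x ` {i. i < N}" using finite_imp_nat_seg_image_inj_on by metis
 have mmc: "mm f \<in> {..<nn f} \<rightarrow> carrier M" if "f \<in> D" for f using lb[OF that] by (simp add: local_basis_def)
 have xc: "x \<in> {..<N} \<rightarrow> carrier M"
 proof
  fix i assume "i \<in> {..<N}"
  then have "x i \<in> X" unfolding x by simp
  then show "x i \<in>. M" unfolding X_def using mmc by fastforce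
 qed
 note sub = lincombs_submodule[OF xc]
 have gen: "mm f i \<in> lincombs N x" if "f \<in> D" "i < nn f" for f i
 proof -
  have "mm f i \<in> X" using that by (auto simp: X_def)
  then obtain j where "j < N" "mm f i = x j" unfolding x by auto
  then show ?thesis using lincombs_base[OF xc] by simp
 qed
 have "y \<in> lincombs N x" if y: "y \<in>. M" for y
 proof (rule comaximal_submodule[OF D sub y])
  fix f assume f: "f \<in> D"
  from lb[OF f] y obtain k :: nat and c where c: "c \<in> {..<nn f} \<rightarrow> carrier R"
   "f [^] k \<odot>.M y = (\<Oplus>.M i\<in>{..<nn f}. c i \<odot>.M mm f i)" unfolding local_basis_def by blast
  have "f [^] k \<odot>.M y \<in> lincombs N x"
   unfolding c(2) using gen[OF f] c(1) submoduleE(4)[OF sub] by (intro finsum_in_submodule[OF sub]) auto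
  then show "\<exists>k::nat. f [^] k \<odot>.M y \<in> lincombs N x" by blast
 qed
 then have "lincombs N x = carrier M" using submoduleE(1)[OF sub] by blast
 with xc show thesis by (rule that)
qed

text \<open>The coordinates of a local basis at \<open>f\<close> are functions on the localization;
  the point is to turn them, up to a power of \<open>f\<close>, into functionals on
  \<open>M\<close>. With global generators \<open>x j\<close> one extends the coordinates of the
  \<open>x j\<close> linearly, but this is well defined only if a single power of \<open>f\<close>
  kills the values on all relations among the \<open>x j\<close>. No chain condition on the ring
  makes the relations finitely generated. Instead the values are compared, locally at each
  \<open>g\<close>, with the coordinates at \<open>g\<close>: the error terms form a finite family
  that does not involve the relation, and one power of \<open>f\<close> kills them.\<close>

lemma local_functionals:
 assumes D: "finite D" "D \<subseteq> carrier R" "genideal R D = carrier R"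
  and lb: "\<And>f. f \<in> D ==> local_basis R M f (nn f) (mm f)"
  and f: "f \<in> D"
 shows "\<exists>(k::nat) mv. mv \<in> {..<nn f} \<rightarrow> functionals R M \<and>
  (\<forall>y\<in>carrier M. f [^] k \<odot>.M y = (\<Oplus>.M i\<in>{..<nn f}. mv i y \<odot>.M mm f i))"
proof -
 have Dc: "g \<in>. R" if "g \<in> D" for g using D(2) that by blast
 note fc = Dc[OF f]
 have mmc: "mm g i \<in>. M" if "g \<in> D" "i < nn g" for g i using lb[OF that(1)] that(2) by (auto simp: local_basis_def)
 have lbz: "\<exists>k::nat. \<forall>i<nn g. g [^] k \<otimes> c i = \<zero>"
  if "g \<in> D" "\<And>i. i < nn g ==> c i \<in>. R" "(\<Oplus>.M i\<in>{..<nn g}. c i \<odot>.M mm g i) = \<zero>.M" for g c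
  using conjunct2[OF conjunct2[OF lb[OF that(1), unfolded local_basis_def]], rule_format, of c] that(2,3) by auto
 obtain N x where x: "x \<in> {..<N::nat} \<rightarrow> carrier M" "lincombs N x = carrier M" by (rule finite_locally_free_generators[OF D lb])
 have xc: "j < N ==> x j \<in>. M" for j using x by auto
 have "\<forall>y\<in>carrier M. \<exists>a. (\<forall>j<N. a j \<in>. R) \<and> y = (\<Oplus>.M j\<in>{..<N}. a j \<odot>.M x j)"
 proof
  fix y assume "y \<in>. M"
  then obtain a where "a \<in> {..<N} \<rightarrow> carrier R" "y = (\<Oplus>.M j\<in>{..<N}. a j \<odot>.M x j)"
   unfolding x(2)[symmetric] lincombs_def by blast
  then show "\<exists>a. (\<forall>j<N. a j \<in>. R) \<and> y = (\<Oplus>.M j\<in>{..<N}. a j \<odot>.M x j)" by (intro exI[of _ a]) auto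
 qed
 from bchoice[OF this] obtain A where
  "\<forall>y\<in>carrier M. (\<forall>j<N. A y j \<in>. R) \<and> y = (\<Oplus>.M j\<in>{..<N}. A y j \<odot>.M x j)" by (elim exE)
 then have A: "\<And>y j. y \<in>. M ==> j < N ==> A y j \<in>. R"
  "\<And>y. y \<in>. M ==> y = (\<Oplus>.M j\<in>{..<N}. A y j \<odot>.M x j)" by simp_all
 have "\<forall>g\<in>D. \<exists>p. \<forall>j<N. (\<forall>i<nn g. snd p j i \<in>. R) \<and>
   g [^] (fst p :: nat) \<odot>.M x j = (\<Oplus>.M i\<in>{..<nn g}. snd p j i \<odot>.M mm g i)"
 proof
  fix g assume g: "g \<in> D"
  let ?P = "\<lambda>j (k::nat). \<exists>c. (\<forall>i<nn g. c i \<in>. R) \<and> g [^] k \<odot>.M x j = (\<Oplus>.M i\<in>{..<nn g}. c i \<odot>.M mm g i)"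
  have "\<exists>k. \<forall>j\<in>{..<N}. ?P j k"
  proof (rule finite_uniform_bound[where P = ?P])
   fix j assume "j \<in> {..<N}"
   then obtain k :: nat and c where "c \<in> {..<nn g} \<rightarrow> carrier R" "g [^] k \<odot>.M x j = (\<Oplus>.M i\<in>{..<nn g}. c i \<odot>.M mm g i)"
    using lb[OF g] xc[of j] unfolding local_basis_def by blast
   then show "\<exists>k. ?P j k" by (intro exI[of _ k] exI[of _ c]) auto
  next
   fix j k l assume j: "j \<in> {..<N}" and "?P j k" and kl: "k \<le> l"
   then obtain c where c: "\<And>i. i < nn g ==> c i \<in>. R" "g [^] k \<odot>.M x j = (\<Oplus>.M i\<in>{..<nn g}. c i \<odot>.M mm g i)" by blast
   have "g [^] l \<odot>.M x j = g [^] (l - k) \<odot>.M (g [^] k \<odot>.M x j)"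
    using kl xc[of j] j Dc[OF g] by (simp add: R.nat_pow_split[of g k l] smult_assoc1)
   also have "\<dots> = (\<Oplus>.M i\<in>{..<nn g}. g [^] (l - k) \<odot>.M (c i \<odot>.M mm g i))"
    unfolding c(2) using c(1) mmc[OF g] Dc[OF g] by (intro finsum_smult_ldistr) auto
   also have "\<dots> = (\<Oplus>.M i\<in>{..<nn g}. (g [^] (l - k) \<otimes> c i) \<odot>.M mm g i)"
    using c(1) mmc[OF g] Dc[OF g] by (intro M.finsum_cong') (auto simp: smult_assoc1)
   finally show "?P j l" using c(1) Dc[OF g] by (intro exI[of _ "\<lambda>i. g [^] (l - k) \<otimes> c i"]) auto
  qed simp
  then obtain k where "\<forall>j\<in>{..<N}. ?P j k" by blast
  from bchoice[OF this] obtain c where "\<forall>j\<in>{..<N}. (\<forall>i<nn g. c j i \<in>. R) \<and> g [^] k \<odot>.M x j = (\<Oplus>.M i\<in>{..<nn g}. c j i \<odot>.M mm g i)"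
   by (elim exE)
  then show "\<exists>p. \<forall>j<N. (\<forall>i<nn g. snd p j i \<in>. R) \<and>
   g [^] (fst p :: nat) \<odot>.M x j = (\<Oplus>.M i\<in>{..<nn g}. snd p j i \<odot>.M mm g i)" by (intro exI[of _ "(k, c)"]) simp
 qed
 from bchoice[OF this] obtain p where p: "\<forall>g\<in>D. \<forall>j<N. (\<forall>i<nn g. snd (p g) j i \<in>. R) \<and>
   g [^] (fst (p g) :: nat) \<odot>.M x j = (\<Oplus>.M i\<in>{..<nn g}. snd (p g) j i \<odot>.M mm g i)" by (elim exE)
 define K where "K g = fst (p g)" for g
 define C where "C g = snd (p g)" for g
 have C: "\<And>g j i. g \<in> D ==> j < N ==> i < nn g ==> C g j i \<in>. R"
  "\<And>g j. g \<in> D ==> j < N ==> g [^] K g \<odot>.M x j = (\<Oplus>.M i\<in>{..<nn g}. C g j i \<odot>.M mm g i)"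
  using p by (simp_all add: C_def K_def)
 \<comment> \<open>For y = \<Sum> a_j x_j these are the coordinates of \<open>g^(K g) y\<close> on
   the local basis at \<open>g\<close>. They depend on the coefficients \<open>a\<close>, not yet on
   y alone.\<close>
 define pr where "pr g a i = (\<Oplus>j\<in>{..<N}. a j \<otimes> C g j i)" for g a i
 have prc: "pr g a i \<in>. R" if "g \<in> D" "\<And>j. j < N ==> a j \<in>. R" "i < nn g" for g a i
  unfolding pr_def using that C(1) by (intro R.finsum_closed) auto
 have pr_sum: "(\<Oplus>.M i\<in>{..<nn g}. pr g a i \<odot>.M mm g i) = g [^] K g \<odot>.M (\<Oplus>.M j\<in>{..<N}. a j \<odot>.M x j)"
  if g: "g \<in> D" and a: "\<And>j. j < N ==> a j \<in>. R" for g a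
 proof -
  have "(\<Oplus>.M i\<in>{..<nn g}. pr g a i \<odot>.M mm g i) = (\<Oplus>.M i\<in>{..<nn g}. \<Oplus>.M j\<in>{..<N}. (a j \<otimes> C g j i) \<odot>.M mm g i)"
   unfolding pr_def using C(1)[OF g] a mmc[OF g] by (intro M.finsum_cong' finsum_smult_rdistr) (auto intro!: M.finsum_closed)
  also have "\<dots> = (\<Oplus>.M j\<in>{..<N}. \<Oplus>.M i\<in>{..<nn g}. (a j \<otimes> C g j i) \<odot>.M mm g i)"
   using C(1)[OF g] a mmc[OF g] by (intro finsum_swap M.abelian_group_axioms) auto
  also have "\<dots> = (\<Oplus>.M j\<in>{..<N}. g [^] K g \<odot>.M (a j \<odot>.M x j))"
  proof (rule M.finsum_cong')
   fix j assume "j \<in> {..<N}"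
   then have j: "j < N" by simp
   have "(\<Oplus>.M i\<in>{..<nn g}. (a j \<otimes> C g j i) \<odot>.M mm g i) = (\<Oplus>.M i\<in>{..<nn g}. a j \<odot>.M (C g j i \<odot>.M mm g i))"
    using C(1)[OF g] a mmc[OF g] j by (intro M.finsum_cong') (auto simp: smult_assoc1)
   also have "\<dots> = a j \<odot>.M (\<Oplus>.M i\<in>{..<nn g}. C g j i \<odot>.M mm g i)"
    using C(1)[OF g] a mmc[OF g] j by (intro finsum_smult_ldistr[symmetric]) auto
   also have "\<dots> = g [^] K g \<odot>.M (a j \<odot>.M x j)"
    unfolding C(2)[OF g j, symmetric] using a[OF j] xc[OF j] Dc[OF g] by (simp add: smult_assoc1[symmetric] R.m_comm)
   finally show "(\<Oplus>.M i\<in>{..<nn g}. (a j \<otimes> C g j i) \<odot>.M mm g i) = g [^] K g \<odot>.M (a j \<odot>.M x j)" .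
  qed (use a xc Dc[OF g] in auto)
  also have "\<dots> = g [^] K g \<odot>.M (\<Oplus>.M j\<in>{..<N}. a j \<odot>.M x j)"
   using a xc Dc[OF g] by (intro finsum_smult_ldistr[symmetric]) auto
  finally show ?thesis .
 qed
 \<comment> \<open>Two ways to compute the coordinates at \<open>f\<close> of
   \<open>g^(K g) x j\<close>: directly from \<open>C f j\<close>, or by expanding on the local
   basis at \<open>g\<close> first and then re-expanding each \<open>mm g h\<close> on the
   generators. \<open>T\<close> is the second, \<open>W\<close> below is the discrepancy; it is a
   relation among the \<open>mm f i\<close>.\<close>
 define T where "T g j i = (\<Oplus>h\<in>{..<nn g}. C g j h \<otimes> pr f (A (mm g h)) i)" for g j i
 define W where "W g j i = g [^] K g \<otimes> C f j i \<ominus> T g j i" for g j i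
 have Amm: "A (mm g h) l \<in>. R" if "g \<in> D" "h < nn g" "l < N" for g h l using A(1)[OF mmc[OF that(1,2)]] that by simp
 have prA: "pr f (A (mm g h)) i \<in>. R" if "g \<in> D" "h < nn g" "i < nn f" for g h i using prc[OF f Amm[OF that(1,2)] that(3)] by simp
 have Tc: "T g j i \<in>. R" if "g \<in> D" "j < N" "i < nn f" for g j i
  unfolding T_def using C(1)[OF that(1,2)] prA[OF that(1) _ that(3)] by (intro R.finsum_closed) auto
 have Wc: "W g j i \<in>. R" if "g \<in> D" "j < N" "i < nn f" for g j i unfolding W_def using that Tc C(1)[OF f] Dc by simp
 have WT: "W g j i \<oplus> T g j i = g [^] K g \<otimes> C f j i" if "g \<in> D" "j < N" "i < nn f" for g j i
  unfolding W_def using that Tc C(1)[OF f] Dc by (simp add: R.minus_eq R.a_assoc R.l_neg)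
 have Wsum: "(\<Oplus>.M i\<in>{..<nn f}. W g j i \<odot>.M mm f i) = \<zero>.M" if g: "g \<in> D" and j: "j < N" for g j
 proof -
  have Ts: "(\<Oplus>.M i\<in>{..<nn f}. T g j i \<odot>.M mm f i) = f [^] K f \<odot>.M (g [^] K g \<odot>.M x j)"
  proof -
   have "(\<Oplus>.M i\<in>{..<nn f}. T g j i \<odot>.M mm f i) =
    (\<Oplus>.M i\<in>{..<nn f}. \<Oplus>.M h\<in>{..<nn g}. (C g j h \<otimes> pr f (A (mm g h)) i) \<odot>.M mm f i)"
    unfolding T_def using C(1)[OF g j] prA[OF g] mmc[OF f] by (intro M.finsum_cong' finsum_smult_rdistr) (auto intro!: M.finsum_closed)
   also have "\<dots> = (\<Oplus>.M h\<in>{..<nn g}. \<Oplus>.M i\<in>{..<nn f}. (C g j h \<otimes> pr f (A (mm g h)) i) \<odot>.M mm f i)"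
    using C(1)[OF g j] prA[OF g] mmc[OF f] by (intro finsum_swap M.abelian_group_axioms) auto
   also have "\<dots> = (\<Oplus>.M h\<in>{..<nn g}. f [^] K f \<odot>.M (C g j h \<odot>.M mm g h))"
   proof (rule M.finsum_cong')
    fix h assume "h \<in> {..<nn g}"
    then have h: "h < nn g" by simp
    have "(\<Oplus>.M i\<in>{..<nn f}. (C g j h \<otimes> pr f (A (mm g h)) i) \<odot>.M mm f i) =
     (\<Oplus>.M i\<in>{..<nn f}. C g j h \<odot>.M (pr f (A (mm g h)) i \<odot>.M mm f i))"
     using C(1)[OF g j h] prA[OF g h] mmc[OF f] by (intro M.finsum_cong') (auto simp: smult_assoc1)
    also have "\<dots> = C g j h \<odot>.M (\<Oplus>.M i\<in>{..<nn f}. pr f (A (mm g h)) i \<odot>.M mm f i)"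
     using C(1)[OF g j h] prA[OF g h] mmc[OF f] by (intro finsum_smult_ldistr[symmetric]) auto
    also have "\<dots> = C g j h \<odot>.M (f [^] K f \<odot>.M mm g h)" using pr_sum[OF f Amm[OF g h]] A(2)[OF mmc[OF g h]] by simp
    also have "\<dots> = f [^] K f \<odot>.M (C g j h \<odot>.M mm g h)"
     using C(1)[OF g j h] fc mmc[OF g h] by (simp add: smult_assoc1[symmetric] R.m_comm)
    finally show "(\<Oplus>.M i\<in>{..<nn f}. (C g j h \<otimes> pr f (A (mm g h)) i) \<odot>.M mm f i) = f [^] K f \<odot>.M (C g j h \<odot>.M mm g h)" .
   qed (use C(1)[OF g j] mmc[OF g] fc in auto)
   also have "\<dots> = f [^] K f \<odot>.M (g [^] K g \<odot>.M x j)"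
    unfolding C(2)[OF g j] using C(1)[OF g j] mmc[OF g] fc by (intro finsum_smult_ldistr[symmetric]) auto
   finally show ?thesis .
  qed
  have "(\<Oplus>.M i\<in>{..<nn f}. W g j i \<odot>.M mm f i) \<oplus>.M (\<Oplus>.M i\<in>{..<nn f}. T g j i \<odot>.M mm f i) =
   (\<Oplus>.M i\<in>{..<nn f}. W g j i \<odot>.M mm f i \<oplus>.M T g j i \<odot>.M mm f i)"
   using Wc[OF g j] Tc[OF g j] mmc[OF f] by (intro M.finsum_addf[symmetric]) auto
  also have "\<dots> = (\<Oplus>.M i\<in>{..<nn f}. g [^] K g \<odot>.M (C f j i \<odot>.M mm f i))"
   using Wc[OF g j] Tc[OF g j] mmc[OF f] C(1)[OF f j] Dc[OF g]
   by (intro M.finsum_cong') (auto simp: smult_l_distr[symmetric] WT[OF g j] smult_assoc1)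
  also have "\<dots> = g [^] K g \<odot>.M (f [^] K f \<odot>.M x j)"
   unfolding C(2)[OF f j] using mmc[OF f] C(1)[OF f j] Dc[OF g] by (intro finsum_smult_ldistr[symmetric]) auto
  also have "\<dots> = f [^] K f \<odot>.M (g [^] K g \<odot>.M x j)" using xc[OF j] fc Dc[OF g] by (simp add: smult_assoc1[symmetric] R.m_comm)
  finally have "(\<Oplus>.M i\<in>{..<nn f}. W g j i \<odot>.M mm f i) \<oplus>.M f [^] K f \<odot>.M (g [^] K g \<odot>.M x j) =
   \<zero>.M \<oplus>.M f [^] K f \<odot>.M (g [^] K g \<odot>.M x j)" unfolding Ts using xc[OF j] fc Dc[OF g] by simp
  moreover have "(\<Oplus>.M i\<in>{..<nn f}. W g j i \<odot>.M mm f i) \<in>. M" using Wc[OF g j] mmc[OF f] by (intro M.finsum_closed) auto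
  ultimately show ?thesis using M.add.right_cancel xc[OF j] fc Dc[OF g] by simp
 qed
 \<comment> \<open>There are only finitely many discrepancies, none involving the coefficients of a
   relation, so one exponent \<open>k'\<close> serves for all of them.\<close>
 have "\<exists>k. \<forall>q\<in>D \<times> {..<N}. \<forall>i<nn f. f [^] (k::nat) \<otimes> W (fst q) (snd q) i = \<zero>"
 proof (rule finite_uniform_bound[where P = "\<lambda>q (k::nat). \<forall>i<nn f. f [^] k \<otimes> W (fst q) (snd q) i = \<zero>"])
  fix q assume "q \<in> D \<times> {..<N}"
  then have q: "fst q \<in> D" "snd q < N" by auto
  show "\<exists>k::nat. \<forall>i<nn f. f [^] k \<otimes> W (fst q) (snd q) i = \<zero>" by (rule lbz[OF f Wc[OF q] Wsum[OF q]])
 next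
  fix q and k l :: nat assume "q \<in> D \<times> {..<N}" "\<forall>i<nn f. f [^] k \<otimes> W (fst q) (snd q) i = \<zero>" "k \<le> l"
  then show "\<forall>i<nn f. f [^] l \<otimes> W (fst q) (snd q) i = \<zero>" using R.nat_pow_annihilates[OF fc Wc] by auto
 qed (use D in simp)
 then obtain k' :: nat where k'W: "\<And>g j i. g \<in> D ==> j < N ==> i < nn f ==> f [^] k' \<otimes> W g j i = \<zero>" by fastforce
 \<comment> \<open>The power of \<open>g\<close> used here depends on the relation \<open>a\<close>.
   This does no harm, because \<open>comaximal_zero\<close> asks only for some power at each
   \<open>g\<close>; the power of \<open>f\<close> must not depend on \<open>a\<close>, and does
   not.\<close>
 have uniform: "f [^] k' \<otimes> pr f a i = \<zero>"
  if a: "\<And>j. j < N ==> a j \<in>. R" and z: "(\<Oplus>.M j\<in>{..<N}. a j \<odot>.M x j) = \<zero>.M" and i: "i < nn f" for a i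
 proof (rule R.comaximal_zero[OF D])
  show "f [^] k' \<otimes> pr f a i \<in>. R" using prc[OF f a i] fc by simp
  fix g assume g: "g \<in> D"
  note gc = Dc[OF g]
  have "(\<Oplus>.M h\<in>{..<nn g}. pr g a h \<odot>.M mm g h) = \<zero>.M" using pr_sum[OF g a] z gc by simp
  then obtain l :: nat where l: "\<And>h. h < nn g ==> g [^] l \<otimes> pr g a h = \<zero>"
   using lbz[OF g, of "pr g a"] prc[OF g a] by auto
  define S where "S = (\<Oplus>h\<in>{..<nn g}. pr g a h \<otimes> pr f (A (mm g h)) i)"
  have Sc: "S \<in>. R" unfolding S_def using prc[OF g a] prA[OF g _ i] by (intro R.finsum_closed) auto
  have S_alt: "S = (\<Oplus>j\<in>{..<N}. a j \<otimes> T g j i)"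
  proof -
   have "S = (\<Oplus>h\<in>{..<nn g}. \<Oplus>j\<in>{..<N}. a j \<otimes> C g j h \<otimes> pr f (A (mm g h)) i)"
    unfolding S_def pr_def[of g] using C(1)[OF g] a prA[OF g _ i] by (intro R.finsum_cong' R.finsum_ldistr) (auto intro!: R.finsum_closed)
   also have "\<dots> = (\<Oplus>j\<in>{..<N}. \<Oplus>h\<in>{..<nn g}. a j \<otimes> C g j h \<otimes> pr f (A (mm g h)) i)"
    using C(1)[OF g] a prA[OF g _ i] by (intro finsum_swap R.abelian_group_axioms) auto
   also have "\<dots> = (\<Oplus>j\<in>{..<N}. a j \<otimes> T g j i)"
   proof (rule R.finsum_cong')
    fix j assume "j \<in> {..<N}"
    then have j: "j < N" by simp
    have "(\<Oplus>h\<in>{..<nn g}. a j \<otimes> C g j h \<otimes> pr f (A (mm g h)) i) = (\<Oplus>h\<in>{..<nn g}. a j \<otimes> (C g j h \<otimes> pr f (A (mm g h)) i))"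
     using C(1)[OF g j] a[OF j] prA[OF g _ i] by (intro R.finsum_cong') (auto simp: R.m_assoc)
    also have "\<dots> = a j \<otimes> T g j i"
     unfolding T_def using C(1)[OF g j] a[OF j] prA[OF g _ i] by (intro R.finsum_rdistr[symmetric]) auto
    finally show "(\<Oplus>h\<in>{..<nn g}. a j \<otimes> C g j h \<otimes> pr f (A (mm g h)) i) = a j \<otimes> T g j i" .
   qed (use a Tc[OF g _ i] in auto)
   finally show ?thesis .
  qed
  define V where "V = (\<Oplus>j\<in>{..<N}. a j \<otimes> W g j i)"
  have Vc: "V \<in>. R" unfolding V_def using a Wc[OF g _ i] by (intro R.finsum_closed) auto
  have "V \<oplus> S = (\<Oplus>j\<in>{..<N}. a j \<otimes> W g j i \<oplus> a j \<otimes> T g j i)"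
   unfolding V_def S_alt using a Wc[OF g _ i] Tc[OF g _ i] by (intro R.finsum_addf[symmetric]) auto
  also have "\<dots> = (\<Oplus>j\<in>{..<N}. g [^] K g \<otimes> (a j \<otimes> C f j i))"
   using a Wc[OF g _ i] Tc[OF g _ i] C(1)[OF f _ i] gc WT[OF g _ i] by (intro R.finsum_cong') (auto simp: R.r_distr[symmetric] R.m_lcomm)
  also have "\<dots> = g [^] K g \<otimes> pr f a i" unfolding pr_def using a C(1)[OF f _ i] gc by (intro R.finsum_rdistr[symmetric]) auto
  finally have VS: "g [^] K g \<otimes> pr f a i = V \<oplus> S" ..
  have V0: "f [^] k' \<otimes> V = \<zero>"
  proof -
   have "f [^] k' \<otimes> V = (\<Oplus>j\<in>{..<N}. f [^] k' \<otimes> (a j \<otimes> W g j i))"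
    unfolding V_def using a Wc[OF g _ i] fc by (intro R.finsum_rdistr) auto
   also have "\<dots> = (\<Oplus>j\<in>{..<N}. \<zero>)" using a Wc[OF g _ i] fc k'W[OF g _ i] by (intro R.finsum_cong') (auto simp: R.m_lcomm)
   finally show ?thesis by simp
  qed
  have S0: "g [^] l \<otimes> S = \<zero>"
  proof -
   have "g [^] l \<otimes> S = (\<Oplus>h\<in>{..<nn g}. g [^] l \<otimes> (pr g a h \<otimes> pr f (A (mm g h)) i))"
    unfolding S_def using prc[OF g a] prA[OF g _ i] gc by (intro R.finsum_rdistr) auto
   also have "\<dots> = (\<Oplus>h\<in>{..<nn g}. \<zero>)"
    using prc[OF g a] prA[OF g _ i] gc l by (intro R.finsum_cong') (auto simp: R.m_assoc[symmetric])
   finally show ?thesis by simp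
  qed
  have "g [^] (l + K g) \<otimes> (f [^] k' \<otimes> pr f a i) = g [^] l \<otimes> (f [^] k' \<otimes> (g [^] K g \<otimes> pr f a i))"
   using gc fc prc[OF f a i] by (simp add: R.nat_pow_mult[symmetric] R.m_ac)
  also have "\<dots> = g [^] l \<otimes> (f [^] k' \<otimes> V) \<oplus> f [^] k' \<otimes> (g [^] l \<otimes> S)"
   unfolding VS using gc fc Vc Sc by (simp add: R.r_distr R.m_lcomm)
  also have "\<dots> = \<zero>" unfolding V0 S0 using gc fc by simp
  finally show "\<exists>k::nat. g [^] k \<otimes> (f [^] k' \<otimes> pr f a i) = \<zero>" by blast
 qed
 have pr_add: "pr f (\<lambda>j. a j \<oplus> b j) i = pr f a i \<oplus> pr f b i"
  if "\<And>j. j < N ==> a j \<in>. R" "\<And>j. j < N ==> b j \<in>. R" "i < nn f" for a b i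
 proof -
  have "pr f (\<lambda>j. a j \<oplus> b j) i = (\<Oplus>j\<in>{..<N}. a j \<otimes> C f j i \<oplus> b j \<otimes> C f j i)"
   unfolding pr_def using that C(1)[OF f _ that(3)] by (intro R.finsum_cong') (auto simp: R.l_distr)
  also have "\<dots> = pr f a i \<oplus> pr f b i" unfolding pr_def using that C(1)[OF f _ that(3)] by (intro R.finsum_addf) auto
  finally show ?thesis .
 qed
 have pr_smult: "pr f (\<lambda>j. c \<otimes> a j) i = c \<otimes> pr f a i"
  if "\<And>j. j < N ==> a j \<in>. R" "c \<in>. R" "i < nn f" for a c i
 proof -
  have "pr f (\<lambda>j. c \<otimes> a j) i = (\<Oplus>j\<in>{..<N}. c \<otimes> (a j \<otimes> C f j i))"
   unfolding pr_def using that C(1)[OF f _ that(3)] by (intro R.finsum_cong') (auto simp: R.m_assoc)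
  also have "\<dots> = c \<otimes> pr f a i" unfolding pr_def using that C(1)[OF f _ that(3)] by (intro R.finsum_rdistr[symmetric]) auto
  finally show ?thesis .
 qed
 have sum_add: "(\<Oplus>.M j\<in>{..<N}. (a j \<oplus> b j) \<odot>.M x j) = (\<Oplus>.M j\<in>{..<N}. a j \<odot>.M x j) \<oplus>.M (\<Oplus>.M j\<in>{..<N}. b j \<odot>.M x j)"
  if "\<And>j. j < N ==> a j \<in>. R" "\<And>j. j < N ==> b j \<in>. R" for a b
 proof -
  have "(\<Oplus>.M j\<in>{..<N}. (a j \<oplus> b j) \<odot>.M x j) = (\<Oplus>.M j\<in>{..<N}. a j \<odot>.M x j \<oplus>.M b j \<odot>.M x j)"
   using that xc by (intro M.finsum_cong') (auto simp: smult_l_distr)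
  also have "\<dots> = (\<Oplus>.M j\<in>{..<N}. a j \<odot>.M x j) \<oplus>.M (\<Oplus>.M j\<in>{..<N}. b j \<odot>.M x j)"
   using that xc by (intro M.finsum_addf) auto
  finally show ?thesis .
 qed
 have sum_smult: "(\<Oplus>.M j\<in>{..<N}. (c \<otimes> a j) \<odot>.M x j) = c \<odot>.M (\<Oplus>.M j\<in>{..<N}. a j \<odot>.M x j)"
  if "\<And>j. j < N ==> a j \<in>. R" "c \<in>. R" for a c
 proof -
  have "(\<Oplus>.M j\<in>{..<N}. (c \<otimes> a j) \<odot>.M x j) = (\<Oplus>.M j\<in>{..<N}. c \<odot>.M (a j \<odot>.M x j))"
   using that xc by (intro M.finsum_cong') (auto simp: smult_assoc1)
  also have "\<dots> = c \<odot>.M (\<Oplus>.M j\<in>{..<N}. a j \<odot>.M x j)" using that xc by (intro finsum_smult_ldistr[symmetric]) auto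
  finally show ?thesis .
 qed
 \<comment> \<open>The coefficients \<open>A y\<close> were chosen arbitrarily; after multiplication
   by \<open>f^k'\<close> the choice no longer matters, and linearity in \<open>y\<close>
   follows.\<close>
 define mv where "mv i y = f [^] k' \<otimes> pr f (A y) i" for i y
 have mv_eq: "mv i y = f [^] k' \<otimes> pr f a i"
  if y: "y \<in>. M" and a: "\<And>j. j < N ==> a j \<in>. R" "y = (\<Oplus>.M j\<in>{..<N}. a j \<odot>.M x j)" and i: "i < nn f" for i y a
 proof -
  let ?d = "\<lambda>j. A y j \<oplus> (\<ominus> \<one>) \<otimes> a j"
  have Ay: "\<And>j. j < N ==> A y j \<in>. R" using A(1)[OF y] .
  have "(\<Oplus>.M j\<in>{..<N}. ?d j \<odot>.M x j) =
   (\<Oplus>.M j\<in>{..<N}. A y j \<odot>.M x j) \<oplus>.M (\<ominus> \<one>) \<odot>.M (\<Oplus>.M j\<in>{..<N}. a j \<odot>.M x j)"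
   using Ay a(1) by (simp add: sum_add sum_smult)
  also have "\<dots> = y \<oplus>.M (\<ominus> \<one>) \<odot>.M y" unfolding A(2)[OF y, symmetric] a(2)[symmetric] ..
  finally have "f [^] k' \<otimes> pr f ?d i = \<zero>" using Ay a(1) y i by (intro uniform) (simp_all add: smult_l_minus M.r_neg)
  moreover have "pr f ?d i = pr f (A y) i \<oplus> (\<ominus> \<one>) \<otimes> pr f a i" using Ay a(1) i by (subst pr_add) (simp_all add: pr_smult)
  ultimately have "mv i y \<ominus> f [^] k' \<otimes> pr f a i = \<zero>"
   using prc[OF f Ay i] prc[OF f a(1) i] fc by (simp add: mv_def R.r_distr R.minus_eq R.l_minus R.r_minus)
  then show ?thesis using prc[OF f Ay i] prc[OF f a(1) i] fc by (simp add: mv_def)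
 qed
 have "mv i \<in> functionals R M" if i: "i < nn f" for i
 proof (rule functionalsI)
  fix y assume y: "y \<in>. M"
  note Ay = A(1)[OF y]
  show "mv i y \<in>. R" using prc[OF f Ay i] fc by (simp add: mv_def)
  show "mv i (b \<odot>.M y) = b \<otimes> mv i y" if b: "b \<in>. R" for b
  proof -
   have "mv i (b \<odot>.M y) = f [^] k' \<otimes> pr f (\<lambda>j. b \<otimes> A y j) i"
    by (rule mv_eq) (use b Ay y i A(2)[OF y] in \<open>simp_all add: sum_smult\<close>)
   then show ?thesis using b Ay i prc[OF f Ay i] fc by (simp add: pr_smult mv_def R.m_lcomm)
  qed
  fix y' assume y': "y' \<in>. M"
  note Ay' = A(1)[OF y']
  have "mv i (y \<oplus>.M y') = f [^] k' \<otimes> pr f (\<lambda>j. A y j \<oplus> A y' j) i"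
   by (rule mv_eq) (use Ay Ay' y y' i A(2)[OF y] A(2)[OF y'] in \<open>simp_all add: sum_add\<close>)
  then show "mv i (y \<oplus>.M y') = mv i y \<oplus> mv i y'"
   using Ay Ay' i prc[OF f Ay i] prc[OF f Ay' i] fc by (simp add: pr_add mv_def R.r_distr)
 qed
 moreover have "f [^] (k' + K f) \<odot>.M y = (\<Oplus>.M i\<in>{..<nn f}. mv i y \<odot>.M mm f i)" if y: "y \<in>. M" for y
 proof -
  note Ay = A(1)[OF y]
  have "f [^] (k' + K f) \<odot>.M y = f [^] k' \<odot>.M (\<Oplus>.M i\<in>{..<nn f}. pr f (A y) i \<odot>.M mm f i)"
   using pr_sum[OF f, of "A y"] Ay A(2)[OF y, symmetric] y fc by (simp add: R.nat_pow_mult[symmetric] smult_assoc1)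
  also have "\<dots> = (\<Oplus>.M i\<in>{..<nn f}. f [^] k' \<odot>.M (pr f (A y) i \<odot>.M mm f i))"
   using prc[OF f Ay] mmc[OF f] fc by (intro finsum_smult_ldistr) auto
  also have "\<dots> = (\<Oplus>.M i\<in>{..<nn f}. mv i y \<odot>.M mm f i)"
   using prc[OF f Ay] mmc[OF f] fc by (intro M.finsum_cong') (auto simp: mv_def smult_assoc1)
  finally show ?thesis .
 qed
 ultimately show ?thesis by (intro exI[of _ "k' + K f"] exI[of _ mv]) auto
qed

lemma functionals_smult: "h \<in> functionals R M ==> c \<in>. R ==> (\<lambda>y. c \<otimes> h y) \<in> functionals R M"
 by (rule functionalsI) (auto simp: functionals_simps R.r_distr R.m_lcomm)

text \<open>The scalars \<open>b\<close> for which multiplication by \<open>b\<close> on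
  \<open>M\<close> factors through a finite free module form an ideal, since two factorizations add
  up by concatenating their families. It contains a power of each \<open>f\<close> of the cover,
  hence 1.\<close>

theorem finite_locally_free_dual_basis:
 assumes "finite_locally_free R M"
 shows "\<exists>n e ep. dual_basis R M n e ep"
proof -
 obtain D where D: "finite D" "D \<subseteq> carrier R" "genideal R D = carrier R"
  and lb: "\<forall>f\<in>D. \<exists>n m. local_basis R M f n m" using assms finite_locally_free_iff[OF module_axioms] by blast
 have "\<forall>f\<in>D. \<exists>p. local_basis R M f (fst p) (snd p)" using lb by fastforce
 from bchoice[OF this] obtain p where p: "\<And>f. f \<in> D ==> local_basis R M f (fst (p f)) (snd (p f))" by blast
 define Q where "Q = {b \<in> carrier R. \<exists>(n::nat) e ep. (\<forall>i<n. e i \<in>. M) \<and> (\<forall>i<n. ep i \<in> functionals R M) \<and>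
  (\<forall>y\<in>carrier M. b \<odot>.M y = (\<Oplus>.M i\<in>{..<n}. ep i y \<odot>.M e i))}"
 have "ideal Q R"
 proof (rule R.ideal_of_closed)
  show "\<zero> \<in> Q" unfolding Q_def by (intro CollectI conjI exI[of _ "0::nat"]) auto
  fix a b assume "a \<in> Q" "b \<in> Q"
  then obtain n e ep m d de where a: "a \<in>. R" "\<And>i. i < n ==> e i \<in>. M" "\<And>i. i < n ==> ep i \<in> functionals R M"
   "\<And>y. y \<in>. M ==> a \<odot>.M y = (\<Oplus>.M i\<in>{..<n::nat}. ep i y \<odot>.M e i)"
   and b: "b \<in>. R" "\<And>i. i < m ==> d i \<in>. M" "\<And>i. i < m ==> de i \<in> functionals R M"
   "\<And>y. y \<in>. M ==> b \<odot>.M y = (\<Oplus>.M i\<in>{..<m::nat}. de i y \<odot>.M d i)" unfolding Q_def by fastforce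
  define e' where "e' i = (if i < n then e i else d (i - n))" for i
  define ep' where "ep' i = (if i < n then ep i else de (i - n))" for i
  have c: "e' i \<in>. M" "ep' i \<in> functionals R M" if "i < n + m" for i
   using a(2,3)[of i] b(2,3)[of "i - n"] that by (auto simp: e'_def ep'_def)
  have "(a \<oplus> b) \<odot>.M y = (\<Oplus>.M i\<in>{..<n + m}. ep' i y \<odot>.M e' i)" if y: "y \<in>. M" for y
  proof -
   have "(\<Oplus>.M i\<in>{..<n + m}. ep' i y \<odot>.M e' i) =
    (\<Oplus>.M i\<in>{..<n}. ep' i y \<odot>.M e' i) \<oplus>.M (\<Oplus>.M i\<in>{..<m}. ep' (n + i) y \<odot>.M e' (n + i))"
    by (rule M.finsum_lessThan_add) (use c(1) functionals_simps(1)[OF c(2)] y in auto)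
   also have "(\<Oplus>.M i\<in>{..<n}. ep' i y \<odot>.M e' i) = (\<Oplus>.M i\<in>{..<n}. ep i y \<odot>.M e i)"
    using a(2) functionals_simps(1)[OF a(3)] y by (intro M.finsum_cong') (auto simp: e'_def ep'_def)
   also have "(\<Oplus>.M i\<in>{..<m}. ep' (n + i) y \<odot>.M e' (n + i)) = (\<Oplus>.M i\<in>{..<m}. de i y \<odot>.M d i)"
    using b(2) functionals_simps(1)[OF b(3)] y by (intro M.finsum_cong') (auto simp: e'_def ep'_def)
   finally show ?thesis using a(1,4) b(1,4) y by (simp add: smult_l_distr)
  qed
  then show "a \<oplus> b \<in> Q" unfolding Q_def using a(1) b(1) c by (intro CollectI conjI exI[of _ "n + m"] exI[of _ e'] exI[of _ ep']) auto
 next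
  fix c b assume c: "c \<in>. R" and "b \<in> Q"
  then obtain m d de where b: "b \<in>. R" "\<And>i. i < m ==> d i \<in>. M" "\<And>i. i < m ==> de i \<in> functionals R M"
   "\<And>y. y \<in>. M ==> b \<odot>.M y = (\<Oplus>.M i\<in>{..<m::nat}. de i y \<odot>.M d i)" unfolding Q_def by fastforce
  have "(c \<otimes> b) \<odot>.M y = (\<Oplus>.M i\<in>{..<m}. (c \<otimes> de i y) \<odot>.M d i)" if y: "y \<in>. M" for y
  proof -
   have "(c \<otimes> b) \<odot>.M y = c \<odot>.M (\<Oplus>.M i\<in>{..<m}. de i y \<odot>.M d i)" using b y c by (simp add: smult_assoc1)
   also have "\<dots> = (\<Oplus>.M i\<in>{..<m}. c \<odot>.M (de i y \<odot>.M d i))"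
    using b(2) functionals_simps(1)[OF b(3)] y c by (intro finsum_smult_ldistr) auto
   also have "\<dots> = (\<Oplus>.M i\<in>{..<m}. (c \<otimes> de i y) \<odot>.M d i)"
    using b(2) functionals_simps(1)[OF b(3)] y c by (intro M.finsum_cong') (auto simp: smult_assoc1)
   finally show ?thesis .
  qed
  then show "c \<otimes> b \<in> Q"
   unfolding Q_def using b c by (intro CollectI conjI exI[of _ m] exI[of _ d] exI[of _ "\<lambda>i y. c \<otimes> de i y"]) (auto intro: functionals_smult)
 qed (simp add: Q_def)
 moreover have "\<exists>k::nat. f [^] k \<in> Q" if f: "f \<in> D" for f
 proof -
  from local_functionals[OF D p f] obtain k :: nat and mv where
   "mv \<in> {..<fst (p f)} \<rightarrow> functionals R M" "\<forall>y\<in>carrier M. f [^] k \<odot>.M y = (\<Oplus>.M i\<in>{..<fst (p f)}. mv i y \<odot>.M snd (p f) i)" by blast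
  moreover have "snd (p f) \<in> {..<fst (p f)} \<rightarrow> carrier M" using p[OF f] by (simp add: local_basis_def)
  ultimately have "f [^] k \<in> Q"
   unfolding Q_def using D f by (intro CollectI conjI exI[of _ "fst (p f)"] exI[of _ "snd (p f)"] exI[of _ mv]) auto
  then show ?thesis by blast
 qed
 ultimately have "\<one> \<in> Q" by (rule R.comaximal_powers[OF D])
 then obtain n :: nat and e ep where "\<forall>i<n. e i \<in>. M" "\<forall>i<n. ep i \<in> functionals R M"
  "\<forall>y\<in>carrier M. \<one> \<odot>.M y = (\<Oplus>.M i\<in>{..<n}. ep i y \<odot>.M e i)" unfolding Q_def by blast
 then have "dual_basis R M n e ep" unfolding dual_basis_def by simp
 then show ?thesis by blast
qed

end

section \<open>Extension of scalars\<close>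

text \<open>
 The locale records what is used of a module \<open>E\<close> of the form \<open>D \<otimes>\<^sub>C M\<close>, so that it applies to any
 record carrying this module.
\<close>

locale scalar_ext =
 fixes C :: "('c, 'x) ring_scheme" and ph :: "'c \<Rightarrow> 'd" and D :: "('d, 'y) ring_scheme"
  and M :: "('c, 'm, 'z) module_scheme" and E :: "('d, 'e, 'w) module_scheme"
  and pt :: "'d \<Rightarrow> 'm \<Rightarrow> 'e"
 assumes M: "module C M" and D: "cring D" and ph: "ph \<in> ring_hom C D" and E: "module D E"
  and pt_closed [simp, intro]: "d \<in>. D ==> m \<in>. M ==> pt d m \<in>. E"
  and pt_add_right: "d \<in>. D ==> m \<in>. M ==> m' \<in>. M ==>
   pt d (m \<oplus>.M m') = pt d m \<oplus>.E pt d m'"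
  and pt_smult: "d \<in>. D ==> d' \<in>. D ==> m \<in>. M ==>
   d \<odot>.E pt d' m = pt (d \<otimes>.D d') m"
  and pt_bal: "c \<in>. C ==> m \<in>. M ==> pt \<one>.D (c \<odot>.M m) = pt (ph c) m"
  and pt_induct [consumes 1, case_names pure add]: "\<And>X P. X \<in>. E ==>
   (\<And>d m. d \<in>. D ==> m \<in>. M ==> P (pt d m)) ==>
   (\<And>X Y. X \<in>. E ==> Y \<in>. E ==> P X ==> P Y ==> P (X \<oplus>.E Y)) ==> P X"
  and functional_ext: "mv \<in> functionals C M ==>
   \<exists>\<nu>\<in>functionals D E. \<forall>d\<in>carrier D. \<forall>m\<in>carrier M. \<nu> (pt d m) = d \<otimes>.D ph (mv m)"
begin

sublocale M: module C M by (rule M)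
sublocale E: module D E by (rule E)
sublocale ph: ring_hom_ring C D ph by (simp add: ring_hom_ring_def ring_hom_ring_axioms_def M.R.ring_axioms E.R.ring_axioms ph)

lemma pt_unit: "d \<in>. D ==> m \<in>. M ==> pt d m = d \<odot>.E pt \<one>.D m" by (simp add: pt_smult)

lemma unit_smult: "c \<in>. C ==> m \<in>. M ==> pt \<one>.D (c \<odot>.M m) = ph c \<odot>.E pt \<one>.D m"
 by (simp add: pt_bal pt_smult)

lemma pt_bal': "d \<in>. D ==> c \<in>. C ==> m \<in>. M ==> pt d (c \<odot>.M m) = pt (d \<otimes>.D ph c) m"
 using pt_unit[of d "c \<odot>.M m"] by (simp add: pt_bal pt_smult)

lemma pt_ahom: "d \<in>. D ==> pt d \<in> ahom M E" by (rule ahomI) (auto simp: pt_add_right)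

lemmas pt_finsum = ahom_finsum[OF M.M.abelian_group_axioms E.M.abelian_group_axioms pt_ahom]
lemmas pt_zero = ahom_zero[OF M.M.abelian_group_axioms E.M.abelian_group_axioms pt_ahom]

text \<open>The extension of a functional by scalars. The locale asserts only its existence, hence
  the choice.\<close>

definition hat :: "('m \<Rightarrow> 'c) \<Rightarrow> 'e \<Rightarrow> 'd" where
 "hat mv = (SOME \<nu>. \<nu> \<in> functionals D E \<and> (\<forall>d\<in>carrier D. \<forall>m\<in>carrier M. \<nu> (pt d m) = d \<otimes>.D ph (mv m)))"

lemma hat:
 assumes "mv \<in> functionals C M"
 shows hat_functional: "hat mv \<in> functionals D E"
  and hat_pt: "d \<in>. D ==> m \<in>. M ==> hat mv (pt d m) = d \<otimes>.D ph (mv m)"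
proof -
 have "\<exists>\<nu>. \<nu> \<in> functionals D E \<and> (\<forall>d\<in>carrier D. \<forall>m\<in>carrier M. \<nu> (pt d m) = d \<otimes>.D ph (mv m))"
  using functional_ext[OF assms] by blast
 from someI_ex[OF this] show "hat mv \<in> functionals D E"
  "d \<in>. D ==> m \<in>. M ==> hat mv (pt d m) = d \<otimes>.D ph (mv m)" unfolding hat_def by blast+
qed

text \<open>The factor \<open>b\<close> lets one lemma serve dual bases, with \<open>b = 1\<close>,
  and local bases, with \<open>b\<close> a power of \<open>f\<close>.\<close>

lemma hat_expand:
 assumes b: "b \<in>. C" and m: "\<And>i. i < n ==> m i \<in>. M" and mv: "\<And>i. i < n ==> mv i \<in> functionals C M"
  and eq: "\<And>y. y \<in>. M ==> b \<odot>.M y = (\<Oplus>.M i\<in>{..<n::nat}. mv i y \<odot>.M m i)"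
  and X: "X \<in>. E"
 shows "ph b \<odot>.E X = (\<Oplus>.E i\<in>{..<n}. hat (mv i) X \<odot>.E pt \<one>.D (m i))"
proof -
 have mvc: "i < n ==> y \<in>. M ==> mv i y \<in>. C" for i y by (rule functionals_simps(1)[OF mv])
 have hc: "i < n ==> Y \<in>. E ==> hat (mv i) Y \<in>. D" for i Y
  by (rule functionals_simps(1)[OF hat_functional[OF mv]])
 show ?thesis using X
 proof (induction rule: pt_induct)
  case (pure d y)
  have "ph b \<odot>.E pt d y = pt d (b \<odot>.M y)" using pure b by (simp add: pt_smult pt_bal' E.R.m_comm)
  also have "\<dots> = (\<Oplus>.E i\<in>{..<n}. pt d (mv i y \<odot>.M m i))" unfolding eq[OF pure(2)] using pure m mvc by (intro pt_finsum) auto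
  also have "\<dots> = (\<Oplus>.E i\<in>{..<n}. hat (mv i) (pt d y) \<odot>.E pt \<one>.D (m i))"
   using pure m mvc hat_pt[OF mv] by (intro E.M.finsum_cong') (auto simp: pt_bal' pt_smult)
  finally show ?case .
 next
  case (add X Y)
  have "(\<Oplus>.E i\<in>{..<n}. hat (mv i) (X \<oplus>.E Y) \<odot>.E pt \<one>.D (m i)) =
   (\<Oplus>.E i\<in>{..<n}. hat (mv i) X \<odot>.E pt \<one>.D (m i) \<oplus>.E hat (mv i) Y \<odot>.E pt \<one>.D (m i))"
   using add(1,2) m hc functionals_simps(2)[OF hat_functional[OF mv]] by (intro E.M.finsum_cong') (auto simp: E.smult_l_distr)
  also have "\<dots> = (\<Oplus>.E i\<in>{..<n}. hat (mv i) X \<odot>.E pt \<one>.D (m i)) \<oplus>.E (\<Oplus>.E i\<in>{..<n}. hat (mv i) Y \<odot>.E pt \<one>.D (m i))"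
   using add(1,2) m hc by (intro E.M.finsum_addf) auto
  finally show ?case using add b by (simp add: E.smult_r_distr)
 qed
qed

lemma dual_basis_ext:
 assumes "dual_basis C M n e ep"
 shows "dual_basis D E n (\<lambda>i. pt \<one>.D (e i)) (\<lambda>i. hat (ep i))" unfolding dual_basis_def
proof (intro conjI ballI)
 have e: "\<And>i. i < n ==> e i \<in>. M" "\<And>i. i < n ==> ep i \<in> functionals C M"
  using assms by (auto simp: dual_basis_def)
 then show "(\<lambda>i. pt \<one>.D (e i)) \<in> {..<n} \<rightarrow> carrier E" "(\<lambda>i. hat (ep i)) \<in> {..<n} \<rightarrow> functionals D E"
  using hat_functional by auto
 fix X assume X: "X \<in>. E"
 have "ph \<one>.C \<odot>.E X = (\<Oplus>.E i\<in>{..<n}. hat (ep i) X \<odot>.E pt \<one>.D (e i))"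
  using assms by (intro hat_expand[OF _ e _ X]) (auto simp: dual_basis_def)
 then show "X = (\<Oplus>.E i\<in>{..<n}. hat (ep i) X \<odot>.E pt \<one>.D (e i))" using X by simp
qed

text \<open>The functionals of a dual basis separate the points of \<open>M\<close>, and their
  extensions take the value \<open>ph (ep i m)\<close> on the image of \<open>m\<close>. This gives
  uniqueness of descended morphisms.\<close>

lemma unit_inj:
 assumes db: "dual_basis C M n e ep" and inj: "inj_on ph (carrier C)"
  and m: "m \<in>. M" "m' \<in>. M" and eq: "pt \<one>.D m = pt \<one>.D m'"
 shows "m = m'"
proof -
 have e: "\<And>i. i < n ==> e i \<in>. M" "\<And>i. i < n ==> ep i \<in> functionals C M"
  "\<And>y. y \<in>. M ==> y = (\<Oplus>.M i\<in>{..<n}. ep i y \<odot>.M e i)" using db by (auto simp: dual_basis_def)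
 have "ep i m = ep i m'" if "i < n" for i
 proof -
  have "hat (ep i) (pt \<one>.D m) = hat (ep i) (pt \<one>.D m')" by (simp add: eq)
  then show ?thesis using m hat_pt[OF e(2)[OF that]] functionals_simps(1)[OF e(2)[OF that]] inj by (simp add: inj_on_eq_iff)
 qed
 then have "(\<Oplus>.M i\<in>{..<n}. ep i m \<odot>.M e i) = (\<Oplus>.M i\<in>{..<n}. ep i m' \<odot>.M e i)"
  using e(1) functionals_simps(1)[OF e(2)] m by (intro M.M.finsum_cong') auto
 then show ?thesis using e(3)[OF m(1)] e(3)[OF m(2)] by simp
qed

end

context module
begin

text \<open>
 Over a module with a dual basis, a local basis is the same as an approximate inverse pair of
 families of elements and functionals; this form is visibly stable under extension of scalars.
\<close>

lemma local_basis_functionals: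
 assumes db: "dual_basis R M N e ep" and lb: "local_basis R M f n m" and f: "f \<in>. R"
 shows "\<exists>(k::nat) mv. (\<forall>i<n. mv i \<in> functionals R M) \<and>
  (\<forall>y\<in>carrier M. f [^] k \<odot>.M y = (\<Oplus>.M i\<in>{..<n}. mv i y \<odot>.M m i)) \<and>
  (\<forall>i<n. \<forall>j<n. mv i (m j) = (if i = j then f [^] k else \<zero>))"
proof -
 have mc: "i < n ==> m i \<in>. M" for i using lb by (auto simp: local_basis_def)
 have e: "\<And>i. i < N ==> e i \<in>. M" "\<And>i. i < N ==> ep i \<in> functionals R M"
  "\<And>y. y \<in>. M ==> y = (\<Oplus>.M i\<in>{..<N}. ep i y \<odot>.M e i)" using db by (auto simp: dual_basis_def)
 note ep = functionals_simps[OF e(2)]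
 have lb3: "\<exists>k::nat. \<forall>i<n. f [^] k \<otimes> c i = \<zero>"
  if "c \<in> {..<n} \<rightarrow> carrier R" "(\<Oplus>.M i\<in>{..<n}. c i \<odot>.M m i) = \<zero>.M" for c
  using lb that unfolding local_basis_def by simp
 let ?P = "\<lambda>j (k::nat). \<exists>c. (\<forall>i<n. c i \<in>. R) \<and> f [^] k \<odot>.M e j = (\<Oplus>.M i\<in>{..<n}. c i \<odot>.M m i)"
 have "\<exists>k. \<forall>j\<in>{..<N}. ?P j k"
 proof (rule finite_uniform_bound[where P = ?P])
  fix j assume "j \<in> {..<N}"
  then obtain k :: nat and c where "c \<in> {..<n} \<rightarrow> carrier R" "f [^] k \<odot>.M e j = (\<Oplus>.M i\<in>{..<n}. c i \<odot>.M m i)"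
   using lb e(1)[of j] unfolding local_basis_def by blast
  then show "\<exists>k. ?P j k" by (intro exI[of _ k] exI[of _ c]) auto
 next
  fix j k l assume j: "j \<in> {..<N}" and "?P j k" and kl: "k \<le> l"
  then obtain c where c: "\<And>i. i < n ==> c i \<in>. R" "f [^] k \<odot>.M e j = (\<Oplus>.M i\<in>{..<n}. c i \<odot>.M m i)" by blast
  have "f [^] l \<odot>.M e j = f [^] (l - k) \<odot>.M (f [^] k \<odot>.M e j)"
   using kl e(1)[of j] j f by (simp add: R.nat_pow_split[of f k l] smult_assoc1)
  also have "\<dots> = (\<Oplus>.M i\<in>{..<n}. f [^] (l - k) \<odot>.M (c i \<odot>.M m i))"
   unfolding c(2) using c(1) mc f by (intro finsum_smult_ldistr) auto
  also have "\<dots> = (\<Oplus>.M i\<in>{..<n}. (f [^] (l - k) \<otimes> c i) \<odot>.M m i)"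
   using c(1) mc f by (intro M.finsum_cong') (auto simp: smult_assoc1)
  finally show "?P j l" using c(1) f by (intro exI[of _ "\<lambda>i. f [^] (l - k) \<otimes> c i"]) auto
 qed simp
 then obtain k where "\<forall>j\<in>{..<N}. ?P j k" by blast
 from bchoice[OF this] obtain c where "\<forall>j\<in>{..<N}. (\<forall>i<n. c j i \<in>. R) \<and> f [^] k \<odot>.M e j = (\<Oplus>.M i\<in>{..<n}. c j i \<odot>.M m i)"
  by (elim exE)
 then have c: "\<And>j i. j < N ==> i < n ==> c j i \<in>. R"
  "\<And>j. j < N ==> f [^] k \<odot>.M e j = (\<Oplus>.M i\<in>{..<n}. c j i \<odot>.M m i)" by simp_all
 \<comment> \<open>Only the finitely many \<open>e j\<close> are expanded on the local basis;
   \<open>y\<close> enters through the linear \<open>ep j\<close>, so \<open>mv i\<close> is linear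
   from the start.\<close>
 define mv where "mv i y = (\<Oplus>j\<in>{..<N}. ep j y \<otimes> c j i)" for i y
 have mv: "mv i \<in> functionals R M" if i: "i < n" for i
 proof (rule functionalsI)
  fix y assume y: "y \<in>. M"
  show "mv i y \<in>. R" unfolding mv_def using ep(1) y c(1) i by (intro R.finsum_closed) auto
  show "mv i (b \<odot>.M y) = b \<otimes> mv i y" if b: "b \<in>. R" for b
  proof -
   have "mv i (b \<odot>.M y) = (\<Oplus>j\<in>{..<N}. b \<otimes> (ep j y \<otimes> c j i))"
    unfolding mv_def using ep(1,3) y c(1) i b by (intro R.finsum_cong') (auto simp: R.m_assoc)
   also have "\<dots> = b \<otimes> mv i y" unfolding mv_def using ep(1) y c(1) i b by (intro R.finsum_rdistr[symmetric]) auto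
   finally show ?thesis .
  qed
  fix y' assume y': "y' \<in>. M"
  have "mv i (y \<oplus>.M y') = (\<Oplus>j\<in>{..<N}. ep j y \<otimes> c j i \<oplus> ep j y' \<otimes> c j i)"
   unfolding mv_def using ep(1,2) y y' c(1) i by (intro R.finsum_cong') (auto simp: R.l_distr)
  also have "\<dots> = mv i y \<oplus> mv i y'" unfolding mv_def using ep(1) y y' c(1) i by (intro R.finsum_addf) auto
  finally show "mv i (y \<oplus>.M y') = mv i y \<oplus> mv i y'" .
 qed
 note mvs = functionals_simps[OF mv]
 have mv_sum: "f [^] k \<odot>.M y = (\<Oplus>.M i\<in>{..<n}. mv i y \<odot>.M m i)" if y: "y \<in>. M" for y
 proof -
  have "f [^] k \<odot>.M y = f [^] k \<odot>.M (\<Oplus>.M j\<in>{..<N}. ep j y \<odot>.M e j)" using e(3)[OF y] by simp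
  also have "\<dots> = (\<Oplus>.M j\<in>{..<N}. f [^] k \<odot>.M (ep j y \<odot>.M e j))" using ep(1) y e(1) f by (intro finsum_smult_ldistr) auto
  also have "\<dots> = (\<Oplus>.M j\<in>{..<N}. \<Oplus>.M i\<in>{..<n}. (ep j y \<otimes> c j i) \<odot>.M m i)"
  proof (rule M.finsum_cong')
   fix j assume "j \<in> {..<N}"
   then have j: "j < N" by simp
   have "f [^] k \<odot>.M (ep j y \<odot>.M e j) = ep j y \<odot>.M (f [^] k \<odot>.M e j)"
    using ep(1)[OF j y] e(1)[OF j] f by (simp add: smult_assoc1[symmetric] R.m_comm)
   also have "\<dots> = (\<Oplus>.M i\<in>{..<n}. ep j y \<odot>.M (c j i \<odot>.M m i))"
    unfolding c(2)[OF j] using ep(1)[OF j y] c(1)[OF j] mc by (intro finsum_smult_ldistr) auto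
   also have "\<dots> = (\<Oplus>.M i\<in>{..<n}. (ep j y \<otimes> c j i) \<odot>.M m i)"
    using ep(1)[OF j y] c(1)[OF j] mc by (intro M.finsum_cong') (auto simp: smult_assoc1)
   finally show "f [^] k \<odot>.M (ep j y \<odot>.M e j) = (\<Oplus>.M i\<in>{..<n}. (ep j y \<otimes> c j i) \<odot>.M m i)" .
  qed (use ep(1) y c(1) mc in \<open>auto intro!: M.finsum_closed\<close>)
  also have "\<dots> = (\<Oplus>.M i\<in>{..<n}. \<Oplus>.M j\<in>{..<N}. (ep j y \<otimes> c j i) \<odot>.M m i)"
   using ep(1) y c(1) mc by (intro finsum_swap M.abelian_group_axioms) auto
  also have "\<dots> = (\<Oplus>.M i\<in>{..<n}. mv i y \<odot>.M m i)" unfolding mv_def using ep(1) y c(1) mc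
   by (intro M.finsum_cong' finsum_smult_rdistr[symmetric]) (auto intro!: R.finsum_closed)
  finally show ?thesis .
 qed
 \<comment> \<open>Orthogonality of \<open>mv\<close> and \<open>m\<close> holds only up to elements
   killed by powers of \<open>f\<close>: for each \<open>j\<close> the differences are coefficients
   of a relation among the \<open>m i\<close>. A further factor \<open>f^l\<close> makes it
   exact.\<close>
 let ?de = "\<lambda>i j. if i = j then f [^] k else \<zero>"
 let ?Q = "\<lambda>j (l::nat). \<forall>i<n. f [^] l \<otimes> (mv i (m j) \<ominus> ?de i j) = \<zero>"
 have dec: "?de i j \<in>. R" for i j using f by simp
 have clij: "mv i (m j) \<ominus> ?de i j \<in>. R" if "i < n" "j < n" for i j by (rule R.minus_closed[OF mvs(1)[OF that(1) mc[OF that(2)]] dec])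
 have "\<exists>l. \<forall>j\<in>{..<n}. ?Q j l"
 proof (rule finite_uniform_bound[where P = ?Q])
  fix j assume "j \<in> {..<n}"
  then have j: "j < n" by simp
  have cl: "\<And>i. i < n ==> mv i (m j) \<ominus> ?de i j \<in>. R" using mvs(1) mc[OF j] f by auto
  have "(\<Oplus>.M i\<in>{..<n}. (mv i (m j) \<ominus> ?de i j) \<odot>.M m i) \<oplus>.M (\<Oplus>.M i\<in>{..<n}. ?de i j \<odot>.M m i)
   = (\<Oplus>.M i\<in>{..<n}. (mv i (m j) \<ominus> ?de i j) \<odot>.M m i \<oplus>.M ?de i j \<odot>.M m i)"
   using cl mc f by (intro M.finsum_addf[symmetric]) auto
  also have "\<dots> = (\<Oplus>.M i\<in>{..<n}. mv i (m j) \<odot>.M m i)" using mvs(1) mc[OF j] mc f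
   by (intro M.finsum_cong') (auto simp: smult_l_distr[symmetric] R.minus_eq R.a_assoc R.l_neg)
  also have "\<dots> = f [^] k \<odot>.M m j" by (rule mv_sum[OF mc[OF j], symmetric])
  also have "(\<Oplus>.M i\<in>{..<n}. ?de i j \<odot>.M m i) = (\<Oplus>.M i\<in>{..<n}. if j = i then f [^] k \<odot>.M m i else \<zero>.M)"
   using mc f by (intro M.finsum_cong') auto
  also have "\<dots> = f [^] k \<odot>.M m j" using j mc f by (intro M.finsum_singleton) auto
  finally have "(\<Oplus>.M i\<in>{..<n}. (mv i (m j) \<ominus> ?de i j) \<odot>.M m i) \<oplus>.M f [^] k \<odot>.M m j = \<zero>.M \<oplus>.M f [^] k \<odot>.M m j"
   using mc[OF j] f by simp
  moreover have "(\<Oplus>.M i\<in>{..<n}. (mv i (m j) \<ominus> ?de i j) \<odot>.M m i) \<in>. M" using cl mc by (intro M.finsum_closed) auto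
  ultimately have s0: "(\<Oplus>.M i\<in>{..<n}. (mv i (m j) \<ominus> ?de i j) \<odot>.M m i) = \<zero>.M"
   using M.add.right_cancel mc[OF j] f by simp
  have pi0: "(\<lambda>i. mv i (m j) \<ominus> ?de i j) \<in> {..<n} \<rightarrow> carrier R" using cl by blast
  show "\<exists>l. ?Q j l" using lb3[of "\<lambda>i. mv i (m j) \<ominus> ?de i j", OF pi0 s0] .
 next
  fix j k' l assume "j \<in> {..<n}" "?Q j k'" "k' \<le> l"
  note Q = this
  show "?Q j l"
  proof (intro allI impI)
   fix i assume "i < n"
   then show "f [^] l \<otimes> (mv i (m j) \<ominus> ?de i j) = \<zero>" using Q by (intro R.nat_pow_annihilates[OF f clij _ Q(3)]) blast+
  qed
 qed simp
 then obtain l where "\<forall>j\<in>{..<n}. ?Q j l" by (elim exE)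
 then have l: "f [^] l \<otimes> (mv i (m j) \<ominus> ?de i j) = \<zero>" if "i < n" "j < n" for i j using that by blast
 have "f [^] l \<otimes> mv i (m j) = (if i = j then f [^] (l + k) else \<zero>)" if "i < n" "j < n" for i j
 proof -
  have "f [^] l \<otimes> mv i (m j) \<ominus> f [^] l \<otimes> ?de i j = \<zero>" using l[OF that] mvs(1)[OF that(1) mc[OF that(2)]] dec[of i j] f
   by (simp add: R.minus_eq R.r_distr R.r_minus del: if_split)
  then have "f [^] l \<otimes> mv i (m j) = f [^] l \<otimes> ?de i j"
   using mvs(1)[OF that(1) mc[OF that(2)]] dec[of i j] f by (subst (asm) R.r_right_minus_eq) auto
  then show ?thesis using f by (auto simp: R.nat_pow_mult)
 qed
 moreover have "f [^] (l + k) \<odot>.M y = (\<Oplus>.M i\<in>{..<n}. (f [^] l \<otimes> mv i y) \<odot>.M m i)" if y: "y \<in>. M" for y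
 proof -
  have "f [^] (l + k) \<odot>.M y = f [^] l \<odot>.M (\<Oplus>.M i\<in>{..<n}. mv i y \<odot>.M m i)"
   unfolding mv_sum[OF y, symmetric] using f y by (simp add: R.nat_pow_mult[symmetric] smult_assoc1)
  also have "\<dots> = (\<Oplus>.M i\<in>{..<n}. f [^] l \<odot>.M (mv i y \<odot>.M m i))" using f y mc mvs(1) by (intro finsum_smult_ldistr) auto
  also have "\<dots> = (\<Oplus>.M i\<in>{..<n}. (f [^] l \<otimes> mv i y) \<odot>.M m i)"
   using f y mc mvs(1) by (intro M.finsum_cong') (auto simp: smult_assoc1)
  finally show ?thesis .
 qed
 ultimately show ?thesis using functionals_smult[OF mv] f by (intro exI[of _ "l + k"] exI[of _ "\<lambda>i y. f [^] l \<otimes> mv i y"]) auto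
qed

lemma local_basisI:
 assumes f: "f \<in>. R" and mc: "\<And>i. i < n ==> m i \<in>. M"
  and mv: "\<And>i. i < n ==> mv i \<in> functionals R M"
  and sum: "\<And>y. y \<in>. M ==> f [^] (k::nat) \<odot>.M y = (\<Oplus>.M i\<in>{..<n}. mv i y \<odot>.M m i)"
  and de: "\<And>i j. i < n ==> j < n ==> mv i (m j) = (if i = j then f [^] k else \<zero>)"
 shows "local_basis R M f n m" unfolding local_basis_def
proof (intro conjI ballI allI impI)
 show "m \<in> {..<n} \<rightarrow> carrier M" using mc by auto
 fix y assume y: "y \<in>. M"
 show "\<exists>(k::nat) c. c \<in> {..<n} \<rightarrow> carrier R \<and> f [^] k \<odot>.M y = (\<Oplus>.M i\<in>{..<n}. c i \<odot>.M m i)"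
  using sum[OF y] functionals_simps(1)[OF mv] y by (intro exI[of _ k] exI[of _ "\<lambda>i. mv i y"]) auto
next
 fix c assume "c \<in> {..<n} \<rightarrow> carrier R" and z: "(\<Oplus>.M i\<in>{..<n}. c i \<odot>.M m i) = \<zero>.M"
 then have c: "i < n ==> c i \<in>. R" for i by auto
 have "f [^] k \<otimes> c i = \<zero>" if i: "i < n" for i
 proof -
  note mvi = functionals_simps[OF mv[OF i]]
  have "\<zero> = mv i (\<Oplus>.M i\<in>{..<n}. c i \<odot>.M m i)"
   unfolding z by (rule ahom_zero[OF M.abelian_group_axioms R.abelian_group_axioms mvi(4), symmetric])
  also have "\<dots> = (\<Oplus>j\<in>{..<n}. mv i (c j \<odot>.M m j))"
   using c mc by (intro ahom_finsum[OF M.abelian_group_axioms R.abelian_group_axioms mvi(4)]) auto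
  also have "\<dots> = (\<Oplus>j\<in>{..<n}. if i = j then c j \<otimes> f [^] k else \<zero>)"
   using c mc mvi(3) de[OF i] f by (intro R.finsum_cong') auto
  also have "\<dots> = c i \<otimes> f [^] k" using i c f by (intro R.finsum_singleton) auto
  finally show ?thesis using c[OF i] f by (simp add: R.m_comm)
 qed
 then show "\<exists>k::nat. \<forall>i<n. f [^] k \<otimes> c i = \<zero>" by blast
qed

end

text \<open>The image of the cover is again comaximal. Independence in a local basis need not
  survive a non-flat extension in an obvious way, but its functional form consists of identities,
  which do.\<close>

lemma (in scalar_ext) finite_locally_free_ext:
 assumes db: "dual_basis C M N e ep" and flf: "finite_locally_free C M"
 shows "finite_locally_free D E"
proof -
 obtain G where G: "finite G" "G \<subseteq> carrier C" "genideal C G = carrier C"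
  and lb: "\<forall>f\<in>G. \<exists>n m. local_basis C M f n m" using flf finite_locally_free_iff[OF M] by blast
 have sub: "ph ` G \<subseteq> carrier D" using G by auto
 have "genideal D (ph ` G) = carrier D"
 proof -
  interpret I: ideal "genideal D (ph ` G)" D by (rule E.R.genideal_ideal[OF sub])
  have "ideal {r \<in> carrier C. ph r \<in> genideal D (ph ` G)} C" by (rule ph.ideal_vimage) unfold_locales
  moreover have "G \<subseteq> {r \<in> carrier C. ph r \<in> genideal D (ph ` G)}" using G E.R.genideal_self[OF sub] by blast
  ultimately have "genideal C G \<subseteq> {r \<in> carrier C. ph r \<in> genideal D (ph ` G)}" by (rule M.R.genideal_minimal)
  then have "\<one>.C \<in> {r \<in> carrier C. ph r \<in> genideal D (ph ` G)}" unfolding G(3) using M.R.one_closed by blast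
  then show ?thesis using I.one_imp_carrier by simp
 qed
 moreover have "\<exists>n m. local_basis D E (ph f) n m" if f: "f \<in> G" for f
 proof -
  have fc: "f \<in>. C" using f G by blast
  obtain n m where lb': "local_basis C M f n m" using lb f by blast
  then have mc: "i < n ==> m i \<in>. M" for i by (auto simp: local_basis_def)
  from M.local_basis_functionals[OF db lb' fc] obtain k :: nat and mv where
   mv: "\<And>i. i < n ==> mv i \<in> functionals C M"
   "\<And>y. y \<in>. M ==> f [^].C k \<odot>.M y = (\<Oplus>.M i\<in>{..<n}. mv i y \<odot>.M m i)"
   "\<And>i j. i < n ==> j < n ==> mv i (m j) = (if i = j then f [^].C k else \<zero>.C)" by blast
  have pw: "ph (f [^].C k) = ph f [^].D k" using fc by (simp add: ph.hom_nat_pow)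
  have "local_basis D E (ph f) n (\<lambda>i. pt \<one>.D (m i))"
  proof (rule E.local_basisI[where mv = "\<lambda>i. hat (mv i)" and k = k])
   show "ph f [^].D k \<odot>.E y = (\<Oplus>.E i\<in>{..<n}. hat (mv i) y \<odot>.E pt \<one>.D (m i))" if "y \<in>. E" for y
    unfolding pw[symmetric] by (rule hat_expand[OF _ mc mv(1,2) that]) (use fc in auto)
   show "hat (mv i) (pt \<one>.D (m j)) = (if i = j then ph f [^].D k else \<zero>.D)" if "i < n" "j < n" for i j
    using hat_pt[OF mv(1)[OF that(1)], of "\<one>.D" "m j"] mc[OF that(2)] mv(3)[OF that] fc by (simp add: pw)
  qed (use fc mc hat_functional[OF mv(1)] in auto)
  then show ?thesis by blast
 qed
 ultimately show ?thesis unfolding finite_locally_free_iff[OF E] using G sub by (intro exI[of _ "ph ` G"]) auto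
qed

section \<open>Base change of modules as an instance of extension of scalars\<close>

lemma module_cong:
 assumes "module R M" "carrier N = carrier M" "ring.add N = ring.add M" "\<zero>.N = \<zero>.M"
  "module.smult N = module.smult M"
 shows "module R N"
proof -
 interpret M: module R M by fact
 show ?thesis by (rule moduleI)
    (simp_all add: assms(2-) M.R.is_cring abelian_group_cong[OF M.M.abelian_group_axioms assms(2-4)]
     M.smult_l_distr M.smult_r_distr M.smult_assoc1)
qed

lemma base_change_obj_simps:
 "carrier (base_change_obj C ph D sg M) = carrier (base_change C ph D M)"
 "ring.add (base_change_obj C ph D sg M) = ring.add (base_change C ph D M)"
 "\<zero>\<^bsub>base_change_obj C ph D sg M\<^esub> = \<zero>\<^bsub>base_change C ph D M\<^esub>"
 "module.smult (base_change_obj C ph D sg M) = module.smult (base_change C ph D M)"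
 "tau (base_change_obj C ph D sg M) = tensor_map C (algebra_via ph D) M sg (tau M)"
 by (simp_all add: base_change_obj_def module.defs tau_module.defs)

lemma base_change_scalar_ext:
 fixes C :: "('c, 'x) ring_scheme" and D :: "('d, 'y) ring_scheme" and M :: "('c, 'm, 'z) module_scheme"
  and E :: "('d, ('d, 'm) tens, 'w) module_scheme"
 assumes M: "module C M" and D: "cring D" and ph: "ph \<in> ring_hom C D"
  and E: "carrier E = carrier (base_change C ph D M)" "ring.add E = ring.add (base_change C ph D M)"
   "\<zero>.E = \<zero>\<^bsub>base_change C ph D M\<^esub>" "module.smult E = module.smult (base_change C ph D M)"
 shows "scalar_ext C ph D M E (pure_tensor C (algebra_via ph D) M)"
proof -
 interpret M: module C M by fact
 interpret D: cring D by fact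
 interpret E: module D E by (rule module_cong[OF base_change_module[OF D ph M] E])
 note hyp = D ph M
 have unit: "pure_tensor C (algebra_via ph D) M d (c \<odot>.M m) = pure_tensor C (algebra_via ph D) M (ph c \<otimes>.D d) m"
  if "d \<in>. D" "c \<in>. C" "m \<in>. M" for c d m using pure_tensor_smult[OF bc_modules[OF hyp], of c d m] that by simp
 have addr: "pure_tensor C (algebra_via ph D) M d (m \<oplus>.M m') =
   pure_tensor C (algebra_via ph D) M d m \<oplus>.E pure_tensor C (algebra_via ph D) M d m'"
  if "d \<in>. D" "m \<in>. M" "m' \<in>. M" for d m m'
  using pure_tensor_add_right[OF bc_modules[OF hyp], of d m m'] that by (simp add: E base_change_simps)
 show ?thesis
 proof
  fix mv assume "mv \<in> functionals C M"
  note mv = functionals_simps[OF this]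
  let ?b = "\<lambda>d m. d \<otimes>.D ph (mv m)"
  let ?\<nu> = "tensor_lift (add_monoid D) (\<lambda>(d, m). ?b d m)"
  have phc: "c \<in>. C ==> ph c \<in>. D" for c by (rule ring_hom_closed[OF ph])
  note L = base_change_lift[OF hyp D.abelian_group_axioms, of ?b]
  have h: "?\<nu> \<in> ahom (base_change C ph D M) D"
   by (rule L(1)) (use phc mv in \<open>simp_all add: D.l_distr D.r_distr ring_hom_add[OF ph] ring_hom_mult[OF ph] D.m_ac\<close>)
  have p: "?\<nu> (pure_tensor C (algebra_via ph D) M d m) = ?b d m" if "d \<in>. D" "m \<in>. M" for d m
   by (rule L(2)) (use that phc mv in \<open>simp_all add: D.l_distr D.r_distr ring_hom_add[OF ph] ring_hom_mult[OF ph] D.m_ac\<close>)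
  have "?\<nu> \<in> functionals D E"
  proof (rule functionalsI)
   fix X assume X': "X \<in>. E"
   then have X: "X \<in> carrier (base_change C ph D M)" by (simp add: E)
   show "?\<nu> X \<in>. D" by (rule ahom_closed[OF h X])
   show "?\<nu> (X \<oplus>.E Y) = ?\<nu> X \<oplus>.D ?\<nu> Y" if "Y \<in>. E" for Y using ahom_add[OF h X, of Y] that by (simp add: E)
   fix d assume d: "d \<in>. D"
   have m: "module D (base_change C ph D M)" by (rule base_change_module[OF hyp])
   interpret B: module D "base_change C ph D M" by (rule m)
   have "?\<nu> (d \<odot>\<^bsub>base_change C ph D M\<^esub> X) = d \<otimes>.D ?\<nu> X" using hyp X
   proof (induction rule: base_change_mod_induct)
    case (pure d' m)
    then show ?case using d phc mv(1) by (simp add: base_change_smult_pure[OF hyp] p D.m_assoc)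
   next
    case (add X Y)
    then show ?case using d ahom_closed[OF h] by (simp add: B.smult_r_distr ahom_add[OF h] D.r_distr)
   qed
   then show "?\<nu> (d \<odot>.E X) = d \<otimes>.D ?\<nu> X" by (simp add: E)
  qed
  with p show "\<exists>\<nu>\<in>functionals D E. \<forall>d\<in>carrier D. \<forall>m\<in>carrier M. \<nu> (pure_tensor C (algebra_via ph D) M d m) = d \<otimes>.D ph (mv m)"
   by blast
 next
  fix X P assume "X \<in>. E"
   and "\<And>d m. d \<in>. D ==> m \<in>. M ==> P (pure_tensor C (algebra_via ph D) M d m)"
   and "\<And>X Y. X \<in>. E ==> Y \<in>. E ==> P X ==> P Y ==> P (X \<oplus>.E Y)"
  then show "P X" using base_change_mod_induct[OF hyp, of X P] by (simp add: E)
 next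
  show "d \<odot>.E pure_tensor C (algebra_via ph D) M d' m = pure_tensor C (algebra_via ph D) M (d \<otimes>.D d') m"
   if "d \<in>. D" "d' \<in>. D" "m \<in>. M" for d d' m using base_change_smult_pure[OF hyp that] by (simp add: E)
  show "pure_tensor C (algebra_via ph D) M d m \<in>. E" if "d \<in>. D" "m \<in>. M" for d m using base_change_closed[OF hyp that] by (simp add: E)
  show "pure_tensor C (algebra_via ph D) M \<one>.D (c \<odot>.M m) = pure_tensor C (algebra_via ph D) M (ph c) m"
   if "c \<in>. C" "m \<in>. M" for c m using unit[OF D.one_closed that] that ring_hom_closed[OF ph] by simp
 qed (use ph addr in auto)
qed

section \<open>Linearizations\<close>

lemma linearization_facts:
 assumes C: "cring C" and sg: "sg \<in> ring_hom C C" and M: "left_tau_module C sg M"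
 shows linearization_hom: "linearization M \<in> ahom (base_change C sg C M) M"
  and linearization_pure: "\<And>b m. b \<in>. C ==> m \<in>. M ==>
   linearization M (pure_tensor C (algebra_via sg C) M b m) = b \<odot>.M tau M m"
  and linearization_smult: "\<And>c X. c \<in>. C ==> X \<in> carrier (base_change C sg C M) ==>
   linearization M (c \<odot>\<^bsub>base_change C sg C M\<^esub> X) = c \<odot>.M linearization M X"
proof -
 have mod: "module C M" using M by (simp add: left_tau_module_def)
 interpret M: module C M by (rule mod)
 have t: "m \<in>. M ==> tau M m \<in>. M"
  "m \<in>. M ==> m' \<in>. M ==> tau M (m \<oplus>.M m') = tau M m \<oplus>.M tau M m'"
  "b \<in>. C ==> m \<in>. M ==> tau M (b \<odot>.M m) = sg b \<odot>.M tau M m" for m m' b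
  using M by (auto simp: left_tau_module_def)
 note sgc = ring_hom_closed[OF sg]
 note hyp = C sg mod
 note L = base_change_lift[OF hyp M.M.abelian_group_axioms, of "\<lambda>b m. b \<odot>.M tau M m"]
 show h: "linearization M \<in> ahom (base_change C sg C M) M" unfolding linearization_def
  by (rule L(1)) (use t sgc in \<open>simp_all add: M.smult_l_distr M.smult_r_distr M.smult_assoc1[symmetric] M.R.m_comm\<close>)
 show p: "linearization M (pure_tensor C (algebra_via sg C) M b m) = b \<odot>.M tau M m"
  if "b \<in>. C" "m \<in>. M" for b m unfolding linearization_def
  by (rule L(2)) (use that t sgc in \<open>simp_all add: M.smult_l_distr M.smult_r_distr M.smult_assoc1[symmetric] M.R.m_comm\<close>)
 fix c X assume c: "c \<in>. C" and X: "X \<in> carrier (base_change C sg C M)"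
 interpret B: module C "base_change C sg C M" by (rule base_change_module[OF hyp])
 from hyp X show "linearization M (c \<odot>\<^bsub>base_change C sg C M\<^esub> X) = c \<odot>.M linearization M X"
 proof (induction rule: base_change_mod_induct)
  case (pure d' m)
  then show ?case using c t by (simp add: base_change_smult_pure[OF hyp] p M.smult_assoc1)
 next
  case (add X Y)
  then show ?case using c ahom_closed[OF h] by (simp add: B.smult_r_distr ahom_add[OF h] M.smult_r_distr)
 qed
qed

text \<open>Invertibility of the linearization enters here: for a functional \<open>ka\<close>, the
  map sending b \<otimes> m to b \<sigma>(ka m) is defined on the Frobenius twist of
  \<open>M\<close>, and the inverse linearization carries it back to \<open>M\<close>. In
  coordinates these functionals are the rows of an inverse of the matrix of \<tau>^n.\<close>

lemma isocrystal_twisted_functional: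
 assumes C: "cring C" and sg: "sg \<in> ring_hom C C" and M: "isocrystal C sg M" and mv: "mv \<in> functionals C M"
 shows "\<exists>mv'\<in>functionals C M. \<forall>y\<in>carrier M. mv' ((tau M ^^ n) y) = (sg ^^ n) (mv y)"
proof (induction n)
 case 0 show ?case using mv by auto
next
 case (Suc n)
 then obtain ka where ka: "ka \<in> functionals C M" "\<And>y. y \<in>. M ==> ka ((tau M ^^ n) y) = (sg ^^ n) (mv y)" by blast
 note kas = functionals_simps[OF ka(1)]
 have ltm: "left_tau_module C sg M" using M by (simp add: isocrystal_def)
 have mod: "module C M" using ltm by (simp add: left_tau_module_def)
 interpret M: module C M by (rule mod)
 interpret B: module C "base_change C sg C M" by (rule base_change_module[OF C sg mod])
 note lin = linearization_facts[OF C sg ltm]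
 note sgc = ring_hom_closed[OF sg]
 have t: "m \<in>. M ==> tau M m \<in>. M" for m using ltm by (auto simp: left_tau_module_def)
 have tn: "m \<in>. M ==> (tau M ^^ n) m \<in>. M" for m by (induction n) (auto simp: t)
 let ?b = "\<lambda>b m. b \<otimes>.C sg (ka m)"
 let ?g = "tensor_lift (add_monoid C) (\<lambda>(b, m). ?b b m)"
 note L = base_change_lift[OF C sg mod M.R.abelian_group_axioms, of ?b]
 have g: "?g \<in> ahom (base_change C sg C M) C"
  by (rule L(1)) (use kas sgc in \<open>simp_all add: M.R.l_distr M.R.r_distr ring_hom_add[OF sg] ring_hom_mult[OF sg] M.R.m_ac\<close>)
 have gp: "?g (pure_tensor C (algebra_via sg C) M b m) = ?b b m" if "b \<in>. C" "m \<in>. M" for b m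
  by (rule L(2)) (use that kas sgc in \<open>simp_all add: M.R.l_distr M.R.r_distr ring_hom_add[OF sg] ring_hom_mult[OF sg] M.R.m_ac\<close>)
 have gs: "?g (c \<odot>\<^bsub>base_change C sg C M\<^esub> X) = c \<otimes>.C ?g X"
  if c: "c \<in>. C" and X: "X \<in> carrier (base_change C sg C M)" for c X using C sg mod X
 proof (induction rule: base_change_mod_induct)
  case (pure d' m)
  then show ?case using c kas sgc by (simp add: base_change_smult_pure[OF C sg mod] gp M.R.m_assoc)
 next
  case (add X Y)
  then show ?case using c ahom_closed[OF g] by (simp add: B.smult_r_distr ahom_add[OF g] M.R.r_distr)
 qed
 have bij: "bij_betw (linearization M) (carrier (base_change C sg C M)) (carrier M)" using M by (simp add: isocrystal_def)
 define linv where "linv = the_inv_into (carrier (base_change C sg C M)) (linearization M)"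
 have linv: "y \<in>. M ==> linv y \<in> carrier (base_change C sg C M)" "y \<in>. M ==> linearization M (linv y) = y"
  "X \<in> carrier (base_change C sg C M) ==> linv (linearization M X) = X" for y X
  using bij the_inv_into_into[of "linearization M" "carrier (base_change C sg C M)" y "carrier (base_change C sg C M)"]
   f_the_inv_into_f[of "linearization M" "carrier (base_change C sg C M)" y]
   the_inv_into_f_f[of "linearization M" "carrier (base_change C sg C M)" X] by (auto simp: bij_betw_def linv_def)
 have inv_add: "linv (y \<oplus>.M y') = linv y \<oplus>\<^bsub>base_change C sg C M\<^esub> linv y'" if "y \<in>. M" "y' \<in>. M" for y y'
  using linv(3)[of "linv y \<oplus>\<^bsub>base_change C sg C M\<^esub> linv y'"] that linv(1,2) ahom_add[OF lin(1)] by simp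
 have inv_smult: "linv (c \<odot>.M y) = c \<odot>\<^bsub>base_change C sg C M\<^esub> linv y" if "c \<in>. C" "y \<in>. M" for c y
  using linv(3)[of "c \<odot>\<^bsub>base_change C sg C M\<^esub> linv y"] that linv(1,2) lin(3) by simp
 have inv_tau: "linv (tau M y) = pure_tensor C (algebra_via sg C) M \<one>.C y" if "y \<in>. M" for y
  using linv(3)[OF base_change_closed[OF C sg mod M.R.one_closed that]] lin(2)[OF M.R.one_closed that] t[OF that] by simp
 have fn: "(\<lambda>y. ?g (linv y)) \<in> functionals C M"
  by (rule functionalsI) (simp_all add: linv(1) inv_add inv_smult ahom_closed[OF g] ahom_add[OF g] gs)
 have "?g (linv ((tau M ^^ Suc n) y)) = (sg ^^ Suc n) (mv y)" if y: "y \<in>. M" for y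
 proof -
  have "?g (linv (tau M ((tau M ^^ n) y))) = sg (ka ((tau M ^^ n) y))" using tn[OF y] kas(1) sgc by (simp add: inv_tau gp)
  then show ?thesis using y by (simp add: ka(2))
 qed
 then show ?case by (intro bexI[OF _ fn] ballI)
qed

text \<open>Injectivity comes from the left inverse sending y to \<Sum> lam_i(y) \<otimes> e_i. On b
  \<otimes> m, the factor \<sigma>(ep_i m) of lam_i(b \<tau> m) crosses the tensor sign as ep_i m,
  and the dual basis reassembles m.\<close>

lemma linearization_bijI:
 assumes D: "cring D" and sg: "sg \<in> ring_hom D D" and E: "left_tau_module D sg E"
  and db: "dual_basis D E n e ep"
  and lam: "\<And>i. i < n ==> lam i \<in> functionals D E"
   "\<And>i y. i < n ==> y \<in>. E ==> lam i (tau E y) = sg (ep i y)"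
  and surj: "\<And>y. y \<in>. E ==> y \<in> linearization E ` carrier (base_change D sg D E)"
 shows "bij_betw (linearization E) (carrier (base_change D sg D E)) (carrier E)"
proof -
 have mod: "module D E" using E by (simp add: left_tau_module_def)
 interpret E: module D E by (rule mod)
 note hyp = D sg mod
 interpret B: module D "base_change D sg D E" by (rule base_change_module[OF hyp])
 note lin = linearization_facts[OF D sg E]
 note sgc = ring_hom_closed[OF sg]
 let ?pt = "pure_tensor D (algebra_via sg D) E" and ?B = "base_change D sg D E"
 have e: "\<And>i. i < n ==> e i \<in>. E" "\<And>i. i < n ==> ep i \<in> functionals D E"
  "\<And>y. y \<in>. E ==> y = (\<Oplus>.E i\<in>{..<n}. ep i y \<odot>.E e i)" using db by (auto simp: dual_basis_def)
 note ep = functionals_simps[OF e(2)] and lams = functionals_simps[OF lam(1)]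
 have t: "m \<in>. E ==> tau E m \<in>. E" for m using E by (auto simp: left_tau_module_def)
 have ptc: "b \<in>. D ==> m \<in>. E ==> ?pt b m \<in>. ?B" for b m by (rule base_change_closed[OF hyp])
 define \<Phi> where "\<Phi> y = (\<Oplus>.?B i\<in>{..<n}. ?pt (lam i y) (e i))" for y
 have \<Phi>: "\<Phi> \<in> ahom E ?B"
 proof (rule ahomI)
  fix y assume y: "y \<in>. E"
  show "\<Phi> y \<in>. ?B" unfolding \<Phi>_def using y e(1) lams(1) ptc by (intro B.M.finsum_closed) auto
  fix y' assume y': "y' \<in>. E"
  have "\<Phi> (y \<oplus>.E y') = (\<Oplus>.?B i\<in>{..<n}. ?pt (lam i y) (e i) \<oplus>.?B ?pt (lam i y') (e i))"
   unfolding \<Phi>_def using y y' e(1) lams(1,2) ptc by (intro B.M.finsum_cong') (auto simp: base_change_add_left[OF hyp])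
  also have "\<dots> = \<Phi> y \<oplus>.?B \<Phi> y'" unfolding \<Phi>_def using y y' e(1) lams(1) ptc by (intro B.M.finsum_addf) auto
  finally show "\<Phi> (y \<oplus>.E y') = \<Phi> y \<oplus>.?B \<Phi> y'" .
 qed
 have left: "\<Phi> (linearization E X) = X" if "X \<in>. ?B" for X
 proof (rule base_change_hom_eqI[OF hyp ahom_comp[OF lin(1) \<Phi>] ahom_id _ that])
  fix b m assume b: "b \<in>. D" and m: "m \<in>. E"
  have "\<Phi> (linearization E (?pt b m)) = (\<Oplus>.?B i\<in>{..<n}. ?pt b (ep i m \<odot>.E e i))" unfolding lin(2)[OF b m] \<Phi>_def
  proof (rule B.M.finsum_cong')
   fix i assume "i \<in> {..<n}"
   then have i: "i < n" by simp
   have "lam i (b \<odot>.E tau E m) = sg (ep i m) \<otimes>.D b"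
    using lams(3)[OF i b t[OF m]] lam(2)[OF i m] b sgc[OF ep(1)[OF i m]] by (simp add: E.R.m_comm)
   then show "?pt (lam i (b \<odot>.E tau E m)) (e i) = ?pt b (ep i m \<odot>.E e i)"
    using pure_tensor_smult[OF bc_modules[OF hyp] ep(1)[OF i m], of b "e i"] b e(1)[OF i] by simp
  qed (use b m e(1) ep(1) ptc in auto)
  also have "\<dots> = ?pt b (\<Oplus>.E i\<in>{..<n}. ep i m \<odot>.E e i)"
  proof (rule ahom_finsum[OF E.M.abelian_group_axioms B.M.abelian_group_axioms, symmetric])
   show "?pt b \<in> ahom E ?B" using pure_tensor_ahom_right[OF bc_modules[OF hyp], of b] b by (simp add: ahom_base_change)
  qed (use m e(1) ep(1) in auto)
  finally show "\<Phi> (linearization E (?pt b m)) = ?pt b m" using e(3)[OF m] by simp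
 qed
 show ?thesis unfolding bij_betw_def
 proof
  show "inj_on (linearization E) (carrier ?B)" by (rule inj_on_inverseI[of _ \<Phi>]) (rule left)
  show "linearization E ` carrier ?B = carrier E" using ahom_closed[OF lin(1)] surj by auto
 qed
qed

lemma left_tau_base_change:
 assumes C: "cring C" and D: "cring D" and ph: "ph \<in> ring_hom C D" and sg: "sg \<in> ring_hom C C" and sg': "sg' \<in> ring_hom D D"
  and comm: "\<And>c. c \<in>. C ==> ph (sg c) = sg' (ph c)" and ltm: "left_tau_module C sg M"
 shows base_change_obj_left_tau: "left_tau_module D sg' (base_change_obj C ph D sg' M)"
  and base_change_obj_scalar_ext: "scalar_ext C ph D M (base_change_obj C ph D sg' M) (pure_tensor C (algebra_via ph D) M)"
  and base_change_obj_tau: "\<And>d m. d \<in>. D ==> m \<in>. M ==>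
   tau (base_change_obj C ph D sg' M) (pure_tensor C (algebra_via ph D) M d m) = pure_tensor C (algebra_via ph D) M (sg' d) (tau M m)"
proof -
 let ?E = "base_change_obj C ph D sg' M" and ?pt = "pure_tensor C (algebra_via ph D) M"
 have mod: "module C M" using ltm by (simp add: left_tau_module_def)
 show se: "scalar_ext C ph D M ?E ?pt" by (rule base_change_scalar_ext[OF mod D ph]) (simp_all add: base_change_obj_simps)
 interpret scalar_ext C ph D M ?E ?pt by (rule se)
 have t: "m \<in>. M ==> tau M m \<in>. M"
  "m \<in>. M ==> m' \<in>. M ==> tau M (m \<oplus>.M m') = tau M m \<oplus>.M tau M m'"
  "b \<in>. C ==> m \<in>. M ==> tau M (b \<odot>.M m) = sg b \<odot>.M tau M m" for m m' b
  using ltm by (auto simp: left_tau_module_def)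
 have ta: "tau M \<in> ahom M M" using t by (intro ahomI) auto
 have sa: "sg' \<in> ahom (algebra_via ph D) (algebra_via ph D)" using ring_hom_ahom[OF sg'] by (simp add: hom_def)
 note B = bc_modules[OF D ph mod]
 have bal: "\<exists>b\<in>carrier C. sg' (a \<odot>\<^bsub>algebra_via ph D\<^esub> d) = b \<odot>\<^bsub>algebra_via ph D\<^esub> sg' d \<and> tau M (a \<odot>.M m) = b \<odot>.M tau M m"
  if "a \<in>. C" "d \<in> carrier (algebra_via ph D)" "m \<in>. M" for a d m using that t(3) ring_hom_closed[OF sg] ring_hom_closed[OF ph]
  by (intro bexI[of _ "sg a"]) (auto simp: comm ring_hom_mult[OF sg'])
 note tm = tensor_map[OF B B sa ta bal]
 show tp: "tau ?E (?pt d m) = ?pt (sg' d) (tau M m)" if "d \<in>. D" "m \<in>. M" for d m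
  unfolding base_change_obj_simps using tm(2)[of d m] that by simp
 have th: "tau ?E \<in> ahom ?E ?E" unfolding base_change_obj_simps(5) using tm(1) by (simp add: hom_def base_change_obj_simps base_change_simps)
 have "tau ?E (d \<odot>.?E X) = sg' d \<odot>.?E tau ?E X" if d: "d \<in>. D" and "X \<in>. ?E" for d X using that(2)
 proof (induction rule: pt_induct)
  case (pure d' m)
  then show ?case using d t(1) ring_hom_closed[OF sg'] by (simp add: pt_smult tp ring_hom_mult[OF sg'])
 next
  case (add X Y)
  then show ?case using d ahom_closed[OF th] ring_hom_closed[OF sg'] by (simp add: E.smult_r_distr ahom_add[OF th])
 qed
 then show "left_tau_module D sg' ?E" unfolding left_tau_module_def using E ahom_closed[OF th] ahom_add[OF th] by auto
qed

text \<open>The twisted functionals of \<open>M\<close> extend to \<open>D\<close> and give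
  injectivity of the new linearization. For surjectivity, m is a sum of terms b \<tau>(x), so d
  \<otimes> m is a sum of multiples d ph(b) of \<tau>(1 \<otimes> x).\<close>

lemma isocrystal_base_change:
 assumes C: "cring C" and D: "cring D" and ph: "ph \<in> ring_hom C D" and sg: "sg \<in> ring_hom C C" and sg': "sg' \<in> ring_hom D D"
  and comm: "\<And>c. c \<in>. C ==> ph (sg c) = sg' (ph c)"
  and iso: "isocrystal C sg M" and db: "dual_basis C M n e ep"
 shows "isocrystal D sg' (base_change_obj C ph D sg' M)"
proof -
 let ?E = "base_change_obj C ph D sg' M" and ?pt = "pure_tensor C (algebra_via ph D) M"
 have ltm: "left_tau_module C sg M" and flf: "finite_locally_free C M"
  and bij: "bij_betw (linearization M) (carrier (base_change C sg C M)) (carrier M)" using iso by (simp_all add: isocrystal_def)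
 note bc = left_tau_base_change[OF C D ph sg sg' comm ltm]
 interpret scalar_ext C ph D M ?E ?pt by (rule bc(2))
 have t: "m \<in>. M ==> tau M m \<in>. M" for m using ltm by (auto simp: left_tau_module_def)
 have e: "\<And>i. i < n ==> ep i \<in> functionals C M" using db by (auto simp: dual_basis_def)
 note lin = linearization_facts[OF D sg' bc(1)] and linM = linearization_facts[OF C sg ltm]
 have tE: "X \<in>. ?E ==> tau ?E X \<in>. ?E"
  "X \<in>. ?E ==> Y \<in>. ?E ==> tau ?E (X \<oplus>.?E Y) = tau ?E X \<oplus>.?E tau ?E Y" for X Y
  using bc(1) by (auto simp: left_tau_module_def)
 have "\<forall>i\<in>{..<n}. \<exists>mv'. mv' \<in> functionals C M \<and> (\<forall>y\<in>carrier M. mv' (tau M y) = sg (ep i y))"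
  using isocrystal_twisted_functional[OF C sg iso e, of _ 1] by auto
 from bchoice[OF this] obtain lam where lam: "\<And>i. i < n ==> lam i \<in> functionals C M"
  "\<And>i y. i < n ==> y \<in>. M ==> lam i (tau M y) = sg (ep i y)" by auto
 have "bij_betw (linearization ?E) (carrier (base_change D sg' D ?E)) (carrier ?E)"
 proof (rule linearization_bijI[OF D sg' bc(1) dual_basis_ext[OF db], of "\<lambda>i. hat (lam i)"])
  fix i assume i: "i < n"
  show "hat (lam i) \<in> functionals D ?E" by (rule hat_functional[OF lam(1)[OF i]])
  note h = functionals_simps[OF hat_functional[OF lam(1)[OF i]]] and h' = functionals_simps[OF hat_functional[OF e[OF i]]]
  fix y assume "y \<in>. ?E"
  then show "hat (lam i) (tau ?E y) = sg' (hat (ep i) y)"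
  proof (induction rule: pt_induct)
   case (pure d m)
   then show ?case using t functionals_simps(1)[OF e[OF i]] ring_hom_closed[OF sg']
    by (simp add: bc(3) hat_pt[OF lam(1)[OF i]] hat_pt[OF e[OF i]] lam(2)[OF i] comm ring_hom_mult[OF sg'])
  next
   case (add X Y)
   then show ?case using tE h(2) h'(1,2) by (simp add: ring_hom_add[OF sg'])
  qed
 next
  interpret B: module D "base_change D sg' D ?E" by (rule base_change_module[OF D sg' E])
  have sum: "a \<oplus>.?E b \<in> linearization ?E ` carrier (base_change D sg' D ?E)"
   if "a \<in> linearization ?E ` carrier (base_change D sg' D ?E)" "b \<in> linearization ?E ` carrier (base_change D sg' D ?E)" for a b
  proof -
   from that obtain X Y where XY: "X \<in> carrier (base_change D sg' D ?E)" "a = linearization ?E X"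
    "Y \<in> carrier (base_change D sg' D ?E)" "b = linearization ?E Y" by blast
   have "a \<oplus>.?E b = linearization ?E (X \<oplus>\<^bsub>base_change D sg' D ?E\<^esub> Y)"
    unfolding XY by (rule ahom_add[OF lin(1) XY(1,3), symmetric])
   then show ?thesis using XY by simp
  qed
  fix y assume "y \<in>. ?E"
  then show "y \<in> linearization ?E ` carrier (base_change D sg' D ?E)"
  proof (induction rule: pt_induct)
   case (pure d m)
   from pure(2) bij obtain X where X: "X \<in> carrier (base_change C sg C M)" "m = linearization M X" by (auto simp: bij_betw_def)
   have "pt d (linearization M X) \<in> linearization ?E ` carrier (base_change D sg' D ?E)" if "pt = ?pt" for pt
    using C sg M.module_axioms X(1) unfolding that
   proof (induction rule: base_change_mod_induct)
    case p: (pure b x)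
    have "?pt d (linearization M (pure_tensor C (algebra_via sg C) M b x)) = ?pt (d \<otimes>.D ph b) (tau M x)"
     using p pure(1) t by (simp add: linM(2) pt_bal')
    also have "\<dots> = (d \<otimes>.D ph b) \<odot>.?E tau ?E (?pt \<one>.D x)"
     using p pure(1) t by (simp add: bc(3) ring_hom_one[OF sg'] pt_smult)
    also have "\<dots> = linearization ?E (pure_tensor D (algebra_via sg' D) ?E (d \<otimes>.D ph b) (?pt \<one>.D x))"
     using p pure(1) by (simp add: lin(2))
    finally show ?case using p pure(1) base_change_closed[OF D sg' E, of "d \<otimes>.D ph b" "?pt \<one>.D x"] by auto
   next
    case (add X Y)
    then show ?case using sum pure(1) ahom_closed[OF linM(1)] by (simp add: ahom_add[OF linM(1)] pt_add_right)
   qed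
   then show ?case unfolding X(2) by blast
  qed (rule sum)
 qed
 then show ?thesis unfolding isocrystal_def using bc(1) finite_locally_free_ext[OF db flf] by blast
qed

section \<open>Full faithfulness from boundedness\<close>

text \<open>Inductive, so that a bound on valuations can be proved along the way a combination is
  built. In the application \<open>S\<close> is the image of a ring, which supplies
  negatives.\<close>

inductive_set span_over :: "('d, 'y) ring_scheme \<Rightarrow> 'd set \<Rightarrow> 'd set \<Rightarrow> 'd set"
 for D :: "('d, 'y) ring_scheme" and S G where
 zero: "\<zero>.D \<in> span_over D S G"
| smult: "s \<in> S ==> g \<in> G ==> s \<otimes>.D g \<in> span_over D S G"
| add: "x \<in> span_over D S G ==> y \<in> span_over D S G ==> x \<oplus>.D y \<in> span_over D S G"

lemma (in cring) span_over_closed: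
 assumes "S \<subseteq> carrier R" "G \<subseteq> carrier R" "x \<in> span_over R S G"
 shows "x \<in>. R" using assms(3) by induction (use assms(1,2) in auto)

lemma (in cring) span_over_smult:
 assumes S: "S \<subseteq> carrier R" "\<And>s t. s \<in> S ==> t \<in> S ==> s \<otimes> t \<in> S" and G: "G \<subseteq> carrier R"
  and s: "s \<in> S" and x: "x \<in> span_over R S G"
 shows "s \<otimes> x \<in> span_over R S G" using x
proof induction
 case zero
 then show ?case using s S by (auto simp: span_over.zero)
next
 case (smult t g)
 then have "s \<otimes> (t \<otimes> g) = (s \<otimes> t) \<otimes> g" using s S G by (simp add: m_assoc subset_iff)
 then show ?case using S(2)[OF s smult(1)] smult(2) by (simp add: span_over.smult)
next
 case (add x y)
 then have "s \<otimes> (x \<oplus> y) = s \<otimes> x \<oplus> s \<otimes> y"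
  using s S span_over_closed[OF S(1) G] by (simp add: r_distr subset_iff)
 then show ?case using add by (simp add: span_over.add)
qed

lemma (in cring) span_over_finsum:
 assumes S: "S \<subseteq> carrier R" and G: "G \<subseteq> carrier R" and "\<And>i. i \<in> I ==> g i \<in> span_over R S G"
 shows "(\<Oplus>i\<in>I. g i) \<in> span_over R S G" using assms(3)
proof (induction I rule: infinite_finite_induct)
 case (insert i I)
 then have "g i \<in>. R" "g \<in> I \<rightarrow> carrier R" using span_over_closed[OF S G] by auto
 then show ?case using insert by (auto intro: span_over.add)
qed (auto simp: span_over.zero)

lemma module_span_least:
 "submodule H B M ==> X \<subseteq> H ==> module_span B M X \<subseteq> H" unfolding module_span_def by blast

lemma module_span_superset: "X \<subseteq> module_span B M X" unfolding module_span_def by blast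

text \<open>Separates the algebra of lattices and morphisms from valuations. \<open>A\<close>,
  \<open>C\<close>, \<open>D\<close> stand for A^b, B^b, B_K, and \<open>zp s\<close> for z^s. The
  arithmetic of K enters through the last two assumptions alone, which are the two cases of the
  argument for sets of matrix entries.\<close>

locale bounded_base_change =
 fixes C :: "'c ring" and D :: "'d ring" and A :: "'a ring"
  and ph :: "'c \<Rightarrow> 'd" and io :: "'a \<Rightarrow> 'c" and sgC :: "'c \<Rightarrow> 'c" and sgD :: "'d \<Rightarrow> 'd" and zp :: "int \<Rightarrow> 'c"
 assumes C: "cring C" and D: "cring D" and A: "cring A"
  and ph: "ph \<in> ring_hom C D" and ph_inj: "inj_on ph (carrier C)" and io: "io \<in> ring_hom A C"
  and sgC: "sgC \<in> ring_hom C C" and sgD: "sgD \<in> ring_hom D D"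
  and sg_comm: "c \<in>. C ==> ph (sgC c) = sgD (ph c)"
  and sg_A: "a \<in>. A ==> sgC (io a) \<in> io ` carrier A"
  and zp_closed [simp]: "zp s \<in>. C" and zp_add: "zp (s + t) = zp s \<otimes>.C zp t" and zp_0: "zp 0 = \<one>.C"
  and zp_sg: "sgC (zp s) = zp s" and zp_nonneg: "0 \<le> s ==> zp s \<in> io ` carrier A"
  and zp_denominator: "c \<in>. C ==> \<exists>h::nat. zp (int h) \<otimes>.C c \<in> io ` carrier A"
  and bounded: "\<And>G n. finite G ==> G \<subseteq> carrier D ==> 0 < n ==>
   (\<And>g. g \<in> G ==> (sgD ^^ n) g \<in> span_over D (ph ` io ` carrier A) G) ==> G \<subseteq> ph ` carrier C"
  and vanishing: "\<And>G n s. finite G ==> G \<subseteq> carrier D ==> 0 < s ==>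
   (\<And>g. g \<in> G ==> \<exists>x\<in>span_over D (ph ` io ` carrier A) ((sgD ^^ n) ` G). g = ph (zp s) \<otimes>.D x) ==> G \<subseteq> {\<zero>.D}"
begin

sublocale C: cring C by (rule C)
sublocale D: cring D by (rule D)
sublocale A: cring A by (rule A)
sublocale ph: ring_hom_ring C D ph by (simp add: ring_hom_ring_def ring_hom_ring_axioms_def C.ring_axioms D.ring_axioms ph)
sublocale io: ring_hom_ring A C io by (simp add: ring_hom_ring_def ring_hom_ring_axioms_def C.ring_axioms A.ring_axioms io)

abbreviation "SA \<equiv> io ` carrier A"
abbreviation "SD \<equiv> ph ` io ` carrier A"

lemma SA_closed: "a \<in> SA ==> a \<in>. C" by auto
lemma SD_sub: "SD \<subseteq> carrier D" by auto
lemma SA_mult: "s \<in> SA ==> t \<in> SA ==> s \<otimes>.C t \<in> SA" by (auto simp flip: io.hom_mult)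
lemma SA_add: "s \<in> SA ==> t \<in> SA ==> s \<oplus>.C t \<in> SA" by (auto simp flip: io.hom_add)
lemma SD_mult: "s \<in> SD ==> t \<in> SD ==> s \<otimes>.D t \<in> SD"
proof -
 assume "s \<in> SD" "t \<in> SD"
 then obtain a b where "a \<in> SA" "b \<in> SA" "s = ph a" "t = ph b" by blast
 then have "s \<otimes>.D t = ph (a \<otimes>.C b)" "a \<otimes>.C b \<in> SA" using SA_closed SA_mult by auto
 then show ?thesis by simp
qed

lemma sgC_pow_SA: "a \<in> SA ==> (sgC ^^ n) a \<in> SA" by (induction n) (auto simp: sg_A)

lemma sg_pow_comm: "c \<in>. C ==> (sgC ^^ n) c \<in>. C \<and> ph ((sgC ^^ n) c) = (sgD ^^ n) (ph c)"
 by (induction n) (auto simp: sg_comm ring_hom_closed[OF sgC])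

lemma ring_hom_pow: "h \<in> ring_hom S S ==> (h ^^ n) \<in> ring_hom S S"
proof (induction n)
 case 0 show ?case by (auto intro: ring_hom_memI)
next
 case (Suc n)
 note r = Suc.IH[OF Suc.prems] and r' = Suc.prems
 show ?case by (rule ring_hom_memI)
    (simp_all add: ring_hom_closed[OF r] ring_hom_closed[OF r'] ring_hom_mult[OF r] ring_hom_mult[OF r']
     ring_hom_add[OF r] ring_hom_add[OF r'] ring_hom_one[OF r] ring_hom_one[OF r'])
qed

lemmas sgD_pow = ring_hom_pow[OF sgD]
lemma zp_pow_sg: "(sgC ^^ n) (zp s) = zp s" by (induction n) (auto simp: zp_sg)

lemma zp_cancel: "zp (- s) \<otimes>.C zp s = \<one>.C" "zp s \<otimes>.C zp (- s) = \<one>.C" by (simp_all flip: zp_add add: zp_0)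

lemma span_smult_SA: "G \<subseteq> carrier D ==> a \<in> SA ==> x \<in> span_over D SD G ==> ph a \<otimes>.D x \<in> span_over D SD G"
 by (rule D.span_over_smult[OF SD_sub SD_mult]) auto

lemma span_sg:
 assumes G: "G \<subseteq> carrier D" and x: "x \<in> span_over D SD G"
 shows "(sgD ^^ n) x \<in> span_over D SD ((sgD ^^ n) ` G)" using x
proof induction
 case zero
 have "(sgD ^^ n) \<zero>.D = \<zero>.D" by (rule ring_hom_zero[OF sgD_pow D.ring_axioms D.ring_axioms])
 then show ?case by (simp add: span_over.zero)
next
 case (smult s g)
 then obtain a where a: "a \<in> SA" "s = ph a" by blast
 then have "(sgD ^^ n) s = ph ((sgC ^^ n) a)" using sg_pow_comm[of a n] SA_closed by simp
 moreover have "(sgD ^^ n) (s \<otimes>.D g) = (sgD ^^ n) s \<otimes>.D (sgD ^^ n) g" using smult G SD_sub by (intro ring_hom_mult[OF sgD_pow]) auto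
 ultimately show ?case using sgC_pow_SA[OF a(1), of n] smult by (auto intro: span_over.smult)
next
 case (add x y)
 then have "(sgD ^^ n) (x \<oplus>.D y) = (sgD ^^ n) x \<oplus>.D (sgD ^^ n) y"
  using D.span_over_closed[OF SD_sub G] by (intro ring_hom_add[OF sgD_pow]) auto
 then show ?case using add by (simp add: span_over.add)
qed

subsection \<open>Lattices\<close>

definition is_lattice :: "('c, 'm, 'z) module_scheme \<Rightarrow> 'm set \<Rightarrow> bool" where
 "is_lattice M T \<longleftrightarrow> submodule T A (restrict_scalars io M) \<and>
  finite_locally_free A ((restrict_scalars io M)\<lparr>carrier := T\<rparr>) \<and> module_span C M T = carrier M"

text \<open>A dual basis of the lattice over \<open>A\<close> is also one of \<open>M\<close> over
  \<open>C\<close>, because \<open>M\<close> is the union of the modules z^(-h) T. That the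
  functionals are integral on \<open>T\<close> is what later keeps coefficients inside
  \<open>SA\<close>.\<close>

lemma lattice_dual_basis:
 fixes M :: "('c, 'm, 'z) module_scheme"
 assumes M: "module C M" and T: "is_lattice M T"
 shows "\<exists>n e ep. dual_basis C M n e ep \<and> (\<forall>i<n. e i \<in> T) \<and> (\<forall>i<n. \<forall>t\<in>T. ep i t \<in> SA)"
proof -
 interpret M: module C M by (rule M)
 interpret MA: module A "restrict_scalars io M" by (rule restrict_scalars_module[OF A M io])
 have sub: "submodule T A (restrict_scalars io M)" using T by (simp add: is_lattice_def)
 note Ts = MA.submoduleE[OF sub, simplified]
 let ?T = "(restrict_scalars io M)\<lparr>carrier := T\<rparr>"
 have modT: "module A ?T" by (rule submodule.submodule_is_module[OF sub MA.module_axioms])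
 interpret T: module A ?T by (rule modT)
 have Tc: "t \<in> T ==> t \<in>. M" for t using Ts(1) by auto
 have TA: "a \<in> SA ==> t \<in> T ==> a \<odot>.M t \<in> T" for a t using Ts(4) by auto
 obtain n e ep0 where db: "dual_basis A ?T n e ep0" using T.finite_locally_free_dual_basis T by (auto simp: is_lattice_def)
 have e: "\<And>i. i < n ==> e i \<in> T" "\<And>i. i < n ==> ep0 i \<in> functionals A ?T"
  "\<And>y. y \<in> T ==> y = (\<Oplus>.?T i\<in>{..<n}. ep0 i y \<odot>.?T e i)" using db by (auto simp: dual_basis_def)
 have ep0: "\<And>i x. i < n ==> x \<in> T ==> ep0 i x \<in>. A"
  "\<And>i x y. i < n ==> x \<in> T ==> y \<in> T ==> ep0 i (x \<oplus>.M y) = ep0 i x \<oplus>.A ep0 i y"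
  "\<And>i x b. i < n ==> b \<in>. A ==> x \<in> T ==> ep0 i (io b \<odot>.M x) = b \<otimes>.A ep0 i x"
  using functionals_simps[OF e(2)] by simp_all
 have inc: "(\<lambda>x. x) \<in> ahom ?T M" by (rule ahomI) (simp_all add: Tc)
 have Tsum: "y = (\<Oplus>.M i\<in>{..<n}. io (ep0 i y) \<odot>.M e i)" if y: "y \<in> T" for y
 proof -
  have "(\<Oplus>.?T i\<in>{..<n}. ep0 i y \<odot>.?T e i) = (\<Oplus>.M i\<in>{..<n}. ep0 i y \<odot>.?T e i)"
   using y e(1) ep0(1) T.smult_closed by (intro ahom_finsum[OF T.M.abelian_group_axioms M.M.abelian_group_axioms inc]) auto
  then show ?thesis using e(3)[OF y] by simp
 qed
 \<comment> \<open>The elements that some power of z moves into \<open>T\<close> form a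
   \<open>C\<close>-submodule, since elements of \<open>C\<close> have z-power denominators; it
   contains \<open>T\<close>, hence is everything.\<close>
 have den: "\<exists>h::nat. zp (int h) \<odot>.M m \<in> T" if "m \<in>. M" for m
 proof -
  define H where "H = {m \<in> carrier M. \<exists>h::nat. zp (int h) \<odot>.M m \<in> T}"
  have up: "zp (int (h + k)) \<odot>.M m \<in> T" if "zp (int h) \<odot>.M m \<in> T" "m \<in>. M" for h k :: nat and m
  proof -
   have "zp (int (h + k)) \<odot>.M m = zp (int k) \<odot>.M (zp (int h) \<odot>.M m)"
    using that by (simp add: zp_add M.smult_assoc1[symmetric] C.m_comm)
   then show ?thesis using TA[OF zp_nonneg that(1), of "int k"] by simp
  qed
  have "submodule H C M"
  proof (rule M.submoduleI)
   show "\<zero>.M \<in> H" using subgroup.one_closed[OF submodule.axioms(1)[OF sub]] by (auto simp: H_def)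
   fix a assume "a \<in> H"
   then obtain h :: nat where h: "a \<in>. M" "zp (int h) \<odot>.M a \<in> T" by (auto simp: H_def)
   have nT: "\<ominus>.M t \<in> T" if "t \<in> T" for t
   proof -
    have "\<ominus>.M t = io (\<ominus>.A \<one>.A) \<odot>.M t" using Tc[OF that] by (simp add: M.smult_l_minus)
    moreover have "io (\<ominus>.A \<one>.A) \<odot>.M t \<in> T" by (rule TA[OF imageI that]) simp
    ultimately show ?thesis by simp
   qed
   have "zp (int h) \<odot>.M (\<ominus>.M a) = \<ominus>.M (zp (int h) \<odot>.M a)" using h by (simp add: M.smult_r_minus)
   then show "\<ominus>.M a \<in> H" using nT[OF h(2)] h(1) unfolding H_def by (intro CollectI conjI exI[of _ h]) simp_all
   fix b assume "b \<in> H"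
   then obtain k :: nat where k: "b \<in>. M" "zp (int k) \<odot>.M b \<in> T" by (auto simp: H_def)
   have "zp (int (h + k)) \<odot>.M (a \<oplus>.M b) \<in> T"
    using Ts(5)[OF up[OF h(2,1), of k] up[OF k(2,1), of h]] h k by (simp add: M.smult_r_distr add.commute)
   then show "a \<oplus>.M b \<in> H" using h k unfolding H_def by blast
  next
   fix c x assume c: "c \<in>. C" and "x \<in> H"
   then obtain h :: nat where h: "x \<in>. M" "zp (int h) \<odot>.M x \<in> T" by (auto simp: H_def)
   obtain k :: nat where k: "zp (int k) \<otimes>.C c \<in> SA" using zp_denominator[OF c] by blast
   have "zp (int (k + h)) \<odot>.M (c \<odot>.M x) = (zp (int k) \<otimes>.C c) \<odot>.M (zp (int h) \<odot>.M x)"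
    using c h by (simp add: zp_add M.smult_assoc1[symmetric] C.m_ac)
   then have "zp (int (k + h)) \<odot>.M (c \<odot>.M x) \<in> T" using TA[OF k h(2)] by simp
   then show "c \<odot>.M x \<in> H" using c h unfolding H_def by blast
  qed (auto simp: H_def)
  moreover have "T \<subseteq> H"
  proof
   fix t assume "t \<in> T"
   then show "t \<in> H" using Tc[of t] by (auto simp: H_def zp_0 intro!: exI[of _ "0::nat"])
  qed
  ultimately have "module_span C M T \<subseteq> H" by (rule module_span_least)
  then show ?thesis using that T by (auto simp: is_lattice_def H_def)
 qed
 define den_of where "den_of m = (SOME h::nat. zp (int h) \<odot>.M m \<in> T)" for m
 have den_of: "zp (int (den_of m)) \<odot>.M m \<in> T" if "m \<in>. M" for m unfolding den_of_def by (rule someI_ex[OF den[OF that]])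
 \<comment> \<open>z^h moves \<open>m\<close> into \<open>T\<close>, where \<open>ep0\<close> is
   defined, and \<open>zp (- h)\<close> undoes it. By \<open>ep_eq\<close> any admissible h gives
   the same value, so two arguments can be treated with one common h.\<close>
 define ep where "ep i m = zp (- int (den_of m)) \<otimes>.C io (ep0 i (zp (int (den_of m)) \<odot>.M m))" for i m
 have shift: "io (ep0 i (zp (int k) \<odot>.M t)) = zp (int k) \<otimes>.C io (ep0 i t)" if i: "i < n" and t: "t \<in> T" for i t and k :: nat
 proof -
  obtain b where b: "b \<in>. A" "zp (int k) = io b" using zp_nonneg[of "int k"] by auto
  then show ?thesis using ep0(1)[OF i t] ep0(3)[OF i b(1) t] by simp
 qed
 have ep_eq: "ep i m = zp (- int h) \<otimes>.C io (ep0 i (zp (int h) \<odot>.M m))"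
  if i: "i < n" and m: "m \<in>. M" and h: "zp (int h) \<odot>.M m \<in> T" for i m and h :: nat
 proof -
  let ?d = "den_of m"
  have common: "zp (- int a) \<otimes>.C io (ep0 i (zp (int a) \<odot>.M m)) = zp (- int (a + b)) \<otimes>.C io (ep0 i (zp (int (a + b)) \<odot>.M m))"
   if "zp (int a) \<odot>.M m \<in> T" for a b :: nat
  proof -
   have "zp (int (a + b)) \<odot>.M m = zp (int b) \<odot>.M (zp (int a) \<odot>.M m)"
    using m by (simp add: zp_add M.smult_assoc1[symmetric] C.m_comm)
   then have "zp (- int (a + b)) \<otimes>.C io (ep0 i (zp (int (a + b)) \<odot>.M m)) =
    (zp (- int (a + b)) \<otimes>.C zp (int b)) \<otimes>.C io (ep0 i (zp (int a) \<odot>.M m))"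
    using ep0(1)[OF i that] by (simp add: shift[OF i that] C.m_assoc)
   then show ?thesis by (simp flip: zp_add)
  qed
  show ?thesis unfolding ep_def using common[OF den_of[OF m], of h] common[OF h, of ?d] by (simp add: add.commute)
 qed
 have ep_T: "ep i t = io (ep0 i t)" if "i < n" "t \<in> T" for i t
  using ep_eq[OF that(1) Tc[OF that(2)], of 0] that Tc[OF that(2)] ep0(1)[OF that] by (simp add: zp_0)
 have epf: "ep i \<in> functionals C M" if i: "i < n" for i
 proof (rule functionalsI)
  fix x assume x: "x \<in>. M"
  obtain h :: nat where h: "zp (int h) \<odot>.M x \<in> T" using den[OF x] by blast
  show "ep i x \<in>. C" using ep_eq[OF i x h] ep0(1)[OF i h] by simp
  {
   fix c assume c: "c \<in>. C"
   obtain k :: nat where "zp (int k) \<otimes>.C c \<in> SA" using zp_denominator[OF c] by blast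
   then obtain b where b: "b \<in>. A" "zp (int k) \<otimes>.C c = io b" by blast
   have 1: "zp (int (k + h)) \<odot>.M (c \<odot>.M x) = io b \<odot>.M (zp (int h) \<odot>.M x)"
    unfolding b(2)[symmetric] using c x by (simp add: zp_add M.smult_assoc1[symmetric] C.m_ac)
   then have 2: "zp (int (k + h)) \<odot>.M (c \<odot>.M x) \<in> T" using TA[of "io b", OF _ h] b by simp
   have "ep i (c \<odot>.M x) = zp (- int (k + h)) \<otimes>.C (io b \<otimes>.C io (ep0 i (zp (int h) \<odot>.M x)))"
    using ep_eq[OF i _ 2] c x b ep0(1,3)[OF i] h unfolding 1 by simp
   also have "\<dots> = (zp (- int (k + h)) \<otimes>.C zp (int k)) \<otimes>.C c \<otimes>.C io (ep0 i (zp (int h) \<odot>.M x))"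
    unfolding b(2)[symmetric] using c ep0(1)[OF i h] by (simp add: C.m_assoc)
   also have "zp (- int (k + h)) \<otimes>.C zp (int k) = zp (- int h)" by (simp flip: zp_add)
   also have "zp (- int h) \<otimes>.C c \<otimes>.C io (ep0 i (zp (int h) \<odot>.M x)) = c \<otimes>.C ep i x"
    using ep_eq[OF i x h] c ep0(1)[OF i h] by (simp add: C.m_ac)
   finally show "ep i (c \<odot>.M x) = c \<otimes>.C ep i x" .
  }
  fix y assume y: "y \<in>. M"
  obtain k :: nat where k: "zp (int k) \<odot>.M y \<in> T" using den[OF y] by blast
  have up: "zp (int (a + b)) \<odot>.M u \<in> T" if "u \<in>. M" "zp (int a) \<odot>.M u \<in> T" for a b :: nat and u
  proof -
   have "zp (int (a + b)) \<odot>.M u = zp (int b) \<odot>.M (zp (int a) \<odot>.M u)"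
    using that by (simp add: zp_add M.smult_assoc1[symmetric] C.m_comm)
   then show ?thesis using TA[OF zp_nonneg that(2), of "int b"] by simp
  qed
  let ?h = "h + k"
  have hx: "zp (int ?h) \<odot>.M x \<in> T" by (rule up[OF x h])
  have hy: "zp (int ?h) \<odot>.M y \<in> T" using up[OF y k, of h] by (simp add: add.commute)
  have d: "zp (int ?h) \<odot>.M (x \<oplus>.M y) = zp (int ?h) \<odot>.M x \<oplus>.M zp (int ?h) \<odot>.M y"
   using x y by (simp add: M.smult_r_distr)
  have "zp (int ?h) \<odot>.M (x \<oplus>.M y) \<in> T" unfolding d by (rule Ts(5)[OF hx hy])
  from ep_eq[OF i _ this] x y have "ep i (x \<oplus>.M y) = zp (- int ?h) \<otimes>.C io (ep0 i (zp (int ?h) \<odot>.M x \<oplus>.M zp (int ?h) \<odot>.M y))"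
   unfolding d by simp
  also have "\<dots> = ep i x \<oplus>.C ep i y" unfolding ep_eq[OF i x hx] ep_eq[OF i y hy] ep0(2)[OF i hx hy]
   using ep0(1)[OF i hx] ep0(1)[OF i hy] by (simp add: C.r_distr)
  finally show "ep i (x \<oplus>.M y) = ep i x \<oplus>.C ep i y" .
 qed
 have "m = (\<Oplus>.M i\<in>{..<n}. ep i m \<odot>.M e i)" if m: "m \<in>. M" for m
 proof -
  obtain h :: nat where h: "zp (int h) \<odot>.M m \<in> T" using den[OF m] by blast
  have "m = zp (- int h) \<odot>.M (zp (int h) \<odot>.M m)" using m by (simp add: M.smult_assoc1[symmetric] zp_cancel)
  also have "\<dots> = zp (- int h) \<odot>.M (\<Oplus>.M i\<in>{..<n}. io (ep0 i (zp (int h) \<odot>.M m)) \<odot>.M e i)" using Tsum[OF h] by simp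
  also have "\<dots> = (\<Oplus>.M i\<in>{..<n}. zp (- int h) \<odot>.M (io (ep0 i (zp (int h) \<odot>.M m)) \<odot>.M e i))"
   using e(1) Tc ep0(1)[OF _ h] by (intro M.finsum_smult_ldistr) auto
  also have "\<dots> = (\<Oplus>.M i\<in>{..<n}. ep i m \<odot>.M e i)"
   using e(1) Tc ep0(1)[OF _ h] ep_eq[OF _ m h] by (intro M.M.finsum_cong') (auto simp: M.smult_assoc1)
  finally show ?thesis .
 qed
 then have "dual_basis C M n e ep" unfolding dual_basis_def using e(1) Tc epf by auto
 moreover have "\<forall>i<n. \<forall>t\<in>T. ep i t \<in> SA" using ep_T ep0(1) by auto
 ultimately show ?thesis using e(1) by blast
qed

text \<open>The two inclusions between z^a T and the span of \<tau>^n T. The second is phrased with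
  an arbitrary submodule \<open>H\<close> containing \<tau>^n T, the form in which it is applied:
  \<open>H\<close> will be the set of elements whose coordinates satisfy a condition.\<close>

definition tau_scales :: "('c, 'm) tau_module \<Rightarrow> 'm set \<Rightarrow> nat \<Rightarrow> int \<Rightarrow> bool" where
 "tau_scales M T n a \<longleftrightarrow> (\<forall>t\<in>T. \<exists>t'\<in>T. (tau M ^^ n) t = zp a \<odot>.M t') \<and>
  (\<forall>H. submodule H A (restrict_scalars io M) \<longrightarrow> (\<forall>t\<in>T. (tau M ^^ n) t \<in> H) \<longrightarrow> (\<forall>t\<in>T. zp a \<odot>.M t \<in> H))"

lemma tau_pow:
 assumes M: "left_tau_module C sgC M"
 shows tau_pow_closed: "x \<in>. M ==> (tau M ^^ n) x \<in>. M"
  and tau_pow_add: "x \<in>. M ==> y \<in>. M ==> (tau M ^^ n) (x \<oplus>.M y) = (tau M ^^ n) x \<oplus>.M (tau M ^^ n) y"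
  and tau_pow_smult: "c \<in>. C ==> x \<in>. M ==> (tau M ^^ n) (c \<odot>.M x) = (sgC ^^ n) c \<odot>.M (tau M ^^ n) x"
proof -
 have t: "m \<in>. M ==> tau M m \<in>. M"
  "m \<in>. M ==> m' \<in>. M ==> tau M (m \<oplus>.M m') = tau M m \<oplus>.M tau M m'"
  "b \<in>. C ==> m \<in>. M ==> tau M (b \<odot>.M m) = sgC b \<odot>.M tau M m" for m m' b
  using M by (auto simp: left_tau_module_def)
 show c: "x \<in>. M ==> (tau M ^^ n) x \<in>. M" for x n by (induction n) (auto simp: t)
 show "x \<in>. M ==> y \<in>. M ==> (tau M ^^ n) (x \<oplus>.M y) = (tau M ^^ n) x \<oplus>.M (tau M ^^ n) y"
  by (induction n) (auto simp: t c)
 show "c \<in>. C ==> x \<in>. M ==> (tau M ^^ n) (c \<odot>.M x) = (sgC ^^ n) c \<odot>.M (tau M ^^ n) x"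
  using sg_pow_comm[of c] by (induction n) (auto simp: t c)
qed

text \<open>\<open>g\<close> may be semilinear, as a power of \<tau> is: a scalar from
  \<open>SA\<close> only has to come out as some scalar from \<open>SA\<close>.\<close>

lemma submodule_scale_preimage:
 fixes M :: "('c, 'm, 'z) module_scheme"
 assumes M: "module C M" and H: "submodule H A (restrict_scalars io M)" and g: "g \<in> ahom M M"
  and sc: "\<And>b x. b \<in> SA ==> x \<in>. M ==> \<exists>b'\<in>SA. g (b \<odot>.M x) = b' \<odot>.M g x"
 shows "submodule {x \<in> carrier M. g x \<in> H} A (restrict_scalars io M)"
proof -
 interpret M: module C M by (rule M)
 interpret MA: module A "restrict_scalars io M" by (rule restrict_scalars_module[OF A M io])
 note Hs = MA.submoduleE[OF H, simplified]
 have HA: "b \<in> SA ==> h \<in> H ==> b \<odot>.M h \<in> H" for b h using Hs(4) by auto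
 have H0: "\<zero>.M \<in> H" using subgroup.one_closed[OF submodule.axioms(1)[OF H]] by simp
 have smul: "io b \<odot>.M x \<in> {x \<in> carrier M. g x \<in> H}" if "b \<in>. A" "x \<in> {x \<in> carrier M. g x \<in> H}" for b x
 proof -
  from sc[of "io b" x] that obtain b' where "b' \<in> SA" "g (io b \<odot>.M x) = b' \<odot>.M g x" by blast
  then show ?thesis using HA[of b' "g x"] that by simp
 qed
 show ?thesis
 proof (rule MA.submoduleI)
  show "\<zero>\<^bsub>restrict_scalars io M\<^esub> \<in> {x \<in> carrier M. g x \<in> H}"
   using ahom_zero[OF M.M.abelian_group_axioms M.M.abelian_group_axioms g] H0 by simp
  fix a assume a: "a \<in> {x \<in> carrier M. g x \<in> H}"
  have "\<ominus>\<^bsub>restrict_scalars io M\<^esub> a = (\<ominus>.A \<one>.A) \<odot>\<^bsub>restrict_scalars io M\<^esub> a"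
   using a MA.smult_l_minus[of "\<one>.A" a] MA.smult_one[of a] by (simp only: A.one_closed restrict_scalars_simps(1) mem_Collect_eq)
  then show "\<ominus>\<^bsub>restrict_scalars io M\<^esub> a \<in> {x \<in> carrier M. g x \<in> H}" using smul[OF _ a, of "\<ominus>.A \<one>.A"] by simp
  fix b assume "b \<in> {x \<in> carrier M. g x \<in> H}"
  then show "a \<oplus>\<^bsub>restrict_scalars io M\<^esub> b \<in> {x \<in> carrier M. g x \<in> H}" using a Hs(5) by (simp add: ahom_add[OF g])
 next
  fix b x assume "b \<in>. A" "x \<in> {x \<in> carrier M. g x \<in> H}"
  then show "b \<odot>\<^bsub>restrict_scalars io M\<^esub> x \<in> {x \<in> carrier M. g x \<in> H}" using smul by simp
 qed auto
qed

text \<open>Allows two pure isocrystals to be compared at one exponent. The powers of z multiply up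
  because \<sigma> fixes z.\<close>

lemma tau_scales_pow:
 assumes M: "left_tau_module C sgC M" and Tc: "T \<subseteq> carrier M" and s: "tau_scales M T n a"
 shows "tau_scales M T (k * n) (int k * a)"
proof (induction k)
 case 0
 have mod: "module C M" using M by (simp add: left_tau_module_def)
 interpret M: module C M by (rule mod)
 show ?case unfolding tau_scales_def using Tc by (auto simp: zp_0 subset_iff)
next
 case (Suc k)
 have mod: "module C M" using M by (simp add: left_tau_module_def)
 interpret M: module C M by (rule mod)
 note tp = tau_pow[OF M]
 have split: "(tau M ^^ (Suc k * n)) x = (tau M ^^ (k * n)) ((tau M ^^ n) x)" for x
 proof -
  have "Suc k * n = k * n + n" by simp
  then show ?thesis by (simp only: funpow_add o_apply)
 qed
 have zs: "zp (int (Suc k) * a) = zp a \<otimes>.C zp (int k * a)" by (simp flip: zp_add add: algebra_simps)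
 show ?case unfolding tau_scales_def
 proof (intro conjI ballI allI impI)
  fix t assume "t \<in> T"
  then obtain t' where t': "t' \<in> T" "(tau M ^^ n) t = zp a \<odot>.M t'" using s by (auto simp: tau_scales_def)
  obtain t'' where t'': "t'' \<in> T" "(tau M ^^ (k * n)) t' = zp (int k * a) \<odot>.M t''" using Suc t' by (auto simp: tau_scales_def)
  have "(tau M ^^ (Suc k * n)) t = zp (int (Suc k) * a) \<odot>.M t''"
   unfolding split t'(2) zs using t' t'' Tc by (simp add: tp(3) zp_pow_sg M.smult_assoc1 subset_iff)
  then show "\<exists>t'\<in>T. (tau M ^^ (Suc k * n)) t = zp (int (Suc k) * a) \<odot>.M t'" using t'' by blast
 next
  fix H t assume H: "submodule H A (restrict_scalars io M)" and HT: "\<forall>t\<in>T. (tau M ^^ (Suc k * n)) t \<in> H" and t: "t \<in> T"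
  \<comment> \<open>The power \<tau>^((k+1)n) is peeled off in two stages. \<open>?H1\<close>
    removes \<tau>^(kn), so that z^a T lies in \<open>?H1\<close>; since z^a commutes with
    \<tau>^(kn), the set \<open>?H2\<close> below contains \<tau>^(kn) T.\<close>
  let ?H1 = "{x \<in> carrier M. (tau M ^^ (k * n)) x \<in> H}"
  have H1: "submodule ?H1 A (restrict_scalars io M)"
  proof (rule submodule_scale_preimage[OF mod H])
   show "(tau M ^^ (k * n)) \<in> ahom M M" by (intro ahomI) (simp_all add: tp)
   show "\<exists>b'\<in>SA. (tau M ^^ (k * n)) (b \<odot>.M x) = b' \<odot>.M (tau M ^^ (k * n)) x" if "b \<in> SA" "x \<in>. M" for b x
    using tp(3)[OF SA_closed[OF that(1)] that(2)] sgC_pow_SA[OF that(1)] by blast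
  qed
  have "\<forall>t\<in>T. (tau M ^^ n) t \<in> ?H1" using HT Tc tp(1) by (auto simp: split[symmetric])
  then have zH1: "\<forall>t\<in>T. zp a \<odot>.M t \<in> ?H1" using s H1 by (auto simp: tau_scales_def)
  let ?H2 = "{x \<in> carrier M. zp a \<odot>.M x \<in> H}"
  have H2: "submodule ?H2 A (restrict_scalars io M)"
  proof (rule submodule_scale_preimage[OF mod H])
   show "(\<lambda>x. zp a \<odot>.M x) \<in> ahom M M" by (intro ahomI) (auto simp: M.smult_r_distr)
   show "\<exists>b'\<in>SA. zp a \<odot>.M (b \<odot>.M x) = b' \<odot>.M (zp a \<odot>.M x)" if "b \<in> SA" "x \<in>. M" for b x
    using that SA_closed[OF that(1)] by (intro bexI[of _ b]) (simp_all add: M.smult_assoc1[symmetric] C.m_comm)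
  qed
  have "\<forall>t\<in>T. (tau M ^^ (k * n)) t \<in> ?H2"
  proof
   fix t assume t: "t \<in> T"
   then have "(tau M ^^ (k * n)) (zp a \<odot>.M t) \<in> H" using zH1 by blast
   then show "(tau M ^^ (k * n)) t \<in> ?H2" using t Tc tp(1) by (auto simp: tp(3) zp_pow_sg subset_iff)
  qed
  then have "zp (int k * a) \<odot>.M t \<in> ?H2" using Suc H2 t by (auto simp: tau_scales_def)
  then show "zp (int (Suc k) * a) \<odot>.M t \<in> H" unfolding zs using t Tc by (auto simp: M.smult_assoc1 subset_iff)
 qed
qed

end

section \<open>Morphisms of base changes as matrices with respect to two lattices\<close>

context bounded_base_change
begin

abbreviation "bco M \<equiv> base_change_obj C ph D sgD M"
abbreviation "bpt M \<equiv> pure_tensor C (algebra_via ph D) M"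

lemma lattice_data:
 assumes "isocrystal C sgC M"
 shows ltm: "left_tau_module C sgC M" and lmod: "module C M"
  and bco_ltm: "left_tau_module D sgD (bco M)"
  and bco_ext: "scalar_ext C ph D M (bco M) (bpt M)"
  and bco_tau: "d \<in>. D ==> m \<in>. M ==> tau (bco M) (bpt M d m) = bpt M (sgD d) (tau M m)"
proof -
 show l: "left_tau_module C sgC M" using assms by (simp add: isocrystal_def)
 then show "module C M" by (simp add: left_tau_module_def)
 show "left_tau_module D sgD (bco M)" "scalar_ext C ph D M (bco M) (bpt M)"
  "d \<in>. D ==> m \<in>. M ==> tau (bco M) (bpt M d m) = bpt M (sgD d) (tau M m)"
  using left_tau_base_change[OF C D ph sgC sgD sg_comm l] by blast+
qed

lemma bco_tau_pow:
 assumes iso: "isocrystal C sgC M"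
 shows "X \<in> carrier (bco M) ==> (tau (bco M) ^^ n) X \<in> carrier (bco M)"
  and "X \<in> carrier (bco M) ==> Y \<in> carrier (bco M) ==>
   (tau (bco M) ^^ n) (X \<oplus>\<^bsub>bco M\<^esub> Y) = (tau (bco M) ^^ n) X \<oplus>\<^bsub>bco M\<^esub> (tau (bco M) ^^ n) Y"
  and "d \<in>. D ==> m \<in>. M ==> (tau (bco M) ^^ n) (bpt M d m) = bpt M ((sgD ^^ n) d) ((tau M ^^ n) m)"
proof -
 have t: "X \<in> carrier (bco M) ==> tau (bco M) X \<in> carrier (bco M)"
  "X \<in> carrier (bco M) ==> Y \<in> carrier (bco M) ==> tau (bco M) (X \<oplus>\<^bsub>bco M\<^esub> Y) = tau (bco M) X \<oplus>\<^bsub>bco M\<^esub> tau (bco M) Y" for X Y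
  using lattice_data(3)[OF iso] by (auto simp: left_tau_module_def)
 show c: "X \<in> carrier (bco M) ==> (tau (bco M) ^^ n) X \<in> carrier (bco M)" for X n by (induction n) (auto simp: t)
 show "X \<in> carrier (bco M) ==> Y \<in> carrier (bco M) ==>
   (tau (bco M) ^^ n) (X \<oplus>\<^bsub>bco M\<^esub> Y) = (tau (bco M) ^^ n) X \<oplus>\<^bsub>bco M\<^esub> (tau (bco M) ^^ n) Y"
  by (induction n) (auto simp: t c)
 show "d \<in>. D ==> m \<in>. M ==> (tau (bco M) ^^ n) (bpt M d m) = bpt M ((sgD ^^ n) d) ((tau M ^^ n) m)"
  by (induction n)
    (auto simp: lattice_data(5)[OF iso] tau_pow(1)[OF lattice_data(1)[OF iso]] ring_hom_closed[OF sgD_pow])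
qed

text \<open>
 The entries of the matrix of a morphism with respect to generators of the two lattices satisfy a
 Frobenius equation twisted by a power of \<open>z\<close>; the sign of the exponent decides whether they are
 bounded or zero.
\<close>

lemma matrix_in_image:
 fixes M :: "('c, 'm) tau_module" and N :: "('c, 'n) tau_module"
 assumes isoM: "isocrystal C sgC M" and isoN: "isocrystal C sgC N"
  and T: "is_lattice M T" and T': "is_lattice N T'" and n: "0 < n"
  and sM: "tau_scales M T n a" and sN: "tau_scales N T' n b"
  and dM: "dual_basis C M p e ep" "\<And>j. j < p ==> e j \<in> T" "\<And>j t. j < p ==> t \<in> T ==> ep j t \<in> SA"
  and dN: "dual_basis C N q e' ep'" "\<And>j. j < q ==> e' j \<in> T'" "\<And>j t. j < q ==> t \<in> T' ==> ep' j t \<in> SA"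
  and f: "f \<in> isocrystal_hom D (bco M) (bco N)"
 shows "\<forall>i<q. \<forall>j<p. scalar_ext.hat ph D N (bco N) (bpt N) (ep' i) (f (bpt M \<one>.D (e j))) \<in> ph ` carrier C"
proof -
 interpret X: scalar_ext C ph D M "bco M" "bpt M" by (rule lattice_data(4)[OF isoM])
 interpret Y: scalar_ext C ph D N "bco N" "bpt N" by (rule lattice_data(4)[OF isoN])
 let ?u = "bpt M \<one>.D" and ?v = "bpt N \<one>.D"
 have Tc: "T \<subseteq> carrier M" "T' \<subseteq> carrier N"
  using T T' subgroup.subset[OF submodule.axioms(1)] by (fastforce simp: is_lattice_def)+
 have f': "X \<in> carrier (bco M) ==> f X \<in> carrier (bco N)"
  "X \<in> carrier (bco M) ==> Y \<in> carrier (bco M) ==> f (X \<oplus>\<^bsub>bco M\<^esub> Y) = f X \<oplus>\<^bsub>bco N\<^esub> f Y"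
  "d \<in>. D ==> X \<in> carrier (bco M) ==> f (d \<odot>\<^bsub>bco M\<^esub> X) = d \<odot>\<^bsub>bco N\<^esub> f X"
  "X \<in> carrier (bco M) ==> f (tau (bco M) X) = tau (bco N) (f X)" for X Y d using f by (auto simp: isocrystal_hom_def)
 have fa: "f \<in> ahom (bco M) (bco N)" using f' by (intro ahomI) auto
 have f_pow: "X \<in> carrier (bco M) ==> f ((tau (bco M) ^^ k) X) = (tau (bco N) ^^ k) (f X)" for X k
  by (induction k) (auto simp: f'(4) bco_tau_pow(1)[OF isoM])
 have e: "\<And>j. j < p ==> e j \<in>. M" "\<And>j. j < p ==> ep j \<in> functionals C M"
  "\<And>y. y \<in>. M ==> y = (\<Oplus>.M j\<in>{..<p}. ep j y \<odot>.M e j)" using dM(1) by (auto simp: dual_basis_def)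
 have e': "\<And>j. j < q ==> e' j \<in>. N" "\<And>j. j < q ==> ep' j \<in> functionals C N"
  using dN(1) by (auto simp: dual_basis_def)
 have Yexp: "Z = (\<Oplus>\<^bsub>bco N\<^esub>m\<in>{..<q}. Y.hat (ep' m) Z \<odot>\<^bsub>bco N\<^esub> ?v (e' m))" if "Z \<in> carrier (bco N)" for Z
  using Y.dual_basis_ext[OF dN(1)] that by (auto simp: dual_basis_def)
 note h = functionals_simps[OF Y.hat_functional[OF e'(2)]]
 define g where "g i j = Y.hat (ep' i) (f (?u (e j)))" for i j
 define G where "G = (\<lambda>(i, j). g i j) ` ({..<q} \<times> {..<p})"
 have uc: "m \<in>. M ==> ?u m \<in> carrier (bco M)" for m by simp
 have gc: "i < q ==> j < p ==> g i j \<in>. D" for i j unfolding g_def using h(1) f'(1) e(1) by simp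
 then have G: "finite G" "G \<subseteq> carrier D" by (auto simp: G_def)
 have gG: "i < q ==> j < p ==> g i j \<in> G" for i j by (auto simp: G_def)
 \<comment> \<open>As \<open>ep j t\<close> lies in \<open>SA\<close>, the coordinates of the image
   of any \<open>t \<in> T\<close> lie in the span of \<open>G\<close>, not only those of the
   generators.\<close>
 have coeff: "Y.hat (ep' i) (f (?u t)) \<in> span_over D SD G" if i: "i < q" and t: "t \<in> T" for i t
 proof -
  have tc: "t \<in>. M" using t Tc by blast
  have epc: "j < p ==> ep j t \<in>. C" for j using dM(3)[OF _ t] SA_closed by blast
  have "f (?u t) = f (\<Oplus>\<^bsub>bco M\<^esub>j\<in>{..<p}. ?u (ep j t \<odot>.M e j))"
   using X.pt_finsum[of "\<one>.D" "\<lambda>j. ep j t \<odot>.M e j" "{..<p}"] e(1) epc e(3)[OF tc] by (simp add: Pi_iff)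
  also have "\<dots> = (\<Oplus>\<^bsub>bco N\<^esub>j\<in>{..<p}. f (?u (ep j t \<odot>.M e j)))"
   using e(1) epc by (intro ahom_finsum[OF X.E.M.abelian_group_axioms Y.E.M.abelian_group_axioms fa]) auto
  finally have "Y.hat (ep' i) (f (?u t)) = Y.hat (ep' i) (\<Oplus>\<^bsub>bco N\<^esub>j\<in>{..<p}. f (?u (ep j t \<odot>.M e j)))" by simp
  also have "\<dots> = (\<Oplus>.D j\<in>{..<p}. Y.hat (ep' i) (f (?u (ep j t \<odot>.M e j))))"
   using e(1) epc f'(1) by (intro ahom_finsum[OF Y.E.M.abelian_group_axioms D.abelian_group_axioms h(4)[OF i]]) auto
  also have "\<dots> \<in> span_over D SD G"
  proof (rule D.span_over_finsum[OF SD_sub G(2)])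
   fix j assume "j \<in> {..<p}"
   then have j: "j < p" by simp
   have "Y.hat (ep' i) (f (?u (ep j t \<odot>.M e j))) = ph (ep j t) \<otimes>.D g i j"
    using e(1)[OF j] epc[OF j] f'(1,3) h(3)[OF i] by (simp add: X.unit_smult g_def)
   then show "Y.hat (ep' i) (f (?u (ep j t \<odot>.M e j))) \<in> span_over D SD G" using dM(3)[OF j t] gG[OF i j] by (auto intro: span_over.smult)
  qed
  finally show ?thesis .
 qed
 have "G \<subseteq> ph ` carrier C"
 proof (cases "0 \<le> a - b")
  case True
  show ?thesis
  proof (rule bounded[OF G n])
   fix x assume "x \<in> G"
   then obtain i j where ij: "i < q" "j < p" "x = g i j" by (auto simp: G_def)
   \<comment> \<open>\<open>lam\<close> inverts \<tau>^n on the i-th coordinate: applied to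
     f(\<tau>^n(1 \<otimes> e_j)) = \<tau>^n f(1 \<otimes> e_j) it returns \<sigma>^n of the matrix
     entry.\<close>
   obtain lam where lam: "lam \<in> functionals C N" "\<And>y. y \<in>. N ==> lam ((tau N ^^ n) y) = (sgC ^^ n) (ep' i y)"
    using isocrystal_twisted_functional[OF C sgC isoN e'(2)[OF ij(1)]] by blast
   note ls = functionals_simps[OF lam(1)] and hl = functionals_simps[OF Y.hat_functional[OF lam(1)]]
   have lam_hat: "Y.hat lam ((tau (bco N) ^^ n) Z) = (sgD ^^ n) (Y.hat (ep' i) Z)" if "Z \<in> carrier (bco N)" for Z using that
   proof (induction rule: Y.pt_induct)
    case (pure d m)
    then show ?case using tau_pow(1)[OF lattice_data(1)[OF isoN]] functionals_simps(1)[OF e'(2)[OF ij(1)]] ring_hom_closed[OF sgD_pow]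
     by (simp add: bco_tau_pow(3)[OF isoN] Y.hat_pt[OF lam(1)] Y.hat_pt[OF e'(2)[OF ij(1)]] lam(2) sg_pow_comm ring_hom_mult[OF sgD_pow])
   next
    case (add U V)
    then show ?case using h(1,2)[OF ij(1)] hl(2) by (simp add: bco_tau_pow[OF isoN] ring_hom_add[OF sgD_pow])
   qed
   \<comment> \<open>The elements on which \<open>lam\<close> is integral form a submodule
     containing \<tau>^n T', hence also z^b T'.\<close>
   have lamT: "zp b \<otimes>.C lam (e' m) \<in> SA" if m: "m < q" for m
   proof -
    interpret MA: module A "restrict_scalars io N" by (rule restrict_scalars_module[OF A Y.M.module_axioms io])
    let ?H = "{y \<in> carrier N. lam y \<in> SA}"
    have sm: "c \<odot>\<^bsub>restrict_scalars io N\<^esub> y \<in> ?H" if "c \<in>. A" "y \<in> ?H" for c y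
     using that ls(3)[of "io c" y] SA_mult[of "io c" "lam y"] by auto
    have "submodule ?H A (restrict_scalars io N)"
    proof (rule MA.submoduleI)
     show "\<zero>\<^bsub>restrict_scalars io N\<^esub> \<in> ?H"
      using ahom_zero[OF Y.M.M.abelian_group_axioms C.abelian_group_axioms ls(4)] io.hom_zero by (auto intro: rev_image_eqI[of "\<zero>.A"])
     fix y assume y: "y \<in> ?H"
     have "\<ominus>\<^bsub>restrict_scalars io N\<^esub> y = (\<ominus>.A \<one>.A) \<odot>\<^bsub>restrict_scalars io N\<^esub> y"
      using y MA.smult_l_minus[of "\<one>.A" y] MA.smult_one[of y] by (simp only: A.one_closed restrict_scalars_simps(1) mem_Collect_eq)
     then show "\<ominus>\<^bsub>restrict_scalars io N\<^esub> y \<in> ?H" using sm[OF _ y, of "\<ominus>.A \<one>.A"] by simp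
     fix y' assume "y' \<in> ?H"
     then show "y \<oplus>\<^bsub>restrict_scalars io N\<^esub> y' \<in> ?H"
      using y ls(2)[of y y'] SA_add[of "lam y" "lam y'"] by (simp only: mem_Collect_eq restrict_scalars_simps Y.M.M.a_closed simp_thms)
    qed (use sm in auto)
    moreover have "\<forall>t\<in>T'. (tau N ^^ n) t \<in> ?H"
     using Tc tau_pow(1)[OF lattice_data(1)[OF isoN]] lam(2) sgC_pow_SA dN(3)[OF ij(1)] by (simp add: subset_iff)
    ultimately have "zp b \<odot>.N e' m \<in> ?H" using sN dN(2)[OF m] unfolding tau_scales_def by blast
    then show ?thesis using ls(3) e'(1)[OF m] by simp
   qed
   from dM(2)[OF ij(2)] sM obtain t where t: "t \<in> T" "(tau M ^^ n) (e j) = zp a \<odot>.M t" by (auto simp: tau_scales_def)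
   have tc: "t \<in>. M" using t Tc by blast
   define Z where "Z = f (?u t)"
   have Z: "Z \<in> carrier (bco N)" unfolding Z_def using f'(1) tc by simp
   have "(sgD ^^ n) x = Y.hat lam (f ((tau (bco M) ^^ n) (?u (e j))))" using lam_hat f'(1) e(1)[OF ij(2)] f_pow unfolding ij(3) g_def by simp
   also have "(tau (bco M) ^^ n) (?u (e j)) = ph (zp a) \<odot>\<^bsub>bco M\<^esub> ?u t"
    using e(1)[OF ij(2)] tc t(2) by (simp add: bco_tau_pow(3)[OF isoM] ring_hom_one[OF sgD_pow] X.unit_smult)
   also have "Y.hat lam (f (ph (zp a) \<odot>\<^bsub>bco M\<^esub> ?u t)) = ph (zp a) \<otimes>.D Y.hat lam Z"
    unfolding Z_def using tc f'(1,3) hl(3) by simp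
   also have "Y.hat lam Z = Y.hat lam (\<Oplus>\<^bsub>bco N\<^esub>m\<in>{..<q}. Y.hat (ep' m) Z \<odot>\<^bsub>bco N\<^esub> ?v (e' m))"
    using Yexp[OF Z] by simp
   also have "\<dots> = (\<Oplus>.D m\<in>{..<q}. Y.hat lam (Y.hat (ep' m) Z \<odot>\<^bsub>bco N\<^esub> ?v (e' m)))"
    using h(1) Z e'(1) by (intro ahom_finsum[OF Y.E.M.abelian_group_axioms D.abelian_group_axioms hl(4)]) auto
   also have "ph (zp a) \<otimes>.D \<dots> = (\<Oplus>.D m\<in>{..<q}. ph (zp a) \<otimes>.D Y.hat lam (Y.hat (ep' m) Z \<odot>\<^bsub>bco N\<^esub> ?v (e' m)))"
    using h(1) hl(1) Z e'(1) by (intro D.finsum_rdistr) auto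
   also have "\<dots> \<in> span_over D SD G"
   proof (rule D.span_over_finsum[OF SD_sub G(2)])
    fix m assume "m \<in> {..<q}"
    then have m: "m < q" by simp
    have lc: "lam (e' m) \<in>. C" using ls(1) e'(1)[OF m] .
    have "ph (zp a) \<otimes>.D Y.hat lam (Y.hat (ep' m) Z \<odot>\<^bsub>bco N\<^esub> ?v (e' m)) = ph (zp a \<otimes>.C lam (e' m)) \<otimes>.D Y.hat (ep' m) Z"
     using h(1)[OF m Z] e'(1)[OF m] lc by (simp add: hl(3) Y.hat_pt[OF lam(1)] D.m_ac)
    \<comment> \<open>The factor z^a comes from \<tau>^n e_j; z^b of it is spent on making
      \<open>lam (e' m)\<close> integral, and the remaining z^(a-b) is integral in this
      case.\<close>
    also have "zp a \<otimes>.C lam (e' m) = zp (a - b) \<otimes>.C (zp b \<otimes>.C lam (e' m))"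
     using lc by (simp add: C.m_assoc[symmetric] flip: zp_add)
    finally show "ph (zp a) \<otimes>.D Y.hat lam (Y.hat (ep' m) Z \<odot>\<^bsub>bco N\<^esub> ?v (e' m)) \<in> span_over D SD G"
     using span_smult_SA[OF G(2) SA_mult[OF zp_nonneg[OF True] lamT[OF m]] coeff[OF m t(1), folded Z_def]] by simp
   qed
   finally show "(sgD ^^ n) x \<in> span_over D SD G" .
  qed
 next
  case False
  then have neg: "0 < b - a" by simp
  have G': "(sgD ^^ n) ` G \<subseteq> carrier D" using G(2) ring_hom_closed[OF sgD_pow] by auto
  have "G \<subseteq> {\<zero>.D}"
  proof (rule vanishing[OF G neg, of n])
   fix x assume "x \<in> G"
   then obtain i j where ij: "i < q" "j < p" "x = g i j" by (auto simp: G_def)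
   interpret MA: module A "restrict_scalars io M" by (rule restrict_scalars_module[OF A X.M.module_axioms io])
   let ?c = "\<lambda>y. Y.hat (ep' i) (f (?u y))"
   have ca: "?c \<in> ahom M D" by (rule ahomI) (use f' h(1,2)[OF ij(1)] in \<open>simp_all add: X.pt_add_right\<close>)
   \<comment> \<open>Here the entries are expressed by their own Frobenius images. The set of y
     whose i-th coordinate is z^b times an element of the span of \<sigma>^n G contains \<tau>^n T,
     hence z^a e_j.\<close>
   let ?H = "{y \<in> carrier M. \<exists>x\<in>span_over D SD ((sgD ^^ n) ` G). ?c y = ph (zp b) \<otimes>.D x}"
   note spc = D.span_over_closed[OF SD_sub G']
   have sm: "c \<odot>\<^bsub>restrict_scalars io M\<^esub> y \<in> ?H" if c: "c \<in>. A" and y: "y \<in> ?H" for c y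
   proof -
    obtain x where x: "x \<in> span_over D SD ((sgD ^^ n) ` G)" "?c y = ph (zp b) \<otimes>.D x" using y by blast
    have "?c (io c \<odot>.M y) = ph (io c) \<otimes>.D ?c y" using c y f'(1,3) h(3)[OF ij(1)] by (simp add: X.unit_smult)
    then have "?c (io c \<odot>.M y) = ph (zp b) \<otimes>.D (ph (io c) \<otimes>.D x)"
     unfolding x(2) using c spc[OF x(1)] by (simp add: D.m_lcomm)
    moreover have "ph (io c) \<otimes>.D x \<in> span_over D SD ((sgD ^^ n) ` G)" using span_smult_SA[OF G' _ x(1)] c by blast
    ultimately show ?thesis using c y by auto
   qed
   have "submodule ?H A (restrict_scalars io M)"
   proof (rule MA.submoduleI)
    show "\<zero>\<^bsub>restrict_scalars io M\<^esub> \<in> ?H"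
     using ahom_zero[OF X.M.M.abelian_group_axioms D.abelian_group_axioms ca] by (auto intro: bexI[OF _ span_over.zero])
    fix y assume y: "y \<in> ?H"
    have "\<ominus>\<^bsub>restrict_scalars io M\<^esub> y = (\<ominus>.A \<one>.A) \<odot>\<^bsub>restrict_scalars io M\<^esub> y"
     using y MA.smult_l_minus[of "\<one>.A" y] MA.smult_one[of y] by (simp only: A.one_closed restrict_scalars_simps(1) mem_Collect_eq)
    then show "\<ominus>\<^bsub>restrict_scalars io M\<^esub> y \<in> ?H" using sm[OF _ y, of "\<ominus>.A \<one>.A"] by simp
    fix y' assume y': "y' \<in> ?H"
    from y y' obtain x x' where x: "x \<in> span_over D SD ((sgD ^^ n) ` G)" "?c y = ph (zp b) \<otimes>.D x"
     "x' \<in> span_over D SD ((sgD ^^ n) ` G)" "?c y' = ph (zp b) \<otimes>.D x'" by blast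
    have "?c (y \<oplus>.M y') = ph (zp b) \<otimes>.D (x \<oplus>.D x')" using ahom_add[OF ca, of y y'] y y' x spc by (simp add: D.r_distr)
    then show "y \<oplus>\<^bsub>restrict_scalars io M\<^esub> y' \<in> ?H" using y y' span_over.add[OF x(1,3)] by auto
   qed (use sm in auto)
   moreover have "\<forall>t\<in>T. (tau M ^^ n) t \<in> ?H"
   proof
    fix t assume t: "t \<in> T"
    have tc: "t \<in>. M" using t Tc by blast
    define Z where "Z = f (?u t)"
    have Z: "Z \<in> carrier (bco N)" unfolding Z_def using f'(1) tc by simp
    have "?u ((tau M ^^ n) t) = (tau (bco M) ^^ n) (?u t)" using tc by (simp add: bco_tau_pow(3)[OF isoM] ring_hom_one[OF sgD_pow])
    then have "?c ((tau M ^^ n) t) = Y.hat (ep' i) ((tau (bco N) ^^ n) Z)" using tc f_pow by (simp add: Z_def)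
    also have "\<dots> = Y.hat (ep' i) ((tau (bco N) ^^ n) (\<Oplus>\<^bsub>bco N\<^esub>m\<in>{..<q}. Y.hat (ep' m) Z \<odot>\<^bsub>bco N\<^esub> ?v (e' m)))"
     using Yexp[OF Z] by simp
    also have "\<dots> = (\<Oplus>.D m\<in>{..<q}. Y.hat (ep' i) ((tau (bco N) ^^ n) (Y.hat (ep' m) Z \<odot>\<^bsub>bco N\<^esub> ?v (e' m))))"
    proof (rule ahom_finsum[OF Y.E.M.abelian_group_axioms D.abelian_group_axioms])
     show "(\<lambda>y. Y.hat (ep' i) ((tau (bco N) ^^ n) y)) \<in> ahom (bco N) D"
      by (rule ahomI) (simp_all add: bco_tau_pow[OF isoN] h(1,2)[OF ij(1)])
    qed (use h(1) Z e'(1) in auto)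
    \<comment> \<open>Since \<tau>^n e'_m lies in z^b T', a factor z^b can be taken out of every
      summand; \<open>zp (- b)\<close> cancels it inside and leaves an integral coefficient.\<close>
    also have "\<dots> = (\<Oplus>.D m\<in>{..<q}. ph (zp b) \<otimes>.D ((sgD ^^ n) (Y.hat (ep' m) Z) \<otimes>.D ph (zp (- b) \<otimes>.C ep' i ((tau N ^^ n) (e' m)))))"
    proof (rule D.finsum_cong')
     fix m assume "m \<in> {..<q}"
     then have m: "m < q" by simp
     have tn: "(tau N ^^ n) (e' m) \<in>. N" by (rule tau_pow(1)[OF lattice_data(1)[OF isoN] e'(1)[OF m]])
     have hm: "Y.hat (ep' m) Z \<in>. D" "(sgD ^^ n) (Y.hat (ep' m) Z) \<in>. D" using h(1)[OF m Z] ring_hom_closed[OF sgD_pow] by auto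
     have ec: "ep' i ((tau N ^^ n) (e' m)) \<in>. C" by (rule functionals_simps(1)[OF e'(2)[OF ij(1)] tn])
     have "ph (zp b) \<otimes>.D ((sgD ^^ n) (Y.hat (ep' m) Z) \<otimes>.D ph (zp (- b) \<otimes>.C ep' i ((tau N ^^ n) (e' m)))) =
      (sgD ^^ n) (Y.hat (ep' m) Z) \<otimes>.D ph (zp b \<otimes>.C zp (- b) \<otimes>.C ep' i ((tau N ^^ n) (e' m)))"
      using hm ec by (simp add: D.m_ac)
     also have "\<dots> = Y.hat (ep' i) ((tau (bco N) ^^ n) (Y.hat (ep' m) Z \<odot>\<^bsub>bco N\<^esub> ?v (e' m)))"
      using hm ec tn e'(1)[OF m] by (simp add: zp_cancel Y.pt_smult bco_tau_pow(3)[OF isoN] Y.hat_pt[OF e'(2)[OF ij(1)]])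
     finally show "Y.hat (ep' i) ((tau (bco N) ^^ n) (Y.hat (ep' m) Z \<odot>\<^bsub>bco N\<^esub> ?v (e' m))) =
      ph (zp b) \<otimes>.D ((sgD ^^ n) (Y.hat (ep' m) Z) \<otimes>.D ph (zp (- b) \<otimes>.C ep' i ((tau N ^^ n) (e' m))))" ..
    qed (use h(1)[OF _ Z] ring_hom_closed[OF sgD_pow] functionals_simps(1)[OF e'(2)[OF ij(1)] tau_pow(1)[OF lattice_data(1)[OF isoN] e'(1)]] in auto)
    also have "\<dots> = ph (zp b) \<otimes>.D (\<Oplus>.D m\<in>{..<q}. (sgD ^^ n) (Y.hat (ep' m) Z) \<otimes>.D ph (zp (- b) \<otimes>.C ep' i ((tau N ^^ n) (e' m))))"
     using h(1)[OF _ Z] ring_hom_closed[OF sgD_pow] functionals_simps(1)[OF e'(2)[OF ij(1)] tau_pow(1)[OF lattice_data(1)[OF isoN] e'(1)]]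
     by (intro D.finsum_rdistr[symmetric]) auto
    finally have eq: "?c ((tau M ^^ n) t) = \<dots>" .
    have "(\<Oplus>.D m\<in>{..<q}. (sgD ^^ n) (Y.hat (ep' m) Z) \<otimes>.D ph (zp (- b) \<otimes>.C ep' i ((tau N ^^ n) (e' m)))) \<in> span_over D SD ((sgD ^^ n) ` G)"
    proof (rule D.span_over_finsum[OF SD_sub G'])
     fix m assume "m \<in> {..<q}"
     then have m: "m < q" by simp
     from dN(2)[OF m] sN obtain t' where t': "t' \<in> T'" "(tau N ^^ n) (e' m) = zp b \<odot>.N t'" by (auto simp: tau_scales_def)
     then have t'c: "t' \<in>. N" using Tc by blast
     have ec: "ep' i t' \<in>. C" by (rule functionals_simps(1)[OF e'(2)[OF ij(1)] t'c])
     have "zp (- b) \<otimes>.C ep' i ((tau N ^^ n) (e' m)) = ep' i t'"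
      unfolding t'(2) using functionals_simps(3)[OF e'(2)[OF ij(1)] zp_closed t'c] ec by (simp add: C.m_assoc[symmetric] zp_cancel)
     then have "(sgD ^^ n) (Y.hat (ep' m) Z) \<otimes>.D ph (zp (- b) \<otimes>.C ep' i ((tau N ^^ n) (e' m))) = ph (ep' i t') \<otimes>.D (sgD ^^ n) (Y.hat (ep' m) Z)"
      using ec h(1)[OF m Z] ring_hom_closed[OF sgD_pow] by (simp add: D.m_comm)
     then show "(sgD ^^ n) (Y.hat (ep' m) Z) \<otimes>.D ph (zp (- b) \<otimes>.C ep' i ((tau N ^^ n) (e' m))) \<in> span_over D SD ((sgD ^^ n) ` G)"
      using span_smult_SA[OF G' dN(3)[OF ij(1) t'(1)] span_sg[OF G(2) coeff[OF m t, folded Z_def], of n]] by simp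
    qed
    with eq show "(tau M ^^ n) t \<in> ?H" using tau_pow(1)[OF lattice_data(1)[OF isoM] tc] by blast
   qed
   ultimately have "zp a \<odot>.M e j \<in> ?H" using sM dM(2)[OF ij(2)] unfolding tau_scales_def by blast
   then obtain y where y: "y \<in> span_over D SD ((sgD ^^ n) ` G)" "?c (zp a \<odot>.M e j) = ph (zp b) \<otimes>.D y" by blast
   \<comment> \<open>Dividing by z^a leaves z^(b-a), a positive power, as \<open>vanishing\<close>
     requires.\<close>
   have "ph (zp (b - a)) \<otimes>.D y = ph (zp (- a)) \<otimes>.D (ph (zp b) \<otimes>.D y)"
    using spc[OF y(1)] by (simp add: D.m_assoc[symmetric] flip: ph.hom_mult zp_add)
   also have "\<dots> = ph (zp (- a)) \<otimes>.D (ph (zp a) \<otimes>.D x)"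
    unfolding y(2)[symmetric] ij(3) g_def using e(1)[OF ij(2)] f'(1,3) h(3)[OF ij(1)] by (simp add: X.unit_smult)
   also have "\<dots> = x" using gc[OF ij(1,2)] ij(3) by (simp add: D.m_assoc[symmetric] zp_cancel flip: ph.hom_mult)
   finally show "\<exists>y\<in>span_over D SD ((sgD ^^ n) ` G). x = ph (zp (b - a)) \<otimes>.D y" using y(1) by auto
  qed
  moreover have "\<zero>.D \<in> ph ` carrier C" using imageI[OF C.zero_closed, of ph] by simp
  ultimately show ?thesis by blast
 qed
 then show ?thesis using gG by (auto simp: g_def)
qed

text \<open>Once the matrix entries come from \<open>C\<close>, a morphism upstairs maps the image
  of \<open>M\<close> into the image of \<open>N\<close>. Injectivity of \<open>N\<close> into its
  base change then defines the descended map and transports every algebraic law to it.\<close>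

lemma full_and_faithful:
 fixes M :: "('c, 'm) tau_module" and N :: "('c, 'n) tau_module"
 assumes isoM: "isocrystal C sgC M" and isoN: "isocrystal C sgC N"
  and T: "is_lattice M T" and T': "is_lattice N T'" and n: "0 < n" "0 < n'"
  and sM: "tau_scales M T n a" and sN: "tau_scales N T' n' b"
 shows "isocrystal D sgD (bco M)"
  and "bij_betw (base_change_mor C ph D M N) (isocrystal_hom C M N) (isocrystal_hom D (bco M) (bco N))"
proof -
 interpret X: scalar_ext C ph D M "bco M" "bpt M" by (rule lattice_data(4)[OF isoM])
 interpret Y: scalar_ext C ph D N "bco N" "bpt N" by (rule lattice_data(4)[OF isoN])
 let ?u = "bpt M \<one>.D" and ?v = "bpt N \<one>.D"
 have Tc: "T \<subseteq> carrier M" "T' \<subseteq> carrier N"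
  using T T' subgroup.subset[OF submodule.axioms(1)] by (fastforce simp: is_lattice_def)+
 obtain p e ep where dM: "dual_basis C M p e ep" "\<forall>j<p. e j \<in> T" "\<forall>j<p. \<forall>t\<in>T. ep j t \<in> SA"
  using lattice_dual_basis[OF X.M.module_axioms T] by blast
 obtain q e' ep' where dN: "dual_basis C N q e' ep'" "\<forall>j<q. e' j \<in> T'" "\<forall>j<q. \<forall>t\<in>T'. ep' j t \<in> SA"
  using lattice_dual_basis[OF Y.M.module_axioms T'] by blast
 show "isocrystal D sgD (bco M)" by (rule isocrystal_base_change[OF C D ph sgC sgD sg_comm isoM dM(1)])
 have tM: "m \<in>. M ==> tau M m \<in>. M" for m using lattice_data(1)[OF isoM] by (auto simp: left_tau_module_def)
 have tN: "m \<in>. N ==> tau N m \<in>. N" for m using lattice_data(1)[OF isoN] by (auto simp: left_tau_module_def)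
 have vinj: "y = y'" if "y \<in>. N" "y' \<in>. N" "?v y = ?v y'" for y y' by (rule Y.unit_inj[OF dN(1) ph_inj that])
 let ?F = "base_change_mor C ph D M N"
 have F: "?F f \<in> isocrystal_hom D (bco M) (bco N)" "\<And>d m. d \<in>. D ==> m \<in>. M ==> ?F f (bpt M d m) = bpt N d (f m)"
  if f: "f \<in> isocrystal_hom C M N" for f
 proof -
  have f': "m \<in>. M ==> f m \<in>. N" "m \<in>. M ==> m' \<in>. M ==> f (m \<oplus>.M m') = f m \<oplus>.N f m'"
   "c \<in>. C ==> m \<in>. M ==> f (c \<odot>.M m) = c \<odot>.N f m" "m \<in>. M ==> f (tau M m) = tau N (f m)" for m m' c
   using f by (auto simp: isocrystal_hom_def)
  have fa: "f \<in> ahom M N" using f' by (intro ahomI) auto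
  have bal: "\<exists>b\<in>carrier C. c \<odot>\<^bsub>algebra_via ph D\<^esub> d = b \<odot>\<^bsub>algebra_via ph D\<^esub> d \<and> f (c \<odot>.M m) = b \<odot>.N f m"
   if "c \<in>. C" "m \<in>. M" for c d m using that f'(3) by blast
  note tm = tensor_map[OF bc_modules[OF D ph Y.M.module_axioms] bc_modules[OF D ph X.M.module_axioms] ahom_id fa bal]
  have r: "?F f Z = tensor_map C (algebra_via ph D) N (\<lambda>c. c) f Z" if "Z \<in> carrier (bco M)" for Z
   using that by (simp add: base_change_mor_def base_change_obj_simps)
  show p: "?F f (bpt M d m) = bpt N d (f m)" if "d \<in>. D" "m \<in>. M" for d m using tm(2)[of d m] r[of "bpt M d m"] that by simp
  have h: "?F f \<in> ahom (bco M) (bco N)"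
  proof (rule ahomI)
   fix Z assume Z: "Z \<in> carrier (bco M)"
   then have Z': "Z \<in> carrier (tensor_ring C (algebra_via ph D) M)" by (simp add: base_change_obj_simps base_change_simps)
   show "?F f Z \<in> carrier (bco N)" using ahom_closed[OF tm(1) Z'] r[OF Z] by (simp add: base_change_obj_simps base_change_simps)
   fix W assume W: "W \<in> carrier (bco M)"
   then have "W \<in> carrier (tensor_ring C (algebra_via ph D) M)" by (simp add: base_change_obj_simps base_change_simps)
   from ahom_add[OF tm(1) Z' this] show "?F f (Z \<oplus>\<^bsub>bco M\<^esub> W) = ?F f Z \<oplus>\<^bsub>bco N\<^esub> ?F f W"
    using r[OF Z] r[OF W] r[OF X.E.M.a_closed[OF Z W]] by (simp add: base_change_obj_simps base_change_simps)
  qed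
  have tE: "Z \<in> carrier (bco M) ==> tau (bco M) Z \<in> carrier (bco M)"
   "Z \<in> carrier (bco M) ==> W \<in> carrier (bco M) ==> tau (bco M) (Z \<oplus>\<^bsub>bco M\<^esub> W) = tau (bco M) Z \<oplus>\<^bsub>bco M\<^esub> tau (bco M) W"
   "U \<in> carrier (bco N) ==> V \<in> carrier (bco N) ==> tau (bco N) (U \<oplus>\<^bsub>bco N\<^esub> V) = tau (bco N) U \<oplus>\<^bsub>bco N\<^esub> tau (bco N) V" for Z W U V
   using lattice_data(3)[OF isoM] lattice_data(3)[OF isoN] by (auto simp: left_tau_module_def)
  have "?F f (d \<odot>\<^bsub>bco M\<^esub> Z) = d \<odot>\<^bsub>bco N\<^esub> ?F f Z" if d: "d \<in>. D" and "Z \<in> carrier (bco M)" for d Z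
   using that(2) by (induction rule: X.pt_induct)
     (use d f'(1) ahom_closed[OF h] in \<open>simp_all add: X.pt_smult Y.pt_smult p X.E.smult_r_distr Y.E.smult_r_distr ahom_add[OF h]\<close>)
  moreover have "?F f (tau (bco M) Z) = tau (bco N) (?F f Z)" if "Z \<in> carrier (bco M)" for Z using that by (induction rule: X.pt_induct)
     (use f'(1,4) tM tE ahom_closed[OF h] ring_hom_closed[OF sgD] in
      \<open>simp_all add: lattice_data(5)[OF isoM] lattice_data(5)[OF isoN] p ahom_add[OF h]\<close>)
  moreover have "?F f \<in> extensional (carrier (bco M))" by (simp add: base_change_mor_def base_change_obj_simps)
  ultimately show "?F f \<in> isocrystal_hom D (bco M) (bco N)"
   unfolding isocrystal_hom_def using ahom_closed[OF h] ahom_add[OF h] by (auto simp: PiE_def)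
 qed
 show "bij_betw ?F (isocrystal_hom C M N) (isocrystal_hom D (bco M) (bco N))" unfolding bij_betw_def
 proof
  show "inj_on ?F (isocrystal_hom C M N)"
  proof (rule inj_onI)
   fix f g assume f: "f \<in> isocrystal_hom C M N" and g: "g \<in> isocrystal_hom C M N" and eq: "?F f = ?F g"
   have fg: "f \<in> carrier M \<rightarrow>\<^sub>E carrier N" "g \<in> carrier M \<rightarrow>\<^sub>E carrier N" using f g by (auto simp: isocrystal_hom_def)
   show "f = g"
   proof (rule PiE_ext[OF fg])
    fix m assume m: "m \<in>. M"
    have "?v (f m) = ?v (g m)" using F(2)[OF f, of "\<one>.D" m] F(2)[OF g, of "\<one>.D" m] m eq by simp
    then show "f m = g m" using fg m by (intro vinj) auto
   qed
  qed
  show "?F ` isocrystal_hom C M N = isocrystal_hom D (bco M) (bco N)"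
  proof
   show "?F ` isocrystal_hom C M N \<subseteq> isocrystal_hom D (bco M) (bco N)" using F(1) by blast
   show "isocrystal_hom D (bco M) (bco N) \<subseteq> ?F ` isocrystal_hom C M N"
   proof
    fix f assume f: "f \<in> isocrystal_hom D (bco M) (bco N)"
    have f': "Z \<in> carrier (bco M) ==> f Z \<in> carrier (bco N)"
     "Z \<in> carrier (bco M) ==> W \<in> carrier (bco M) ==> f (Z \<oplus>\<^bsub>bco M\<^esub> W) = f Z \<oplus>\<^bsub>bco N\<^esub> f W"
     "d \<in>. D ==> Z \<in> carrier (bco M) ==> f (d \<odot>\<^bsub>bco M\<^esub> Z) = d \<odot>\<^bsub>bco N\<^esub> f Z"
     "Z \<in> carrier (bco M) ==> f (tau (bco M) Z) = tau (bco N) (f Z)" for Z W d using f by (auto simp: isocrystal_hom_def)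
    \<comment> \<open>The product of the two exponents is a common multiple, so both lattices
      satisfy a scaling condition for the same power of \<tau>.\<close>
    have sM': "tau_scales M T (n' * n) (int n' * a)" by (rule tau_scales_pow[OF lattice_data(1)[OF isoM] Tc(1) sM])
    have sN': "tau_scales N T' (n' * n) (int n * b)" using tau_scales_pow[OF lattice_data(1)[OF isoN] Tc(2) sN, of n] by (simp add: mult.commute)
    have mat: "\<forall>i<q. \<forall>j<p. Y.hat (ep' i) (f (?u (e j))) \<in> ph ` carrier C"
     by (rule matrix_in_image[OF isoM isoN T T' _ sM' sN' dM(1) _ _ dN(1) _ _ f]) (use n dM dN in auto)
    have e: "\<And>j. j < p ==> e j \<in>. M" "\<And>j. j < p ==> ep j \<in> functionals C M"
     "\<And>y. y \<in>. M ==> y = (\<Oplus>.M j\<in>{..<p}. ep j y \<odot>.M e j)" using dM(1) by (auto simp: dual_basis_def)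
    have e': "\<And>j. j < q ==> e' j \<in>. N" "\<And>j. j < q ==> ep' j \<in> functionals C N"
     using dN(1) by (auto simp: dual_basis_def)
    let ?I = "{Z \<in> carrier (bco M). f Z \<in> ?v ` carrier N}"
    have v_add: "Z \<oplus>\<^bsub>bco N\<^esub> W \<in> ?v ` carrier N" if "Z \<in> ?v ` carrier N" "W \<in> ?v ` carrier N" for Z W
     using that by (auto simp flip: Y.pt_add_right)
    have v_sum: "(\<Oplus>\<^bsub>bco N\<^esub>j\<in>J. k j) \<in> ?v ` carrier N" if "\<And>j. j \<in> J ==> k j \<in> ?v ` carrier N" for J :: "nat set" and k
     using that
    proof (induction J rule: infinite_finite_induct)
     case (insert j J)
     have "k i \<in> carrier (bco N)" if "i \<in> insert j J" for i using insert.prems[OF that] by auto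
     then show ?case using insert by (subst Y.E.M.finsum_insert) (auto intro!: v_add)
    qed (auto intro!: rev_image_eqI[OF Y.M.M.zero_closed] simp: Y.pt_zero)
    have v_smult: "ph c \<odot>\<^bsub>bco N\<^esub> Z \<in> ?v ` carrier N" if "c \<in>. C" "Z \<in> ?v ` carrier N" for c Z
     using that by (auto simp flip: Y.unit_smult)
    \<comment> \<open>Expanding on the \<open>e' i\<close>, with coefficients in the image of
      \<open>C\<close>, expresses the image of a generator by elements coming from
      \<open>N\<close>.\<close>
    have fe: "f (?u (e j)) \<in> ?v ` carrier N" if j: "j < p" for j
    proof -
     have Z: "f (?u (e j)) \<in> carrier (bco N)" using f'(1) e(1)[OF j] by simp
     have "f (?u (e j)) = (\<Oplus>\<^bsub>bco N\<^esub>i\<in>{..<q}. Y.hat (ep' i) (f (?u (e j))) \<odot>\<^bsub>bco N\<^esub> ?v (e' i))"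
      using Y.dual_basis_ext[OF dN(1)] Z by (auto simp: dual_basis_def)
     also have "\<dots> \<in> ?v ` carrier N"
     proof (rule v_sum)
      fix i assume i: "i \<in> {..<q}"
      then obtain c where "c \<in>. C" "Y.hat (ep' i) (f (?u (e j))) = ph c" using mat j by blast
      then show "Y.hat (ep' i) (f (?u (e j))) \<odot>\<^bsub>bco N\<^esub> ?v (e' i) \<in> ?v ` carrier N" using v_smult e'(1) i by auto
     qed
     finally show ?thesis .
    qed
    have fu: "f (?u m) \<in> ?v ` carrier N" if m: "m \<in>. M" for m
    proof -
     have epc: "j < p ==> ep j m \<in>. C" for j by (rule functionals_simps(1)[OF e(2) m])
     have fa: "f \<in> ahom (bco M) (bco N)" using f' by (intro ahomI) auto
     have "f (?u m) = f (\<Oplus>\<^bsub>bco M\<^esub>j\<in>{..<p}. ?u (ep j m \<odot>.M e j))"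
      using X.pt_finsum[of "\<one>.D" "\<lambda>j. ep j m \<odot>.M e j" "{..<p}"] e(1) epc e(3)[OF m] by (simp add: Pi_iff)
     also have "\<dots> = (\<Oplus>\<^bsub>bco N\<^esub>j\<in>{..<p}. f (?u (ep j m \<odot>.M e j)))"
      using e(1) epc by (intro ahom_finsum[OF X.E.M.abelian_group_axioms Y.E.M.abelian_group_axioms fa]) auto
     also have "\<dots> \<in> ?v ` carrier N" by (rule v_sum) (use e(1) epc fe v_smult f'(3) in \<open>auto simp: X.unit_smult\<close>)
     finally show ?thesis .
    qed
    \<comment> \<open>The value is determined by its image upstairs, so additivity, linearity and
      compatibility with \<tau> follow by applying \<open>vinj\<close>.\<close>
    define g where "g = restrict (\<lambda>m. SOME y. y \<in>. N \<and> ?v y = f (?u m)) (carrier M)"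
    have g: "g m \<in>. N" "?v (g m) = f (?u m)" if m: "m \<in>. M" for m
    proof -
     have "\<exists>y. y \<in>. N \<and> ?v y = f (?u m)" using fu[OF m] by auto
     from someI_ex[OF this] show "g m \<in>. N" "?v (g m) = f (?u m)" using m by (auto simp: g_def)
    qed
    have "g \<in> isocrystal_hom C M N" unfolding isocrystal_hom_def
    proof (intro CollectI conjI ballI)
     show "g \<in> carrier M \<rightarrow>\<^sub>E carrier N" using g(1) by (auto simp: g_def)
     show "g (x \<oplus>.M y) = g x \<oplus>.N g y" if "x \<in>. M" "y \<in>. M" for x y
      using that g f'(2) by (intro vinj) (auto simp: X.pt_add_right Y.pt_add_right)
     show "g (c \<odot>.M x) = c \<odot>.N g x" if "c \<in>. C" "x \<in>. M" for c x
      using that g f'(3) by (intro vinj) (auto simp: X.unit_smult Y.unit_smult)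
     show "g (tau M x) = tau N (g x)" if x: "x \<in>. M" for x
     proof (rule vinj)
      have "?v (g (tau M x)) = f (tau (bco M) (?u x))" using x g(2)[OF tM[OF x]] by (simp add: lattice_data(5)[OF isoM] ring_hom_one[OF sgD])
      also have "\<dots> = tau (bco N) (?v (g x))" using x f'(4) g(2)[OF x] by simp
      also have "\<dots> = ?v (tau N (g x))" using g(1)[OF x] by (simp add: lattice_data(5)[OF isoN] ring_hom_one[OF sgD])
      finally show "?v (g (tau M x)) = ?v (tau N (g x))" .
     qed (use x g(1) tM tN in auto)
    qed
    moreover have "?F g = f"
    proof (rule PiE_ext)
     show "?F g \<in> carrier (bco M) \<rightarrow>\<^sub>E carrier (bco N)" "f \<in> carrier (bco M) \<rightarrow>\<^sub>E carrier (bco N)"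
      using F(1)[OF \<open>g \<in> isocrystal_hom C M N\<close>] f by (auto simp: isocrystal_hom_def)
     fix Z assume "Z \<in> carrier (bco M)"
     then show "?F g Z = f Z"
     proof (induction rule: X.pt_induct)
      case (pure d m)
      have "f (bpt M d m) = d \<odot>\<^bsub>bco N\<^esub> f (?u m)" using pure f'(3) X.pt_unit[OF pure] by simp
      also have "\<dots> = bpt N d (g m)" using pure g[OF pure(2)] Y.pt_unit[of d "g m"] by simp
      finally show ?case using F(2)[OF \<open>g \<in> isocrystal_hom C M N\<close>] pure by simp
     next
      case (add Z W)
      have "?F g (Z \<oplus>\<^bsub>bco M\<^esub> W) = ?F g Z \<oplus>\<^bsub>bco N\<^esub> ?F g W"
       using F(1)[OF \<open>g \<in> isocrystal_hom C M N\<close>] add by (auto simp: isocrystal_hom_def)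
      then show ?case using add f'(2) by simp
     qed
    qed
    ultimately show "f \<in> ?F ` isocrystal_hom C M N" by blast
   qed
  qed
 qed
qed

end

section \<open>Completions\<close>

declare ideal_power.simps(2) [simp del]

lemma (in ideal) mem_coset_iff:
 assumes "p \<in>. R"
 shows "q \<in> I +> p \<longleftrightarrow> q \<in>. R \<and> q \<ominus> p \<in> I"
proof
 assume "q \<in> I +> p"
 then obtain h where "h \<in> I" "q = h \<oplus> p" by (auto simp: a_r_coset_def')
 then show "q \<in>. R \<and> q \<ominus> p \<in> I" using assms Icarr by (simp add: a_minus_def a_assoc r_neg)
next
 assume "q \<in>. R \<and> q \<ominus> p \<in> I"
 then have "q = (q \<ominus> p) \<oplus> p" "q \<ominus> p \<in> I" using assms by (simp_all add: a_minus_def a_assoc l_neg)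
 then show "q \<in> I +> p" unfolding a_r_coset_def' by blast
qed

lemma (in ideal) coset_eq_iff:
 assumes "p \<in>. R" "q \<in>. R"
 shows "I +> q = I +> p \<longleftrightarrow> q \<ominus> p \<in> I"
proof
 assume "I +> q = I +> p"
 moreover have "q \<in> I +> q" using assms mem_coset_iff[of q q] by (simp add: a_minus_def r_neg)
 ultimately show "q \<ominus> p \<in> I" using mem_coset_iff[OF assms(1)] by simp
next
 assume *: "q \<ominus> p \<in> I"
 have m: "\<ominus> (q \<ominus> p) \<in> I" using * by simp
 show "I +> q = I +> p"
 proof (rule Set.set_eqI)
  fix r
  have e: "r \<ominus> p = (r \<ominus> q) \<oplus> (q \<ominus> p)" "r \<ominus> q = (r \<ominus> p) \<oplus> \<ominus> (q \<ominus> p)" if "r \<in>. R"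
   using that assms by (simp_all add: a_minus_def a_assoc minus_add r_neg1 a_comm[of "\<ominus> q" p])
  show "r \<in> I +> q \<longleftrightarrow> r \<in> I +> p" unfolding mem_coset_iff[OF assms(1)] mem_coset_iff[OF assms(2)]
   using additive_subgroup.a_closed[OF additive_subgroup_axioms _ *, of "r \<ominus> q"] additive_subgroup.a_closed[OF additive_subgroup_axioms _ m, of "r \<ominus> p"] e by metis
 qed
qed

lemma (in ideal) coset_ops:
 assumes "p \<in>. R" "q \<in>. R"
 shows "(I +> p) \<oplus>\<^bsub>R Quot I\<^esub> (I +> q) = I +> (p \<oplus> q)" "(I +> p) \<otimes>\<^bsub>R Quot I\<^esub> (I +> q) = I +> (p \<otimes> q)"
 using ring_hom_add[OF rcos_ring_hom assms] ring_hom_mult[OF rcos_ring_hom assms] by simp_all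

context cring
begin

lemma ideal_power_ideal: "ideal I R ==> ideal (ideal_power R I n) R"
 by (induction n) (auto simp: oneideal ideal_power.simps(2) intro: ideal_prod_is_ideal)

lemma ideal_power_Suc: "ideal I R ==> ideal_power R I (Suc n) \<subseteq> ideal_power R I n"
 using ideal_prod_inter[OF _ ideal_power_ideal, of I I n] by (auto simp: ideal_power.simps(2))

context
 fixes I assumes I: "ideal I R"
begin

private abbreviation "J n \<equiv> ideal_power R I n"
private abbreviation "cp \<equiv> completion R I"

interpretation J: ideal "J n" R for n by (rule ideal_power_ideal[OF I])

lemma completion_sel:
 "carrier cp = {x. \<forall>n. x n \<in> carrier (R Quot J n) \<and> x (Suc n) \<subseteq> x n}"
 "(x \<otimes>.cp y) n = x n \<otimes>\<^bsub>R Quot J n\<^esub> y n" "(x \<oplus>.cp y) n = x n \<oplus>\<^bsub>R Quot J n\<^esub> y n"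
 "\<one>.cp n = \<one>\<^bsub>R Quot J n\<^esub>" "\<zero>.cp n = \<zero>\<^bsub>R Quot J n\<^esub>" by (simp_all add: completion_def Let_def)

lemma quot_carrier: "carrier (R Quot J n) = {J n +> p | p. p \<in> carrier R}" by (auto simp: FactRing_def A_RCOSETS_def')

lemma completion_mem:
 assumes "x \<in>. cp" "p \<in> x n"
 shows "p \<in>. R" "x n = J n +> p"
proof -
 have "x n \<in> carrier (R Quot J n)" using assms(1) by (simp add: completion_sel)
 then obtain q where q: "q \<in>. R" "x n = J n +> q" by (auto simp: quot_carrier)
 then have "p \<in>. R" "p \<ominus> q \<in> J n" using assms(2) J.mem_coset_iff by auto
 then show "p \<in>. R" "x n = J n +> p" using q J.coset_eq_iff[OF q(1)] by auto
qed

lemma completion_rep: "x \<in>. cp ==> \<exists>p. p \<in> x n"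
proof -
 assume "x \<in>. cp"
 then have "x n \<in> carrier (R Quot J n)" by (simp add: completion_sel)
 then obtain q where "q \<in>. R" "x n = J n +> q" by (auto simp: quot_carrier)
 then have "q \<in> x n" using J.mem_coset_iff[of q q n] by (simp add: a_minus_def r_neg)
 then show ?thesis by blast
qed

lemma completion_decreasing: "x \<in>. cp ==> m \<le> n ==> x n \<subseteq> x m"
 by (rule lift_Suc_antimono_le[of x]) (auto simp: completion_sel)

lemma completionI:
 assumes "\<And>n. p n \<in>. R" "\<And>n. p (Suc n) \<ominus> p n \<in> J n"
 shows "(\<lambda>n. J n +> p n) \<in>. cp"
proof -
 have "J (Suc n) +> p (Suc n) \<subseteq> J n +> p n" for n
 proof
  fix r assume "r \<in> J (Suc n) +> p (Suc n)"
  then have r: "r \<in>. R" "r \<ominus> p (Suc n) \<in> J n" using J.mem_coset_iff[OF assms(1)] subsetD[OF ideal_power_Suc[OF I]] by auto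
  have "r \<ominus> p n = (r \<ominus> p (Suc n)) \<oplus> (p (Suc n) \<ominus> p n)"
   using r assms(1)[of n] assms(1)[of "Suc n"] by (simp add: a_minus_def a_assoc r_neg1)
  then show "r \<in> J n +> p n" using r additive_subgroup.a_closed[OF J.additive_subgroup_axioms, OF r(2) assms(2)] J.mem_coset_iff[OF assms(1)] by simp
 qed
 then show ?thesis using assms(1) by (auto simp: completion_sel(1) quot_carrier)
qed

text \<open>Each level of an element is a coset, so one common representative per level suffices;
  later proofs compute with representatives and never with cosets.\<close>

lemma completion_eqI:
 assumes "x \<in>. cp" "y \<in>. cp" "\<And>n. \<exists>p. p \<in> x n \<and> p \<in> y n"
 shows "x = y" using assms(3) completion_mem(2)[OF assms(1)] completion_mem(2)[OF assms(2)] by (intro ext) metis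

lemma coset_self: "p \<in>. R ==> p \<in> J n +> p" using J.mem_coset_iff[of p p n] by (simp add: a_minus_def r_neg)

lemma completion_op_mem:
 assumes x: "x \<in>. cp" and y: "y \<in>. cp" and p: "p \<in> x n" "q \<in> y n"
 shows "p \<oplus> q \<in> (x \<oplus>.cp y) n" "p \<otimes> q \<in> (x \<otimes>.cp y) n" using completion_mem[OF x p(1)] completion_mem[OF y p(2)]
 by (simp_all add: completion_sel J.coset_ops coset_self)

lemma completion_one_zero_mem: "\<one> \<in> \<one>.cp n" "\<zero> \<in> \<zero>.cp n"
 using coset_self[of \<one> n] J.zero_closed by (auto simp: completion_sel FactRing_def)

lemma completion_op_closed:
 assumes x: "x \<in>. cp" and y: "y \<in>. cp"
 shows "x \<oplus>.cp y \<in>. cp" "x \<otimes>.cp y \<in>. cp"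
proof -
 obtain p q where p: "\<And>n. p n \<in> x n" "\<And>n. q n \<in> y n" using completion_rep[OF x] completion_rep[OF y] by metis
 note m = completion_mem[OF x p(1)] completion_mem[OF y p(2)]
 have d: "p (Suc n) \<ominus> p n \<in> J n" "q (Suc n) \<ominus> q n \<in> J n" for n
  using subsetD[OF completion_decreasing[OF x] p(1), of n "Suc n"] subsetD[OF completion_decreasing[OF y] p(2), of n "Suc n"]
   m(2)[of n] m(4)[of n] J.mem_coset_iff[OF m(1)] J.mem_coset_iff[OF m(3)] by simp_all
 have "p (Suc n) \<oplus> q (Suc n) \<ominus> (p n \<oplus> q n) = (p (Suc n) \<ominus> p n) \<oplus> (q (Suc n) \<ominus> q n)" for n
  using m(1,3)[of n] m(1,3)[of "Suc n"] by (simp add: a_minus_def minus_add a_ac)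
 then have "(\<lambda>n. J n +> (p n \<oplus> q n)) \<in>. cp"
  using m(1,3) d additive_subgroup.a_closed[OF J.additive_subgroup_axioms] by (intro completionI) auto
 moreover have "x \<oplus>.cp y = (\<lambda>n. J n +> (p n \<oplus> q n))" using m by (intro ext) (simp add: completion_sel J.coset_ops)
 ultimately show "x \<oplus>.cp y \<in>. cp" by simp
 have "p (Suc n) \<otimes> q (Suc n) \<ominus> p n \<otimes> q n = (p (Suc n) \<ominus> p n) \<otimes> q (Suc n) \<oplus> p n \<otimes> (q (Suc n) \<ominus> q n)" for n
  using m(1,3)[of n] m(1,3)[of "Suc n"] by (simp add: a_minus_def l_distr r_distr l_minus r_minus a_assoc r_neg1 r_neg2)
 then have "p (Suc n) \<otimes> q (Suc n) \<ominus> p n \<otimes> q n \<in> J n" for n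
  using additive_subgroup.a_closed[OF J.additive_subgroup_axioms, OF J.I_r_closed[OF d(1) m(3)] J.I_l_closed[OF d(2) m(1)]] by simp
 then have "(\<lambda>n. J n +> (p n \<otimes> q n)) \<in>. cp" using m(1,3) by (intro completionI) auto
 moreover have "x \<otimes>.cp y = (\<lambda>n. J n +> (p n \<otimes> q n))" using m by (intro ext) (simp add: completion_sel J.coset_ops)
 ultimately show "x \<otimes>.cp y \<in>. cp" by simp
qed

lemma to_completion_closed: "p \<in>. R ==> to_completion R I p \<in>. cp"
 unfolding to_completion_def by (rule completionI) (simp_all add: a_minus_def r_neg)

lemma to_completion_mem: "p \<in>. R ==> p \<in> to_completion R I p n" by (simp add: to_completion_def coset_self)

lemma completion_consts: "\<one>.cp = to_completion R I \<one>" "\<zero>.cp = to_completion R I \<zero>"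
proof -
 show "\<one>.cp = to_completion R I \<one>" by (intro ext) (simp add: completion_sel to_completion_def FactRing_def)
 have "J n +> \<zero> = J n" for n by (rule a_coset_add_zero[OF J.a_subset])
 then show "\<zero>.cp = to_completion R I \<zero>" by (intro ext) (simp add: completion_sel to_completion_def FactRing_def)
qed

lemma completion_cring: "cring cp"
proof -
 note cl = completion_op_closed
 have c01: "\<one>.cp \<in>. cp" "\<zero>.cp \<in>. cp" by (simp_all add: completion_consts to_completion_closed)
 have eq: "x = y" if "x \<in>. cp" "y \<in>. cp" "\<And>n. x n = y n" for x y by (rule ext) (rule that)
 have q: "cring (R Quot J n)" for n by (rule J.quotient_is_cring[OF is_cring])
 interpret q: cring "R Quot J n" for n by (rule q)
 have e: "x n \<in> carrier (R Quot J n)" if "x \<in>. cp" for x n using that by (simp add: completion_sel)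
 show ?thesis
 proof (rule cringI)
  show "abelian_group cp"
  proof (rule abelian_groupI)
   fix x assume x: "x \<in>. cp"
   \<comment> \<open>The additive inverse is taken to be (-1) x, which reuses closure under
     multiplication.\<close>
   have "to_completion R I (\<ominus> \<one>) \<otimes>.cp x \<oplus>.cp x = \<zero>.cp"
   proof (rule completion_eqI)
    fix n
    obtain p where p: "p \<in> x n" using completion_rep[OF x] by blast
    have "\<ominus> \<one> \<otimes> p \<oplus> p \<in> (to_completion R I (\<ominus> \<one>) \<otimes>.cp x \<oplus>.cp x) n"
     by (intro completion_op_mem cl x p to_completion_closed to_completion_mem) simp_all
    then show "\<exists>p. p \<in> (to_completion R I (\<ominus> \<one>) \<otimes>.cp x \<oplus>.cp x) n \<and> p \<in> \<zero>.cp n"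
     using completion_mem(1)[OF x p] completion_one_zero_mem(2) by (intro exI[of _ \<zero>]) (simp add: l_minus l_neg)
   qed (use x c01 cl to_completion_closed in auto)
   then show "\<exists>y\<in>carrier cp. y \<oplus>.cp x = \<zero>.cp" using cl(2)[OF _ x] to_completion_closed by blast
  next
   fix x y z assume "x \<in>. cp" "y \<in>. cp" "z \<in>. cp"
   then show "x \<oplus>.cp y \<oplus>.cp z = x \<oplus>.cp (y \<oplus>.cp z)" by (intro ext) (simp add: completion_sel q.a_assoc)
  next
   fix x y assume "x \<in>. cp" "y \<in>. cp"
   then show "x \<oplus>.cp y = y \<oplus>.cp x" by (intro ext) (simp add: completion_sel q.a_comm)
  next
   fix x assume "x \<in>. cp"
   then show "\<zero>.cp \<oplus>.cp x = x" by (intro ext) (simp add: completion_sel q.l_zero)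
  qed (use cl c01 in auto)
  show "Group.comm_monoid cp"
  proof (rule comm_monoidI)
   fix x y z assume "x \<in>. cp" "y \<in>. cp" "z \<in>. cp"
   then show "x \<otimes>.cp y \<otimes>.cp z = x \<otimes>.cp (y \<otimes>.cp z)" by (intro ext) (simp add: completion_sel q.m_assoc)
  next
   fix x y assume "x \<in>. cp" "y \<in>. cp"
   then show "x \<otimes>.cp y = y \<otimes>.cp x" by (intro ext) (simp add: completion_sel q.m_comm)
  next
   fix x assume "x \<in>. cp"
   then show "\<one>.cp \<otimes>.cp x = x" by (intro ext) (simp add: completion_sel q.l_one)
  qed (use cl c01 in auto)
  fix x y z assume "x \<in>. cp" "y \<in>. cp" "z \<in>. cp"
  then show "(x \<oplus>.cp y) \<otimes>.cp z = x \<otimes>.cp z \<oplus>.cp y \<otimes>.cp z" by (intro ext) (simp add: completion_sel q.l_distr)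
 qed
qed

lemma to_completion_hom: "to_completion R I \<in> ring_hom R cp" by (rule ring_hom_memI)
   (simp_all add: to_completion_closed completion_consts, simp_all add: to_completion_def completion_sel J.coset_ops fun_eq_iff)

end

end

text \<open>\<open>f\<close> carries the n-th power of \<open>I\<close> into the n-th power of
  \<open>I'\<close>. Hence the union over all representatives in \<open>completion_map\<close> is a
  single coset, given by any one of them.\<close>

lemma completion_map:
 assumes R: "cring R" "ideal I R" and R': "cring R'" "ideal I' R'"
  and f: "f \<in> ring_hom R R'" and fI: "\<And>x. x \<in> I ==> f x \<in> I'"
 shows completion_map_hom: "completion_map R' I' f \<in> ring_hom (completion R I) (completion R' I')"
  and completion_map_mem: "\<And>x n p. x \<in> carrier (completion R I) ==> p \<in> x n ==> f p \<in> completion_map R' I' f x n"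
proof -
 interpret R: cring R by fact
 interpret R': cring R' by fact
 have iJ: "ideal (ideal_power R I n) R" for n by (rule R.ideal_power_ideal[OF R(2)])
 have iJ': "ideal (ideal_power R' I' n) R'" for n by (rule R'.ideal_power_ideal[OF R'(2)])
 note fc = ring_hom_closed[OF f]
 have fd: "f (p \<ominus>.R q) = f p \<ominus>.R' f q" if "p \<in>. R" "q \<in>. R" for p q
  using ahom_diff[OF R.abelian_group_axioms R'.abelian_group_axioms ring_hom_ahom[OF f]] that .
 have fJ: "f p \<in> ideal_power R' I' n" if "p \<in> ideal_power R I n" for p n using that
 proof (induction n arbitrary: p)
  case (Suc n)
  from Suc.prems have "p \<in> I \<cdot>.R ideal_power R I n" by (simp add: ideal_power.simps(2))
  then have "f p \<in> I' \<cdot>.R' ideal_power R' I' n"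
  proof (induction)
   case (prod i j)
   then show ?case using fI Suc.IH ideal.Icarr[OF R(2)] ideal.Icarr[OF iJ] by (auto simp: ring_hom_mult[OF f] intro: ideal_prod.prod)
  next
   case (sum s t)
   then show ?case using subsetD[OF R.ideal_prod_in_carrier[OF R(2) iJ]] by (auto simp: ring_hom_add[OF f] intro: ideal_prod.sum)
  qed
  then show ?case by (simp add: ideal_power.simps(2))
 qed (simp add: fc)
 have val: "completion_map R' I' f x n = ideal_power R' I' n +>.R' f p"
  if x: "x \<in> carrier (completion R I)" and p: "p \<in> x n" for x n p
 proof -
  note m = R.completion_mem[OF R(2) x p]
  have "ideal_power R' I' n +>.R' f q = ideal_power R' I' n +>.R' f p" if q: "q \<in> x n" for q
  proof -
   have qc: "q \<in>. R" by (rule R.completion_mem(1)[OF R(2) x q])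
   have "q \<ominus>.R p \<in> ideal_power R I n" using q m ideal.mem_coset_iff[OF iJ m(1)] by auto
   then have "f q \<ominus>.R' f p \<in> ideal_power R' I' n" using fJ fd qc m(1) by metis
   then show ?thesis using ideal.coset_eq_iff[OF iJ'] fc qc m(1) by auto
  qed
  then have "completion_map R' I' f x n = (\<Union>q\<in>x n. ideal_power R' I' n +>.R' f p)"
   unfolding completion_map_def by (rule SUP_cong[OF refl])
  then show ?thesis using p by auto
 qed
 show mem: "f p \<in> completion_map R' I' f x n" if "x \<in> carrier (completion R I)" "p \<in> x n" for x n p
  using val[OF that] R'.coset_self[OF R'(2) fc[OF R.completion_mem(1)[OF R(2) that]]] by simp
 have cl: "completion_map R' I' f x \<in> carrier (completion R' I')" if x: "x \<in> carrier (completion R I)" for x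
 proof -
  obtain p where p: "\<And>n. p n \<in> x n" using R.completion_rep[OF R(2) x] by metis
  note m = R.completion_mem[OF R(2) x p]
  have "p (Suc n) \<ominus>.R p n \<in> ideal_power R I n" for n
   using R.completion_decreasing[OF R(2) x, of n "Suc n"] p[of "Suc n"] m[of n] ideal.mem_coset_iff[OF iJ m(1)] by auto
  then have "f (p (Suc n)) \<ominus>.R' f (p n) \<in> ideal_power R' I' n" for n using fJ fd[OF m(1) m(1)] by metis
  then have "(\<lambda>n. ideal_power R' I' n +>.R' f (p n)) \<in> carrier (completion R' I')"
   using fc m(1) by (intro R'.completionI[OF R'(2)]) auto
  moreover have "completion_map R' I' f x = (\<lambda>n. ideal_power R' I' n +>.R' f (p n))" using val[OF x p] by (intro ext)
  ultimately show ?thesis by simp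
 qed
 show "completion_map R' I' f \<in> ring_hom (completion R I) (completion R' I')"
 proof (rule ring_hom_memI)
  fix x y assume x: "x \<in> carrier (completion R I)" and y: "y \<in> carrier (completion R I)"
  note clo = R.completion_op_closed[OF R(2) x y] R'.completion_op_closed[OF R'(2) cl[OF x] cl[OF y]]
  have ex: "\<exists>r. r \<in> completion_map R' I' f (x \<oplus>\<^bsub>completion R I\<^esub> y) n \<and> r \<in> (completion_map R' I' f x \<oplus>\<^bsub>completion R' I'\<^esub> completion_map R' I' f y) n"
   "\<exists>r. r \<in> completion_map R' I' f (x \<otimes>\<^bsub>completion R I\<^esub> y) n \<and> r \<in> (completion_map R' I' f x \<otimes>\<^bsub>completion R' I'\<^esub> completion_map R' I' f y) n" for n
  proof -
   obtain p q where p: "p \<in> x n" "q \<in> y n" using R.completion_rep[OF R(2) x] R.completion_rep[OF R(2) y] by metis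
   have pq: "p \<in>. R" "q \<in>. R" using R.completion_mem(1)[OF R(2)] x y p by blast+
   note o1 = R.completion_op_mem[OF R(2) x y p] and o2 = R'.completion_op_mem[OF R'(2) cl[OF x] cl[OF y] mem[OF x p(1)] mem[OF y p(2)]]
   from mem[OF clo(1) o1(1)] o2(1) show "\<exists>r. r \<in> completion_map R' I' f (x \<oplus>\<^bsub>completion R I\<^esub> y) n \<and> r \<in> (completion_map R' I' f x \<oplus>\<^bsub>completion R' I'\<^esub> completion_map R' I' f y) n"
    using ring_hom_add[OF f pq] by auto
   from mem[OF clo(2) o1(2)] o2(2) show "\<exists>r. r \<in> completion_map R' I' f (x \<otimes>\<^bsub>completion R I\<^esub> y) n \<and> r \<in> (completion_map R' I' f x \<otimes>\<^bsub>completion R' I'\<^esub> completion_map R' I' f y) n"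
    using ring_hom_mult[OF f pq] by auto
  qed
  show "completion_map R' I' f (x \<oplus>\<^bsub>completion R I\<^esub> y) = completion_map R' I' f x \<oplus>\<^bsub>completion R' I'\<^esub> completion_map R' I' f y"
   by (rule R'.completion_eqI[OF R'(2) cl[OF clo(1)] clo(3) ex(1)])
  show "completion_map R' I' f (x \<otimes>\<^bsub>completion R I\<^esub> y) = completion_map R' I' f x \<otimes>\<^bsub>completion R' I'\<^esub> completion_map R' I' f y"
   by (rule R'.completion_eqI[OF R'(2) cl[OF clo(2)] clo(4) ex(2)])
 next
  interpret cR: cring "completion R I" by (rule R.completion_cring[OF R(2)])
  interpret cR': cring "completion R' I'" by (rule R'.completion_cring[OF R'(2)])
  show "completion_map R' I' f \<one>\<^bsub>completion R I\<^esub> = \<one>\<^bsub>completion R' I'\<^esub>"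
  proof (rule R'.completion_eqI[OF R'(2) cl[OF cR.one_closed] cR'.one_closed])
   fix n
   show "\<exists>p. p \<in> completion_map R' I' f \<one>\<^bsub>completion R I\<^esub> n \<and> p \<in> \<one>\<^bsub>completion R' I'\<^esub> n"
    using mem[OF cR.one_closed R.completion_one_zero_mem(1)[OF R(2)], of n] R'.completion_one_zero_mem(1)[OF R'(2), of n] ring_hom_one[OF f]
    by auto
  qed
 qed (rule cl)
qed

section \<open>The Frobenius homomorphism\<close>

lemma (in cring) binomial_expansion:
 assumes "x \<in>. R" "y \<in>. R"
 shows "(x \<oplus> y) [^] (n::nat) = (\<Oplus>k\<in>{..n}. [(n choose k)] \<cdot> (x [^] k \<otimes> y [^] (n - k)))"
proof (induction n)
 case 0 show ?case using assms by simp
next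
 case (Suc n)
 let ?t = "\<lambda>k. x [^] k \<otimes> y [^] (Suc n - k)"
 let ?g = "\<lambda>k. [(if k = 0 then 0 else n choose (k - 1))] \<cdot> ?t k" and ?h = "\<lambda>k. [(n choose k)] \<cdot> ?t k"
 let ?f = "\<lambda>k. [(n choose k)] \<cdot> (x [^] k \<otimes> y [^] (n - k))"
 have cl: "?f k \<in>. R" "?g k \<in>. R" "?h k \<in>. R" "?t k \<in>. R" for k using assms by simp_all
 have "(x \<oplus> y) [^] Suc n = (\<Oplus>k\<in>{..n}. ?f k) \<otimes> x \<oplus> (\<Oplus>k\<in>{..n}. ?f k) \<otimes> y"
  using assms cl by (simp add: Suc r_distr)
 also have "(\<Oplus>k\<in>{..n}. ?f k) \<otimes> x = (\<Oplus>k\<in>{..n}. ?g (Suc k))"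
  using assms cl by (subst finsum_ldistr) (auto intro!: finsum_cong' simp: add_pow_ldistr add_pow_rdistr m_assoc m_comm m_lcomm)
 also have "\<dots> = (\<Oplus>k\<in>{..Suc n}. ?g k)" using assms cl finsum_Suc2[of ?g n] by (simp del: finsum_Suc nat_pow_Suc)
 also have "(\<Oplus>k\<in>{..n}. ?f k) \<otimes> y = (\<Oplus>k\<in>{..n}. ?h k)"
  using assms cl by (subst finsum_ldistr) (auto intro!: finsum_cong' simp: add_pow_ldistr m_assoc Suc_diff_le)
 also have "\<dots> = (\<Oplus>k\<in>{..Suc n}. ?h k)" using assms cl finsum_Suc[of ?h n] by (simp del: finsum_Suc add: binomial_eq_0)
 also have "(\<Oplus>k\<in>{..Suc n}. ?g k) \<oplus> (\<Oplus>k\<in>{..Suc n}. ?h k) = (\<Oplus>k\<in>{..Suc n}. ?g k \<oplus> ?h k)"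
  using cl by (intro finsum_addf[symmetric]) auto
 also have "\<dots> = (\<Oplus>k\<in>{..Suc n}. [(Suc n choose k)] \<cdot> ?t k)"
 proof (rule finsum_cong')
  fix k show "?g k \<oplus> ?h k = [(Suc n choose k)] \<cdot> ?t k"
   using cl(4)[of k] by (cases k) (simp_all add: add.nat_pow_mult del: add.nat_pow_Suc)
 qed (use cl in auto)
 finally show ?case .
qed

lemma (in cring) prime_char_pow_add:
 assumes p: "prime (p::nat)" "[p] \<cdot> \<one> = \<zero>" and xy: "x \<in>. R" "y \<in>. R"
 shows "(x \<oplus> y) [^] (p ^ n) = x [^] (p ^ n) \<oplus> y [^] (p ^ n)"
proof -
 have z: "[m] \<cdot> u = \<zero>" if "p dvd m" "u \<in>. R" for m u
 proof -
  from that(1) obtain k where "m = p * k" by blast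
  then have "[m] \<cdot> \<one> = \<zero>" using add.nat_pow_pow[of \<one> k p] p(2) by simp
  then show ?thesis using add_pow_ldistr[of \<one> u m] that(2) by simp
 qed
 have pp: "(x \<oplus> y) [^] p = x [^] p \<oplus> y [^] p" if xy: "x \<in>. R" "y \<in>. R" for x y
 proof -
  have "(x \<oplus> y) [^] p = (\<Oplus>k\<in>{..p}. [(p choose k)] \<cdot> (x [^] k \<otimes> y [^] (p - k)))" by (rule binomial_expansion[OF xy])
  also have "\<dots> = (\<Oplus>k\<in>{0, p}. [(p choose k)] \<cdot> (x [^] k \<otimes> y [^] (p - k)))"
  proof (rule add.finprod_mono_neutral_cong_right)
   fix k assume "k \<in> {..p} - {0, p}"
   then show "[(p choose k)] \<cdot> (x [^] k \<otimes> y [^] (p - k)) = \<zero>" using xy by (intro z dvd_choose_prime p(1)) auto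
  qed (use xy in auto)
  also have "\<dots> = x [^] p \<oplus> y [^] p" using xy prime_gt_0_nat[OF p(1)] by (simp add: a_comm)
  finally show ?thesis .
 qed
 show ?thesis
 proof (induction n)
  case (Suc n)
  have "(x \<oplus> y) [^] (p ^ Suc n) = ((x \<oplus> y) [^] (p ^ n)) [^] p" using xy by (simp add: nat_pow_pow mult.commute)
  also have "\<dots> = x [^] (p ^ Suc n) \<oplus> y [^] (p ^ Suc n)" using xy by (simp add: Suc.IH pp nat_pow_pow mult.commute)
  finally show ?case .
 qed (use xy in simp)
qed

text \<open>Every prime l dividing the order is the additive order of 1: a subgroup of order l
  contains a nonzero x with l x = 0, and x cancels because the ring is a field. So only one prime
  divides the order.\<close>

lemma finite_field_card:
 assumes "field Q" "finite (carrier Q)"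
 shows "\<exists>p n. prime (p::nat) \<and> card (carrier Q) = p ^ n \<and> [p] \<cdot>.Q \<one>.Q = \<zero>.Q"
proof -
 interpret Q: field Q by fact
 let ?q = "card (carrier Q)" and ?p = "group.ord (add_monoid Q) \<one>.Q"
 have "card {\<zero>.Q, \<one>.Q} \<le> ?q" by (rule card_mono[OF assms(2)]) auto
 then have q1: "1 < ?q" by auto
 have one: "[l] \<cdot>.Q \<one>.Q = \<zero>.Q \<longleftrightarrow> ?p dvd l" for l :: nat
  using group.pow_eq_id[OF Q.a_group, of "\<one>.Q" l] by (simp add: add_pow_def)
 have prm: "l = ?p" if l: "prime l" "l dvd ?q" for l
 proof -
  obtain m where "order (add_monoid Q) = l ^ 1 * m" using l(2) by (auto simp: order_def)
  then obtain H where H: "subgroup H (add_monoid Q)" "card H = l" using sylow_thm[OF l(1) Q.a_group, of 1 m] assms(2) by auto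
  have "\<not> H \<subseteq> {\<zero>.Q}" using H(2) l(1) card_mono[of "{\<zero>.Q}" H] by (auto dest: prime_gt_1_nat)
  then obtain x where x: "x \<in> H" "x \<noteq> \<zero>.Q" by blast
  have xc: "x \<in>. Q" using subgroup.subset[OF H(1)] x(1) by auto
  interpret H: group "(add_monoid Q)\<lparr>carrier := H\<rparr>" by (rule subgroup.subgroup_is_group[OF H(1) Q.a_group])
  have "x [^]\<^bsub>(add_monoid Q)\<lparr>carrier := H\<rparr>\<^esub> l = \<zero>.Q"
   using H.pow_order_eq_1[of x] x(1) H(2) by (simp add: order_def)
  then have "[l] \<cdot>.Q x = \<zero>.Q" using monoid.nat_pow_consistent[OF Q.a_monoid, of x l H] by (simp add: add_pow_def)
  then have "([l] \<cdot>.Q \<one>.Q) \<otimes>.Q x = \<zero>.Q" using Q.add_pow_ldistr[of "\<one>.Q" x l] xc by simp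
  then have "?p dvd l" using x(2) xc one[of l] Q.integral by auto
  moreover have "?p \<noteq> 1" using one[of 1] by auto
  ultimately show ?thesis using l(1) by (metis prime_nat_iff)
 qed
 obtain l where l: "prime l" "l dvd ?q" using q1 prime_factor_nat[of ?q] by auto
 have p: "prime ?p" using prm[OF l] l by simp
 obtain r where r: "?q = ?p ^ multiplicity ?p ?q * r" "\<not> ?p dvd r"
  by (rule multiplicity_decompose'[of ?q ?p]) (use p q1 prime_gt_1_nat[OF p] that in auto)
 have "r = 1"
 proof (rule ccontr)
  assume "r \<noteq> 1"
  then obtain l where l: "prime l" "l dvd r" using prime_factor_nat by blast
  then have "l dvd ?q" using r(1) by (metis dvd_mult)
  then show False using prm l r(2) by blast
 qed
 then show ?thesis using r(1) p one[of ?p] by auto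
qed

lemma finite_field_pow_card:
 assumes "field Q" "finite (carrier Q)" "a \<in>. Q"
 shows "a [^].Q card (carrier Q) = a"
proof (cases "a = \<zero>.Q")
 case True
 interpret Q: field Q by fact
 have "card (carrier Q) \<noteq> 0" using assms by auto
 then show ?thesis using True by (simp add: Q.nat_pow_zero)
next
 case False
 interpret Q: field Q by fact
 interpret G: group "mult_of Q" by (rule Q.field_mult_group)
 have "a [^].Q card (carrier Q - {\<zero>.Q}) = \<one>.Q" using G.pow_order_eq_1[of a] assms False by (simp add: order_def nat_pow_mult_of)
 moreover have "card (carrier Q) = Suc (card (carrier Q - {\<zero>.Q}))" using card_Suc_Diff1[OF assms(2), of "\<zero>.Q"] by simp
 ultimately show ?thesis using assms(3) by (simp only: Q.nat_pow_Suc Q.l_one)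
qed

lemma (in algebra) smult_one_hom: "(\<lambda>a. a \<odot>.M \<one>.M) \<in> ring_hom R M"
 by (rule ring_hom_memI) (simp_all add: smult_l_distr smult_assoc1 smult_assoc2)

text \<open>Every element of F_q equals its q-th power. Hence the q-Frobenius of \<open>S\<close> is
  F_q-linear and can act on a tensor product over F_q through one factor alone.\<close>

lemma frob_smult:
 assumes "field Q" "finite (carrier Q)" "algebra Q S" "a \<in>. Q" "s \<in>. S"
 shows "frob Q S (a \<odot>.S s) = a \<odot>.S frob Q S s"
proof -
 interpret S: algebra Q S by fact
 interpret Q: field Q by fact
 have "(a \<odot>.S \<one>.S) [^].S n = (a [^].Q n) \<odot>.S \<one>.S" for n :: nat
 proof (induction n)
  case (Suc n) then show ?case using assms(4) ring_hom_mult[OF S.smult_one_hom, of "a [^].Q n" a] by simp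
 qed simp
 then have "(a \<odot>.S \<one>.S) [^].S card (carrier Q) = a \<odot>.S \<one>.S" using finite_field_pow_card[OF assms(1,2,4)] by simp
 then have "((a \<odot>.S \<one>.S) \<otimes>.S s) [^].S card (carrier Q) = (a \<odot>.S \<one>.S) \<otimes>.S s [^].S card (carrier Q)"
  using assms(4,5) by (subst S.nat_pow_distrib) simp_all
 then show ?thesis using assms(4,5) by (simp add: frob_def S.smult_assoc2)
qed

lemma frob_hom:
 assumes "field Q" "finite (carrier Q)" "algebra Q S"
 shows "frob Q S \<in> ring_hom S S"
proof -
 interpret S: algebra Q S by fact
 obtain p n where p: "prime (p::nat)" "card (carrier Q) = p ^ n" "[p] \<cdot>.Q \<one>.Q = \<zero>.Q" using finite_field_card[OF assms(1,2)] by blast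
 have "[m] \<cdot>.S \<one>.S = ([m] \<cdot>.Q \<one>.Q) \<odot>.S \<one>.S" for m :: nat by (induction m) (simp_all add: S.smult_l_distr)
 then have ps: "[p] \<cdot>.S \<one>.S = \<zero>.S" using p(3) by simp
 show ?thesis
 proof (rule ring_hom_memI)
  fix x y assume "x \<in>. S" "y \<in>. S"
  then show "frob Q S (x \<oplus>.S y) = frob Q S x \<oplus>.S frob Q S y" "frob Q S (x \<otimes>.S y) = frob Q S x \<otimes>.S frob Q S y"
   unfolding frob_def p(2) by (rule S.prime_char_pow_add[OF p(1) ps], rule S.nat_pow_distrib)
 qed (simp_all add: frob_def)
qed

section \<open>Valuation rings over a finite field\<close>

locale valued_algebra =
 fixes Q :: "'q ring" and K :: "('q, 'k) module" and v :: "'k \<Rightarrow> int"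
 assumes Q: "field Q" "finite (carrier Q)" and K: "field K" and alg: "algebra Q K" and dv: "discrete_valuation K v"
begin

sublocale Q: field Q by (rule Q)
sublocale K: field K by (rule K)
sublocale KQ: algebra Q K by (rule alg)

abbreviation "ball \<equiv> val_ball K v"
abbreviation "R \<equiv> int_ring K v"

lemma v_mult: "x \<in>. K ==> y \<in>. K ==> x \<noteq> \<zero>.K ==> y \<noteq> \<zero>.K ==> v (x \<otimes>.K y) = v x + v y"
 using dv by (auto simp: discrete_valuation_def)

lemma v_one: "v \<one>.K = 0" using v_mult[of "\<one>.K" "\<one>.K"] by simp

lemma v_pow: "x \<in>. K ==> x \<noteq> \<zero>.K ==> x [^].K (n::nat) \<noteq> \<zero>.K \<and> v (x [^].K n) = int n * v x"
 by (induction n) (auto simp: v_one v_mult K.integral_iff algebra_simps)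

lemma v_minus: "x \<in>. K ==> x \<noteq> \<zero>.K ==> v (\<ominus>.K x) = v x"
proof -
 assume x: "x \<in>. K" "x \<noteq> \<zero>.K"
 have n: "\<ominus>.K \<one>.K \<noteq> \<zero>.K" using K.minus_equality[of "\<zero>.K" "\<one>.K"] K.minus_minus[of "\<one>.K"] by auto
 have "v (\<ominus>.K \<one>.K) + v (\<ominus>.K \<one>.K) = 0" using v_mult[OF _ _ n n] by (simp add: K.l_minus v_one)
 then show ?thesis using v_mult[OF _ x(1) n x(2)] x by (simp add: K.l_minus)
qed

lemma ball_closed: "x \<in> ball n ==> x \<in>. K" by (simp add: val_ball_def)
lemma ball_zero: "\<zero>.K \<in> ball n" by (simp add: val_ball_def)
lemma ball_mono: "x \<in> ball m ==> n \<le> m ==> x \<in> ball n" by (auto simp: val_ball_def)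

lemma ball_minus: "x \<in> ball n ==> \<ominus>.K x \<in> ball n" by (cases "x = \<zero>.K") (auto simp: val_ball_def v_minus)

lemma ball_add: "x \<in> ball n ==> y \<in> ball n ==> x \<oplus>.K y \<in> ball n"
 using dv by (cases "x = \<zero>.K"; cases "y = \<zero>.K"; force simp: val_ball_def discrete_valuation_def)

lemma ball_mult: "x \<in> ball m ==> y \<in> ball n ==> x \<otimes>.K y \<in> ball (m + n)"
 by (cases "x = \<zero>.K"; cases "y = \<zero>.K") (auto simp: val_ball_def v_mult)

text \<open>The powers of a nonzero scalar repeat in a finite field, so its image in
  \<open>K\<close> has valuation 0; every ball is therefore an F_q-subspace.\<close>

lemma ball_smult: assumes a: "a \<in>. Q" and x: "x \<in> ball n" shows "a \<odot>.K x \<in> ball n"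
proof (cases "a = \<zero>.Q")
 case True then show ?thesis using x by (simp add: ball_zero ball_closed)
next
 case False
 let ?u = "\<lambda>a. a \<odot>.K \<one>.K"
 note h = KQ.smult_one_hom
 have mult: "?u (b \<otimes>.Q c) = ?u b \<otimes>.K ?u c" if "b \<in>. Q" "c \<in>. Q" for b c using ring_hom_mult[OF h that] .
 have pow: "?u (a [^].Q (i::nat)) = ?u a [^].K i" for i
 proof (induction i)
  case (Suc i) show ?case using mult[of "a [^].Q i" a] a by (simp only: Suc Q.nat_pow_Suc K.nat_pow_Suc Q.nat_pow_closed)
 qed simp
 have "\<not> inj_on (\<lambda>i::nat. a [^].Q i) UNIV"
  using finite_subset[OF _ Q(2)] a finite_imageD[of "\<lambda>i::nat. a [^].Q i" UNIV] by (auto simp: image_subset_iff)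
 then obtain i j :: nat where ij: "a [^].Q i = a [^].Q j" "i \<noteq> j" by (auto simp: inj_on_def)
 have un: "?u a \<noteq> \<zero>.K"
 proof
  assume "?u a = \<zero>.K"
  then have "?u (a \<otimes>.Q inv\<^bsub>Q\<^esub> a) = \<zero>.K" using mult[of a "inv\<^bsub>Q\<^esub> a"] a False Q.field_Units by simp
  then show False using a False Q.field_Units by simp
 qed
 have uc: "?u a \<in>. K" using a by simp
 have "v (?u a [^].K i) = v (?u a [^].K j)" using pow[of i] pow[of j] ij(1) by simp
 then have "int i * v (?u a) = int j * v (?u a)" using v_pow[OF uc un] by simp
 then have "v (?u a) = 0" using ij(2) by simp
 then have "?u a \<in> ball 0" using uc by (simp add: val_ball_def)
 then show ?thesis using ball_mult[of "?u a" 0 x n] x a ball_closed[OF x] by (simp add: KQ.smult_assoc2)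
qed

lemma int_ring_simps [simp]:
 "carrier R = ball 0" "\<zero>.R = \<zero>.K" "\<one>.R = \<one>.K" "x \<oplus>.R y = x \<oplus>.K y" "x \<otimes>.R y = x \<otimes>.K y" "a \<odot>.R x = a \<odot>.K x"
 by (simp_all add: int_ring_def)

lemma int_ring_pow [simp]: "x [^].R (n::nat) = x [^].K n" by (simp add: nat_pow_def)

lemma one_in_ball: "\<one>.K \<in> ball 0" by (simp add: val_ball_def v_one)

lemma int_ring_algebra: "algebra Q R"
proof (rule algebraI)
 have "subring (ball 0) K" by (rule K.subringI) (use ball_closed one_in_ball ball_minus ball_add ball_mult[of _ 0 _ 0] in auto)
 then show "cring R" unfolding int_ring_def using K.subcring_iff[of "ball 0"] K.subcringI' ball_closed by blast
qed (auto simp: Q.is_cring ball_smult ball_closed KQ.smult_l_distr KQ.smult_r_distr KQ.smult_assoc1 KQ.smult_assoc2)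

lemma int_ring_minus [simp]: "x \<in> ball 0 ==> \<ominus>.R x = \<ominus>.K x"
proof -
 interpret R: algebra Q R by (rule int_ring_algebra)
 assume x: "x \<in> ball 0"
 show ?thesis using R.minus_equality[of "\<ominus>.K x" x] x ball_minus[OF x] ball_closed[OF x] K.l_neg by simp
qed

lemma inclusion_hom: "(\<lambda>x. x) \<in> ring_hom R K" by (rule ring_hom_memI) (auto dest: ball_closed)

end

section \<open>Digit expansions\<close>

text \<open>For E the valuation ring of the local field, this is the F_q-dual of O/z^N, as
  functionals on O.\<close>

definition cofunctionals :: "('q, 'x) ring_scheme \<Rightarrow> ('q, 'f) module \<Rightarrow> 'f \<Rightarrow> nat \<Rightarrow> ('f \<Rightarrow> 'q) set" where
 "cofunctionals Q E z N = {l \<in> functionals Q E. \<forall>u\<in>carrier E. l (z [^].E N \<otimes>.E u) = \<zero>.Q}"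

text \<open>A list of pairs, so that the families belonging to successive digits can be
  appended.\<close>

definition dual_sum :: "('q, 'f) module \<Rightarrow> (('f \<Rightarrow> 'q) \<times> 'f) list \<Rightarrow> 'f \<Rightarrow> 'f" where
 "dual_sum E es u = foldr (\<lambda>(l, e) x. (l u \<odot>.E e) \<oplus>.E x) es \<zero>.E"

lemma dual_sum_simps [simp]:
 "dual_sum E [] u = \<zero>.E" "dual_sum E ((l, e) # es) u = (l u \<odot>.E e) \<oplus>.E dual_sum E es u" by (simp_all add: dual_sum_def)

text \<open>Only the first digit is assumed: finitely many functionals determine an element modulo
  z. All further digits follow by cancelling z.\<close>

locale finite_digits =
 fixes Q :: "'q ring" and E :: "('q, 'f) module" and z :: 'f
 assumes QO: "algebra Q E" and z_closed: "z \<in>. E"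
  and z_cancel: "x \<in>. E ==> y \<in>. E ==> z \<otimes>.E x = z \<otimes>.E y ==> x = y"
  and dual_one: "\<exists>es. set es \<subseteq> cofunctionals Q E z 1 \<times> carrier E \<and>
   (\<forall>u\<in>carrier E. \<exists>u'\<in>carrier E. u = dual_sum E es u \<oplus>.E z \<otimes>.E u')"
begin

sublocale E: algebra Q E by (rule QO)

abbreviation "Lam \<equiv> cofunctionals Q E z"

lemma dual_sum_facts:
 assumes "set es \<subseteq> Lam N \<times> carrier E"
 shows dual_sum_closed: "x \<in>. E ==> dual_sum E es x \<in>. E"
  and dual_sum_add: "x \<in>. E ==> y \<in>. E ==> dual_sum E es (x \<oplus>.E y) = dual_sum E es x \<oplus>.E dual_sum E es y"
  and dual_sum_smult: "x \<in>. E ==> a \<in>. Q ==> dual_sum E es (a \<odot>.E x) = a \<odot>.E dual_sum E es x"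
  and dual_sum_zero: "x \<in>. E ==> dual_sum E es (z [^].E N \<otimes>.E x) = \<zero>.E"
proof -
 have "(\<forall>x\<in>carrier E. dual_sum E es x \<in>. E \<and> dual_sum E es (z [^].E N \<otimes>.E x) = \<zero>.E \<and>
  (\<forall>y\<in>carrier E. dual_sum E es (x \<oplus>.E y) = dual_sum E es x \<oplus>.E dual_sum E es y) \<and>
  (\<forall>a\<in>carrier Q. dual_sum E es (a \<odot>.E x) = a \<odot>.E dual_sum E es x))" using assms
 proof (induction es)
  case (Cons p es)
  obtain l e where p: "p = (l, e)" by (cases p)
  then have l: "l \<in> functionals Q E" "\<And>u. u \<in>. E ==> l (z [^].E N \<otimes>.E u) = \<zero>.Q" "e \<in>. E"
   using Cons.prems by (auto simp: cofunctionals_def)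
  have IH: "dual_sum E es x \<in>. E" "dual_sum E es (z [^].E N \<otimes>.E x) = \<zero>.E"
   "y \<in>. E ==> dual_sum E es (x \<oplus>.E y) = dual_sum E es x \<oplus>.E dual_sum E es y"
   "a \<in>. Q ==> dual_sum E es (a \<odot>.E x) = a \<odot>.E dual_sum E es x" if "x \<in>. E" for x y a using Cons that by auto
  show ?case using l by (auto simp: p IH functionals_simps[OF l(1)] E.smult_l_distr E.smult_r_distr E.smult_assoc1 E.a_ac)
 qed (auto simp: E.smult_r_null)
 then show "x \<in>. E ==> dual_sum E es x \<in>. E"
  "x \<in>. E ==> y \<in>. E ==> dual_sum E es (x \<oplus>.E y) = dual_sum E es x \<oplus>.E dual_sum E es y"
  "x \<in>. E ==> a \<in>. Q ==> dual_sum E es (a \<odot>.E x) = a \<odot>.E dual_sum E es x"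
  "x \<in>. E ==> dual_sum E es (z [^].E N \<otimes>.E x) = \<zero>.E" by auto
qed

definition "es1 = (SOME es. set es \<subseteq> Lam 1 \<times> carrier E \<and>
   (\<forall>u\<in>carrier E. \<exists>u'\<in>carrier E. u = dual_sum E es u \<oplus>.E z \<otimes>.E u'))"

lemma es1: "set es1 \<subseteq> Lam 1 \<times> carrier E"
  "u \<in>. E ==> \<exists>u'\<in>carrier E. u = dual_sum E es1 u \<oplus>.E z \<otimes>.E u'"
 using someI_ex[OF dual_one] unfolding es1_def by auto

text \<open>The element left when the first digit is removed and the rest divided by z. Cancellation
  of z makes it unique, and therefore linear in \<open>u\<close>.\<close>

definition "tail u = (SOME u'. u' \<in>. E \<and> u = dual_sum E es1 u \<oplus>.E z \<otimes>.E u')"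

lemma tail: "u \<in>. E ==> tail u \<in>. E" "u \<in>. E ==> u = dual_sum E es1 u \<oplus>.E z \<otimes>.E tail u"
 using someI_ex[OF es1(2)[unfolded Bex_def], of u] unfolding tail_def by auto

lemma tail_eqI:
 assumes "u \<in>. E" "t \<in>. E" "u = dual_sum E es1 u \<oplus>.E z \<otimes>.E t"
 shows "tail u = t"
proof (rule z_cancel)
 have "dual_sum E es1 u \<oplus>.E z \<otimes>.E tail u = dual_sum E es1 u \<oplus>.E z \<otimes>.E t" using tail(2)[OF assms(1)] assms(3) by metis
 then show "z \<otimes>.E tail u = z \<otimes>.E t"
  using assms tail(1) z_closed dual_sum_closed[OF es1(1)] E.r_neg1[of "dual_sum E es1 u" "z \<otimes>.E tail u"] E.r_neg1[of "dual_sum E es1 u" "z \<otimes>.E t"] by simp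
qed (use assms tail in auto)

lemma tail_z: "u \<in>. E ==> tail (z \<otimes>.E u) = u" using dual_sum_zero[OF es1(1), of u] z_closed by (intro tail_eqI) auto

lemma tail_linear:
 "x \<in>. E ==> y \<in>. E ==> tail (x \<oplus>.E y) = tail x \<oplus>.E tail y"
 "x \<in>. E ==> a \<in>. Q ==> tail (a \<odot>.E x) = a \<odot>.E tail x"
proof -
 note cl = tail(1) z_closed dual_sum_closed[OF es1(1)]
 assume x: "x \<in>. E"
 note tx = tail(2)[OF x]
 show "tail (x \<oplus>.E y) = tail x \<oplus>.E tail y" if y: "y \<in>. E"
 proof (rule tail_eqI)
  have "x \<oplus>.E y = (dual_sum E es1 x \<oplus>.E z \<otimes>.E tail x) \<oplus>.E (dual_sum E es1 y \<oplus>.E z \<otimes>.E tail y)"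
   using tx tail(2)[OF y] by metis
  also have "\<dots> = (dual_sum E es1 x \<oplus>.E dual_sum E es1 y) \<oplus>.E z \<otimes>.E (tail x \<oplus>.E tail y)"
   using x y cl by (simp add: E.r_distr E.a_ac)
  finally show "x \<oplus>.E y = dual_sum E es1 (x \<oplus>.E y) \<oplus>.E z \<otimes>.E (tail x \<oplus>.E tail y)"
   unfolding dual_sum_add[OF es1(1) x y] .
 qed (use x y cl in auto)
 show "tail (a \<odot>.E x) = a \<odot>.E tail x" if a: "a \<in>. Q"
 proof (rule tail_eqI)
  have "a \<odot>.E x = a \<odot>.E (dual_sum E es1 x \<oplus>.E z \<otimes>.E tail x)" using tx by metis
  also have "\<dots> = a \<odot>.E dual_sum E es1 x \<oplus>.E z \<otimes>.E (a \<odot>.E tail x)"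
   using x a cl E.smult_assoc2[of a "tail x" z] by (simp add: E.smult_r_distr E.m_comm)
  finally show "a \<odot>.E x = dual_sum E es1 (a \<odot>.E x) \<oplus>.E z \<otimes>.E (a \<odot>.E tail x)"
   unfolding dual_sum_smult[OF es1(1) x a] .
 qed (use x a cl in auto)
qed

text \<open>The same digits read one place later. The second part shows that every functional arises
  from another by composition with multiplication by z; this makes multiplication by z injective on
  the completed tensor product.\<close>

lemma cofunctional_shift:
 assumes l: "l \<in> Lam N"
 shows "(\<lambda>u. l (tail u)) \<in> Lam (Suc N)" "u \<in>. E ==> l (tail (z \<otimes>.E u)) = l u"
proof -
 have f: "l \<in> functionals Q E" using l by (simp add: cofunctionals_def)
 have e: "z [^].E Suc N \<otimes>.E u = z \<otimes>.E (z [^].E N \<otimes>.E u)" if "u \<in>. E" for u using that z_closed by (simp add: E.m_ac)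
 show "(\<lambda>u. l (tail u)) \<in> Lam (Suc N)" unfolding cofunctionals_def
 proof (intro CollectI conjI ballI)
  show "(\<lambda>u. l (tail u)) \<in> functionals Q E" by (rule functionalsI) (simp_all add: tail(1) tail_linear functionals_simps[OF f])
  fix u assume "u \<in>. E"
  then show "l (tail (z [^].E Suc N \<otimes>.E u)) = \<zero>.Q" using l z_closed by (simp only: e) (simp add: tail_z cofunctionals_def)
 qed
 show "u \<in>. E ==> l (tail (z \<otimes>.E u)) = l u" by (simp add: tail_z)
qed

lemma cofunctional_mono: "l \<in> Lam N ==> N \<le> M ==> l \<in> Lam M"
proof -
 assume l: "l \<in> Lam N" and "N \<le> M"
 then obtain k where k: "M = N + k" using le_Suc_ex by blast
 have "z [^].E M \<otimes>.E u = z [^].E N \<otimes>.E (z [^].E k \<otimes>.E u)" if "u \<in>. E" for u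
  using that z_closed unfolding k by (simp add: E.nat_pow_mult[symmetric] E.m_assoc)
 then show "l \<in> Lam M" using l z_closed by (auto simp: cofunctionals_def)
qed

lemma cofunctional_mult:
 assumes l: "l \<in> Lam N" and x: "x \<in>. E"
 shows "(\<lambda>u. l (x \<otimes>.E u)) \<in> Lam N"
proof -
 have f: "l \<in> functionals Q E" using l by (simp add: cofunctionals_def)
 have "x \<otimes>.E (a \<odot>.E u) = a \<odot>.E (x \<otimes>.E u)" if "a \<in>. Q" "u \<in>. E" for a u
  using that x E.smult_assoc2[of a u x] by (simp add: E.m_comm)
 then have "(\<lambda>u. l (x \<otimes>.E u)) \<in> functionals Q E"
  using x by (intro functionalsI) (simp_all add: functionals_simps[OF f] E.r_distr)
 moreover have "x \<otimes>.E (z [^].E N \<otimes>.E u) = z [^].E N \<otimes>.E (x \<otimes>.E u)" if "u \<in>. E" for u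
  using that x z_closed by (simp add: E.m_ac)
 ultimately show ?thesis using l x by (auto simp: cofunctionals_def)
qed

lemma cofunctional_mult_z:
 assumes l: "l \<in> Lam (Suc N)"
 shows "(\<lambda>u. l (z \<otimes>.E u)) \<in> Lam N"
proof -
 have "z [^].E Suc N \<otimes>.E u = z \<otimes>.E (z [^].E N \<otimes>.E u)" if "u \<in>. E" for u using that z_closed by (simp add: E.m_ac)
 then show ?thesis using l cofunctional_mult[OF l z_closed] by (auto simp: cofunctionals_def)
qed

lemma dual_expansion:
 "\<exists>es. set es \<subseteq> Lam N \<times> carrier E \<and>
   (\<forall>u\<in>carrier E. \<exists>u'\<in>carrier E. u = dual_sum E es u \<oplus>.E z [^].E N \<otimes>.E u')"
proof (induction N)
 case 0 show ?case by (intro exI[of _ "[]"]) auto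
next
 case (Suc N)
 then obtain es where es: "set es \<subseteq> Lam N \<times> carrier E"
  and exp: "\<And>u. u \<in>. E ==> \<exists>u'\<in>carrier E. u = dual_sum E es u \<oplus>.E z [^].E N \<otimes>.E u'" by blast
 \<comment> \<open>The first digit is read by \<open>es1\<close>, the next ones are the digits of
   the tail, their vectors multiplied by z.\<close>
 let ?es = "es1 @ map (\<lambda>(l, e). (\<lambda>u. l (tail u), z \<otimes>.E e)) es"
 have "set ?es \<subseteq> Lam (Suc N) \<times> carrier E"
  using es es1(1) cofunctional_mono[of _ 1 "Suc N"] cofunctional_shift(1)[of _ N] z_closed by auto
 moreover have ds: "dual_sum E ?es u = dual_sum E es1 u \<oplus>.E z \<otimes>.E dual_sum E es (tail u)" if u: "u \<in>. E" for u
 proof -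
  have 1: "dual_sum E (map (\<lambda>(l, e). (\<lambda>u. l (tail u), z \<otimes>.E e)) es) u = z \<otimes>.E dual_sum E es (tail u)" using es
  proof (induction es)
   case (Cons p es)
   obtain l e where p: "p = (l, e)" by (cases p)
   have lc: "l (tail u) \<in>. Q" "e \<in>. E" "dual_sum E es (tail u) \<in>. E"
    using Cons.prems p functionals_simps(1) tail(1)[OF u] dual_sum_closed[of es N] by (auto simp: cofunctionals_def)
   have "l (tail u) \<odot>.E (z \<otimes>.E e) = z \<otimes>.E (l (tail u) \<odot>.E e)"
    using lc E.smult_assoc2[of "l (tail u)" e z] z_closed by (simp add: E.m_comm)
   then show ?case using Cons lc z_closed by (simp add: p E.r_distr)
  qed (simp add: z_closed)
  have 2: "dual_sum E (fs @ gs) u = dual_sum E fs u \<oplus>.E dual_sum E gs u"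
   if "set fs \<subseteq> Lam (Suc N) \<times> carrier E" "set gs \<subseteq> Lam (Suc N) \<times> carrier E" for fs gs using that
  proof (induction fs)
   case (Cons p fs)
   obtain l e where p: "p = (l, e)" by (cases p)
   have "l u \<in>. Q" "e \<in>. E" "dual_sum E fs u \<in>. E" "dual_sum E gs u \<in>. E"
    using Cons.prems p functionals_simps(1) u dual_sum_closed[of _ "Suc N"] by (auto simp: cofunctionals_def)
   then show ?case using Cons by (simp add: p E.a_assoc)
  qed (use u dual_sum_closed in simp)
  show ?thesis using 1 2[of es1 "map (\<lambda>(l, e). (\<lambda>u. l (tail u), z \<otimes>.E e)) es"] \<open>set ?es \<subseteq> Lam (Suc N) \<times> carrier E\<close> by simp
 qed
 moreover have "\<exists>u'\<in>carrier E. u = dual_sum E ?es u \<oplus>.E z [^].E Suc N \<otimes>.E u'" if u: "u \<in>. E" for u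
 proof -
  obtain u' where u': "u' \<in>. E" "tail u = dual_sum E es (tail u) \<oplus>.E z [^].E N \<otimes>.E u'" using exp[OF tail(1)[OF u]] by blast
  have c: "dual_sum E es (tail u) \<in>. E" "dual_sum E es1 u \<in>. E" using dual_sum_closed[OF es tail(1)[OF u]] dual_sum_closed[OF es1(1) u] .
  have "u = dual_sum E es1 u \<oplus>.E z \<otimes>.E (dual_sum E es (tail u) \<oplus>.E z [^].E N \<otimes>.E u')"
   using tail(2)[OF u] u'(2) by metis
  then have "u = dual_sum E ?es u \<oplus>.E z [^].E Suc N \<otimes>.E u'" using ds[OF u] u' c z_closed by (simp add: E.r_distr E.a_assoc E.m_ac)
  then show ?thesis using u'(1) by blast
 qed
 ultimately show ?case by blast
qed

end

section \<open>The valuation ring of a local field as a ring with digits\<close>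

lemma (in valued_algebra) v_inv:
 assumes "x \<in>. K" "x \<noteq> \<zero>.K"
 shows "inv\<^bsub>K\<^esub> x \<in>. K" "inv\<^bsub>K\<^esub> x \<noteq> \<zero>.K" "x \<otimes>.K inv\<^bsub>K\<^esub> x = \<one>.K" "v (inv\<^bsub>K\<^esub> x) = - v x"
proof -
 have u: "x \<in> Units K" using assms K.field_Units by simp
 show i: "inv\<^bsub>K\<^esub> x \<in>. K" "x \<otimes>.K inv\<^bsub>K\<^esub> x = \<one>.K" using u by simp_all
 then show n: "inv\<^bsub>K\<^esub> x \<noteq> \<zero>.K" using assms by auto
 show "v (inv\<^bsub>K\<^esub> x) = - v x" using v_mult[OF assms(1) i(1) assms(2) n] i(2) v_one by simp
qed

locale local_field = valued_algebra Q F w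
 for Q :: "'q ring" and F :: "('q, 'f) module" and w :: "'f \<Rightarrow> int" +
 fixes z :: 'f
 assumes lf: "local_field_over Q F w" and unif: "uniformizer F w z"
begin

sublocale R: algebra Q R by (rule int_ring_algebra)

lemma z: "z \<in>. F" "z \<noteq> \<zero>.F" "w z = 1" "z \<in> ball 0" "z \<in> ball 1"
proof -
 have m: "ball 1 = {x \<otimes>.F z | x. x \<in> ball 0}" and z0: "z \<in> ball 0"
  using unif by (simp_all add: uniformizer_def max_ideal_def cgenideal_def)
 then show zc: "z \<in>. F" "z \<in> ball 0" using ball_closed by auto
 have "1 \<in> w ` (carrier F - {\<zero>.F})" using lf by (simp add: local_field_over_def)
 then obtain x where "1 = w x" "x \<in> carrier F - {\<zero>.F}" by (rule imageE)
 then have x: "x \<in>. F" "x \<noteq> \<zero>.F" "w x = 1" by auto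
 then have "x \<in> ball 1" by (simp add: val_ball_def)
 then obtain y where y: "x = y \<otimes>.F z" "y \<in> ball 0" unfolding m by blast
 show nz: "z \<noteq> \<zero>.F" using x y ball_closed by auto
 have "y \<noteq> \<zero>.F" using x y zc by auto
 then have "w y \<ge> 0" "w y + w z = 1" using x(3) y v_mult[OF ball_closed[OF y(2)] zc(1) _ nz] by (auto simp: val_ball_def)
 moreover show z1: "z \<in> ball 1" unfolding m using zc one_in_ball by (intro CollectI exI[of _ "\<one>.F"]) simp
 ultimately show "w z = 1" using nz by (auto simp: val_ball_def)
qed

lemma ball_div: "x \<in> ball (int n) ==> \<exists>u\<in>ball 0. x = z [^].F n \<otimes>.F u"
proof -
 assume x: "x \<in> ball (int n)"
 have p: "z [^].F n \<in>. F" "z [^].F n \<noteq> \<zero>.F" "w (z [^].F n) = int n" using v_pow[OF z(1,2)] z by auto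
 note i = v_inv[OF p(1,2)]
 have "inv\<^bsub>F\<^esub> (z [^].F n) \<in> ball (- int n)" using i p(3) by (simp add: val_ball_def)
 from ball_mult[OF this x] have "inv\<^bsub>F\<^esub> (z [^].F n) \<otimes>.F x \<in> ball 0" by simp
 moreover have "x = z [^].F n \<otimes>.F (inv\<^bsub>F\<^esub> (z [^].F n) \<otimes>.F x)"
  using K.m_assoc[OF p(1) i(1) ball_closed[OF x]] i(3) ball_closed[OF x] by simp
 ultimately show ?thesis by blast
qed

abbreviation "kf \<equiv> R Quot ball 1"
abbreviation "pr \<equiv> \<lambda>u. ball 1 +>.R u"
abbreviation "hk \<equiv> \<lambda>a. pr (a \<odot>.F \<one>.F)"

lemma residue_ideal: "ideal (ball 1) R" using R.cgenideal_ideal[of z] unif z(4) by (simp add: uniformizer_def max_ideal_def)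

lemma pr_hom: "pr \<in> ring_hom R kf" by (rule ideal.rcos_ring_hom[OF residue_ideal])

lemma pr_eq_iff: "u \<in> ball 0 ==> t \<in> ball 0 ==> pr u = pr t \<longleftrightarrow> (\<exists>x\<in>ball 0. u = t \<oplus>.F z \<otimes>.F x)"
proof -
 assume ut: "u \<in> ball 0" "t \<in> ball 0"
 note c = ball_closed[OF ut(1)] ball_closed[OF ut(2)]
 have "pr u = pr t \<longleftrightarrow> u \<ominus>.F t \<in> ball 1"
  using ideal.coset_eq_iff[OF residue_ideal, of t u] ut by (simp add: a_minus_def)
 also have "\<dots> \<longleftrightarrow> (\<exists>x\<in>ball 0. u \<ominus>.F t = z \<otimes>.F x)"
  using ball_div[of _ 1] ball_mult[OF z(5), of _ 0] z(1) by auto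
 also have "\<dots> \<longleftrightarrow> (\<exists>x\<in>ball 0. u = t \<oplus>.F z \<otimes>.F x)"
 proof (rule bex_cong[OF refl])
  fix x assume "x \<in> ball 0"
  then have x: "z \<otimes>.F x \<in>. F" using ball_closed z(1) by simp
  have "t \<oplus>.F (u \<ominus>.F t) = u" using c by (simp add: a_minus_def K.a_lcomm[of t u] K.r_neg)
  moreover have "(t \<oplus>.F z \<otimes>.F x) \<ominus>.F t = z \<otimes>.F x" using c x by (simp add: a_minus_def K.a_comm[of t] K.a_assoc K.r_neg)
  ultimately show "u \<ominus>.F t = z \<otimes>.F x \<longleftrightarrow> u = t \<oplus>.F z \<otimes>.F x" by metis
 qed
 finally show ?thesis .
qed

lemma hk_hom: "hk \<in> ring_hom Q kf" using ring_hom_trans[OF R.smult_one_hom pr_hom] by (simp add: comp_def)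

text \<open>The residue degree is defined through \<open>ring.dim\<close>, which has its usual
  meaning once finite dimension is known. The elements of the finite residue field, as a list, form
  a spanning family.\<close>

lemma residue_basis:
 "\<exists>Vs. ring.independent kf (hk ` carrier Q) Vs \<and> ring.Span kf (hk ` carrier Q) Vs = carrier kf \<and> set Vs \<subseteq> carrier kf \<and>
   length Vs = residue_degree Q F w \<and> 0 < residue_degree Q F w \<and> subfield (hk ` carrier Q) kf \<and> inj_on hk (carrier Q)"
proof -
 interpret k: ring kf by (rule ideal.quotient_is_ring[OF residue_ideal])
 interpret h: ring_hom_ring Q kf hk by (simp add: ring_hom_ring_def ring_hom_ring_axioms_def Q.ring_axioms k.ring_axioms hk_hom)
 have one: "\<one>.kf \<noteq> \<zero>.kf"
 proof
  assume "\<one>.kf = \<zero>.kf"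
  then have "pr \<one>.F = ball 1" by (simp add: FactRing_def)
  moreover have "\<one>.F \<in> pr \<one>.F"
   using ideal.mem_coset_iff[OF residue_ideal, of "\<one>.F" "\<one>.F"] one_in_ball by (simp add: a_minus_def K.r_neg ball_zero)
  ultimately show False by (simp add: val_ball_def v_one)
 qed
 note sf = h.img_is_subfield[OF Q.carrier_is_subfield one]
 have "finite (carrier kf)" using lf by (simp add: local_field_over_def max_ideal_def)
 then obtain Us where Us: "set Us = carrier kf" using finite_list by blast
 have sp: "k.Span (hk ` carrier Q) Us = carrier kf"
  using k.Span_base_incl[OF sf(2), of Us] k.Span_in_carrier[OF subfieldE(3)[OF sf(2)], of Us] Us by auto
 have "k.finite_dimension (hk ` carrier Q) (carrier kf)" using k.Span_finite_dimension[OF sf(2), of Us] Us sp by simp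
 from k.finite_dimensionE[OF sf(2) this]
 have d: "k.dimension (residue_degree Q F w) (hk ` carrier Q) (carrier kf)" by (simp add: residue_degree_def max_ideal_def over_def Let_def)
 have "residue_degree Q F w \<noteq> 0"
 proof
  assume "residue_degree Q F w = 0"
  then have "k.dimension 0 (hk ` carrier Q) (carrier kf)" using d by metis
  from k.dimension_zero[OF sf(2) this] have "\<one>.kf \<in> {\<zero>.kf}" using k.one_closed by metis
  then show False using one by blast
 qed
 then have pos: "0 < residue_degree Q F w" by simp
 obtain Vs where V: "set Vs \<subseteq> carrier kf \<and> k.independent (hk ` carrier Q) Vs \<and> length Vs = residue_degree Q F w \<and> k.Span (hk ` carrier Q) Vs = carrier kf"
  using k.exists_base[OF sf(2) d] by (elim exE)
 show ?thesis using V[THEN conjunct1] V[THEN conjunct2, THEN conjunct1] V[THEN conjunct2, THEN conjunct2]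
  by (intro exI[of _ Vs] conjI pos sf) (erule conjE | assumption)+
qed

text \<open>Purity gives only r > 0; boundedness needs r times the residue degree to be positive, so
  that the Frobenius power really enlarges valuations.\<close>

lemma residue_degree_pos: "0 < residue_degree Q F w" using residue_basis by blast

lemma z_cancel: "x \<in> ball 0 ==> y \<in> ball 0 ==> z \<otimes>.F x = z \<otimes>.F y ==> x = y"
 using K.m_lcancel[OF z(2,1)] ball_closed by blast

text \<open>The functionals are the coordinates of the residue class on an F_q-basis of the residue
  field, the vectors are lifts of that basis, and two elements agree modulo z when their residue
  classes do.\<close>

lemma digit_functionals:
 "\<exists>es. set es \<subseteq> cofunctionals Q R z 1 \<times> carrier R \<and>
   (\<forall>u\<in>carrier R. \<exists>u'\<in>carrier R. u = dual_sum R es u \<oplus>.R z \<otimes>.R u')"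
proof -
 interpret k: ring kf by (rule ideal.quotient_is_ring[OF residue_ideal])
 obtain Vs where ind: "k.independent (hk ` carrier Q) Vs" and sp: "k.Span (hk ` carrier Q) Vs = carrier kf"
  and Vs: "set Vs \<subseteq> carrier kf" and sf: "subfield (hk ` carrier Q) kf" and inj: "inj_on hk (carrier Q)" using residue_basis by blast
 define P where "P u Ls \<longleftrightarrow> set Ls \<subseteq> carrier Q \<and> length Ls = length Vs \<and> pr u = k.combine (map hk Ls) Vs" for u Ls
 have prc: "pr u \<in>. kf" if "u \<in> ball 0" for u using ring_hom_closed[OF pr_hom] that by simp
 have hc: "hk a \<in>. kf" if "a \<in>. Q" for a using ring_hom_closed[OF hk_hom that] .
 have ex1: "\<exists>!Ls. P u Ls" if u: "u \<in> ball 0" for u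
 proof -
  have uni: "\<exists>!Ks. set Ks \<subseteq> hk ` carrier Q \<and> length Ks = length Vs \<and> pr u = k.combine Ks Vs"
   by (rule k.unique_decomposition[OF sf ind]) (unfold sp, rule prc[OF u])
  then obtain Ks where Ks: "set Ks \<subseteq> hk ` carrier Q" "length Ks = length Vs" "pr u = k.combine Ks Vs" by blast
  then have "Ks \<in> lists (hk ` carrier Q)" by auto
  then obtain Ls where Ls: "Ls \<in> lists (carrier Q)" "Ks = map hk Ls" unfolding lists_image by blast
  have "P u Ls" unfolding P_def using Ls Ks by auto
  moreover have "Ms = Ls" if M: "P u Ms" for Ms
  proof -
   have "map hk Ms = map hk Ls"
    by (rule Uniq_D[OF ex1_iff_ex_Uniq[THEN iffD1, THEN conjunct2, OF uni]]) (use Ks M Ls(2) in \<open>auto simp: P_def\<close>)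
   then show ?thesis using inj Ls(1) M by (intro map_inj_on[of hk]) (auto simp: P_def intro: inj_on_subset)
  qed
  ultimately show ?thesis by blast
 qed
 define L where "L u = (THE Ls. P u Ls)" for u
 have L: "P u (L u)" and LI: "P u Ls ==> L u = Ls" if "u \<in> ball 0" for u Ls
  using theI'[OF ex1[OF that]] the1_equality[OF ex1[OF that], of Ls] unfolding L_def by auto
 let ?n = "length Vs"
 define l where "l i u = L u ! i" for i u
 have set_hk: "set (map hk Ls) \<subseteq> carrier kf" if "set Ls \<subseteq> carrier Q" for Ls using that hc by auto
 have L_add: "L (u \<oplus>.F t) = map2 (\<oplus>.Q) (L u) (L t)" if ut: "u \<in> ball 0" "t \<in> ball 0" for u t
 proof (rule LI[OF ball_add[OF ut]])
  have p: "P u (L u)" "P t (L t)" using L ut by auto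
  have s: "a \<oplus>.Q b \<in>. Q" if "(a, b) \<in> set (zip (L u) (L t))" for a b
   using set_zip_leftD[OF that] set_zip_rightD[OF that] p by (auto simp: P_def)
  have m: "map hk (map2 (\<oplus>.Q) (L u) (L t)) = map2 (\<oplus>.kf) (map hk (L u)) (map hk (L t))"
   using p ring_hom_add[OF hk_hom] by (intro nth_equalityI) (auto simp: P_def subset_iff)
  have "pr (u \<oplus>.F t) = pr u \<oplus>.kf pr t" using ring_hom_add[OF pr_hom, of u t] ut by simp
  also have "\<dots> = k.combine (map2 (\<oplus>.kf) (map hk (L u)) (map hk (L t))) Vs"
   using p Vs set_hk k.combine_add[of "map hk (L u)" Vs "map hk (L t)"] by (simp add: P_def)
  finally show "P (u \<oplus>.F t) (map2 (\<oplus>.Q) (L u) (L t))" unfolding P_def m using p s by (auto simp: P_def)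
 qed
 have L_smult: "L (a \<odot>.F u) = map ((\<otimes>.Q) a) (L u)" if au: "a \<in>. Q" "u \<in> ball 0" for u a
 proof (rule LI[OF ball_smult[OF au]])
  have p: "P u (L u)" using L au by auto
  have m: "map hk (map ((\<otimes>.Q) a) (L u)) = map ((\<otimes>.kf) (hk a)) (map hk (L u))"
   using p au ring_hom_mult[OF hk_hom] by (auto simp: P_def)
  have "pr (a \<odot>.F u) = hk a \<otimes>.kf pr u"
   using ring_hom_mult[OF pr_hom, of "a \<odot>.F \<one>.F" u] au ball_closed ball_smult[OF au(1) one_in_ball] by (simp add: KQ.smult_assoc2)
  also have "\<dots> = k.combine (map ((\<otimes>.kf) (hk a)) (map hk (L u))) Vs"
   using p Vs set_hk hc[OF au(1)] k.combine_r_distr[of "map hk (L u)" Vs "hk a"] by (simp add: P_def)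
  finally show "P (a \<odot>.F u) (map ((\<otimes>.Q) a) (L u))" unfolding P_def m using p au by (auto simp: P_def)
 qed
 have L_zero: "L (z \<otimes>.F u) = replicate ?n \<zero>.Q" if u: "u \<in> ball 0" for u
 proof (rule LI)
  show zu: "z \<otimes>.F u \<in> ball 0" using ball_mult[OF z(4) u] by simp
  have "pr (z \<otimes>.F u) = pr \<zero>.F" unfolding pr_eq_iff[OF zu ball_zero] using u ball_closed[OF zu] by (intro bexI[of _ u]) simp_all
  then have e: "pr (z \<otimes>.F u) = \<zero>.kf"
   using ahom_zero[OF R.abelian_group_axioms k.abelian_group_axioms ring_hom_ahom[OF pr_hom]] by simp
  have "hk \<zero>.Q = \<zero>.kf" using ahom_zero[OF Q.abelian_group_axioms k.abelian_group_axioms ring_hom_ahom[OF hk_hom]] .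
  then show "P (z \<otimes>.F u) (replicate ?n \<zero>.Q)" unfolding P_def e using k.combine_replicate[OF Vs] by (auto simp: set_replicate_conv_if)
 qed
 have lf: "l i \<in> cofunctionals Q R z 1" if i: "i < ?n" for i
 proof -
  have len: "length (L u) = ?n" "set (L u) \<subseteq> carrier Q" if "u \<in> ball 0" for u using L[OF that] by (auto simp: P_def)
  have lQ: "L u ! i \<in>. Q" if "u \<in> ball 0" for u using subsetD[OF len(2)[OF that] nth_mem] i len(1)[OF that] by simp
  have "l i \<in> functionals Q R" by (rule functionalsI) (use i len lQ in \<open>simp_all add: l_def L_add L_smult\<close>)
  then show ?thesis using L_zero i z(1) by (simp add: cofunctionals_def l_def)
 qed
 have "\<forall>V\<in>carrier kf. \<exists>e\<in>ball 0. pr e = V" by (auto simp: FactRing_def A_RCOSETS_def')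
 then have rp_ex: "\<exists>f. \<forall>V\<in>carrier kf. f V \<in> ball 0 \<and> pr (f V) = V" by (intro bchoice) (simp add: Bex_def)
 obtain rp where rp0: "\<forall>V\<in>carrier kf. rp V \<in> ball 0 \<and> pr (rp V) = V" using rp_ex by (elim exE)
 have rp: "\<And>V. V \<in>. kf ==> rp V \<in> ball 0" "\<And>V. V \<in>. kf ==> pr (rp V) = V" using rp0 by simp_all
 let ?es = "map (\<lambda>i. (l i, rp (Vs ! i))) [0..<?n]"
 have es: "set ?es \<subseteq> cofunctionals Q R z 1 \<times> ball 0" using lf rp(1)[OF subsetD[OF Vs nth_mem]] by auto
 have comb: "dual_sum R fs u \<in> ball 0 \<and> pr (dual_sum R fs u) = k.combine (map (\<lambda>(l, e). hk (l u)) fs) (map (\<lambda>(l, e). pr e) fs)"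
  if "set fs \<subseteq> cofunctionals Q R z 1 \<times> ball 0" "u \<in> ball 0" for fs u using that(1)
 proof (induction fs)
  case Nil
  show ?case using ahom_zero[OF R.abelian_group_axioms k.abelian_group_axioms ring_hom_ahom[OF pr_hom]] ball_zero by simp
 next
  case (Cons p fs)
  obtain l e where p: "p = (l, e)" by (cases p)
  have l: "l u \<in>. Q" "e \<in> ball 0" using Cons.prems that(2) p functionals_simps(1)[of l Q R u] by (auto simp: cofunctionals_def)
  have "pr (l u \<odot>.F e) = hk (l u) \<otimes>.kf pr e"
   using ring_hom_mult[OF pr_hom, of "l u \<odot>.F \<one>.F" e] l ball_closed ball_smult[OF l(1) one_in_ball] by (simp add: KQ.smult_assoc2)
  moreover have "l u \<odot>.F e \<in> ball 0" by (rule ball_smult[OF l])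
  ultimately show ?case using Cons ring_hom_add[OF pr_hom, of "l u \<odot>.F e" "dual_sum R fs u"] by (auto simp: p ball_add)
 qed
 have "\<exists>u'\<in>ball 0. u = dual_sum R ?es u \<oplus>.F z \<otimes>.F u'" if u: "u \<in> ball 0" for u
 proof -
  have p: "length (L u) = ?n" "pr u = k.combine (map hk (L u)) Vs" using L[OF u] by (auto simp: P_def)
  have "map (\<lambda>(l, e). hk (l u)) ?es = map hk (L u)" using p(1) by (intro nth_equalityI) (auto simp: l_def)
  moreover have "map (\<lambda>(l, e). pr e) ?es = Vs" using rp(2)[OF subsetD[OF Vs nth_mem]] by (intro nth_equalityI) auto
  ultimately have "pr u = pr (dual_sum R ?es u)" using comb[OF es u] p(2) by simp
  then show ?thesis using pr_eq_iff[OF u conjunct1[OF comb[OF es u]]] by simp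
 qed
 then show ?thesis using es by (intro exI[of _ ?es]) simp
qed

sublocale finite_digits Q R z by unfold_locales (use z z_cancel digit_functionals in auto)

end

section \<open>Coordinates on completed tensor products\<close>

locale digit_tensor = finite_digits Q E z for Q :: "'q ring" and E :: "('q, 'f) module" and z :: 'f +
 fixes S :: "('q, 's) module"
 assumes QS: "algebra Q S"
begin

sublocale S: algebra Q S by (rule QS)

abbreviation "T \<equiv> tensor_ring Q S E"
abbreviation "pt \<equiv> pure_tensor Q S E"

sublocale T: cring T by (rule tensor_cring[OF QS QO])

lemmas SE = S.module_axioms E.module_axioms
lemmas pt_closed [simp] = pure_tensor_closed[OF SE]
lemmas T_induct = tensor_induct[OF SE, consumes 1, case_names pure add]
lemmas T_mult = tensor_mult_pure[OF QS QO]

definition "coord l = tensor_lift (add_monoid S) (\<lambda>(s, t). l t \<odot>.S s)"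

lemma cofunctional_functional: "l \<in> Lam N ==> l \<in> functionals Q E" by (simp add: cofunctionals_def)

lemma coord:
 assumes l: "l \<in> functionals Q E"
 shows coord_hom: "coord l \<in> ahom T S"
  and coord_pure: "\<And>s t. s \<in>. S ==> t \<in>. E ==> coord l (pt s t) = l t \<odot>.S s"
proof -
 have "cring Q" using QS by (simp add: algebra_def module_def)
 have qc: "a \<otimes>.Q b = b \<otimes>.Q a" if "a \<in>. Q" "b \<in>. Q" for a b
  by (rule comm_monoid.m_comm[OF cring.axioms(2)[OF \<open>cring Q\<close>] that])
 have b: "l t \<odot>.S (a \<odot>.S s) = l (a \<odot>.E t) \<odot>.S s" if "a \<in>. Q" "s \<in>. S" "t \<in>. E" for a s t
  using that functionals_simps(1,3)[OF l] by (simp flip: S.smult_assoc1 add: qc[of "l t"])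
 note L = tensor_lift[OF SE S.abelian_group_axioms, of "\<lambda>s t. l t \<odot>.S s"]
 show "coord l \<in> ahom T S" unfolding coord_def by (rule L(1)) (simp_all add: functionals_simps(1,2)[OF l] S.smult_l_distr S.smult_r_distr b)
 show "coord l (pt s t) = l t \<odot>.S s" if "s \<in>. S" "t \<in>. E" for s t
  unfolding coord_def by (rule L(2)) (simp_all add: that functionals_simps(1,2)[OF l] S.smult_l_distr S.smult_r_distr b)
qed

lemmas coord_add = ahom_add[OF coord_hom] and coord_closed = ahom_closed[OF coord_hom]
lemmas coord_zero = ahom_zero[OF T.abelian_group_axioms S.abelian_group_axioms coord_hom]
lemmas coord_diff = ahom_diff[OF T.abelian_group_axioms S.abelian_group_axioms coord_hom]

text \<open>Multiplication by t is absorbed into the functional. For this reason statements about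
  coordinates below concern all of \<open>Lam N\<close> at once and not a fixed basis of it.\<close>

lemma coord_mult_pure:
 assumes l: "l \<in> Lam N" and s: "s \<in>. S" and t: "t \<in>. E" and p: "p \<in>. T"
 shows "coord l (pt s t \<otimes>.T p) = s \<otimes>.S coord (\<lambda>u. l (t \<otimes>.E u)) p"
proof -
 note f = cofunctional_functional[OF l] cofunctional_functional[OF cofunctional_mult[OF l t]]
 note fc = functionals_simps(1)[OF f(1)]
 show ?thesis using p
 proof (induction rule: T_induct)
  case (pure s' t')
  then have "l (t \<otimes>.E t') \<odot>.S (s \<otimes>.S s') = s \<otimes>.S (l (t \<otimes>.E t') \<odot>.S s')"
   using s t S.smult_assoc2[of "l (t \<otimes>.E t')" s' s] fc by (simp add: S.m_comm)
  then show ?case using pure s t by (simp add: T_mult coord_pure[OF f(1)] coord_pure[OF f(2)])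
 qed (use s t in \<open>simp_all add: T.r_distr coord_add[OF f(1)] coord_add[OF f(2)] coord_closed[OF f(2)] S.r_distr\<close>)
qed

text \<open>Covers the inclusion of the valuation ring in K and the Frobenius maps of both.\<close>

definition qlinear_hom :: "('q, 'x) module \<Rightarrow> ('x \<Rightarrow> 's) \<Rightarrow> bool" where
 "qlinear_hom S' h \<longleftrightarrow> algebra Q S' \<and> h \<in> ring_hom S' S \<and>
 (\<forall>a\<in>carrier Q. \<forall>s\<in>carrier S'. h (a \<odot>.S' s) = a \<odot>.S h s)"

abbreviation "Tm h \<equiv> tensor_map Q S E h (\<lambda>x. x)"

lemma Tm:
 assumes "qlinear_hom S' h"
 shows Tm_hom: "Tm h \<in> ring_hom (tensor_ring Q S' E) T"
  and Tm_pure: "\<And>s t. s \<in>. S' ==> t \<in>. E ==> Tm h (pure_tensor Q S' E s t) = pt (h s) t"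
proof -
 have S': "algebra Q S'" and h: "h \<in> ring_hom S' S" "\<And>a s. a \<in>. Q ==> s \<in>. S' ==> h (a \<odot>.S' s) = a \<odot>.S h s"
  using assms by (auto simp: qlinear_hom_def)
 interpret S': algebra Q S' by (rule S')
 have i: "(\<lambda>x. x) \<in> ring_hom E E" by (rule ring_hom_memI) auto
 show "Tm h \<in> ring_hom (tensor_ring Q S' E) T" by (rule tensor_map_ring_hom[OF QS QO S' QO h(1) i]) (use h(2) in blast)
 show "Tm h (pure_tensor Q S' E s t) = pt (h s) t" if "s \<in>. S'" "t \<in>. E" for s t
  by (rule tensor_map_pure[OF SE S'.module_axioms E.module_axioms ring_hom_ahom[OF h(1)] ahom_id]) (use that h(2) in blast)+
qed

text \<open>A map of coefficient algebras acts coordinate by coordinate. For the Frobenius this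
  means that \<sigma> raises each coordinate to the q-th power, so that valuations of coordinates
  can be followed.\<close>

lemma coord_natural:
 assumes h: "qlinear_hom S' h" and l: "l \<in> functionals Q E" and p: "p \<in> carrier (tensor_ring Q S' E)"
 shows "coord l (Tm h p) = h (digit_tensor.coord S' l p)"
proof -
 have S': "algebra Q S'" and hh: "h \<in> ring_hom S' S" "\<And>a s. a \<in>. Q ==> s \<in>. S' ==> h (a \<odot>.S' s) = a \<odot>.S h s"
  using h by (auto simp: qlinear_hom_def)
 interpret S': digit_tensor Q E z S' by (intro digit_tensor.intro digit_tensor_axioms.intro finite_digits_axioms S')
 show ?thesis
 proof (rule tensor_hom_eqI[OF S'.SE ahom_comp[OF ring_hom_ahom[OF Tm_hom[OF h]] coord_hom[OF l]] ahom_comp[OF S'.coord_hom[OF l] ring_hom_ahom[OF hh(1)]] _ p])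
  fix s t assume "s \<in>. S'" "t \<in>. E"
  then show "coord l (Tm h (S'.pt s t)) = h (S'.coord l (S'.pt s t))"
   using ring_hom_closed[OF hh(1)] functionals_simps(1)[OF l] by (simp add: Tm_pure[OF h] coord_pure[OF l] S'.coord_pure[OF l] hh(2))
 qed
qed

text \<open>Used with \<open>H\<close> a ball of K, where it says that elements of A_R do not lower
  valuations, and with \<open>H\<close> zero, where it makes the common kernel of the coordinates an
  ideal.\<close>

lemma coord_mult_closed:
 assumes h: "qlinear_hom S' h" and p: "p \<in> carrier (tensor_ring Q S' E)" and j: "j \<in>. T"
  and H: "\<And>x y. x \<in> H ==> y \<in> H ==> x \<oplus>.S y \<in> H" "\<And>s x. s \<in>. S' ==> x \<in> H ==> h s \<otimes>.S x \<in> H"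
  and jH: "\<And>l. l \<in> Lam N ==> coord l j \<in> H" and l: "l \<in> Lam N"
 shows "coord l (Tm h p \<otimes>.T j) \<in> H"
proof -
 have S': "algebra Q S'" and hh: "h \<in> ring_hom S' S" using h by (auto simp: qlinear_hom_def)
 interpret S': digit_tensor Q E z S' by (intro digit_tensor.intro digit_tensor_axioms.intro finite_digits_axioms S')
 note tc = ring_hom_closed[OF Tm_hom[OF h]] and ta = ring_hom_add[OF Tm_hom[OF h]]
 from p show ?thesis
 proof (induction rule: S'.T_induct)
  case (pure s t)
  then show ?case using ring_hom_closed[OF hh] by (simp add: Tm_pure[OF h] coord_mult_pure[OF l _ _ j] H(2) jH cofunctional_mult[OF l])
 next
  case (add X Y)
  then show ?case using j H(1) by (simp add: ta tc T.l_distr coord_add[OF cofunctional_functional[OF l]])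
 qed
qed

lemma qlinear_id: "qlinear_hom S (\<lambda>x. x)" using QS by (auto simp: qlinear_hom_def intro: ring_hom_memI)

lemma Tm_id: "p \<in>. T ==> Tm (\<lambda>x. x) p = p"
 by (rule tensor_hom_eqI[OF SE ring_hom_ahom[OF Tm_hom[OF qlinear_id]] ahom_id]) (simp add: Tm_pure[OF qlinear_id])

section \<open>Coordinates and the adic filtration\<close>

definition "I = genideal T {pt s (z \<otimes>.E t) | s t. s \<in>. S \<and> t \<in> carrier E}"

lemma I_gens: "{pt s (z \<otimes>.E t) | s t. s \<in>. S \<and> t \<in> carrier E} \<subseteq> carrier T" using z_closed by auto

lemma I_ideal: "ideal I T" unfolding I_def by (rule T.genideal_ideal[OF I_gens])

abbreviation "J \<equiv> ideal_power T I"

sublocale J: ideal "J N" T for N by (rule T.ideal_power_ideal[OF I_ideal])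

text \<open>Together with \<open>coord_zero_power\<close> this identifies the N-th power of
  \<open>I\<close> with the common kernel of the coordinates in \<open>Lam N\<close>, so the
  coordinates describe the completion exactly.\<close>

lemma coord_vanish: "p \<in> J N ==> l \<in> Lam N ==> coord l p = \<zero>.S"
proof (induction N arbitrary: p l)
 case 0
 then have p: "p \<in>. T" and l: "l \<in> functionals Q E" "\<And>t. t \<in>. E ==> l t = \<zero>.Q" by (auto simp: cofunctionals_def)
 from p show ?case by (induction rule: T_induct) (simp_all add: coord_pure[OF l(1)] l(2) coord_add[OF l(1)])
next
 case (Suc N)
 \<comment> \<open>\<open>?V\<close> consists of the multipliers taking \<open>?W\<close> one level
   deeper. It is an ideal, so the generators of \<open>I\<close> suffice, and there the factor z
   turns a functional in \<open>Lam (Suc N)\<close> into one in \<open>Lam N\<close>.\<close>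
 let ?W = "{j \<in> carrier T. \<forall>m\<in>Lam N. coord m j = \<zero>.S}"
 let ?V = "{i \<in> carrier T. \<forall>j\<in>?W. \<forall>l\<in>Lam (Suc N). coord l (i \<otimes>.T j) = \<zero>.S}"
 have Wm: "x \<otimes>.T j \<in> ?W" if "x \<in>. T" "j \<in> ?W" for x j
  using coord_mult_closed[OF qlinear_id that(1), of j "{\<zero>.S}" N] that by (simp add: Tm_id)
 have "ideal ?V T"
 proof (rule T.ideal_of_closed)
  fix x y assume x: "x \<in> ?V" and y: "y \<in> ?V"
  show "x \<oplus>.T y \<in> ?V" using x y by (auto simp: T.l_distr coord_add[OF cofunctional_functional])
 next
  fix x y assume x: "x \<in>. T" and y: "y \<in> ?V"
  show "x \<otimes>.T y \<in> ?V"
  proof (intro CollectI conjI ballI)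
   fix j l assume "j \<in> ?W" "l \<in> Lam (Suc N)"
   then have "coord l (y \<otimes>.T (x \<otimes>.T j)) = \<zero>.S" "j \<in>. T" using Wm[OF x] y by auto
   then show "coord l (x \<otimes>.T y \<otimes>.T j) = \<zero>.S" using x y by (simp add: T.m_ac)
  qed (use x y in auto)
 qed (auto simp: coord_zero[OF cofunctional_functional])
 moreover have "{pt s (z \<otimes>.E t) | s t. s \<in>. S \<and> t \<in> carrier E} \<subseteq> ?V"
 proof (intro subsetI CollectI conjI ballI)
  fix i j l assume i: "i \<in> {pt s (z \<otimes>.E t) | s t. s \<in>. S \<and> t \<in> carrier E}" and j: "j \<in> ?W" and l: "l \<in> Lam (Suc N)"
  from i obtain s t where st: "i = pt s (z \<otimes>.E t)" "s \<in>. S" "t \<in>. E" by blast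
  have "i \<otimes>.T j = pt \<one>.S z \<otimes>.T (pt s t \<otimes>.T j)" using st j z_closed by (simp add: T_mult flip: T.m_assoc)
  moreover have "coord l (pt \<one>.S z \<otimes>.T (pt s t \<otimes>.T j)) = \<one>.S \<otimes>.S coord (\<lambda>u. l (z \<otimes>.E u)) (pt s t \<otimes>.T j)"
   using st j z_closed by (intro coord_mult_pure[OF l]) auto
  ultimately show "coord l (i \<otimes>.T j) = \<zero>.S" using Wm[OF _ j, of "pt s t"] st cofunctional_mult_z[OF l] by simp
 qed (use I_gens in blast)
 ultimately have IV: "I \<subseteq> ?V" unfolding I_def by (rule T.genideal_minimal)
 have "p \<in> I \<cdot>.T J N" using Suc.prems by (simp add: ideal_power.simps(2))
 then have "p \<in>. T \<and> coord l p = \<zero>.S"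
 proof (induction)
  case (prod i j)
  then show ?case using IV Suc.IH Suc.prems(2) J.Icarr by (auto simp: subset_iff)
 next
  case (sum x y)
  then show ?case by (simp add: coord_add[OF cofunctional_functional[OF Suc.prems(2)]])
 qed
 then show ?case ..
qed

lemma pt_z_power: "s \<in>. S ==> t \<in>. E ==> pt s (z [^].E N \<otimes>.E t) \<in> J N"
proof (induction N)
 case (Suc N)
 have "pt \<one>.S (z \<otimes>.E \<one>.E) \<in> {pt s (z \<otimes>.E t) | s t. s \<in>. S \<and> t \<in> carrier E}" by blast
 then have "pt \<one>.S z \<in> I" using T.genideal_self[OF I_gens] z_closed by (auto simp: I_def)
 then have "pt \<one>.S z \<otimes>.T pt s (z [^].E N \<otimes>.E t) \<in> I \<cdot>.T J N" using Suc by (intro ideal_prod.prod) auto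
 moreover have "z \<otimes>.E (z [^].E N \<otimes>.E t) = z [^].E Suc N \<otimes>.E t" using z_closed Suc.prems by (simp add: E.m_ac)
 moreover have "z [^].E N \<otimes>.E t \<in>. E" using Suc.prems z_closed by simp
 note T_mult[OF S.one_closed z_closed Suc.prems(1) this]
 ultimately show ?case by (simp only: S.l_one[OF Suc.prems(1)] ideal_power.simps(2))
qed simp

definition "recombine c es = foldr (\<lambda>(l, e) y. pt (c l) e \<oplus>.T y) es \<zero>.T"

lemma recombine_simps [simp]:
 "recombine c [] = \<zero>.T" "recombine c ((l, e) # es) = pt (c l) e \<oplus>.T recombine c es" by (simp_all add: recombine_def)

lemma recombine_closed:
 "set es \<subseteq> L \<times> carrier E ==> (\<And>l. l \<in> L ==> c l \<in>. S) ==> recombine c es \<in>. T"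
 by (induction es) auto

definition "basis N = (SOME es. set es \<subseteq> Lam N \<times> carrier E \<and>
   (\<forall>u\<in>carrier E. \<exists>u'\<in>carrier E. u = dual_sum E es u \<oplus>.E z [^].E N \<otimes>.E u'))"

lemma basis: "set (basis N) \<subseteq> Lam N \<times> carrier E"
  "u \<in>. E ==> \<exists>u'\<in>carrier E. u = dual_sum E (basis N) u \<oplus>.E z [^].E N \<otimes>.E u'"
 using someI_ex[OF dual_expansion[of N]] unfolding basis_def by auto

text \<open>For a pure tensor s \<otimes> t, recombining gives s \<otimes> t' with t' the part of t
  seen by \<open>basis N\<close>; the difference s \<otimes> z^N u lies in the N-th power of
  \<open>I\<close>.\<close>

lemma recombine_coord:
 assumes p: "p \<in>. T"
 shows "p \<ominus>.T recombine (\<lambda>l. coord l p) (basis N) \<in> J N"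
proof -
 have cl: "recombine (\<lambda>l. coord l p) es \<in>. T" if "set es \<subseteq> Lam N \<times> carrier E" "p \<in>. T" for p es
  by (rule recombine_closed[OF that(1)]) (rule coord_closed[OF cofunctional_functional that(2)])
 have pure_eq: "recombine (\<lambda>l. coord l (pt s t)) es = pt s (dual_sum E es t)"
  if es: "set es \<subseteq> Lam N \<times> carrier E" and st: "s \<in>. S" "t \<in>. E" for s t es using es
 proof (induction es)
  case Nil show ?case using pure_tensor_zero_right[OF SE st(1)] by simp
 next
  case (Cons p es)
  obtain l e where p: "p = (l, e)" by (cases p)
  have l: "l \<in> functionals Q E" "e \<in>. E" using Cons.prems p cofunctional_functional by auto
  have "pt (l t \<odot>.S s) e = pt s (l t \<odot>.E e)"
   using functionals_simps(1)[OF l(1) st(2)] st(1) l(2) by (simp add: pure_tensor_smult[OF SE])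
  then show ?case using Cons l st dual_sum_closed[of es N t] functionals_simps(1)[OF l(1) st(2)]
   by (simp add: p coord_pure[OF l(1)] pure_tensor_add_right[OF SE])
 qed
 have add_eq: "recombine (\<lambda>l. coord l (x \<oplus>.T y)) es = recombine (\<lambda>l. coord l x) es \<oplus>.T recombine (\<lambda>l. coord l y) es"
  if es: "set es \<subseteq> Lam N \<times> carrier E" and xy: "x \<in>. T" "y \<in>. T" for x y es using es
 proof (induction es)
  case (Cons p es)
  obtain l e where p: "p = (l, e)" by (cases p)
  have l: "l \<in> functionals Q E" "e \<in>. E" using Cons.prems p cofunctional_functional by auto
  then show ?case using Cons xy cl[of es x] cl[of es y] by (simp add: p coord_add[OF l(1)] coord_closed[OF l(1)] pure_tensor_add_left[OF SE] T.a_ac)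
 qed simp
 from p show ?thesis
 proof (induction rule: T_induct)
  case (pure s t)
  obtain u where u: "u \<in>. E" "t = dual_sum E (basis N) t \<oplus>.E z [^].E N \<otimes>.E u" using basis(2)[OF pure(2)] by blast
  have d: "dual_sum E (basis N) t \<in>. E" by (rule dual_sum_closed[OF basis(1) pure(2)])
  have zc: "z [^].E N \<otimes>.E u \<in>. E" using u(1) z_closed by simp
  have "pt s t = pt s (dual_sum E (basis N) t) \<oplus>.T pt s (z [^].E N \<otimes>.E u)"
   using pure_tensor_add_right[OF SE pure(1) d zc] u(2) by metis
  then have "pt s t \<ominus>.T recombine (\<lambda>l. coord l (pt s t)) (basis N) = pt s (z [^].E N \<otimes>.E u)"
   unfolding pure_eq[OF basis(1) pure(1,2)]
   using pure(1) d zc by (simp add: a_minus_def T.a_comm[of "pt s (dual_sum E (basis N) t)"] T.a_assoc T.r_neg)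
  then show ?case using pt_z_power[OF pure(1) u(1)] by simp
 next
  case (add x y)
  note c = cl[OF basis(1) add(1)] cl[OF basis(1) add(2)]
  have "x \<oplus>.T y \<ominus>.T recombine (\<lambda>l. coord l (x \<oplus>.T y)) (basis N) =
   (x \<ominus>.T recombine (\<lambda>l. coord l x) (basis N)) \<oplus>.T (y \<ominus>.T recombine (\<lambda>l. coord l y) (basis N))"
   unfolding add_eq[OF basis(1) add(1,2)] using add(1,2) c by (simp add: a_minus_def T.minus_add T.a_ac)
  then show ?case using additive_subgroup.a_closed[OF J.additive_subgroup_axioms add(3,4)] by simp
 qed
qed

lemma coord_zero_power:
 assumes p: "p \<in>. T" and z: "\<And>l. l \<in> Lam N ==> coord l p = \<zero>.S"
 shows "p \<in> J N"
proof -
 have "recombine (\<lambda>l. coord l p) es = \<zero>.T" if "set es \<subseteq> Lam N \<times> carrier E" for es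
  using that by (induction es) (auto simp: z pure_tensor_zero_left[OF SE])
 then show ?thesis using recombine_coord[OF p, of N] p basis(1)[of N] by (simp add: a_minus_def)
qed

lemma coord_cong:
 assumes "p \<in>. T" "q \<in>. T" "l \<in> Lam N" "q \<ominus>.T p \<in> J N"
 shows "coord l q = coord l p"
proof -
 note l = cofunctional_functional[OF assms(3)]
 have "coord l q \<ominus>.S coord l p = \<zero>.S" using coord_vanish[OF assms(4,3)] coord_diff[OF l assms(2,1)] by simp
 then show ?thesis using coord_closed[OF l] assms(1,2) by (simp add: S.r_right_minus_eq)
qed

end

section \<open>Coordinates on the completion\<close>

context digit_tensor
begin

abbreviation "A \<equiv> completion T I"
abbreviation "ta p \<equiv> to_completion T I p"

sublocale A: cring A by (rule T.completion_cring[OF I_ideal])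

lemmas A_mem = T.completion_mem[OF I_ideal] and A_rep = T.completion_rep[OF I_ideal]
 and A_op_mem = T.completion_op_mem[OF I_ideal] and ta_closed [simp] = T.to_completion_closed[OF I_ideal]
 and ta_mem = T.to_completion_mem[OF I_ideal] and ta_hom = T.to_completion_hom[OF I_ideal]

text \<open>A functional in \<open>Lam N\<close> does not distinguish representatives of level
  \<open>N\<close>; \<open>acoord_eq\<close> extends this to representatives of any deeper
  level.\<close>

definition "acoord N l x = coord l (SOME p. p \<in> x N)"

lemma acoord_eq:
 assumes x: "x \<in>. A" and p: "p \<in> x M" and N: "N \<le> M" and l: "l \<in> Lam N"
 shows "acoord N l x = coord l p"
proof -
 have q: "(SOME p. p \<in> x N) \<in> x N" using A_rep[OF x, of N] by (rule someI_ex)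
 have pN: "p \<in> x N" using T.completion_decreasing[OF I_ideal x N] p by blast
 note m = A_mem[OF x pN] A_mem[OF x q]
 have "(SOME p. p \<in> x N) \<ominus>.T p \<in> J N" using J.mem_coset_iff[OF m(1)] q m(2) by simp
 then show ?thesis unfolding acoord_def by (rule coord_cong[OF m(1,3) l])
qed

lemma acoord_closed: "x \<in>. A ==> l \<in> Lam N ==> acoord N l x \<in>. S"
proof -
 assume x: "x \<in>. A" and l: "l \<in> Lam N"
 obtain p where p: "p \<in> x N" using A_rep[OF x, of N] ..
 show ?thesis using acoord_eq[OF x p order_refl l] coord_closed[OF cofunctional_functional[OF l] A_mem(1)[OF x p]] by simp
qed

lemma acoord_add:
 assumes x: "x \<in>. A" and y: "y \<in>. A" and l: "l \<in> Lam N"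
 shows "acoord N l (x \<oplus>.A y) = acoord N l x \<oplus>.S acoord N l y"
proof -
 obtain p q where p: "p \<in> x N" and q: "q \<in> y N" using A_rep[OF x, of N] A_rep[OF y, of N] by blast
 show ?thesis using acoord_eq[OF x p order_refl l] acoord_eq[OF y q order_refl l] A_mem(1)[OF x p] A_mem(1)[OF y q]
   acoord_eq[OF A.a_closed[OF x y] A_op_mem(1)[OF x y p q] order_refl l] by (simp add: coord_add[OF cofunctional_functional[OF l]])
qed

lemma acoord_zero: "l \<in> Lam N ==> acoord N l \<zero>.A = \<zero>.S"
 using acoord_eq[OF A.zero_closed T.completion_one_zero_mem(2)[OF I_ideal] order_refl] coord_zero[OF cofunctional_functional] by simp

lemma acoord_zeroD:
 assumes x: "x \<in>. A" and z: "\<And>N l. l \<in> Lam N ==> acoord N l x = \<zero>.S"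
 shows "x = \<zero>.A"
proof (rule T.completion_eqI[OF I_ideal x A.zero_closed])
 fix n
 obtain p where p: "p \<in> x n" using A_rep[OF x, of n] ..
 have "p \<in> J n" using coord_zero_power[OF A_mem(1)[OF x p]] z acoord_eq[OF x p order_refl] by metis
 then show "\<exists>p. p \<in> x n \<and> p \<in> \<zero>.A n" using p by (auto simp: T.completion_sel[OF I_ideal] FactRing_def)
qed

text \<open>Functionals are total functions, so two of them with the same values on \<open>E\<close>
  may still differ as terms.\<close>

lemma coord_ext:
 assumes "l \<in> functionals Q E" "l' \<in> functionals Q E" "\<And>u. u \<in>. E ==> l u = l' u" "p \<in>. T"
 shows "coord l p = coord l' p" by (rule tensor_hom_eqI[OF SE coord_hom[OF assms(1)] coord_hom[OF assms(2)] _ assms(4)])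
   (simp add: assms(3) coord_pure[OF assms(1)] coord_pure[OF assms(2)])

lemma acoord_mult_pure:
 assumes x: "x \<in>. A" and l: "l \<in> Lam N" and s: "s \<in>. S" and t: "t \<in>. E"
 shows "acoord N l (ta (pt s t) \<otimes>.A x) = s \<otimes>.S acoord N (\<lambda>u. l (t \<otimes>.E u)) x"
proof -
 obtain p where p: "p \<in> x N" using A_rep[OF x, of N] ..
 have st: "pt s t \<in>. T" using s t by simp
 note m = A_op_mem(2)[OF ta_closed[OF st] x ta_mem[OF st] p]
 show ?thesis using acoord_eq[OF A.m_closed[OF ta_closed[OF st] x] m order_refl l] acoord_eq[OF x p order_refl cofunctional_mult[OF l t]]
   coord_mult_pure[OF l s t A_mem(1)[OF x p]] by simp
qed

abbreviation "za \<equiv> ta (pt \<one>.S z)"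

lemma acoord_mult_z:
 assumes x: "x \<in>. A" and l: "l \<in> Lam (Suc N)"
 shows "acoord (Suc N) l (za \<otimes>.A x) = acoord N (\<lambda>u. l (z \<otimes>.E u)) x"
proof -
 obtain p where p: "p \<in> x (Suc N)" using A_rep[OF x, of "Suc N"] ..
 have lz: "(\<lambda>u. l (z \<otimes>.E u)) \<in> Lam N" by (rule cofunctional_mult_z[OF l])
 show ?thesis using acoord_mult_pure[OF x l S.one_closed z_closed] acoord_eq[OF x p order_refl cofunctional_mult[OF l z_closed]]
   acoord_eq[OF x p _ lz] coord_closed[OF cofunctional_functional[OF lz] A_mem(1)[OF x p]] by simp
qed

text \<open>Every coordinate of x is a coordinate of z x, taken with the shifted functional.\<close>

lemma za_torsion_free:
 assumes x: "x \<in>. A" and z0: "za \<otimes>.A x = \<zero>.A"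
 shows "x = \<zero>.A"
proof (rule acoord_zeroD[OF x])
 fix N l assume l: "l \<in> Lam N"
 note l' = cofunctional_shift(1)[OF l]
 obtain p where p: "p \<in> x N" using A_rep[OF x, of N] ..
 have lz: "(\<lambda>u. l (tail (z \<otimes>.E u))) \<in> Lam N" by (rule cofunctional_mult_z[OF l'])
 have "coord l p = coord (\<lambda>u. l (tail (z \<otimes>.E u))) p"
  by (rule coord_ext[OF cofunctional_functional[OF l] cofunctional_functional[OF lz] _ A_mem(1)[OF x p]])
    (rule cofunctional_shift(2)[OF l, symmetric])
 then show "acoord N l x = \<zero>.S"
  using acoord_mult_z[OF x l'] acoord_zero[OF l'] z0 acoord_eq[OF x p order_refl l] acoord_eq[OF x p order_refl lz] by simp
qed

text \<open>All coordinates of level \<open>N\<close> are F_q-combinations of the finitely many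
  attached to \<open>basis N\<close>. Stated for every closed set \<open>H\<close> so that a ball
  can take the place of the span.\<close>

lemma acoord_finite:
 assumes x: "x \<in>. A"
 shows "\<exists>G. finite G \<and> G \<subseteq> carrier S \<and> (\<forall>H. G \<subseteq> H \<longrightarrow> \<zero>.S \<in> H \<longrightarrow> (\<forall>a\<in>H. \<forall>b\<in>H. a \<oplus>.S b \<in> H) \<longrightarrow>
  (\<forall>c\<in>carrier Q. \<forall>a\<in>H. c \<odot>.S a \<in> H) \<longrightarrow> (\<forall>l\<in>Lam N. acoord N l x \<in> H))"
proof -
 obtain p where p: "p \<in> x N" using A_rep[OF x, of N] ..
 note pc = A_mem(1)[OF x p]
 let ?G = "(\<lambda>(l, e). coord l p) ` set (basis N)"
 have "acoord N l x \<in> H" if H: "?G \<subseteq> H" "\<zero>.S \<in> H" "\<forall>a\<in>H. \<forall>b\<in>H. a \<oplus>.S b \<in> H" "\<forall>c\<in>carrier Q. \<forall>a\<in>H. c \<odot>.S a \<in> H"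
  and l: "l \<in> Lam N" for H l
 proof -
  note f = cofunctional_functional[OF l]
  have rc: "recombine (\<lambda>l. coord l p) es \<in>. T" if "set es \<subseteq> Lam N \<times> carrier E" for es
   by (rule recombine_closed[OF that]) (rule coord_closed[OF cofunctional_functional pc])
  have "coord l (recombine (\<lambda>l. coord l p) es) \<in> H" if "set es \<subseteq> set (basis N)" for es using that
  proof (induction es)
   case Nil show ?case using H(2) coord_zero[OF f] by simp
  next
   case (Cons q es)
   obtain m e where q: "q = (m, e)" by (cases q)
   have "(m, e) \<in> set (basis N)" "set es \<subseteq> set (basis N)" using Cons.prems q by auto
   then have m: "m \<in> Lam N" "e \<in>. E" "coord m p \<in> H" "set es \<subseteq> Lam N \<times> carrier E" using basis(1)[of N] H(1) by auto
   have mc: "coord m p \<in>. S" by (rule coord_closed[OF cofunctional_functional[OF m(1)] pc])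
   have "coord l (recombine (\<lambda>l. coord l p) (q # es)) = l e \<odot>.S coord m p \<oplus>.S coord l (recombine (\<lambda>l. coord l p) es)"
    using m(2) mc rc[OF m(4)] by (simp add: q coord_add[OF f] coord_pure[OF f])
   moreover have "l e \<odot>.S coord m p \<in> H" using H(4) functionals_simps(1)[OF f m(2)] m(3) by blast
   ultimately show ?case using H(3) Cons by simp
  qed
  moreover have "coord l p = coord l (recombine (\<lambda>l. coord l p) (basis N))"
   by (rule coord_cong[OF rc[OF basis(1)] pc l recombine_coord[OF pc]])
  ultimately show ?thesis using acoord_eq[OF x p order_refl l] by simp
 qed
 moreover have "?G \<subseteq> carrier S" using basis(1)[of N] coord_closed[OF cofunctional_functional pc] by auto
 ultimately show ?thesis by (intro exI[of _ ?G]) simp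
qed

section \<open>Functoriality of the completed tensor product in the coefficient algebra\<close>

abbreviation "cm h \<equiv> completion_map T I (Tm h)"

context
 fixes S' :: "('q, 'r) module" and h
 assumes h: "qlinear_hom S' h"
begin

lemma S'_algebra: "algebra Q S'" and h_hom: "h \<in> ring_hom S' S" using h by (auto simp: qlinear_hom_def)

interpretation S': digit_tensor Q E z S' by (intro digit_tensor.intro digit_tensor_axioms.intro finite_digits_axioms S'_algebra)

lemma I_gen: "s \<in>. S ==> t \<in>. E ==> pt s (z \<otimes>.E t) \<in> I"
 unfolding I_def by (rule subsetD[OF T.genideal_self[OF I_gens]]) blast

lemma Tm_I: "x \<in> S'.I ==> Tm h x \<in> I"
proof -
 note tc = ring_hom_closed[OF Tm_hom[OF h]]
 let ?V = "{x \<in> carrier S'.T. Tm h x \<in> I}"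
 have "ideal ?V S'.T" by (rule S'.T.ideal_of_closed)
    (auto simp: ring_hom_add[OF Tm_hom[OF h]] ring_hom_mult[OF Tm_hom[OF h]] tc
     ahom_zero[OF S'.T.abelian_group_axioms T.abelian_group_axioms ring_hom_ahom[OF Tm_hom[OF h]]]
     additive_subgroup.zero_closed[OF ideal.axioms(1)[OF I_ideal]]
     intro: additive_subgroup.a_closed[OF ideal.axioms(1)[OF I_ideal]] ideal.I_l_closed[OF I_ideal])
 moreover have "{S'.pt s (z \<otimes>.E t) | s t. s \<in>. S' \<and> t \<in> carrier E} \<subseteq> ?V"
  using z_closed ring_hom_closed[OF h_hom] by (auto simp: Tm_pure[OF h] I_gen)
 ultimately have "S'.I \<subseteq> ?V" unfolding S'.I_def by (rule S'.T.genideal_minimal)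
 then show "x \<in> S'.I ==> Tm h x \<in> I" by blast
qed

lemma cm_hom: "cm h \<in> ring_hom S'.A A" by (rule completion_map_hom[OF S'.T.is_cring S'.I_ideal T.is_cring I_ideal Tm_hom[OF h]]) (rule Tm_I)

lemma cm_mem: "x \<in>. S'.A ==> p \<in> x n ==> Tm h p \<in> cm h x n"
 by (rule completion_map_mem[OF S'.T.is_cring S'.I_ideal T.is_cring I_ideal Tm_hom[OF h]]) (rule Tm_I, assumption+)

lemma cm_ta: "p \<in>. S'.T ==> cm h (to_completion S'.T S'.I p) = ta (Tm h p)"
proof (rule T.completion_eqI[OF I_ideal])
 assume p: "p \<in>. S'.T"
 show "cm h (S'.ta p) \<in>. A" "ta (Tm h p) \<in>. A" using p ring_hom_closed[OF cm_hom] ring_hom_closed[OF Tm_hom[OF h] p] by simp_all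
 show "\<exists>q. q \<in> cm h (S'.ta p) n \<and> q \<in> ta (Tm h p) n" for n
  using cm_mem[OF S'.ta_closed[OF p] S'.ta_mem[OF p]] ta_mem[OF ring_hom_closed[OF Tm_hom[OF h] p]] by blast
qed

lemma acoord_natural:
 assumes x: "x \<in>. S'.A" and l: "l \<in> Lam N"
 shows "acoord N l (cm h x) = h (S'.acoord N l x)"
proof -
 obtain p where p: "p \<in> x N" using S'.A_rep[OF x, of N] ..
 show ?thesis using acoord_eq[OF ring_hom_closed[OF cm_hom x] cm_mem[OF x p] order_refl l] S'.acoord_eq[OF x p order_refl l]
   coord_natural[OF h cofunctional_functional[OF l] S'.A_mem(1)[OF x p]] by simp
qed

lemma acoord_mult_closed:
 assumes a: "a \<in>. S'.A" and x: "x \<in>. A"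
  and H: "\<And>x y. x \<in> H ==> y \<in> H ==> x \<oplus>.S y \<in> H" "\<And>s x. s \<in>. S' ==> x \<in> H ==> h s \<otimes>.S x \<in> H"
  and xH: "\<And>l. l \<in> Lam N ==> acoord N l x \<in> H" and l: "l \<in> Lam N"
 shows "acoord N l (cm h a \<otimes>.A x) \<in> H"
proof -
 obtain p q where p: "p \<in> a N" and q: "q \<in> x N" using S'.A_rep[OF a, of N] A_rep[OF x, of N] by blast
 note ca = ring_hom_closed[OF cm_hom a]
 have "coord l (Tm h p \<otimes>.T q) \<in> H" by (rule coord_mult_closed[OF h S'.A_mem(1)[OF a p] A_mem(1)[OF x q] H _ l])
    (use xH acoord_eq[OF x q order_refl] in simp_all)
 then show ?thesis using acoord_eq[OF A.m_closed[OF ca x] A_op_mem(2)[OF ca x cm_mem[OF a p] q] order_refl l] by simp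
qed

lemma cm_injective:
 assumes inj: "inj_on h (carrier S')" and x: "x \<in>. S'.A" and z: "cm h x = \<zero>.A"
 shows "x = \<zero>.S'.A"
proof (rule S'.acoord_zeroD[OF x])
 fix N l assume l: "l \<in> Lam N"
 have "h (S'.acoord N l x) = h \<zero>.S'"
  using acoord_natural[OF x l] z acoord_zero[OF l] ahom_zero[OF S'.S.abelian_group_axioms S.abelian_group_axioms ring_hom_ahom[OF h_hom]] by simp
 then show "S'.acoord N l x = \<zero>.S'" using inj_onD[OF inj] S'.acoord_closed[OF x l] by simp
qed

text \<open>An element descends as soon as its coordinates do: at each level a representative is
  rebuilt from preimages of the coordinates. Representatives of successive levels fit together
  because their coordinates agree after applying the injective \<open>h\<close>.\<close>

lemma cm_lift:
 assumes inj: "inj_on h (carrier S')" and x: "x \<in>. A"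
  and im: "\<And>N l. l \<in> Lam N ==> acoord N l x \<in> h ` carrier S'"
 shows "x \<in> cm h ` carrier S'.A"
proof -
 define c where "c N l = inv_into (carrier S') h (acoord N l x)" for N l
 define p where "p N = S'.recombine (c N) (basis N)" for N
 have c: "c N l \<in>. S'" "h (c N l) = acoord N l x" if "l \<in> Lam N" for N l
  using inv_into_into[OF im[OF that]] f_inv_into_f[OF im[OF that]] by (simp_all add: c_def)
 have p: "p N \<in>. S'.T" for N unfolding p_def by (rule S'.recombine_closed[OF basis(1)]) (rule c(1))
 have Tp: "Tm h (p N) \<in> x N" for N
 proof -
  obtain q where q: "q \<in> x N" using A_rep[OF x, of N] ..
  have "S'.recombine (c N) es \<in>. S'.T \<and> Tm h (S'.recombine (c N) es) = recombine (\<lambda>l. coord l q) es"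
   if "set es \<subseteq> Lam N \<times> carrier E" for es using that
  proof (induction es)
   case Nil
   show ?case using ahom_zero[OF S'.T.abelian_group_axioms T.abelian_group_axioms ring_hom_ahom[OF Tm_hom[OF h]]] by simp
  next
   case (Cons y es)
   obtain l e where y: "y = (l, e)" by (cases y)
   have l: "l \<in> Lam N" "e \<in>. E" using Cons.prems y by auto
   then show ?case using Cons c[OF l(1)] acoord_eq[OF x q order_refl l(1)] by (simp add: y ring_hom_add[OF Tm_hom[OF h]] Tm_pure[OF h])
  qed
  from this[OF basis(1)] have e: "Tm h (p N) = recombine (\<lambda>l. coord l q) (basis N)" by (simp add: p_def)
  have "Tm h (p N) \<in>. T" by (rule ring_hom_closed[OF Tm_hom[OF h] p])
  moreover have "q \<ominus>.T Tm h (p N) \<in> J N" unfolding e by (rule recombine_coord[OF A_mem(1)[OF x q]])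
  ultimately have "J N +>.T q = J N +>.T Tm h (p N)" using J.coset_eq_iff[of "Tm h (p N)" q] A_mem(1)[OF x q] by simp
  then show ?thesis using A_mem(2)[OF x q] T.coset_self[OF I_ideal \<open>Tm h (p N) \<in>. T\<close>] by simp
 qed
 have "p (Suc N) \<ominus>.S'.T p N \<in> S'.J N" for N
 proof (rule S'.coord_zero_power)
  fix l assume l: "l \<in> Lam N"
  note f = cofunctional_functional[OF l]
  \<comment> \<open>The image of \<open>p M\<close> represents x at level M, so its coordinates in
    \<open>Lam N\<close> are the same for all M \<ge> N.\<close>
  have "h (S'.coord l (p M)) = acoord N l x" if "N \<le> M" for M using coord_natural[OF h f p] acoord_eq[OF x Tp that l] by simp
  then have "S'.coord l (p (Suc N)) = S'.coord l (p N)" using inj_onD[OF inj _ S'.coord_closed[OF f p] S'.coord_closed[OF f p]] by simp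
  then show "S'.coord l (p (Suc N) \<ominus>.S'.T p N) = \<zero>.S'"
   using S'.coord_diff[OF f p p] S'.coord_closed[OF f p] by (simp add: a_minus_def S'.S.r_neg)
 qed (use p in simp)
 then have x': "(\<lambda>N. S'.J N +>.S'.T p N) \<in>. S'.A" by (rule S'.T.completionI[OF S'.I_ideal p])
 have "cm h (\<lambda>N. S'.J N +>.S'.T p N) = x" by (rule T.completion_eqI[OF I_ideal ring_hom_closed[OF cm_hom x'] x])
    (use Tp cm_mem[OF x' S'.T.coset_self[OF S'.I_ideal p]] in blast)
 then show ?thesis using x' by blast
qed

end

end

section \<open>Inverting the uniformizer\<close>

text \<open>\<open>u h\<close> is the h-th power of an element about to be inverted. It is z when
  A_S is extended to B_S, and an element of positive valuation when R is extended to K. Denominators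
  of a sum are cleared by the product of the two powers.\<close>

lemma tensor_denominators:
 assumes S: "algebra A S" and T: "algebra A T"
  and u: "\<And>h k. u (h + k) = u h \<otimes>\<^bsub>tensor_ring A S T\<^esub> u k" "\<And>h. u h \<in> D"
  and D: "D \<subseteq> carrier (tensor_ring A S T)" "\<And>x y. x \<in> D ==> y \<in> D ==> x \<oplus>\<^bsub>tensor_ring A S T\<^esub> y \<in> D"
   "\<And>x y. x \<in> D ==> y \<in> D ==> x \<otimes>\<^bsub>tensor_ring A S T\<^esub> y \<in> D"
  and pure: "\<And>s t. s \<in>. S ==> t \<in>. T ==> \<exists>h::nat. u h \<otimes>\<^bsub>tensor_ring A S T\<^esub> pure_tensor A S T s t \<in> D"
  and X: "X \<in> carrier (tensor_ring A S T)"
 shows "\<exists>h. u h \<otimes>\<^bsub>tensor_ring A S T\<^esub> X \<in> D" using X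
proof (induction rule: tensor_alg_induct[OF S T, consumes 1, case_names pure add])
 case (pure s t) then show ?case by (rule assms(8))
next
 case (add X Y)
 interpret P: cring "tensor_ring A S T" by (rule tensor_cring[OF S T])
 obtain h k where h: "u h \<otimes>\<^bsub>tensor_ring A S T\<^esub> X \<in> D" and k: "u k \<otimes>\<^bsub>tensor_ring A S T\<^esub> Y \<in> D"
  using add.IH by blast
 have uc: "u h \<in> carrier (tensor_ring A S T)" for h using D(1) u(2) by blast
 have "u (h + k) \<otimes>\<^bsub>tensor_ring A S T\<^esub> (X \<oplus>\<^bsub>tensor_ring A S T\<^esub> Y) =
  u k \<otimes>\<^bsub>tensor_ring A S T\<^esub> (u h \<otimes>\<^bsub>tensor_ring A S T\<^esub> X) \<oplus>\<^bsub>tensor_ring A S T\<^esub> u h \<otimes>\<^bsub>tensor_ring A S T\<^esub> (u k \<otimes>\<^bsub>tensor_ring A S T\<^esub> Y)"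
  using add.hyps uc by (simp add: u(1) P.r_distr P.m_ac)
 also have "\<dots> \<in> D" using D(2,3) u(2) h k by blast
 finally show ?case by blast
qed

locale A_setting = local_field Q F w z
 for Q :: "'q ring" and F :: "('q, 'f) module" and w :: "'f \<Rightarrow> int" and z :: 'f +
 fixes S :: "('q, 's) module"
 assumes algS: "algebra Q S"
begin

sublocale digit_tensor Q R z S by (intro digit_tensor.intro digit_tensor_axioms.intro finite_digits_axioms algS)

lemma A_pre_eq: "A_pre Q F w S = T" by (simp add: A_pre_def)

lemma A_ideal_eq: "A_ideal Q F w S = I"
proof -
 have "x \<in> max_ideal F w \<longleftrightarrow> (\<exists>t\<in>ball 0. x = z \<otimes>.F t)" for x
  using ball_div[of x 1] ball_mult[OF z(5), of _ 0] z(1) by (auto simp: max_ideal_def)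
 then have "{pure_tensor Q S (int_ring F w) s x | s x. s \<in>. S \<and> x \<in> max_ideal F w} =
  {pt s (z \<otimes>.R t) | s t. s \<in>. S \<and> t \<in> carrier R}" by auto
 then show ?thesis unfolding A_ideal_def A_pre_eq I_def by simp
qed

lemma A_ring_eq: "A_ring Q F w S = A" by (simp add: A_ring_def A_pre_eq A_ideal_eq)

abbreviation "tht \<equiv> O_to_A Q F w S"
abbreviation "rh \<equiv> S_to_A Q F w S"

lemma O_to_A_eq: "tht x = ta (pt \<one>.S x)" by (simp add: O_to_A_def A_pre_eq A_ideal_eq)
lemma S_to_A_eq: "rh s = ta (pt s \<one>.F)" by (simp add: S_to_A_def A_pre_eq A_ideal_eq)

lemma O_to_A_hom: "tht \<in> ring_hom R A"
 using ring_hom_trans[OF pure_tensor_ring_hom_right[OF QS QO] ta_hom] by (simp add: comp_def O_to_A_eq[abs_def])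

lemma S_to_A_hom: "rh \<in> ring_hom S A"
 using ring_hom_trans[OF pure_tensor_ring_hom_left[OF QS QO] ta_hom] by (simp add: comp_def S_to_A_eq[abs_def])

section \<open>The ring B_S as A_S with z inverted\<close>

abbreviation "AO \<equiv> A_over_O Q F w S"
abbreviation "FO \<equiv> F_over_O F"
abbreviation "B \<equiv> B_ring Q F w S"
abbreviation "al \<equiv> A_to_B Q F w S"
abbreviation "ka \<equiv> F_to_B Q F w S"

lemma AO_eq: "AO = algebra_via tht A" by (simp add: A_over_O_def A_ring_eq)

lemma AO_algebra: "algebra R AO" unfolding AO_eq by (rule algebra_via_algebra[OF R.is_cring A.is_cring O_to_A_hom])

lemma FO_algebra: "algebra R FO" unfolding F_over_O_def by (rule algebra_via_algebra[OF R.is_cring K.is_cring inclusion_hom])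

sublocale AO: algebra R AO by (rule AO_algebra)
sublocale FO: algebra R FO by (rule FO_algebra)

lemma AO_simps [simp]: "carrier AO = carrier A" "\<one>.AO = \<one>.A" "\<zero>.AO = \<zero>.A" "x \<oplus>.AO y = x \<oplus>.A y"
  "x \<otimes>.AO y = x \<otimes>.A y" "u \<odot>.AO x = tht u \<otimes>.A x"
 and FO_simps [simp]: "carrier FO = carrier F" "\<one>.FO = \<one>.F" "\<zero>.FO = \<zero>.F" "f \<oplus>.FO g = f \<oplus>.F g"
  "f \<otimes>.FO g = f \<otimes>.F g" "u \<odot>.FO f = u \<otimes>.F f" by (simp_all add: AO_eq F_over_O_def)

lemma B_eq: "B = tensor_ring R AO FO" by (simp add: B_ring_def)

sublocale B: cring B unfolding B_eq by (rule tensor_cring[OF AO_algebra FO_algebra])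

lemma A_to_B_eq: "al a = pure_tensor R AO FO a \<one>.F" by (simp add: A_to_B_def AF_to_B_def)
lemma F_to_B_eq: "ka f = pure_tensor R AO FO \<one>.A f" by (simp add: F_to_B_def AF_to_B_def A_ring_eq)

lemma A_to_B_hom: "al \<in> ring_hom A B" using pure_tensor_ring_hom_left[OF AO_algebra FO_algebra] unfolding B_eq A_to_B_eq[abs_def]
 by (simp add: ring_hom_def)

lemma F_to_B_hom: "ka \<in> ring_hom F B" using pure_tensor_ring_hom_right[OF AO_algebra FO_algebra] unfolding B_eq F_to_B_eq[abs_def]
 by (simp add: ring_hom_def)

lemma B_pure: "a \<in>. A ==> f \<in>. F ==> pure_tensor R AO FO a f = al a \<otimes>.B ka f"
 unfolding B_eq A_to_B_eq F_to_B_eq using tensor_mult_pure[OF AO_algebra FO_algebra, of a "\<one>.F" "\<one>.A" f] by simp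

lemma O_to_B: "u \<in> ball 0 ==> al (tht u) = ka u"
 using pure_tensor_smult[OF AO.module_axioms FO.module_axioms, of u "\<one>.A" "\<one>.F"] ring_hom_closed[OF O_to_A_hom, of u] ball_closed[of u]
 by (simp add: A_to_B_eq F_to_B_eq)

abbreviation "zf s \<equiv> z [^].F (s::int)"

lemma zf_units: "zf s = z [^]\<^bsub>units_of F\<^esub> s" "z \<in> Units F"
proof -
 show u: "z \<in> Units F" using z K.field_Units by simp
 have n1: "z [^]\<^bsub>units_of F\<^esub> n = z [^].F n" for n :: nat by (simp add: nat_pow_def units_of_def)
 have n2: "z [^].F n \<in> Units F" for n :: nat using u by (induction n) auto
 show "zf s = z [^]\<^bsub>units_of F\<^esub> s" unfolding int_pow_def2 n1 K.units_of_inv[OF n2] ..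
qed

lemma zf: "zf (s + t) = zf s \<otimes>.F zf t" "zf 0 = \<one>.F" "zf (int n) = z [^].F n" "zf s \<in>. F"
proof -
 have zu: "z \<in> carrier (units_of F)" using zf_units(2) by (simp add: units_of_def)
 show "zf (s + t) = zf s \<otimes>.F zf t" unfolding zf_units using group.int_pow_mult[OF K.units_group zu, of s t] by (simp add: units_of_mult)
 show "zf s \<in>. F" unfolding zf_units using group.int_pow_closed[OF K.units_group zu, of s] by (simp add: units_of_def Units_def)
qed (simp_all add: int_pow_int)

definition "kz s = ka (zf s)"

lemma kz: "kz (s + t) = kz s \<otimes>.B kz t" "kz 0 = \<one>.B" "kz s \<in>. B"
 unfolding kz_def using zf ring_hom_mult[OF F_to_B_hom] ring_hom_one[OF F_to_B_hom] ring_hom_closed[OF F_to_B_hom] by simp_all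

lemma z_pow_ball: "z [^].F (n::nat) \<in> ball 0" using v_pow[OF z(1,2), of n] z by (simp add: val_ball_def)

lemma kz_nat: "kz (int n) = al (tht (z [^].F n))" by (simp add: kz_def zf O_to_B[OF z_pow_ball])

lemma theta_z_pow: "tht (z [^].F (n::nat)) \<in>. A" using ring_hom_closed[OF O_to_A_hom] z_pow_ball by simp

text \<open>Integrality for all large \<open>k\<close>, not for one, is what the criterion for
  eventual vanishing asks for.\<close>

lemma F_denominator: "f \<in>. F ==> \<exists>k0::nat. \<forall>k\<ge>k0. z [^].F k \<otimes>.F f \<in> ball 0"
proof -
 assume f: "f \<in>. F"
 show ?thesis
 proof (intro exI allI impI)
  fix k assume "nat (- w f) \<le> k"
  then have "z [^].F k \<in> ball (int k)" "f \<in> ball (- int k)" using v_pow[OF z(1,2), of k] z f by (auto simp: val_ball_def)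
  from ball_mult[OF this] show "z [^].F k \<otimes>.F f \<in> ball 0" by simp
 qed
qed

lemma B_denominator: "x \<in>. B ==> \<exists>h::nat. kz (int h) \<otimes>.B x \<in> al ` carrier A"
proof -
 assume x: "x \<in>. B"
 have cl: "al ` carrier A \<subseteq> carrier B" using ring_hom_closed[OF A_to_B_hom] by auto
 have ad: "x \<oplus>.B y \<in> al ` carrier A" "x \<otimes>.B y \<in> al ` carrier A" if "x \<in> al ` carrier A" "y \<in> al ` carrier A" for x y
  using that by (auto simp flip: ring_hom_add[OF A_to_B_hom] ring_hom_mult[OF A_to_B_hom])
 have pure: "\<exists>h::nat. kz (int h) \<otimes>.B pure_tensor R AO FO a f \<in> al ` carrier A"
  if af: "a \<in>. AO" "f \<in>. FO" for a f
 proof -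
  obtain k :: nat where "\<forall>k'\<ge>k. z [^].F k' \<otimes>.F f \<in> ball 0" using F_denominator[OF af(2)[simplified]] ..
  then have k: "z [^].F k \<otimes>.F f \<in> ball 0" by simp
  have c: "a \<in>. A" "f \<in>. F" "al a \<in>. B" "ka f \<in>. B" using af ring_hom_closed[OF A_to_B_hom] ring_hom_closed[OF F_to_B_hom] by auto
  have "kz (int k) \<otimes>.B pure_tensor R AO FO a f = al a \<otimes>.B (kz (int k) \<otimes>.B ka f)" using c kz(3) by (simp add: B_pure B.m_ac)
  also have "kz (int k) \<otimes>.B ka f = al (tht (z [^].F k \<otimes>.F f))"
   using c zf(4)[of "int k"] by (simp add: kz_def O_to_B[OF k] ring_hom_mult[OF F_to_B_hom] zf(3))
  finally have e: "kz (int k) \<otimes>.B pure_tensor R AO FO a f = al a \<otimes>.B al (tht (z [^].F k \<otimes>.F f))" .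
  show ?thesis by (rule exI[of _ k], unfold e, rule ad(2)) (use c(1) ring_hom_closed[OF O_to_A_hom] k in auto)
 qed
 show ?thesis unfolding B_eq by (rule tensor_denominators[OF AO_algebra FO_algebra, where u = "\<lambda>h. kz (int h)" and D = "al ` carrier A"])
    (use x cl ad pure kz kz_nat theta_z_pow in \<open>simp_all add: B_eq\<close>)
qed

lemma theta_z_torsion_free: "a \<in>. A ==> tht (z [^].F (k::nat)) \<otimes>.A a = \<zero>.A ==> a = \<zero>.A"
proof (induction k)
 case 0 then show ?case using ring_hom_one[OF O_to_A_hom] by simp
next
 case (Suc k)
 have "tht (z [^].F Suc k) = tht z \<otimes>.A tht (z [^].F k)"
  using ring_hom_mult[OF O_to_A_hom, of "z [^].F k" z] z_pow_ball z theta_z_pow ring_hom_closed[OF O_to_A_hom, of z] by (simp add: A.m_comm)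
 then have "za \<otimes>.A (tht (z [^].F k) \<otimes>.A a) = \<zero>.A"
  using Suc.prems theta_z_pow ring_hom_closed[OF O_to_A_hom, of z] z(4) by (simp add: A.m_assoc O_to_A_eq)
 then show ?case using za_torsion_free theta_z_pow Suc by simp
qed

text \<open>A_S has no z-torsion, so inverting z loses nothing. The tensor a \<otimes> f is sent to
  z^k f times a, which makes sense for large k and is eventually balanced.\<close>

lemma A_to_B_zero: assumes a: "a \<in>. A" and a0: "al a = \<zero>.B" shows "a = \<zero>.A"
proof -
 \<comment> \<open>The value zero is a placeholder for those \<open>k\<close> at which z^k f is not
   yet integral.\<close>
 define b where "b k m f = (if z [^].F k \<otimes>.F f \<in> ball 0 then tht (z [^].F k \<otimes>.F f) \<otimes>.A m else \<zero>.A)" for k :: nat and m f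
 note tc = ring_hom_closed[OF O_to_A_hom, simplified]
 have zc: "z [^].F (k::nat) \<in>. F" for k using z(1) by simp
 have "\<exists>k0. \<forall>k\<ge>k0. b k a \<one>.F = \<zero>.A"
 proof (rule pure_tensor_zero_eventually[OF AO.module_axioms FO.module_axioms A.abelian_group_axioms, where b = b])
  show "b k m n \<in>. A" if "m \<in>. AO" for k m n using that tc by (simp add: b_def)
  show "\<exists>k0. \<forall>k\<ge>k0. b k (m \<oplus>.AO m') n = b k m n \<oplus>.A b k m' n" if "m \<in>. AO" "m' \<in>. AO" for m m' n
   using that tc by (simp add: b_def A.r_distr)
  show "\<exists>k0. \<forall>k\<ge>k0. b k m (n \<oplus>.FO n') = b k m n \<oplus>.A b k m n'"
   if m: "m \<in>. AO" and n: "n \<in>. FO" "n' \<in>. FO" for m n n'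
  proof -
   obtain k1 :: nat where k1: "\<forall>k\<ge>k1. z [^].F k \<otimes>.F n \<in> ball 0" using F_denominator[OF n(1)[simplified]] ..
   obtain k2 :: nat where k2: "\<forall>k\<ge>k2. z [^].F k \<otimes>.F n' \<in> ball 0" using F_denominator[OF n(2)[simplified]] ..
   note k = k1 k2
   have "b k m (n \<oplus>.FO n') = b k m n \<oplus>.A b k m n'" if "k \<ge> max k1 k2" for k
    using k that n m ball_add[of "z [^].F k \<otimes>.F n" 0 "z [^].F k \<otimes>.F n'"] tc
     ring_hom_add[OF O_to_A_hom, of "z [^].F k \<otimes>.F n" "z [^].F k \<otimes>.F n'"] by (simp add: b_def K.r_distr zc A.l_distr)
   then show ?thesis by blast
  qed
  show "\<exists>k0. \<forall>k\<ge>k0. b k (u \<odot>.AO m) n = b k m (u \<odot>.FO n)"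
   if u: "u \<in>. R" and m: "m \<in>. AO" and n: "n \<in>. FO" for u m n
  proof -
   obtain k1 :: nat where k: "\<forall>k\<ge>k1. z [^].F k \<otimes>.F n \<in> ball 0" using F_denominator[OF n[simplified]] ..
   have uc: "u \<in>. F" "u \<in> ball 0" using u ball_closed by auto
   have "b k (u \<odot>.AO m) n = b k m (u \<odot>.FO n)" if "k \<ge> k1" for k
   proof -
    have kn: "z [^].F k \<otimes>.F n \<in> ball 0" using k that by simp
    have "z [^].F k \<otimes>.F (u \<otimes>.F n) = (z [^].F k \<otimes>.F n) \<otimes>.F u" using zc n uc by (simp add: K.m_ac)
    then show ?thesis
     using kn ball_mult[OF kn uc(2)] ring_hom_mult[OF O_to_A_hom, of "z [^].F k \<otimes>.F n" u] uc tc m by (simp add: b_def A.m_assoc)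
   qed
   then show ?thesis by blast
  qed
  show "pure_tensor R AO FO a \<one>.F = \<zero>\<^bsub>tensor_ring R AO FO\<^esub>" using a0 by (simp add: A_to_B_eq B_eq)
 qed (use a in auto)
 then obtain k0 where "b k0 a \<one>.F = \<zero>.A" by blast
 then show ?thesis using theta_z_torsion_free[OF a] z_pow_ball zc by (simp add: b_def)
qed

lemma S_to_B_hom: "S_to_B Q F w S \<in> ring_hom S B" using ring_hom_trans[OF S_to_A_hom A_to_B_hom] by (simp add: comp_def S_to_B_def[abs_def])

lemma A_map_eq: "A_map Q F w S h = cm h" by (simp add: A_map_def[abs_def] A_pre_eq A_ideal_eq)

lemma B_map:
 assumes h: "qlinear_hom S' h"
 shows B_map_hom: "B_map Q F w S h \<in> ring_hom (B_ring Q F w S') B"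
  and B_map_A: "\<And>a. a \<in> carrier (A_ring Q F w S') ==> B_map Q F w S h (A_to_B Q F w S' a) = al (cm h a)"
  and B_map_F: "\<And>f. f \<in>. F ==> B_map Q F w S h (F_to_B Q F w S' f) = ka f"
  and cm_S: "\<And>s. s \<in>. S' ==> cm h (S_to_A Q F w S' s) = rh (h s)"
proof -
 interpret S': A_setting Q F w z S' by (intro A_setting.intro A_setting_axioms.intro local_field_axioms S'_algebra[OF h])
 have hom: "cm h \<in> ring_hom S'.AO AO" using cm_hom[OF h] by (simp add: ring_hom_def)
 have i: "(\<lambda>x. x) \<in> ring_hom FO FO" by (rule ring_hom_memI) auto
 have th: "cm h (S'.tht u) = tht u" if "u \<in> ball 0" for u
  using cm_ta[OF h, of "S'.pt \<one>.S' u"] Tm_pure[OF h, of "\<one>.S'" u] that ring_hom_one[OF h_hom[OF h]] by (simp add: O_to_A_eq S'.O_to_A_eq)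
 show "cm h (S_to_A Q F w S' s) = rh (h s)" if "s \<in>. S'" for s
  using cm_ta[OF h, of "S'.pt s \<one>.F"] Tm_pure[OF h, of s "\<one>.F"] that one_in_ball by (simp add: S_to_A_eq S'.S_to_A_eq)
 have bal: "\<exists>b\<in>carrier R. cm h (u \<odot>.S'.AO a) = b \<odot>.AO cm h a \<and> u \<odot>.FO f = b \<odot>.FO f"
  if "u \<in>. R" "a \<in>. S'.AO" "f \<in>. FO" for u a f
  using that ring_hom_mult[OF cm_hom[OF h]] ring_hom_closed[OF S'.O_to_A_hom] th by (intro bexI[of _ u]) auto
 show "B_map Q F w S h \<in> ring_hom (B_ring Q F w S') B" unfolding B_map_def B_eq S'.B_eq A_map_eq
  by (rule tensor_map_ring_hom[OF AO_algebra FO_algebra S'.AO_algebra FO_algebra hom i]) (rule bal)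
 have p: "B_map Q F w S h (pure_tensor R S'.AO FO a f) = pure_tensor R AO FO (cm h a) f" if "a \<in>. S'.A" "f \<in>. F" for a f
  unfolding B_map_def A_map_eq
  by (rule tensor_map_pure[OF AO.module_axioms FO.module_axioms S'.AO.module_axioms FO.module_axioms ring_hom_ahom[OF hom] ring_hom_ahom[OF i]])
    (rule bal, use that in auto)
 show "B_map Q F w S h (A_to_B Q F w S' a) = al (cm h a)" if "a \<in> carrier (A_ring Q F w S')" for a
  using p[of a "\<one>.F"] that by (simp add: A_to_B_eq S'.A_to_B_eq S'.A_ring_eq)
 show "B_map Q F w S h (F_to_B Q F w S' f) = ka f" if "f \<in>. F" for f
  using p[of "\<one>.S'.A" f] that ring_hom_one[OF cm_hom[OF h]] by (simp add: F_to_B_eq S'.F_to_B_eq)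
qed

lemma qlinear_frob: "qlinear_hom S (frob Q S)" using frob_hom[OF Q QS] frob_smult[OF Q QS] QS by (simp add: qlinear_hom_def)

end

section \<open>The rings over the valuation ring\<close>

lemma (in digit_tensor) acoord_eqI:
 assumes x: "x \<in>. A" and y: "y \<in>. A" and e: "\<And>N l. l \<in> Lam N ==> acoord N l x = acoord N l y"
 shows "x = y"
proof (rule T.completion_eqI[OF I_ideal x y])
 fix n
 obtain p q where p: "p \<in> x n" and q: "q \<in> y n" using A_rep[OF x, of n] A_rep[OF y, of n] by blast
 note pc = A_mem(1)[OF x p] and qc = A_mem(1)[OF y q]
 have "q \<ominus>.T p \<in> J n"
 proof (rule coord_zero_power)
  fix l assume l: "l \<in> Lam n"
  note f = cofunctional_functional[OF l]
  show "coord l (q \<ominus>.T p) = \<zero>.S"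
   using coord_diff[OF f qc pc] e[OF l] acoord_eq[OF x p order_refl l] acoord_eq[OF y q order_refl l] coord_closed[OF f pc]
   by (simp add: a_minus_def S.r_neg)
 qed (use pc qc in simp)
 then have "q \<in> x n" using J.mem_coset_iff[OF pc] A_mem(2)[OF x p] qc by simp
 then show "\<exists>p. p \<in> x n \<and> p \<in> y n" using q by blast
qed

locale pure_setting = F: local_field Q F w z + K: valued_algebra Q K v
 for Q :: "'q ring" and F :: "('q, 'f) module" and w z and K :: "('q, 'k) module" and v +
 assumes nontriv: "nontrivial_valuation K v"
begin

abbreviation "R \<equiv> int_ring K v"

sublocale BK: A_setting Q F w z K by (intro A_setting.intro A_setting_axioms.intro F.local_field_axioms K.alg)
sublocale BR: A_setting Q F w z R by (intro A_setting.intro A_setting_axioms.intro F.local_field_axioms K.int_ring_algebra)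

lemma incl: "BK.qlinear_hom R (\<lambda>x. x)" using K.int_ring_algebra K.inclusion_hom by (simp add: BK.qlinear_hom_def)

abbreviation "ci \<equiv> BK.cm (\<lambda>x. x)"
abbreviation "bi \<equiv> B_map Q F w K (\<lambda>x. x)"

lemmas ci_hom = BK.cm_hom[OF incl] and bi_hom = BK.B_map_hom[OF incl]

lemma bi_A: "a \<in>. BR.A ==> bi (BR.al a) = BK.al (ci a)" using BK.B_map_A[OF incl] by (simp add: BR.A_ring_eq)

lemma bi_kz: "bi (BR.kz s) = BK.kz s" using BK.B_map_F[OF incl] F.z by (simp add: BR.kz_def BK.kz_def BK.zf)

lemma S_to_B_K: "c \<in>. R ==> bi (S_to_B Q F w R c) = S_to_B Q F w K c"
 using bi_A[OF ring_hom_closed[OF BR.S_to_A_hom]] BK.cm_S[OF incl] by (simp add: S_to_B_def)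

abbreviation "sK \<equiv> BK.cm (frob Q K)"
abbreviation "sR \<equiv> BR.cm (frob Q R)"
abbreviation "sgK \<equiv> sigma_B Q F w K"
abbreviation "sgR \<equiv> sigma_B Q F w R"

lemma frob_R: "frob Q R = frob Q K" by (simp add: frob_def[abs_def])

lemmas sK_hom = BK.cm_hom[OF BK.qlinear_frob] and sR_hom = BR.cm_hom[OF BR.qlinear_frob]
lemmas sgK_hom = BK.B_map_hom[OF BK.qlinear_frob, folded sigma_B_def]
 and sgR_hom = BR.B_map_hom[OF BR.qlinear_frob, folded sigma_B_def]

lemma sgK_A: "a \<in>. BK.A ==> sgK (BK.al a) = BK.al (sK a)"
 using BK.B_map_A[OF BK.qlinear_frob] by (simp add: sigma_B_def BK.A_ring_eq)
lemma sgR_A: "a \<in>. BR.A ==> sgR (BR.al a) = BR.al (sR a)"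
 using BR.B_map_A[OF BR.qlinear_frob] by (simp add: sigma_B_def BR.A_ring_eq)
lemma sgK_F: "f \<in>. F ==> sgK (BK.ka f) = BK.ka f" using BK.B_map_F[OF BK.qlinear_frob] by (simp add: sigma_B_def)
lemma sgR_F: "f \<in>. F ==> sgR (BR.ka f) = BR.ka f" using BR.B_map_F[OF BR.qlinear_frob] by (simp add: sigma_B_def)
lemma sgK_S: "c \<in>. K ==> sgK (S_to_B Q F w K c) = S_to_B Q F w K (frob Q K c)"
 using sgK_A[OF ring_hom_closed[OF BK.S_to_A_hom]] BK.cm_S[OF BK.qlinear_frob] by (simp add: S_to_B_def)
lemma sgR_S: "c \<in>. R ==> sgR (S_to_B Q F w R c) = S_to_B Q F w R (frob Q K c)"
 using sgR_A[OF ring_hom_closed[OF BR.S_to_A_hom]] BR.cm_S[OF BR.qlinear_frob] by (simp add: S_to_B_def frob_R)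

text \<open>Compared on coordinates, which separate points: on both sides the coordinate is the q-th
  power of that of \<open>a\<close>.\<close>

lemma ci_frob: "a \<in>. BR.A ==> ci (sR a) = sK (ci a)"
proof (rule BK.acoord_eqI)
 assume a: "a \<in>. BR.A"
 note c = ring_hom_closed[OF sR_hom a] ring_hom_closed[OF ci_hom a]
 show "ci (sR a) \<in>. BK.A" "sK (ci a) \<in>. BK.A" using ring_hom_closed[OF ci_hom c(1)] ring_hom_closed[OF sK_hom c(2)] .
 fix N l assume l: "l \<in> F.Lam N"
 show "BK.acoord N l (ci (sR a)) = BK.acoord N l (sK (ci a))" using BK.acoord_natural[OF incl c(1) l] BR.acoord_natural[OF BR.qlinear_frob a l]
   BK.acoord_natural[OF BK.qlinear_frob c(2) l] BK.acoord_natural[OF incl a l] by (simp add: frob_R)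
qed

lemma bi_sg: "b \<in>. BR.B ==> bi (sgR b) = sgK (bi b)"
proof -
 assume b: "b \<in>. BR.B"
 note ac = ring_hom_closed[OF BR.A_to_B_hom] ring_hom_closed[OF BR.F_to_B_hom] ring_hom_closed[OF BK.A_to_B_hom] ring_hom_closed[OF BK.F_to_B_hom]
 show ?thesis
 proof (rule tensor_hom_eqI[OF BR.AO.module_axioms BK.FO.module_axioms, folded BR.B_eq,
    OF ahom_comp[OF ring_hom_ahom[OF sgR_hom] ring_hom_ahom[OF bi_hom]] ahom_comp[OF ring_hom_ahom[OF bi_hom] ring_hom_ahom[OF sgK_hom]] _ b])
  fix a f assume "a \<in>. BR.AO" "f \<in>. BR.FO"
  then have a: "a \<in>. BR.A" "f \<in>. F" by simp_all
  note c = ring_hom_closed[OF sR_hom a(1)] ring_hom_closed[OF ci_hom a(1)]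
  show "bi (sgR (pure_tensor F.R BR.AO BR.FO a f)) = sgK (bi (pure_tensor F.R BR.AO BR.FO a f))"
   using a c ac by (simp add: BR.B_pure ring_hom_mult[OF sgR_hom] ring_hom_mult[OF bi_hom] ring_hom_mult[OF sgK_hom]
     sgR_A sgR_F bi_A BK.B_map_F[OF incl] sgK_A sgK_F ci_frob)
 qed
qed

lemma ci_zero: "a \<in>. BR.A ==> ci a = \<zero>.BK.A ==> a = \<zero>.BR.A" by (rule BK.cm_injective[OF incl]) auto

section \<open>The rings A^b and B^b and their maps\<close>

abbreviation "KR \<equiv> K_over_R K"
abbreviation "AR \<equiv> A_over_R Q F w K v"
abbreviation "BRm \<equiv> B_over_R Q F w K v"

lemma over_R_algebras: "algebra R KR" "algebra R AR" "algebra R BRm"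
proof -
 have c: "cring R" using K.int_ring_algebra by (simp add: algebra_def)
 show "algebra R KR" unfolding K_over_R_def by (rule algebra_via_algebra[OF c K.K.is_cring K.inclusion_hom])
 show "algebra R AR" unfolding A_over_R_def BR.A_ring_eq by (rule algebra_via_algebra[OF c BR.A.is_cring BR.S_to_A_hom])
 show "algebra R BRm" unfolding B_over_R_def by (rule algebra_via_algebra[OF c BR.B.is_cring BR.S_to_B_hom])
qed

lemma over_R_simps [simp]: "carrier KR = carrier K" "\<one>.KR = \<one>.K" "x \<oplus>.KR y = x \<oplus>.K y" "x \<otimes>.KR y = x \<otimes>.K y" "r \<odot>.KR x = r \<otimes>.K x"
 "carrier AR = carrier BR.A" "\<one>.AR = \<one>.BR.A" "a \<oplus>.AR a' = a \<oplus>.BR.A a'" "a \<otimes>.AR a' = a \<otimes>.BR.A a'" "r \<odot>.AR a = BR.rh r \<otimes>.BR.A a"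
 "carrier BRm = carrier BR.B" "\<one>.BRm = \<one>.BR.B" "b \<oplus>.BRm b' = b \<oplus>.BR.B b'" "b \<otimes>.BRm b' = b \<otimes>.BR.B b'" "r \<odot>.BRm b = S_to_B Q F w R r \<otimes>.BR.B b"
 by (simp_all add: K_over_R_def A_over_R_def B_over_R_def BR.A_ring_eq)

lemma over_R_modules: "module R KR" "module R AR" "module R BRm" using over_R_algebras by (simp_all add: algebra_def)

abbreviation "Ab \<equiv> Ab_ring Q F w K v"
abbreviation "Bb \<equiv> Bb_ring Q F w K v"
abbreviation "io \<equiv> Ab_to_Bb Q F w K v"
abbreviation "ph \<equiv> Bb_to_BK Q F w K"
abbreviation "sgb \<equiv> sigma_Bb Q F w K v"
abbreviation "ptA \<equiv> pure_tensor R KR AR"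
abbreviation "ptB \<equiv> pure_tensor R KR BRm"
abbreviation "zp s \<equiv> F_to_Bb Q F w K v (z [^].F (s::int))"

lemma Ab_cring: "cring Ab" unfolding Ab_ring_def by (rule tensor_cring[OF over_R_algebras(1,2)])
lemma Bb_cring: "cring Bb" unfolding Bb_ring_def by (rule tensor_cring[OF over_R_algebras(1,3)])

sublocale Ab: cring Ab by (rule Ab_cring)
sublocale Bb: cring Bb by (rule Bb_cring)

lemma ptA_closed: "c \<in>. K ==> a \<in>. BR.A ==> ptA c a \<in>. Ab"
 unfolding Ab_ring_def by (rule pure_tensor_closed[OF over_R_modules(1,2)]) simp_all
lemma ptB_closed: "c \<in>. K ==> b \<in>. BR.B ==> ptB c b \<in>. Bb"
 unfolding Bb_ring_def by (rule pure_tensor_closed[OF over_R_modules(1,3)]) simp_all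
lemma ptB_mult: "c \<in>. K ==> b \<in>. BR.B ==> c' \<in>. K ==> b' \<in>. BR.B ==>
  ptB c b \<otimes>.Bb ptB c' b' = ptB (c \<otimes>.K c') (b \<otimes>.BR.B b')"
 unfolding Bb_ring_def using tensor_mult_pure[OF over_R_algebras(1,3), of c b c' b'] by simp
lemma Bb_one: "\<one>.Bb = ptB \<one>.K \<one>.BR.B" unfolding Bb_ring_def by (simp add: tensor_ring_sel(2))

lemma BR_al_closed: "a \<in>. BR.A ==> BR.al a \<in>. BR.B" by (rule ring_hom_closed[OF BR.A_to_B_hom])

lemma io: "io \<in> ring_hom Ab Bb" "\<And>c a. c \<in>. K ==> a \<in>. BR.A ==> io (ptA c a) = ptB c (BR.al a)"
proof -
 have i: "(\<lambda>c. c) \<in> ring_hom KR KR" by (rule ring_hom_memI) auto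
 have h: "BR.al \<in> ring_hom AR BRm" using BR.A_to_B_hom by (simp add: ring_hom_def)
 have bal: "\<exists>s\<in>carrier R. r \<odot>.KR c = s \<odot>.KR c \<and> BR.al (r \<odot>.AR a) = s \<odot>.BRm BR.al a"
  if "r \<in>. R" "a \<in>. AR" for r c a using that ring_hom_mult[OF BR.A_to_B_hom] ring_hom_closed[OF BR.S_to_A_hom]
  by (intro bexI[of _ r]) (simp_all add: S_to_B_def)
 show "io \<in> ring_hom Ab Bb" unfolding Ab_to_Bb_def Ab_ring_def Bb_ring_def
  by (rule tensor_map_ring_hom[OF over_R_algebras(1,3,1,2) i h]) (rule bal)
 show "io (ptA c a) = ptB c (BR.al a)" if "c \<in>. K" "a \<in>. BR.A" for c a unfolding Ab_to_Bb_def
  by (rule tensor_map_pure[OF over_R_modules(1,3,1,2) ring_hom_ahom[OF i] ring_hom_ahom[OF h]]) (rule bal, use that in simp_all)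
qed

lemma ph: "ph \<in> ring_hom Bb BK.B"
  "\<And>c b. c \<in>. K ==> b \<in>. BR.B ==> ph (ptB c b) = S_to_B Q F w K c \<otimes>.BK.B bi b"
proof -
 have f: "S_to_B Q F w K \<in> ring_hom KR BK.B" using BK.S_to_B_hom by (simp add: ring_hom_def)
 have g: "bi \<in> ring_hom BRm BK.B" using bi_hom by (simp add: ring_hom_def)
 have bal: "S_to_B Q F w K (r \<odot>.KR c) \<otimes>.BK.B bi b = S_to_B Q F w K c \<otimes>.BK.B bi (r \<odot>.BRm b)"
  if "r \<in>. R" "c \<in>. KR" "b \<in>. BRm" for r c b
 proof -
  have rc: "r \<in>. K" using that(1) K.ball_closed by simp
  show ?thesis using that rc ring_hom_closed[OF BR.S_to_B_hom] ring_hom_closed[OF BK.S_to_B_hom] ring_hom_closed[OF bi_hom] S_to_B_K[of r]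
   by (simp add: ring_hom_mult[OF BK.S_to_B_hom] ring_hom_mult[OF bi_hom] BK.B.m_ac)
 qed
 note L = tensor_lift_ring_hom[OF over_R_algebras(1,3) BK.B.is_cring f g]
 show "ph \<in> ring_hom Bb BK.B" unfolding Bb_to_BK_def Bb_ring_def by (rule L(1)) (rule bal)
 show "ph (ptB c b) = S_to_B Q F w K c \<otimes>.BK.B bi b" if "c \<in>. K" "b \<in>. BR.B" for c b
  unfolding Bb_to_BK_def by (rule L(2)) (rule bal, use that in simp_all)
qed

lemma sgb: "sgb \<in> ring_hom Bb Bb"
  "\<And>c b. c \<in>. K ==> b \<in>. BR.B ==> sgb (ptB c b) = ptB (frob Q K c) (sgR b)"
proof -
 note fh = frob_hom[OF K.Q K.alg] and fr = frob_hom[OF K.Q K.int_ring_algebra, unfolded frob_R]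
 have f: "frob Q K \<in> ring_hom KR KR" using fh by (simp add: ring_hom_def)
 have g: "sgR \<in> ring_hom BRm BRm" using sgR_hom by (simp add: ring_hom_def)
 have bal: "\<exists>s\<in>carrier R. frob Q K (r \<odot>.KR c) = s \<odot>.KR frob Q K c \<and> sgR (r \<odot>.BRm b) = s \<odot>.BRm sgR b"
  if "r \<in>. R" "c \<in>. KR" "b \<in>. BRm" for r c b
  using that ring_hom_closed[OF fr] K.ball_closed[of r] ring_hom_closed[OF BR.S_to_B_hom] sgR_S[of r]
  by (intro bexI[of _ "frob Q K r"]) (simp_all add: ring_hom_mult[OF fh] ring_hom_mult[OF sgR_hom])
 show "sgb \<in> ring_hom Bb Bb" unfolding sigma_Bb_def Bb_ring_def by (rule tensor_map_ring_hom[OF over_R_algebras(1,3,1,3) f g]) (rule bal)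
 show "sgb (ptB c b) = ptB (frob Q K c) (sgR b)" if "c \<in>. K" "b \<in>. BR.B" for c b unfolding sigma_Bb_def
  by (rule tensor_map_pure[OF over_R_modules(1,3,1,3) ring_hom_ahom[OF f] ring_hom_ahom[OF g]]) (rule bal, use that in simp_all)
qed

lemma sg_comm: "x \<in>. Bb ==> ph (sgb x) = sgK (ph x)"
proof -
 assume x: "x \<in>. Bb"
 show ?thesis
 proof (rule tensor_hom_eqI[OF over_R_modules(1,3), folded Bb_ring_def,
    OF ahom_comp[OF ring_hom_ahom[OF sgb(1)] ring_hom_ahom[OF ph(1)]] ahom_comp[OF ring_hom_ahom[OF ph(1)] ring_hom_ahom[OF sgK_hom]] _ x])
  fix c b assume "c \<in>. KR" "b \<in>. BRm"
  then have c: "c \<in>. K" "b \<in>. BR.B" by simp_all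
  have fc: "frob Q K c \<in>. K" by (rule ring_hom_closed[OF frob_hom[OF K.Q K.alg] c(1)])
  show "ph (sgb (ptB c b)) = sgK (ph (ptB c b))"
   using c fc ring_hom_closed[OF sgR_hom c(2)] ring_hom_closed[OF BK.S_to_B_hom c(1)] ring_hom_closed[OF bi_hom c(2)]
   by (simp add: sgb(2) ph(2) ring_hom_mult[OF sgK_hom] bi_sg sgK_S)
 qed
qed

text \<open>A substitute for a uniformizer of R: the valuation of K is not normalized, but an
  element of positive valuation has n-th powers of valuation at least n, which is all that clearing
  denominators requires.\<close>

lemma pseudo_uniformizer: "\<exists>p\<in>carrier K. p \<noteq> \<zero>.K \<and> 0 < v p"
proof -
 obtain x where x: "x \<in>. K" "x \<noteq> \<zero>.K" "v x \<noteq> 0" using nontriv by (auto simp: nontrivial_valuation_def)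
 show ?thesis
 proof (cases "0 < v x")
  case True then show ?thesis using x by blast
 next
  case False
  then have "0 < v (inv\<^bsub>K\<^esub> x)" using K.v_inv(4)[OF x(1,2)] x(3) by simp
  then show ?thesis using K.v_inv[OF x(1,2)] by blast
 qed
qed

definition "pu = (SOME p. p \<in>. K \<and> p \<noteq> \<zero>.K \<and> 0 < v p)"

lemma pu: "pu \<in>. K" "pu \<noteq> \<zero>.K" "0 < v pu" using someI_ex[OF pseudo_uniformizer[unfolded Bex_def]] unfolding pu_def by auto

lemma pu_pow: "pu [^].K (n::nat) \<in>. K" "pu [^].K (n::nat) \<noteq> \<zero>.K" "pu [^].K (n::nat) \<in> K.ball (int n)"
proof -
 have "int n * 1 \<le> int n * v pu" using pu(3) by (intro mult_left_mono) auto
 then show "pu [^].K n \<in>. K" "pu [^].K n \<noteq> \<zero>.K" "pu [^].K n \<in> K.ball (int n)"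
  using K.v_pow[OF pu(1,2), of n] pu(1) by (simp_all add: val_ball_def)
qed

text \<open>A high power of \<open>pu\<close> moves any tensor into the tensors 1 \<otimes> t, and
  it is invertible in K. Hence an element of A^b is a single constant from K times an element of
  A_R.\<close>

lemma tensor_K_pure:
 assumes T: "algebra R T" and X: "X \<in> carrier (tensor_ring R KR T)"
 shows "\<exists>c\<in>carrier K. \<exists>t\<in>carrier T. X = pure_tensor R KR T c t"
proof -
 let ?P = "tensor_ring R KR T" and ?pt = "pure_tensor R KR T"
 let ?D = "{?pt \<one>.K t | t. t \<in> carrier T}"
 interpret T: algebra R T by (rule T)
 interpret P: cring ?P by (rule tensor_cring[OF over_R_algebras(1) T])
 note M = over_R_modules(1) T.module_axioms
 have mult: "?pt c t \<otimes>.?P ?pt c' t' = ?pt (c \<otimes>.K c') (t \<otimes>.T t')"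
  if "c \<in>. K" "t \<in>. T" "c' \<in>. K" "t' \<in>. T" for c t c' t' using tensor_mult_pure[OF over_R_algebras(1) T, of c t c' t'] that by simp
 have int: "?pt c t = ?pt \<one>.K (c \<odot>.T t)" if "c \<in>. R" "t \<in>. T" for c t
  using pure_tensor_smult[OF M, of c "\<one>.K" t] that K.ball_closed[of c] by simp
 have pR: "pu [^].K (h::nat) \<in>. R" for h using K.ball_mono[OF pu_pow(3), of 0 h] by simp
 have "\<exists>h::nat. ?pt (pu [^].K h) \<one>.T \<otimes>.?P X \<in> ?D"
 proof (rule tensor_denominators[OF over_R_algebras(1) T, where D = ?D])
  show "?pt (pu [^].K (h + k)) \<one>.T = ?pt (pu [^].K h) \<one>.T \<otimes>.?P ?pt (pu [^].K k) \<one>.T" for h k :: nat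
   using pu_pow by (simp add: mult K.K.nat_pow_mult pu(1))
  show "?pt (pu [^].K h) \<one>.T \<in> ?D" for h :: nat unfolding int[OF pR T.one_closed] using T.smult_closed[OF pR T.one_closed] by blast
  show "?D \<subseteq> carrier ?P" using pure_tensor_closed[OF M] by auto
  show "x \<oplus>.?P y \<in> ?D" if xy: "x \<in> ?D" "y \<in> ?D" for x y
  proof -
   obtain t t' where t: "x = ?pt \<one>.K t" "t \<in>. T" "y = ?pt \<one>.K t'" "t' \<in>. T" using xy by blast
   then have "x \<oplus>.?P y = ?pt \<one>.K (t \<oplus>.T t')" using pure_tensor_add_right[OF M, of "\<one>.K" t t'] by simp
   then show ?thesis using t by blast
  qed
  show "x \<otimes>.?P y \<in> ?D" if xy: "x \<in> ?D" "y \<in> ?D" for x y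
  proof -
   obtain t t' where t: "x = ?pt \<one>.K t" "t \<in>. T" "y = ?pt \<one>.K t'" "t' \<in>. T" using xy by blast
   then have "x \<otimes>.?P y = ?pt \<one>.K (t \<otimes>.T t')" using mult[of "\<one>.K" t "\<one>.K" t'] by simp
   then show ?thesis using t by blast
  qed
  show "\<exists>h::nat. ?pt (pu [^].K h) \<one>.T \<otimes>.?P ?pt c t \<in> ?D" if "c \<in>. KR" "t \<in>. T" for c t
  proof -
   have c: "c \<in>. K" "c \<in> K.ball (- int (nat (- v c)))" using that by (auto simp: val_ball_def)
   let ?h = "nat (- v c)"
   have "pu [^].K ?h \<otimes>.K c \<in>. R" using K.ball_mult[OF pu_pow(3)[of ?h] c(2)] by simp
   then have "?pt (pu [^].K ?h) \<one>.T \<otimes>.?P ?pt c t = ?pt \<one>.K ((pu [^].K ?h \<otimes>.K c) \<odot>.T t)"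
    "(pu [^].K ?h \<otimes>.K c) \<odot>.T t \<in>. T"
    using that c pu_pow(1) int[of "pu [^].K ?h \<otimes>.K c" t] by (simp_all add: mult T.smult_closed)
   then show ?thesis by blast
  qed
 qed (rule X)
 then obtain h :: nat and t where t: "?pt (pu [^].K h) \<one>.T \<otimes>.?P X = ?pt \<one>.K t" "t \<in>. T" by blast
 let ?c = "inv\<^bsub>K\<^esub> (pu [^].K h)"
 note i = K.v_inv[OF pu_pow(1,2), of h]
 have cl: "?pt ?c \<one>.T \<in>. ?P" "?pt (pu [^].K h) \<one>.T \<in>. ?P" using pure_tensor_closed[OF M] i(1) pu_pow(1) by simp_all
 have "?pt ?c \<one>.T \<otimes>.?P ?pt (pu [^].K h) \<one>.T = \<one>.?P" using i pu_pow(1)[of h] by (simp add: mult tensor_ring_sel(2) K.K.m_comm)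
 then have "X = ?pt ?c \<one>.T \<otimes>.?P (?pt (pu [^].K h) \<one>.T \<otimes>.?P X)" using P.m_assoc[OF cl X] X by simp
 also have "\<dots> = ?pt ?c t" using t(2) i(1) by (simp add: t(1) mult)
 finally show ?thesis using i(1) t(2) by blast
qed

lemma Ab_pure: "x \<in>. Ab ==> \<exists>c\<in>carrier K. \<exists>a\<in>carrier BR.A. x = ptA c a"
 using tensor_K_pure[OF over_R_algebras(2)] by (simp add: Ab_ring_def)
lemma Bb_pure: "x \<in>. Bb ==> \<exists>c\<in>carrier K. \<exists>b\<in>carrier BR.B. x = ptB c b"
 using tensor_K_pure[OF over_R_algebras(3)] by (simp add: Bb_ring_def)

lemma zp_eq: "zp s = ptB \<one>.K (BR.kz s)" by (simp add: F_to_Bb_def BR.kz_def)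

lemma ph_zp: "ph (zp s) = BK.kz s" using BR.kz(3)[of s] BK.kz(3)[of s] by (simp add: zp_eq ph(2) bi_kz ring_hom_one[OF BK.S_to_B_hom])

lemma zp_denominator: "x \<in>. Bb ==> \<exists>h::nat. zp (int h) \<otimes>.Bb x \<in> io ` carrier Ab"
proof -
 assume "x \<in>. Bb"
 then obtain c b where c: "c \<in>. K" "b \<in>. BR.B" "x = ptB c b" using Bb_pure by blast
 obtain h a where h: "BR.kz (int h) \<otimes>.BR.B b = BR.al a" "a \<in>. BR.A" using BR.B_denominator[OF c(2)] by blast
 have "zp (int h) \<otimes>.Bb x = io (ptA c a)" using c h BR.kz(3) by (simp add: zp_eq ptB_mult io(2))
 then show ?thesis using ptA_closed[OF c(1) h(2)] by blast
qed

text \<open>For a pure tensor c \<otimes> b with c nonzero, divide by c and clear the z-denominators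
  of b. What remains is injectivity of A_R \<rightarrow> A_K, visible on coordinates, and of A_K
  \<rightarrow> B_K.\<close>

lemma ph_inj: "inj_on ph (carrier Bb)"
proof -
 have ker: "x = \<zero>.Bb" if x: "x \<in>. Bb" and x0: "ph x = \<zero>.BK.B" for x
 proof -
  obtain c b where c: "c \<in>. K" "b \<in>. BR.B" "x = ptB c b" using Bb_pure[OF x] by blast
  show ?thesis
  proof (cases "c = \<zero>.K")
   case True
   have "ptB \<zero>.KR b = \<zero>.Bb" unfolding Bb_ring_def by (rule pure_tensor_zero_left[OF over_R_modules(1,3)]) (simp add: c)
   then show ?thesis using True c(3) by (simp add: K_over_R_def)
  next
   case False
   note i = K.v_inv[OF c(1) False]
   have bc: "bi b \<in>. BK.B" "S_to_B Q F w K c \<in>. BK.B" "S_to_B Q F w K (inv\<^bsub>K\<^esub> c) \<in>. BK.B"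
    using ring_hom_closed[OF bi_hom c(2)] ring_hom_closed[OF BK.S_to_B_hom] c i by auto
   have "S_to_B Q F w K (inv\<^bsub>K\<^esub> c) \<otimes>.BK.B S_to_B Q F w K c = \<one>.BK.B"
    using ring_hom_mult[OF BK.S_to_B_hom i(1) c(1)] ring_hom_one[OF BK.S_to_B_hom] i c by (simp add: K.K.m_comm)
   then have "bi b = S_to_B Q F w K (inv\<^bsub>K\<^esub> c) \<otimes>.BK.B (S_to_B Q F w K c \<otimes>.BK.B bi b)"
    using BK.B.m_assoc[OF bc(3,2,1)] bc by simp
   also have "\<dots> = \<zero>.BK.B" using x0 c bc by (simp add: ph(2))
   finally have b0: "bi b = \<zero>.BK.B" .
   obtain h a where h: "BR.kz (int h) \<otimes>.BR.B b = BR.al a" "a \<in>. BR.A" using BR.B_denominator[OF c(2)] by blast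
   have "BK.al (ci a) = \<zero>.BK.B" using bi_A[OF h(2)] ring_hom_mult[OF bi_hom BR.kz(3)[of "int h"] c(2)] h(1) b0 BK.kz(3) by (simp add: bi_kz)
   then have "a = \<zero>.BR.A" using BK.A_to_B_zero[OF ring_hom_closed[OF ci_hom h(2)]] ci_zero[OF h(2)] by simp
   then have "BR.kz (int h) \<otimes>.BR.B b = \<zero>.BR.B"
    using h(1) ahom_zero[OF BR.A.abelian_group_axioms BR.B.abelian_group_axioms ring_hom_ahom[OF BR.A_to_B_hom]] by simp
   moreover have "BR.kz (- int h) \<otimes>.BR.B BR.kz (int h) = \<one>.BR.B" using BR.kz(1)[of "- int h" "int h"] BR.kz(2) by simp
   ultimately have "b = \<zero>.BR.B" using BR.B.m_assoc[OF BR.kz(3) BR.kz(3) c(2), of "- int h" "int h"] c(2) BR.kz(3) by simp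
   moreover have "ptB c \<zero>.BRm = \<zero>.Bb" unfolding Bb_ring_def by (rule pure_tensor_zero_right[OF over_R_modules(1,3)]) (simp add: c)
   ultimately show ?thesis using c(3) by (simp add: B_over_R_def)
  qed
 qed
 show ?thesis
 proof (rule inj_onI)
  fix x y assume xy: "x \<in>. Bb" "y \<in>. Bb" "ph x = ph y"
  have "ph (x \<ominus>.Bb y) = \<zero>.BK.B"
   using ahom_diff[OF Bb.abelian_group_axioms BK.B.abelian_group_axioms ring_hom_ahom[OF ph(1)] xy(1,2)] xy(3) ring_hom_closed[OF ph(1) xy(2)]
   by (simp add: a_minus_def BK.B.r_neg)
  then have "x \<ominus>.Bb y = \<zero>.Bb" using ker xy by simp
  then show "x = y" using xy by (simp add: Bb.r_right_minus_eq)
 qed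
qed

end

section \<open>Boundedness and vanishing\<close>

context pure_setting
begin

abbreviation "SD \<equiv> ph ` io ` carrier Ab"

text \<open>Of the two factors only the constant \<open>c\<close> can lower valuations of
  coordinates, by at most the fixed amount -v(c).\<close>

lemma SD_form: "s \<in> SD ==> \<exists>c\<in>carrier K. \<exists>a\<in>carrier BR.A. s = BK.al (BK.rh c \<otimes>.BK.A ci a)"
proof -
 assume "s \<in> SD"
 then obtain x where x: "x \<in>. Ab" "s = ph (io x)" by blast
 then obtain c a where c: "c \<in>. K" "a \<in>. BR.A" "x = ptA c a" using Ab_pure by blast
 have "s = BK.al (BK.rh c) \<otimes>.BK.B BK.al (ci a)" using c x(2) BR_al_closed by (simp add: io(2) ph(2) bi_A S_to_B_def)
 then have "s = BK.al (BK.rh c \<otimes>.BK.A ci a)"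
  using ring_hom_mult[OF BK.A_to_B_hom ring_hom_closed[OF BK.S_to_A_hom c(1)] ring_hom_closed[OF ci_hom c(2)]] by simp
 then show ?thesis using c by blast
qed

lemma SD_sub: "SD \<subseteq> carrier BK.B" using ring_hom_closed[OF ph(1)] ring_hom_closed[OF io(1)] by auto

lemma al_inj: "x \<in>. BK.A ==> y \<in>. BK.A ==> BK.al x = BK.al y ==> x = y"
proof -
 assume x: "x \<in>. BK.A" and y: "y \<in>. BK.A" and e: "BK.al x = BK.al y"
 have "BK.al (x \<ominus>.BK.A y) = \<zero>.BK.B"
  using ahom_diff[OF BK.A.abelian_group_axioms BK.B.abelian_group_axioms ring_hom_ahom[OF BK.A_to_B_hom] x y] e ring_hom_closed[OF BK.A_to_B_hom y]
  by (simp add: a_minus_def BK.B.r_neg)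
 then have "x \<ominus>.BK.A y = \<zero>.BK.A" using BK.A_to_B_zero x y by simp
 then show "x = y" using x y by (simp add: BK.A.r_right_minus_eq)
qed

text \<open>The level \<open>N\<close> is kept explicit because a bound may depend on it. An element
  of A_K whose bound can be chosen independently of \<open>N\<close> is one that a constant from K
  moves into A_R.\<close>

definition "bd t N x \<longleftrightarrow> (\<forall>l\<in>F.Lam N. BK.acoord N l x \<in> K.ball t)"

lemma bd_mono: "bd t N x ==> t' \<le> t ==> bd t' N x" using K.ball_mono by (auto simp: bd_def)

lemma bd_mult_pure:
 assumes x: "x \<in>. BK.A" and c: "c \<in> K.ball m" and u: "u \<in>. F.R" and b: "bd t N x"
 shows "bd (m + t) N (BK.ta (BK.pt c u) \<otimes>.BK.A x)" unfolding bd_def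
proof
 fix l assume l: "l \<in> F.Lam N"
 have "BK.acoord N (\<lambda>y. l (u \<otimes>.F.R y)) x \<in> K.ball t" using b F.cofunctional_mult[OF l u] by (simp add: bd_def)
 then show "BK.acoord N l (BK.ta (BK.pt c u) \<otimes>.BK.A x) \<in> K.ball (m + t)"
  unfolding BK.acoord_mult_pure[OF x l K.ball_closed[OF c] u] by (rule K.ball_mult[OF c])
qed

text \<open>Balls are stable under multiplication by R, so factors from A_R cost nothing.\<close>

lemma bd_mult_ci:
 assumes a: "a \<in>. BR.A" and x: "x \<in>. BK.A" and b: "bd t N x"
 shows "bd t N (ci a \<otimes>.BK.A x)" unfolding bd_def
proof
 fix l assume l: "l \<in> F.Lam N"
 show "BK.acoord N l (ci a \<otimes>.BK.A x) \<in> K.ball t"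
 proof (rule BK.acoord_mult_closed[OF incl a x _ _ _ l])
  show "s \<otimes>.K y \<in> K.ball t" if "s \<in>. R" "y \<in> K.ball t" for s y using K.ball_mult[of s 0 y t] that by simp
 qed (use b K.ball_add in \<open>auto simp: bd_def\<close>)
qed

text \<open>The bound found here depends on \<open>N\<close>, since it comes from the finitely many
  coordinates of that level.\<close>

lemma bd_exists: "x \<in>. BK.A ==> \<exists>j::nat. bd (- int j) N x"
proof -
 assume x: "x \<in>. BK.A"
 obtain G where G: "finite G" "G \<subseteq> carrier K" and H: "\<forall>H. G \<subseteq> H \<longrightarrow> \<zero>.K \<in> H \<longrightarrow> (\<forall>a\<in>H. \<forall>b\<in>H. a \<oplus>.K b \<in> H) \<longrightarrow>
  (\<forall>c\<in>carrier Q. \<forall>a\<in>H. c \<odot>.K a \<in> H) \<longrightarrow> (\<forall>l\<in>F.Lam N. BK.acoord N l x \<in> H)"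
  using BK.acoord_finite[OF x, of N] by (elim exE conjE)
 have "\<exists>j. \<forall>y\<in>G. y \<in> K.ball (- int j)"
 proof (rule finite_uniform_bound[where P = "\<lambda>y j. y \<in> K.ball (- int j)", OF G(1)])
  fix y assume "y \<in> G"
  then have "y \<in> K.ball (- int (nat (- v y)))" using G(2) by (auto simp: val_ball_def)
  then show "\<exists>j. y \<in> K.ball (- int j)" ..
 qed (rule K.ball_mono, assumption, simp)
 then obtain j where j: "G \<subseteq> K.ball (- int j)" by blast
 have "\<forall>l\<in>F.Lam N. BK.acoord N l x \<in> K.ball (- int j)" using H[rule_format, OF j] K.ball_zero K.ball_add K.ball_smult by simp
 then show ?thesis unfolding bd_def by blast
qed

text \<open>The order of quantifiers matters: the loss \<open>k\<close> is determined by the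
  coefficients of the combination and is the same for every bound \<open>t\<close> and every level
  \<open>N\<close>.\<close>

lemma span_bd:
 assumes G: "G \<subseteq> carrier BK.A" and y: "y \<in> span_over BK.B SD (BK.al ` G)"
 shows "\<exists>x\<in>carrier BK.A. y = BK.al x \<and> (\<exists>k::nat. \<forall>t N. (\<forall>g\<in>G. bd t N g) \<longrightarrow> bd (t - int k) N x)"
 using y
proof (induction rule: span_over.induct)
 case zero
 show ?case
 proof (intro bexI conjI exI allI impI)
  show "\<zero>.BK.B = BK.al \<zero>.BK.A"
   using ahom_zero[OF BK.A.abelian_group_axioms BK.B.abelian_group_axioms ring_hom_ahom[OF BK.A_to_B_hom]] by simp
  show "bd (t - int 0) N \<zero>.BK.A" for t N using BK.acoord_zero K.ball_zero by (simp add: bd_def)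
 qed simp
next
 case (smult s y)
 obtain g where g: "g \<in> G" "y = BK.al g" using smult(2) by blast
 have gc: "g \<in>. BK.A" using G g by blast
 obtain c a where ca: "c \<in>. K" "a \<in>. BR.A" "s = BK.al (BK.rh c \<otimes>.BK.A ci a)" using SD_form[OF smult(1)] by blast
 note cl = ring_hom_closed[OF BK.S_to_A_hom ca(1)] ring_hom_closed[OF ci_hom ca(2)]
 let ?x = "BK.rh c \<otimes>.BK.A (ci a \<otimes>.BK.A g)"
 have cm: "c \<in> K.ball (- int (nat (- v c)))" using ca(1) by (auto simp: val_ball_def)
 show ?case
 proof (intro bexI conjI exI allI impI)
  show "s \<otimes>.BK.B y = BK.al ?x"
   using cl gc by (simp add: ca(3) g(2) ring_hom_mult[OF BK.A_to_B_hom] ring_hom_closed[OF BK.A_to_B_hom] BK.B.m_assoc)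
  fix t N assume "\<forall>g\<in>G. bd t N g"
  then have "bd t N (ci a \<otimes>.BK.A g)" using bd_mult_ci[OF ca(2) gc] g(1) by simp
  from bd_mult_pure[OF BK.A.m_closed[OF cl(2) gc] cm, of "\<one>.F", OF _ this]
  show "bd (t - int (nat (- v c))) N ?x" using F.one_in_ball by (simp add: BK.S_to_A_eq)
 qed (use cl gc in simp)
next
 case (add y y')
 obtain x k x' k' where x: "x \<in>. BK.A" "y = BK.al x" "\<And>t N. (\<forall>g\<in>G. bd t N g) ==> bd (t - int k) N x"
  and x': "x' \<in>. BK.A" "y' = BK.al x'" "\<And>t N. (\<forall>g\<in>G. bd t N g) ==> bd (t - int k') N x'" using add.IH by blast
 show ?case
 proof (intro bexI conjI exI allI impI)
  show "y \<oplus>.BK.B y' = BK.al (x \<oplus>.BK.A x')" using x x' by (simp add: ring_hom_add[OF BK.A_to_B_hom])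
  fix t N assume "\<forall>g\<in>G. bd t N g"
  then have "bd (t - int (max k k')) N x" "bd (t - int (max k k')) N x'" using bd_mono[OF x(3)] bd_mono[OF x'(3)] by auto
  then show "bd (t - int (max k k')) N (x \<oplus>.BK.A x')" using x(1) x'(1) K.ball_add by (simp add: bd_def BK.acoord_add)
 qed (use x x' in simp)
qed

lemma span_scale:
 assumes G: "G \<subseteq> carrier BK.B" and u: "u \<in>. BK.B" and y: "y \<in> span_over BK.B SD G"
 shows "u \<otimes>.BK.B y \<in> span_over BK.B SD ((\<lambda>g. u \<otimes>.BK.B g) ` G)" using y
proof (induction rule: span_over.induct)
 case zero then show ?case using u by (simp add: span_over.zero)
next
 case (smult s g)
 then have c: "s \<in>. BK.B" "g \<in>. BK.B" using SD_sub G by auto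
 have "s \<otimes>.BK.B (u \<otimes>.BK.B g) \<in> span_over BK.B SD ((\<lambda>g. u \<otimes>.BK.B g) ` G)"
  using smult by (intro span_over.smult) auto
 then show ?case using c u by (simp add: BK.B.m_lcomm)
next
 case (add x y)
 then show ?case using u BK.B.span_over_closed[OF SD_sub G] by (simp add: BK.B.r_distr span_over.add)
qed

lemma sK_pow: "a \<in>. BK.A ==> (sK ^^ n) a \<in>. BK.A \<and> (sgK ^^ n) (BK.al a) = BK.al ((sK ^^ n) a)"
 by (induction n) (auto simp: sgK_A ring_hom_closed[OF sK_hom])

lemma sgK_pow_kz: "x \<in>. BK.B ==> (sgK ^^ n) x \<in>. BK.B \<and> (sgK ^^ n) (BK.kz s \<otimes>.BK.B x) = BK.kz s \<otimes>.BK.B (sgK ^^ n) x"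
proof (induction n)
 case (Suc n)
 have "sgK (BK.kz s) = BK.kz s" using sgK_F BK.zf by (simp add: BK.kz_def)
 then show ?case using Suc BK.kz(3) by (auto simp: ring_hom_closed[OF sgK_hom] ring_hom_mult[OF sgK_hom])
qed simp

abbreviation "q \<equiv> card (carrier Q)"

lemma q_ge_2: "2 \<le> q" using card_mono[OF K.Q(2), of "{\<zero>.Q, \<one>.Q}"] domain.one_not_zero[OF field.axioms(1)[OF K.Q(1)]] by simp

lemma sK_pow_acoord: "a \<in>. BK.A ==> l \<in> F.Lam N ==> BK.acoord N l ((sK ^^ n) a) = BK.acoord N l a [^].K (q ^ n)"
proof (induction n)
 case 0 then show ?case using BK.acoord_closed by simp
next
 case (Suc n)
 note c = BK.acoord_closed[OF Suc.prems]
 have "BK.acoord N l (sK ((sK ^^ n) a)) = frob Q K (BK.acoord N l ((sK ^^ n) a))"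
  using BK.acoord_natural[OF BK.qlinear_frob _ Suc.prems(2)] sK_pow[OF Suc.prems(1)] by simp
 also have "\<dots> = BK.acoord N l a [^].K (q ^ Suc n)" using c by (simp add: Suc.IH[OF Suc.prems] frob_def K.K.nat_pow_pow mult.commute)
 finally show ?case by simp
qed

text \<open>If the valuation of y were at most t, that of its e-th power would be at most 2t, which
  is less than t - k as t < -k. So below -k a bound can be raised by one.\<close>

lemma pow_ball_improve:
 assumes y: "y \<in>. K" and e: "2 \<le> (e::nat)" and t: "t < - int k" and b: "y [^].K e \<in> K.ball (t - int k)"
 shows "y \<in> K.ball (t + 1)"
proof (cases "y = \<zero>.K")
 case False
 have "t < v y"
 proof (rule ccontr)
  assume "\<not> t < v y"
  then have "v y \<le> t" "v y \<le> 0" using t by auto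
  then have "int e * v y \<le> 2 * v y" using e by (intro mult_right_mono_neg) auto
  moreover have "t - int k \<le> int e * v y" using b K.v_pow[OF y False, of e] by (simp add: val_ball_def)
  ultimately show False using t \<open>v y \<le> t\<close> by linarith
 qed
 then show ?thesis using y by (simp add: val_ball_def)
qed (simp add: K.ball_zero)

text \<open>Coordinates exist on A_K only, so matrix entries are multiplied into it by a common
  power of z.\<close>

lemma clear_denominators:
 assumes "finite G" "G \<subseteq> carrier BK.B"
 shows "\<exists>h::nat. \<exists>f. \<forall>g\<in>G. f g \<in>. BK.A \<and> BK.kz (int h) \<otimes>.BK.B g = BK.al (f g)"
proof -
 have "\<exists>h::nat. \<forall>g\<in>G. BK.kz (int h) \<otimes>.BK.B g \<in> BK.al ` carrier BK.A"
 proof (rule finite_uniform_bound[where P = "\<lambda>g h. BK.kz (int h) \<otimes>.BK.B g \<in> BK.al ` carrier BK.A", OF assms(1)])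
  fix g assume "g \<in> G"
  then show "\<exists>h. BK.kz (int h) \<otimes>.BK.B g \<in> BK.al ` carrier BK.A" using BK.B_denominator assms(2) by blast
 next
  fix g and k l :: nat
  assume g: "g \<in> G" and k: "BK.kz (int k) \<otimes>.BK.B g \<in> BK.al ` carrier BK.A" and kl: "k \<le> l"
  obtain a where a: "BK.kz (int k) \<otimes>.BK.B g = BK.al a" "a \<in>. BK.A" using k by blast
  have "BK.kz (int l) = BK.kz (int (l - k)) \<otimes>.BK.B BK.kz (int k)" using BK.kz(1)[of "int (l - k)" "int k"] kl by (simp add: of_nat_diff)
  then have "BK.kz (int l) \<otimes>.BK.B g = BK.kz (int (l - k)) \<otimes>.BK.B BK.al a"
   using g assms(2) BK.kz(3) a(1) by (simp add: BK.B.m_assoc subset_iff)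
  also have "\<dots> = BK.al (BK.tht (z [^].F (l - k)) \<otimes>.BK.A a)"
   unfolding BK.kz_nat using ring_hom_mult[OF BK.A_to_B_hom BK.theta_z_pow a(2)] by simp
  finally show "BK.kz (int l) \<otimes>.BK.B g \<in> BK.al ` carrier BK.A" using BK.A.m_closed[OF BK.theta_z_pow a(2)] by blast
 qed
 then obtain h :: nat where h: "\<forall>g\<in>G. \<exists>a. a \<in>. BK.A \<and> BK.kz (int h) \<otimes>.BK.B g = BK.al a" by blast
 show ?thesis by (rule exI[of _ h]) (rule bchoice[OF h])
qed

text \<open>Multiplication by z^h commutes with \<sigma> and with spans, so the hypothesis passes to
  the elements \<open>f g\<close> of A_K, where coordinates can be used.\<close>

lemma bounded:
 assumes G: "finite G" "G \<subseteq> carrier BK.B" and n: "0 < n"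
  and span: "\<And>g. g \<in> G ==> (sgK ^^ n) g \<in> span_over BK.B SD G"
 shows "G \<subseteq> ph ` carrier Bb"
proof
 obtain h :: nat and f where f0: "\<forall>g\<in>G. f g \<in>. BK.A \<and> BK.kz (int h) \<otimes>.BK.B g = BK.al (f g)"
  using clear_denominators[OF G] by (elim exE)
 then have f: "g \<in> G ==> f g \<in>. BK.A" "g \<in> G ==> BK.kz (int h) \<otimes>.BK.B g = BK.al (f g)" for g by simp_all
 have fG: "f ` G \<subseteq> carrier BK.A" using f(1) by auto
 have im: "(\<lambda>g. BK.kz (int h) \<otimes>.BK.B g) ` G = BK.al ` f ` G" using f(2) by (force simp: image_image)
 have q2: "2 \<le> q ^ n" using self_le_power[of q n] q_ge_2 n by linarith
 \<comment> \<open>One loss \<open>k\<close> for all elements of \<open>G\<close>, all levels and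
   all bounds; it becomes the final bound.\<close>
 have "\<exists>k::nat. \<forall>g\<in>G. \<forall>t N. (\<forall>x\<in>f ` G. bd t N x) \<longrightarrow> bd (t - int k) N ((sK ^^ n) (f g))"
 proof (rule finite_uniform_bound[where P = "\<lambda>g k. \<forall>t N. (\<forall>x\<in>f ` G. bd t N x) \<longrightarrow> bd (t - int k) N ((sK ^^ n) (f g))", OF G(1)])
  fix g assume g: "g \<in> G"
  have "BK.al ((sK ^^ n) (f g)) = BK.kz (int h) \<otimes>.BK.B (sgK ^^ n) g"
   using sK_pow[OF f(1)[OF g], of n] sgK_pow_kz[of g n "int h"] f(2)[OF g] g G(2) by auto
  then have "BK.al ((sK ^^ n) (f g)) \<in> span_over BK.B SD (BK.al ` f ` G)"
   using span_scale[OF G(2) BK.kz(3) span[OF g], of "int h"] by (simp add: im)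
  from span_bd[OF fG this] obtain x k where x: "x \<in>. BK.A" "BK.al ((sK ^^ n) (f g)) = BK.al x"
   and k: "\<forall>t N. (\<forall>x\<in>f ` G. bd t N x) \<longrightarrow> bd (t - int k) N x" by blast
  have "(sK ^^ n) (f g) = x" using al_inj[OF _ x] sK_pow[OF f(1)[OF g]] by simp
  then show "\<exists>k::nat. \<forall>t N. (\<forall>x\<in>f ` G. bd t N x) \<longrightarrow> bd (t - int k) N ((sK ^^ n) (f g))" using k by blast
 next
  fix g and k l :: nat
  assume k: "\<forall>t N. (\<forall>x\<in>f ` G. bd t N x) \<longrightarrow> bd (t - int k) N ((sK ^^ n) (f g))" and "k \<le> l"
  then have "t - int l \<le> t - int k" for t by simp
  then show "\<forall>t N. (\<forall>x\<in>f ` G. bd t N x) \<longrightarrow> bd (t - int l) N ((sK ^^ n) (f g))"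
   using k by (intro allI impI) (rule bd_mono, blast+)
 qed
 then obtain k :: nat where k: "g \<in> G ==> \<forall>x\<in>f ` G. bd t N x ==> bd (t - int k) N ((sK ^^ n) (f g))" for g t N by blast
 \<comment> \<open>\<sigma>^n multiplies valuations by q^n \<ge> 2 while the equation loses only
   \<open>k\<close>, so a bound below -k improves by one, for all elements of \<open>G\<close>
   simultaneously.\<close>
 have descend: "\<forall>x\<in>f ` G. bd (- int (k + i)) N x ==> \<forall>x\<in>f ` G. bd (- int k) N x" for i N
 proof (induction i)
  case (Suc i)
  have "bd (- int (k + i)) N (f g)" if g: "g \<in> G" for g unfolding bd_def
  proof
   fix l assume l: "l \<in> F.Lam N"
   have "BK.acoord N l (f g) [^].K (q ^ n) \<in> K.ball (- int (k + Suc i) - int k)"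
    unfolding sK_pow_acoord[OF f(1)[OF g] l, symmetric] using k[OF g Suc.prems] l unfolding bd_def by blast
   from pow_ball_improve[OF BK.acoord_closed[OF f(1)[OF g] l] q2 _ this]
   show "BK.acoord N l (f g) \<in> K.ball (- int (k + i))" by simp
  qed
  then show ?case using Suc.IH by blast
 qed simp
 \<comment> \<open>The descent starts from a bound that depends on \<open>N\<close> and ends at one
   that does not.\<close>
 have bdk: "\<forall>x\<in>f ` G. bd (- int k) N x" for N
 proof -
  have "\<exists>j. \<forall>x\<in>f ` G. bd (- int j) N x" by (rule finite_uniform_bound[where P = "\<lambda>x j. bd (- int j) N x"])
     (use G(1) fG bd_exists in \<open>auto elim: bd_mono\<close>)
  then obtain j where "\<forall>x\<in>f ` G. bd (- int j) N x" ..
  moreover have "- int (k + j) \<le> - int j" by simp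
  ultimately have "\<forall>x\<in>f ` G. bd (- int (k + j)) N x" by (intro ballI) (rule bd_mono, blast+)
  then show ?thesis by (rule descend)
 qed
 fix g assume g: "g \<in> G"
 have gc: "g \<in>. BK.B" using g G(2) by blast
 let ?p = "pu [^].K k"
 \<comment> \<open>Scaling by \<open>pu^k\<close> makes all coordinates integral, so
   \<open>cm_lift\<close> applies. The scaling is undone inside K \<otimes> B_R.\<close>
 let ?x = "BK.rh ?p \<otimes>.BK.A f g"
 note i = K.v_inv[OF pu_pow(1)[of k] pu_pow(2)[of k]]
 have rhp: "BK.rh ?p \<in>. BK.A" by (rule ring_hom_closed[OF BK.S_to_A_hom pu_pow(1)])
 have "?x \<in> ci ` carrier BR.A"
 proof (rule BK.cm_lift[OF incl])
  fix N l assume l: "l \<in> F.Lam N"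
  have "bd (int k + - int k) N (BK.ta (BK.pt ?p \<one>.F) \<otimes>.BK.A f g)"
   by (rule bd_mult_pure[OF f(1)[OF g] pu_pow(3)]) (use bdk g F.one_in_ball in auto)
  then show "BK.acoord N l ?x \<in> (\<lambda>x. x) ` carrier R" using l by (simp add: bd_def BK.S_to_A_eq)
 qed (use rhp f(1)[OF g] in auto)
 then obtain a where a: "a \<in>. BR.A" "?x = ci a" by blast
 let ?S = "S_to_B Q F w K" and ?i = "inv\<^bsub>K\<^esub> ?p"
 note Sc = ring_hom_closed[OF BK.S_to_B_hom]
 have alf: "BK.al (f g) \<in>. BK.B" by (rule ring_hom_closed[OF BK.A_to_B_hom f(1)[OF g]])
 have 1: "?S ?p \<otimes>.BK.B BK.al (f g) = bi (BR.al a)" using ring_hom_mult[OF BK.A_to_B_hom rhp f(1)[OF g]] a by (simp add: S_to_B_def bi_A)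
 have 2: "?S ?i \<otimes>.BK.B ?S ?p = \<one>.BK.B"
  using ring_hom_mult[OF BK.S_to_B_hom i(1) pu_pow(1)[of k]] ring_hom_one[OF BK.S_to_B_hom] i(3) K.K.m_comm[OF i(1) pu_pow(1)[of k]] by simp
 have 3: "BK.al (f g) = ?S ?i \<otimes>.BK.B bi (BR.al a)" using BK.B.m_assoc[OF Sc[OF i(1)] Sc[OF pu_pow(1)[of k]] alf] 2 alf by (simp flip: 1)
 have 4: "BK.kz (- int h) \<otimes>.BK.B BK.kz (int h) = \<one>.BK.B" using BK.kz(1)[of "- int h" "int h"] BK.kz(2) by simp
 note bc = ring_hom_closed[OF bi_hom BR_al_closed[OF a(1)]]
 have "g = BK.kz (- int h) \<otimes>.BK.B BK.al (f g)"
  using BK.B.m_assoc[OF BK.kz(3) BK.kz(3) gc, of "- int h" "int h"] 4 gc by (simp flip: f(2)[OF g])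
 also have "\<dots> = ?S ?i \<otimes>.BK.B (BK.kz (- int h) \<otimes>.BK.B bi (BR.al a))"
  unfolding 3 by (rule BK.B.m_lcomm[OF BK.kz(3) Sc[OF i(1)] bc])
 also have "\<dots> = ph (ptB ?i (BR.kz (- int h) \<otimes>.BR.B BR.al a))"
  using i(1) BR.kz(3) BR_al_closed[OF a(1)] by (simp add: ph(2) ring_hom_mult[OF bi_hom] bi_kz)
 finally show "g \<in> ph ` carrier Bb" using ptB_closed[OF i(1) BR.B.m_closed[OF BR.kz(3) BR_al_closed[OF a(1)]]] by blast
qed

text \<open>A positive power of z raises the level: the coordinates of \<open>f g\<close> at level N
  + 1 are coordinates at level N of a combination of the \<sigma>^n-images, which vanish by
  induction. The loss from coefficients in A^b is immaterial for zero coordinates.\<close>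

lemma vanishing:
 assumes G: "finite G" "G \<subseteq> carrier BK.B" and s: "0 < s"
  and span: "\<And>g. g \<in> G ==> \<exists>x\<in>span_over BK.B SD ((sgK ^^ n) ` G). g = ph (zp s) \<otimes>.BK.B x"
 shows "G \<subseteq> {\<zero>.BK.B}"
proof
 obtain h :: nat and f where f0: "\<forall>g\<in>G. f g \<in>. BK.A \<and> BK.kz (int h) \<otimes>.BK.B g = BK.al (f g)"
  using clear_denominators[OF G] by (elim exE)
 then have f: "g \<in> G ==> f g \<in>. BK.A" "g \<in> G ==> BK.kz (int h) \<otimes>.BK.B g = BK.al (f g)" for g by simp_all
 \<comment> \<open>One factor z is reserved for raising the level; the remaining z^j is integral and
   costs nothing.\<close>
 obtain j where "s = int (Suc j)" using s zero_less_imp_eq_int[of s] gr0_conv_Suc by metis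
 then have zs: "ph (zp s) = BK.al (BK.tht (z [^].F Suc j))" by (simp only: ph_zp BK.kz_nat)
 let ?G = "(\<lambda>g. (sK ^^ n) (f g)) ` G"
 have Gc: "?G \<subseteq> carrier BK.A" using sK_pow f(1) by auto
 have sgG: "(sgK ^^ n) ` G \<subseteq> carrier BK.B" using sgK_pow_kz G(2) by auto
 have im: "(\<lambda>g. BK.kz (int h) \<otimes>.BK.B g) ` (sgK ^^ n) ` G = BK.al ` ?G" unfolding image_image
 proof (rule image_cong[OF refl])
  fix g assume g: "g \<in> G"
  then show "BK.kz (int h) \<otimes>.BK.B (sgK ^^ n) g = BK.al ((sK ^^ n) (f g))"
   using sK_pow[OF f(1)[OF g], of n] sgK_pow_kz[of g n "int h"] f(2)[OF g] G(2) by auto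
 qed
 have step: "\<exists>x\<in>carrier BK.A. f g = BK.za \<otimes>.BK.A (BK.tht (z [^].F j) \<otimes>.BK.A x) \<and>
   (\<exists>k::nat. \<forall>t N. (\<forall>g\<in>?G. bd t N g) \<longrightarrow> bd (t - int k) N x)" if g: "g \<in> G" for g
 proof -
  obtain y where y: "y \<in> span_over BK.B SD ((sgK ^^ n) ` G)" "g = ph (zp s) \<otimes>.BK.B y" using span[OF g] by blast
  have yc: "y \<in>. BK.B" by (rule BK.B.span_over_closed[OF SD_sub sgG y(1)])
  have "BK.kz (int h) \<otimes>.BK.B y \<in> span_over BK.B SD (BK.al ` ?G)" using span_scale[OF sgG BK.kz(3) y(1), of "int h"] by (simp only: im)
  from span_bd[OF Gc this] obtain x k where x: "x \<in>. BK.A" "BK.kz (int h) \<otimes>.BK.B y = BK.al x"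
   and k: "\<forall>t N. (\<forall>g\<in>?G. bd t N g) \<longrightarrow> bd (t - int k) N x" by blast
  note tz = BK.theta_z_pow[of "Suc j"]
  have "BK.al (f g) = ph (zp s) \<otimes>.BK.B BK.al x" using f(2)[OF g] y(2) yc BK.kz(3) by (simp add: ph_zp BK.B.m_lcomm flip: x(2))
  also have "\<dots> = BK.al (BK.tht (z [^].F Suc j) \<otimes>.BK.A x)" unfolding zs by (rule ring_hom_mult[OF BK.A_to_B_hom tz x(1), symmetric])
  finally have "f g = BK.tht (z [^].F Suc j) \<otimes>.BK.A x" by (rule al_inj[OF f(1)[OF g] BK.A.m_closed[OF tz x(1)]])
  also have "BK.tht (z [^].F Suc j) = BK.tht (z [^].F j) \<otimes>.BK.A BK.za"
   using ring_hom_mult[OF BK.O_to_A_hom, of "z [^].F j" z] BK.z_pow_ball F.z(4) by (simp add: BK.O_to_A_eq)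
  finally have "f g = BK.za \<otimes>.BK.A (BK.tht (z [^].F j) \<otimes>.BK.A x)" using x(1) BK.theta_z_pow[of j] F.z(4) by (simp add: BK.A.m_ac)
  then show ?thesis using x(1) k by blast
 qed
 \<comment> \<open>Membership in \<open>bd t N\<close> for every \<open>t\<close> encodes vanishing
   of the coordinates of level \<open>N\<close>, since a nonzero element has a definite integer
   valuation. In this form \<open>span_bd\<close> applies unchanged.\<close>
 have all: "\<forall>g\<in>G. \<forall>t. bd t N (f g)" for N
 proof (induction N)
  case 0
  show ?case
  proof (intro ballI allI)
   fix g t assume g: "g \<in> G"
   obtain p where p: "p \<in> f g 0" using BK.A_rep[OF f(1)[OF g], of 0] ..
   have "BK.acoord 0 l (f g) = \<zero>.K" if l: "l \<in> F.Lam 0" for l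
    using BK.acoord_eq[OF f(1)[OF g] p order_refl l] BK.coord_vanish[OF _ l, of p] BK.A_mem(1)[OF f(1)[OF g] p] by simp
   then show "bd t 0 (f g)" using K.ball_zero by (simp add: bd_def)
  qed
 next
  case (Suc N)
  have pow: "bd t N ((sK ^^ n) (f g))" if g: "g \<in> G" for g t unfolding bd_def
  proof
   fix l assume l: "l \<in> F.Lam N"
   let ?y = "BK.acoord N l (f g)"
   \<comment> \<open>A ball is closed under taking powers only if its radius is not negative, hence
     the maximum with 0. The exponent q^n may be 1 here, as \<open>n\<close> may be 0.\<close>
   have b: "?y \<in> K.ball (max t 0)" using Suc.IH g l by (simp add: bd_def)
   have "?y [^].K Suc e \<in> K.ball (max t 0)" for e :: nat
   proof (induction e)
    case (Suc e)
    show ?case using K.ball_mono[OF K.ball_mult[OF Suc b], of "max t 0"] by (subst K.K.nat_pow_Suc) simp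
   qed (use b K.ball_closed in simp)
   from this[of "q ^ n - 1"] have "?y [^].K (q ^ n) \<in> K.ball (max t 0)" using q_ge_2 by simp
   then show "BK.acoord N l ((sK ^^ n) (f g)) \<in> K.ball t" using K.ball_mono sK_pow_acoord[OF f(1)[OF g] l] by simp
  qed
  show ?case
  proof (intro ballI allI)
   fix g t assume g: "g \<in> G"
   obtain x where x: "x \<in>. BK.A" "f g = BK.za \<otimes>.BK.A (BK.tht (z [^].F j) \<otimes>.BK.A x)"
    and ex: "\<exists>k::nat. \<forall>t N. (\<forall>g\<in>?G. bd t N g) \<longrightarrow> bd (t - int k) N x" using step[OF g] by blast
   obtain k :: nat where k: "\<forall>t N. (\<forall>g\<in>?G. bd t N g) \<longrightarrow> bd (t - int k) N x" using ex ..
   have "bd ((t + int k) - int k) N x" using k pow by blast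
   then have "bd (0 + t) N (BK.tht (z [^].F j) \<otimes>.BK.A x)"
    unfolding BK.O_to_A_eq by (intro bd_mult_pure[OF x(1) K.one_in_ball]) (use BK.z_pow_ball in simp_all)
   then have b: "bd t N (BK.tht (z [^].F j) \<otimes>.BK.A x)" by simp
   show "bd t (Suc N) (f g)" unfolding bd_def x(2)
   proof
    fix l assume l: "l \<in> F.Lam (Suc N)"
    show "BK.acoord (Suc N) l (BK.za \<otimes>.BK.A (BK.tht (z [^].F j) \<otimes>.BK.A x)) \<in> K.ball t"
     unfolding BK.acoord_mult_z[OF BK.A.m_closed[OF BK.theta_z_pow x(1)] l] using b F.cofunctional_mult_z[OF l] by (simp add: bd_def)
   qed
  qed
 qed
 fix g assume g: "g \<in> G"
 have "f g = \<zero>.BK.A"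
 proof (rule BK.acoord_zeroD[OF f(1)[OF g]])
  fix N l assume l: "l \<in> F.Lam N"
  \<comment> \<open>A nonzero element never lies in the ball just beyond its own valuation.\<close>
  have "BK.acoord N l (f g) \<in> K.ball (v (BK.acoord N l (f g)) + 1)" using all g l by (simp add: bd_def)
  then show "BK.acoord N l (f g) = \<zero>.K" by (simp add: val_ball_def)
 qed
 then have "BK.kz (int h) \<otimes>.BK.B g = \<zero>.BK.B"
  using f(2)[OF g] ahom_zero[OF BK.A.abelian_group_axioms BK.B.abelian_group_axioms ring_hom_ahom[OF BK.A_to_B_hom]] by simp
 moreover have "BK.kz (- int h) \<otimes>.BK.B BK.kz (int h) = \<one>.BK.B" using BK.kz(1)[of "- int h" "int h"] BK.kz(2) by simp
 moreover have "g \<in>. BK.B" using g G(2) by blast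
 ultimately have "g = \<zero>.BK.B" using BK.B.m_assoc[OF BK.kz(3) BK.kz(3), of g "- int h" "int h"] BK.kz(3) by simp
 then show "g \<in> {\<zero>.BK.B}" by simp
qed

section \<open>The rings A^b, B^b and B_K satisfy the descent hypotheses\<close>

lemma pure_bounded_base_change: "bounded_base_change Bb BK.B Ab ph io sgb sgK (\<lambda>s. zp s)"
proof
 note fh = ring_hom_closed[OF frob_hom[OF K.Q K.alg]]
 show "sgb (io x) \<in> io ` carrier Ab" if x: "x \<in>. Ab" for x
 proof -
  obtain c a where c: "c \<in>. K" "a \<in>. BR.A" "x = ptA c a" using Ab_pure[OF x] by blast
  have "sgb (io x) = io (ptA (frob Q K c) (sR a))" using c BR_al_closed fh ring_hom_closed[OF sR_hom] by (simp add: io(2) sgb(2) sgR_A)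
  then show ?thesis using ptA_closed[OF fh[OF c(1)] ring_hom_closed[OF sR_hom c(2)]] by blast
 qed
 show zc: "zp s \<in>. Bb" for s using ptB_closed BR.kz(3) by (simp add: zp_eq)
 show "zp (s + t) = zp s \<otimes>.Bb zp t" for s t using BR.kz(3) by (simp add: zp_eq ptB_mult BR.kz(1))
 show "zp 0 = \<one>.Bb" unfolding zp_eq BR.kz(2) Bb_one ..
 show "sgb (zp s) = zp s" for s
  using BR.kz(3)[of s] sgR_F[of "z [^].F s"] BR.zf(4) ring_hom_one[OF frob_hom[OF K.Q K.alg]] by (simp add: zp_eq sgb(2)) (simp add: BR.kz_def)
 show "zp s \<in> io ` carrier Ab" if s0: "0 \<le> s" for s
 proof -
  obtain m where m: "s = int m" using zero_le_imp_eq_int[OF s0] by blast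
  have "zp s = io (ptA \<one>.K (BR.tht (z [^].F m)))" using BR.theta_z_pow[of m] by (simp add: zp_eq m BR.kz_nat io(2))
  then show ?thesis using ptA_closed[of "\<one>.K"] BR.theta_z_pow by blast
 qed
 show "G \<subseteq> ph ` carrier Bb" if "finite G" "G \<subseteq> carrier BK.B" "0 < n"
  "\<And>g. g \<in> G ==> (sgK ^^ n) g \<in> span_over BK.B SD G" for G n by (rule bounded[OF that])
 show "G \<subseteq> {\<zero>.BK.B}" if "finite G" "G \<subseteq> carrier BK.B" "0 < s"
  "\<And>g. g \<in> G ==> \<exists>x\<in>span_over BK.B SD ((sgK ^^ n) ` G). g = ph (zp s) \<otimes>.BK.B x" for G n s
  by (rule vanishing[OF that])
qed (rule Bb_cring Ab_cring BK.B.is_cring ph(1) ph_inj io(1) sgb(1) sgK_hom | erule sg_comm zp_denominator)+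

end

lemma (in bounded_base_change) tau_scalesI:
 assumes "(\<lambda>t. zp a \<odot>.M t) ` T = module_span A (restrict_scalars io M) ((tau M ^^ n) ` T)"
 shows "tau_scales M T n a" unfolding tau_scales_def
proof (intro conjI ballI allI impI)
 fix t assume "t \<in> T"
 then have "(tau M ^^ n) t \<in> (\<lambda>t. zp a \<odot>.M t) ` T" unfolding assms using module_span_superset by fast
 then show "\<exists>t'\<in>T. (tau M ^^ n) t = zp a \<odot>.M t'" by blast
next
 fix H t assume H: "submodule H A (restrict_scalars io M)" "\<forall>t\<in>T. (tau M ^^ n) t \<in> H" and t: "t \<in> T"
 have "(\<lambda>t. zp a \<odot>.M t) ` T \<subseteq> H" unfolding assms by (rule module_span_least[OF H(1)]) (use H(2) in blast)
 then show "zp a \<odot>.M t \<in> H" using t by blast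
qed

theorem theorem8p12:
  fixes Fq :: "'q ring" and F :: "('q, 'f) module" and w :: "'f \<Rightarrow> int" and z :: 'f
    and K :: "('q, 'k) module" and v :: "'k \<Rightarrow> int"
    and M :: "(('k, 'f) Bb_elt, 'm) tau_module" and N :: "(('k, 'f) Bb_elt, 'n) tau_module"
  assumes "field Fq" and "finite (carrier Fq)"
    and "local_field_over Fq F w" and "uniformizer F w z"
    and "field K" and "algebra Fq K"
    and "discrete_valuation K v" and "nontrivial_valuation K v"
    and "pure_isocrystal Fq F w z K v M" and "pure_isocrystal Fq F w z K v N"
  shows "isocrystal (B_ring Fq F w K) (sigma_B Fq F w K) (BK_obj Fq F w K v M) \<and>
    isocrystal (B_ring Fq F w K) (sigma_B Fq F w K) (BK_obj Fq F w K v N) \<and>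
    bij_betw (BK_mor Fq F w K v M N)
      (isocrystal_hom (Bb_ring Fq F w K v) M N)
      (isocrystal_hom (B_ring Fq F w K) (BK_obj Fq F w K v M) (BK_obj Fq F w K v N))"
proof -
 have lf: "field F" "algebra Fq F" "discrete_valuation F w" using assms(3) by (auto simp: local_field_over_def)
 interpret S: pure_setting Fq F w z K v
  by (intro pure_setting.intro local_field.intro valued_algebra.intro local_field_axioms.intro pure_setting_axioms.intro assms lf)
 interpret X: bounded_base_change "Bb_ring Fq F w K v" "B_ring Fq F w K" "Ab_ring Fq F w K v" "Bb_to_BK Fq F w K"
   "Ab_to_Bb Fq F w K v" "sigma_Bb Fq F w K v" "sigma_B Fq F w K" "\<lambda>s. F_to_Bb Fq F w K v (z [^].F s)" by (rule S.pure_bounded_base_change)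
 have M: "isocrystal (Bb_ring Fq F w K v) (sigma_Bb Fq F w K v) M"
  and N: "isocrystal (Bb_ring Fq F w K v) (sigma_Bb Fq F w K v) N" using assms(9,10) by (auto simp: pure_isocrystal_def)
 obtain s r T where T: "0 < r" "isocrystal_lattice Fq F w K v M T"
  "(\<lambda>t. F_to_Bb Fq F w K v (z [^].F (s::int)) \<odot>.M t) ` T =
    module_span (Ab_ring Fq F w K v) (restrict_scalars (Ab_to_Bb Fq F w K v) M) ((tau M ^^ (r * residue_degree Fq F w)) ` T)"
  using assms(9) unfolding pure_isocrystal_def by (elim conjE exE)
 obtain s' r' T' where T': "0 < r'" "isocrystal_lattice Fq F w K v N T'"
  "(\<lambda>t. F_to_Bb Fq F w K v (z [^].F (s'::int)) \<odot>.N t) ` T' =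
    module_span (Ab_ring Fq F w K v) (restrict_scalars (Ab_to_Bb Fq F w K v) N) ((tau N ^^ (r' * residue_degree Fq F w)) ` T')"
  using assms(10) unfolding pure_isocrystal_def by (elim conjE exE)
 have L: "X.is_lattice M T" "X.is_lattice N T'" using T(2) T'(2) by (simp_all add: isocrystal_lattice_def X.is_lattice_def Let_def)
 have pos: "0 < r * residue_degree Fq F w" "0 < r' * residue_degree Fq F w" using T(1) T'(1) S.F.residue_degree_pos by simp_all
 note sc = X.tau_scalesI[OF T(3)] X.tau_scalesI[OF T'(3)]
 \<comment> \<open>The statement about the base change being an isocrystal concerns the source
   object; for \<open>N\<close> it is obtained from the pair \<open>N\<close>,
   \<open>N\<close>.\<close>
 show ?thesis unfolding BK_obj_def BK_mor_def
  using X.full_and_faithful[OF M N L pos sc] X.full_and_faithful(1)[OF N N L(2) L(2) pos(2) pos(2) sc(2) sc(2)] by simp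
qed

end
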